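(* Let $(X,d,\mu)$ be a complete, doubling metric measure space with doubling constant $C_\mu$, and let $1<p<\infty$. Suppose that an open set $\Omega\subset X$ satisfies a $p$-Hardy inequality with respect to $\mu$, with constant $C_p\ge1$. Then there exists a constant $\delta_p>0$ such that if $w$ is a weight which is (i) $p$-admissible, and (ii) $\delta$-regularizable in $\Omega$ for some $0<\delta\le\delta_p$, then $\Omega$ satisfies a $p$-Hardy inequality with respect to $w\,d\mu$, with constant depending only on $p$, $C_\mu$, and the $p$-admissibility constants of $w$. Moreover, one may take $\delta_p=\frac{p}{2C_0}(2C_p)^{-1/p}$, where $C_0\ge 1$ is the constant, depending only on $C_\mu$, in the gradient estimate for discrete convolutions of regularizable weights recalled in the context.
   Context: Notation: $B(x,r)=\{y:d(x,y)<r\}$, $CB(x,r)=B(x,Cr)$, $d_\Omega(x)=d(x,X\setminus\Omega)$. A Borel measure $m$ is doubling if for some constant $C_m\ge1$, $0<m(B(x,2r))\le C_m m(B(x,r))<\infty$ for all $x\in X$, $r>0$. A weight is a non-negative $w\in L^1_{\mathrm{loc}}(X,\mu)$; write $w\,d\mu$ for the weighted measure, and $w_B=\frac1{\mu(B)}\int_B w\,d\mu$. $w$ is a doubling weight if $w\,d\mu$ is doubling. $w$ is $p$-admissible if $m=w\,d\mu$ is doubling and supports a $(1,p)$-Poincaré inequality: there are $C_{PI},\lambda\ge1$ such that for all balls $B$ of radius $r$ and all functions $u$ with upper gradient $g$, $$\frac{1}{m(B)}\int_B|u-u_{B,m}|\,dm\le C_{PI}\,r\left(\frac1{m(\lambda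 B)}\int_{\lambda B}g^p\,dm\right)^{1/p},\qquad u_{B,m}=\frac1{m(B)}\int_Bu\,dm.$$ The $p$-admissibility constants of $w$ are the doubling constant of $w\,d\mu$ and $C_{PI},\lambda$. (A Borel $g\ge 0$ is an upper gradient of $u$ if $|u(\gamma(b))-u(\gamma(a))|\le\int_\gamma g\,ds$ for all nonconstant compact rectifiable curves $\gamma:[a,b]\to X$, where the right-hand side is required to be $\infty$ if $u(\gamma(a))$ or $u(\gamma(b))$ is not finite; it is a $p$-weak upper gradient if this holds outside a family of curves of $p$-modulus zero.) For $\delta>0$, a doubling weight $w$ is $\delta$-regularizable in $\Omega$ if whenever $x,x'\in\Omega$ and $B_x=B(x,d_\Omega(x)/8)$, $B_{x'}=B(x',d_\Omega(x')/8)$ satisfy $2B_{x'}\cap B_x\neq\varnothing$, one has $|w_{B_x}-w_{B_{x'}}|\le\delta\,w_{B_x}$. For a measure $m$ on $X$, $\Omega$ satisfies a $p$-Hardy inequality with respect to $m$ with constant $C_p\ge 1$ if $\int_\Omega\frac{|u|^p}{d_\Omega^p}\,dm\le C_p\int_\Omega g_u^p\,dm$ for all $u\in\mathrm{Lip}_c(\Omega)$ (Lipschitz functions with compact support in $\Omega$), where $g_u$ is the minimal $p$-weak upper gradient of $u$ (with respect to $m$). The constant $C_0$: let $\{B_i\}_i$, $B_i=B(x_i,r_i)$, $r_i=d_\Omega(x_i)/8$, be a countable Whitney cover of $\Omega$ with $\Omega=\bigcup_iB_i$ and $\sum_i\chi_{6B_i}\le C$, and $\{\varphi_i\}$ a partition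 of unity on $\Omega$ with $\varphi_i$ being $C/r_i$-Lipschitz, $0\le\varphi_i\le\chi_{2B_i}$, $\sum_i\varphi_i=1$ on $\Omega$, $\varphi_i\ge C^{-1}$ on $B_i$, where $C$ depends only on $C_\mu$. For a weight $w$ let $\widetilde w=\sum_i w_{B_i}\varphi_i$. Then $C_0\ge1$ is a constant depending only on $C_\mu$ such that $g_{\widetilde w}\le C_0\,\delta\, d_\Omega^{-1}\,\widetilde w$ a.e. in $\Omega$ for every weight $w$ which is $\delta$-regularizable in $\Omega$.
   Formalization: The weighted Hardy constant may also depend on C_p (otherwise the claim fails: w=1, p=2, annuli ε<|x|<1 in the plane); spaces are subsets of one ambient metric space, and the space of bounded sequences contains an isometric copy of every doubling space. *)

theory Defs
  imports "HOL-Analysis.Analysis"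
begin

text \<open>
  A metric space is a subset \<open>X\<close> of a type of class \<open>metric_space\<close>, with the induced metric.
  Every notion below is intrinsic to \<open>X\<close> (relative balls, curves inside \<open>X\<close>, relatively open
  sets, Borel sets of \<open>X\<close>).  In this way one can quantify over all spaces inside a formula,
  as is needed for constants that do not depend on the space: doubling spaces are separable,
  hence all of them embed isometrically into the single type of bounded real sequences
  with the supremum norm.
\<close>

definition ball_in :: "'a::metric_space set \<Rightarrow> 'a \<Rightarrow> real \<Rightarrow> 'a set" where
  "ball_in X x r = ball x r \<inter> X"

text \<open>\<open>d(x, X \<setminus> \<Omega>)\<close>.  If \<open>\<Omega> = X\<close> this is \<open>0\<close> by the convention for \<open>infdist\<close>, and since
  \<open>1 / 0 = 0\<close> the function \<open>1 / d_compl\<close> is then \<open>0\<close>, as it is with the convention that the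
  distance to the empty set is infinite.\<close>

definition d_compl :: "'a::metric_space set \<Rightarrow> 'a set \<Rightarrow> 'a \<Rightarrow> real" where
  "d_compl X \<Omega> x = infdist x (X - \<Omega>)"

text \<open>Powers of extended non-negative numbers, for exponents \<open>q > 0\<close>.\<close>

definition enn_powr :: "ennreal \<Rightarrow> real \<Rightarrow> ennreal" where
  "enn_powr t q = (if t = \<infinity> then \<infinity> else ennreal (enn2real t powr q))"

definition avg :: "'a measure \<Rightarrow> 'a set \<Rightarrow> ('a \<Rightarrow> real) \<Rightarrow> real" where
  "avg m B f = (LINT x:B|m. f x) / measure m B"

definition doubling :: "'a::metric_space set \<Rightarrow> 'a measure \<Rightarrow> real \<Rightarrow> bool" where
  "doubling X m C \<longleftrightarrow>
     sets m = sets (restrict_space borel X) \<and> 1 \<le> C \<and>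
     (\<forall>x\<in>X. \<forall>r>0.
        0 < emeasure m (ball_in X x (2 * r)) \<and>
        emeasure m (ball_in X x (2 * r)) \<le> ennreal C * emeasure m (ball_in X x r) \<and>
        ennreal C * emeasure m (ball_in X x r) < \<infinity>)"

text \<open>A curve is a triple \<open>(\<gamma>, a, b)\<close>; only the values of \<open>\<gamma>\<close> on \<open>[a, b]\<close> matter.\<close>

type_synonym 'a curve = "(real \<Rightarrow> 'a) \<times> real \<times> real"

definition curve_length :: "(real \<Rightarrow> 'a::metric_space) \<Rightarrow> real \<Rightarrow> real \<Rightarrow> ennreal" where
  "curve_length \<gamma> a b =
     (SUP ts \<in> {ts. sorted ts \<and> set ts \<subseteq> {a..b}}.
        ennreal (\<Sum>i < length ts - 1. dist (\<gamma> (ts ! i)) (\<gamma> (ts ! Suc i))))"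

definition rect_curves :: "'a::metric_space set \<Rightarrow> 'a curve set" where
  "rect_curves X =
     {(\<gamma>, a, b). a < b \<and> continuous_on {a..b} \<gamma> \<and> \<gamma> ` {a..b} \<subseteq> X \<and>
        curve_length \<gamma> a b < \<infinity> \<and> (\<exists>t\<in>{a..b}. \<gamma> t \<noteq> \<gamma> a)}"

text \<open>Parametrization by arc length on \<open>[0, curve_length \<gamma> a b]\<close>.  It does not depend on the
  choice of \<open>t\<close>, because \<open>\<gamma>\<close> is constant on every interval on which the length
  does not increase.\<close>

definition arc_param :: "(real \<Rightarrow> 'a::metric_space) \<Rightarrow> real \<Rightarrow> real \<Rightarrow> real \<Rightarrow> 'a" where
  "arc_param \<gamma> a b s = \<gamma> (SOME t. t \<in> {a..b} \<and> curve_length \<gamma> a t = ennreal s)"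

definition line_integral :: "('a::metric_space \<Rightarrow> ennreal) \<Rightarrow> 'a curve \<Rightarrow> ennreal" where
  "line_integral g = (\<lambda>(\<gamma>, a, b).
     \<integral>\<^sup>+ s \<in> {0..enn2real (curve_length \<gamma> a b)}. g (arc_param \<gamma> a b s) \<partial>lborel)"

definition ug_along :: "('a::metric_space \<Rightarrow> ereal) \<Rightarrow> ('a \<Rightarrow> ennreal) \<Rightarrow> 'a curve \<Rightarrow> bool" where
  "ug_along u g = (\<lambda>(\<gamma>, a, b).
     (if \<bar>u (\<gamma> a)\<bar> = \<infinity> \<or> \<bar>u (\<gamma> b)\<bar> = \<infinity> then line_integral g (\<gamma>, a, b) = \<infinity>
      else e2ennreal \<bar>u (\<gamma> b) - u (\<gamma> a)\<bar> \<le> line_integral g (\<gamma>, a, b)))"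

definition upper_gradient ::
  "'a::metric_space set \<Rightarrow> ('a \<Rightarrow> ereal) \<Rightarrow> ('a \<Rightarrow> ennreal) \<Rightarrow> bool" where
  "upper_gradient X u g \<longleftrightarrow>
     g \<in> borel_measurable (restrict_space borel X) \<and> (\<forall>c \<in> rect_curves X. ug_along u g c)"

definition modulus :: "real \<Rightarrow> 'a::metric_space measure \<Rightarrow> 'a curve set \<Rightarrow> ennreal" where
  "modulus p m \<Gamma> =
     (INF \<rho> \<in> {\<rho> \<in> borel_measurable m. \<forall>c\<in>\<Gamma>. 1 \<le> line_integral \<rho> c}.
        \<integral>\<^sup>+ x. enn_powr (\<rho> x) p \<partial>m)"

text \<open>Below \<open>m\<close> is a measure on the Borel sets of \<open>X\<close>, so \<open>borel_measurable m\<close> means Borel on \<open>X\<close>.\<close>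

definition weak_upper_gradient ::
  "real \<Rightarrow> 'a::metric_space set \<Rightarrow> 'a measure \<Rightarrow> ('a \<Rightarrow> ereal) \<Rightarrow> ('a \<Rightarrow> ennreal) \<Rightarrow> bool" where
  "weak_upper_gradient p X m u g \<longleftrightarrow>
     g \<in> borel_measurable m \<and>
     (\<exists>\<Gamma> \<subseteq> rect_curves X. modulus p m \<Gamma> = 0 \<and> (\<forall>c \<in> rect_curves X - \<Gamma>. ug_along u g c))"

definition Lp_loc :: "real \<Rightarrow> 'a::metric_space set \<Rightarrow> 'a measure \<Rightarrow> ('a \<Rightarrow> ennreal) \<Rightarrow> bool" where
  "Lp_loc p X m g \<longleftrightarrow>
     g \<in> borel_measurable m \<and>
     (\<forall>x\<in>X. \<exists>r>0. (\<integral>\<^sup>+ y \<in> ball_in X x r. enn_powr (g y) p \<partial>m) < \<infinity>)"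

text \<open>\<open>g\<close> is (a representative of) the minimal \<open>p\<close>-weak upper gradient \<open>g\<^sub>u\<close> of \<open>u\<close>,
  which is unique up to sets of measure zero.\<close>

definition minimal_wug ::
  "real \<Rightarrow> 'a::metric_space set \<Rightarrow> 'a measure \<Rightarrow> ('a \<Rightarrow> ereal) \<Rightarrow> ('a \<Rightarrow> ennreal) \<Rightarrow> bool" where
  "minimal_wug p X m u g \<longleftrightarrow>
     weak_upper_gradient p X m u g \<and> Lp_loc p X m g \<and>
     (\<forall>h. weak_upper_gradient p X m u h \<and> Lp_loc p X m h \<longrightarrow> (AE x in m. g x \<le> h x))"

definition Lip_c :: "'a::metric_space set \<Rightarrow> 'a set \<Rightarrow> ('a \<Rightarrow> real) set" where
  "Lip_c X \<Omega> =
     {u. (\<exists>L. L-lipschitz_on X u) \<and>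
         compact (closure {x\<in>X. u x \<noteq> 0}) \<and> closure {x\<in>X. u x \<noteq> 0} \<subseteq> \<Omega>}"

definition hardy ::
  "real \<Rightarrow> 'a::metric_space set \<Rightarrow> 'a set \<Rightarrow> 'a measure \<Rightarrow> real \<Rightarrow> bool" where
  "hardy p X \<Omega> m C \<longleftrightarrow>
     1 \<le> C \<and>
     (\<forall>u \<in> Lip_c X \<Omega>. \<forall>g. minimal_wug p X m (\<lambda>x. ereal (u x)) g \<longrightarrow>
        (\<integral>\<^sup>+ x \<in> \<Omega>. ennreal (\<bar>u x\<bar> powr p / d_compl X \<Omega> x powr p) \<partial>m)
          \<le> ennreal C * (\<integral>\<^sup>+ x \<in> \<Omega>. enn_powr (g x) p \<partial>m))"

definition weight :: "'a::metric_space set \<Rightarrow> 'a measure \<Rightarrow> ('a \<Rightarrow> real) \<Rightarrow> bool" where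
  "weight X \<mu> w \<longleftrightarrow>
     w \<in> borel_measurable \<mu> \<and> (\<forall>x\<in>X. 0 \<le> w x) \<and>
     (\<forall>x\<in>X. \<exists>r>0. set_integrable \<mu> (ball_in X x r) w)"

abbreviation weighted :: "('a \<Rightarrow> real) \<Rightarrow> 'a measure \<Rightarrow> 'a measure" where
  "weighted w \<mu> \<equiv> density \<mu> (\<lambda>x. ennreal (w x))"

text \<open>The inequality is required for all \<open>u\<close> for which its left-hand side makes sense,
  that is, \<open>u\<close> is Borel and integrable on the ball in question.\<close>

definition poincare ::
  "real \<Rightarrow> 'a::metric_space set \<Rightarrow> 'a measure \<Rightarrow> real \<Rightarrow> real \<Rightarrow> bool" where
  "poincare p X m C\<^sub>P\<^sub>I \<Lambda> \<longleftrightarrow>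
     1 \<le> C\<^sub>P\<^sub>I \<and> 1 \<le> \<Lambda> \<and>
     (\<forall>x\<in>X. \<forall>r>0. \<forall>u g.
        u \<in> borel_measurable m \<and>
        (\<integral>\<^sup>+ y \<in> ball_in X x r. e2ennreal \<bar>u y\<bar> \<partial>m) < \<infinity> \<and>
        upper_gradient X u g \<longrightarrow>
        (\<integral>\<^sup>+ y \<in> ball_in X x r.
            e2ennreal \<bar>u y - ereal (avg m (ball_in X x r) (\<lambda>z. real_of_ereal (u z)))\<bar> \<partial>m)
          / emeasure m (ball_in X x r)
        \<le> ennreal (C\<^sub>P\<^sub>I * r) *
          enn_powr ((\<integral>\<^sup>+ y \<in> ball_in X x (\<Lambda> * r). enn_powr (g y) p \<partial>m)
                    / emeasure m (ball_in X x (\<Lambda> * r))) (1 / p))"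

definition admissible ::
  "real \<Rightarrow> 'a::metric_space set \<Rightarrow> 'a measure \<Rightarrow> ('a \<Rightarrow> real) \<Rightarrow> real \<Rightarrow> real \<Rightarrow> real \<Rightarrow> bool" where
  "admissible p X \<mu> w C\<^sub>w C\<^sub>P\<^sub>I \<Lambda> \<longleftrightarrow>
     weight X \<mu> w \<and> doubling X (weighted w \<mu>) C\<^sub>w \<and> poincare p X (weighted w \<mu>) C\<^sub>P\<^sub>I \<Lambda>"

text \<open>The dilation \<open>t B\<^sub>x\<close> of \<open>B\<^sub>x = B(x, d(x, X \<setminus> \<Omega>) / 8)\<close>.\<close>

definition wball :: "'a::metric_space set \<Rightarrow> 'a set \<Rightarrow> real \<Rightarrow> 'a \<Rightarrow> 'a set" where
  "wball X \<Omega> t x = ball_in X x (t * (d_compl X \<Omega> x / 8))"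

definition regularizable ::
  "'a::metric_space set \<Rightarrow> 'a measure \<Rightarrow> 'a set \<Rightarrow> real \<Rightarrow> ('a \<Rightarrow> real) \<Rightarrow> bool" where
  "regularizable X \<mu> \<Omega> \<delta> w \<longleftrightarrow>
     weight X \<mu> w \<and> (\<exists>C. doubling X (weighted w \<mu>) C) \<and>
     (\<forall>x\<in>\<Omega>. \<forall>x'\<in>\<Omega>. wball X \<Omega> 2 x' \<inter> wball X \<Omega> 1 x \<noteq> {} \<longrightarrow>
        \<bar>avg \<mu> (wball X \<Omega> 1 x) w - avg \<mu> (wball X \<Omega> 1 x') w\<bar> \<le> \<delta> * avg \<mu> (wball X \<Omega> 1 x) w)"

definition whitney_partition ::
  "'a::metric_space set \<Rightarrow> 'a set \<Rightarrow> real \<Rightarrow> nat set \<Rightarrow> (nat \<Rightarrow> 'a) \<Rightarrow> (nat \<Rightarrow> 'a \<Rightarrow> real) \<Rightarrow> bool" where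
  "whitney_partition X \<Omega> C I x \<phi> \<longleftrightarrow>
     0 < C \<and>
     x ` I \<subseteq> \<Omega> \<and>
     \<Omega> = (\<Union>i\<in>I. wball X \<Omega> 1 (x i)) \<and>
     (\<forall>y\<in>X. finite {i\<in>I. y \<in> wball X \<Omega> 6 (x i)} \<and>
            real (card {i\<in>I. y \<in> wball X \<Omega> 6 (x i)}) \<le> C) \<and>
     (\<forall>i\<in>I. (C / (d_compl X \<Omega> (x i) / 8))-lipschitz_on X (\<phi> i) \<and>
        (\<forall>y\<in>X. 0 \<le> \<phi> i y \<and> \<phi> i y \<le> indicator (wball X \<Omega> 2 (x i)) y) \<and>
        (\<forall>y\<in>wball X \<Omega> 1 (x i). 1 / C \<le> \<phi> i y)) \<and>
     (\<forall>y\<in>\<Omega>. ((\<lambda>i. \<phi> i y) has_sum 1) I)"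

definition discrete_convolution ::
  "'a::metric_space set \<Rightarrow> 'a measure \<Rightarrow> 'a set \<Rightarrow> nat set \<Rightarrow> (nat \<Rightarrow> 'a) \<Rightarrow> (nat \<Rightarrow> 'a \<Rightarrow> real) \<Rightarrow>
     ('a \<Rightarrow> real) \<Rightarrow> 'a \<Rightarrow> real" where
  "discrete_convolution X \<mu> \<Omega> I x \<phi> w y =
     (\<Sum>\<^sub>\<infinity>i\<in>I. avg \<mu> (wball X \<Omega> 1 (x i)) w * \<phi> i y)"

text \<open>
  \<open>C\<^sub>0\<close> is a valid constant in the gradient estimate for discrete convolutions, for all spaces
  with doubling constant \<open>C\<^sub>\<mu>\<close>.  The constant \<open>C\<close> of the Whitney data
  is also chosen before the space.  The discrete convolution lives on \<open>\<Omega>\<close>, so its minimal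
  \<open>p\<close>-weak upper gradient is taken with \<open>\<Omega>\<close> as the underlying space.
\<close>

definition gradient_constant :: "'a::metric_space itself \<Rightarrow> real \<Rightarrow> real \<Rightarrow> real \<Rightarrow> bool" where
  "gradient_constant (_ :: 'a itself) p C\<^sub>\<mu> C\<^sub>0 \<longleftrightarrow>
     (\<exists>C. \<forall>(X :: 'a set) \<mu> \<Omega>.
        complete X \<and> doubling X \<mu> C\<^sub>\<mu> \<and> openin (top_of_set X) \<Omega> \<and> \<Omega> \<noteq> X \<longrightarrow>
        (\<exists>I x \<phi>. whitney_partition X \<Omega> C I x \<phi> \<and>
           (\<forall>\<delta>>0. \<forall>w g.
              regularizable X \<mu> \<Omega> \<delta> w \<and>
              minimal_wug p \<Omega> (restrict_space \<mu> \<Omega>)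
                (\<lambda>y. ereal (discrete_convolution X \<mu> \<Omega> I x \<phi> w y)) g \<longrightarrow>
              (AE y in restrict_space \<mu> \<Omega>.
                 g y \<le> ennreal (C\<^sub>0 * \<delta> / d_compl X \<Omega> y *
                                 discrete_convolution X \<mu> \<Omega> I x \<phi> w y)))))"

end

theory Submission
  imports Defs
begin

text \<open>
  Let \<open>w\<close> be \<open>\<delta>\<close>-regularizable, and let \<open>W = \<Sum> w\<^bsub>B_i\<^esub> \<phi>\<^sub>i\<close> be its discrete convolution along a Whitney
  partition.  Neighbouring averages of \<open>w\<close> differ by at most \<open>\<delta>\<close> times their size, so \<open>W\<close> has a
  gradient of size \<open>C\<^sub>0 \<delta> W / d\<close>, where \<open>d\<close> is the distance to the complement of \<open>\<Omega>\<close>.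

  Testing the Hardy inequality for \<open>\<mu>\<close> with \<open>v W\<^sup>1\<^sup>/\<^sup>p\<close> gives, by the Leibniz rule, the Hardy inequality for \<open>v\<close> with
  respect to \<open>W d\<mu>\<close> up to an extra term \<open>(C\<^sub>0 \<delta> / p)\<^sup>p \<integral> |v|\<^sup>p d\<^sup>-\<^sup>p W d\<mu>\<close>, which is absorbed into the left-hand side
  when \<open>\<delta>\<close> is below the threshold (\<open>weighted_hardy\<close>).  On a Whitney ball \<open>W\<close> is comparable to the average
  of \<open>w\<close>, but not to \<open>w\<close> itself, and the gradient of a function with respect to \<open>\<mu>\<close> is not controlled by the one with respect
  to \<open>w d\<mu>\<close>.  Therefore a test function \<open>u\<close> is first replaced by \<open>v = \<Sum> u\<^bsub>B_j\<^esub> \<psi>\<^sub>j\<close>, where the averages are taken with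
  respect to \<open>w d\<mu>\<close> and the balls \<open>B\<^sub>j\<close> belong to a Whitney partition \<open>\<psi>\<close> which is so fine that their dilations in the Poincare
  inequality stay in \<open>\<Omega>\<close>.  The function \<open>v\<close> has an upper gradient that is dominated by a combination of indicator functions of
  the balls, with coefficients that the Poincare inequality for \<open>w d\<mu>\<close> bounds by averages of the gradient of \<open>u\<close>; for functions of this kind the measures \<open>w d\<mu>\<close> and \<open>W d\<mu>\<close> are
  interchangeable.  The difference \<open>u - v\<close> is controlled on each ball by the Poincare inequality with exponent \<open>p\<close> on both
  sides, which follows from the one with exponents \<open>1\<close> and \<open>p\<close> by telescoping (\<open>poincare_p_p\<close>).  This is carried out
  in \<open>hardy_of_upper_gradient\<close>.  The partition that defines \<open>W\<close> does not enter the constant: \<open>W\<close> is a convex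
  combination of averages that are all comparable to each other.

  Both inequalities are about minimal weak upper gradients, so their existence has to be shown before they can be used:
  for \<open>W\<close> in \<open>\<Omega>\<close>, where they enter the gradient estimate, and for \<open>v W\<^sup>1\<^sup>/\<^sup>p\<close> in \<open>X\<close>
  (\<open>minimal_wug_exists\<close>).  A \<open>p\<close>-weak upper gradient is handled as a function that satisfies the upper
  gradient inequality along all curves on which a fixed \<open>p\<close>-integrable function \<open>\<rho>\<close> is integrable (\<open>ug_off\<close>), and
  inequalities along a curve are proved locally and then added up (\<open>increment_le_nn_integral\<close>).
\<close>


section \<open>Curves and their parametrization by arc length\<close>

text \<open>The sums in the definition of the length of a curve, as a recursion on the partition, so that
  partitions can be split and concatenated.\<close>

fun polygon_length :: "(real \<Rightarrow> 'a::metric_space) \<Rightarrow> real list \<Rightarrow> real" where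
  "polygon_length \<gamma> (x # y # zs) = dist (\<gamma> x) (\<gamma> y) + polygon_length \<gamma> (y # zs)"
| "polygon_length \<gamma> _ = 0"

lemma polygon_length_nonneg: "0 \<le> polygon_length \<gamma> ts"
  by (induction \<gamma> ts rule: polygon_length.induct) auto

lemma polygon_length_eq_sum:
  "(\<Sum>i < length ts - 1. dist (\<gamma> (ts ! i)) (\<gamma> (ts ! Suc i))) = polygon_length \<gamma> ts"
  proof (induction \<gamma> ts rule: polygon_length.induct)
  case (1 \<gamma> x y zs)
  have "length (x # y # zs) - 1 = Suc (length (y # zs) - 1)" by simp
  then show ?case using 1 by (simp only: sum.lessThan_Suc_shift) simp
qed auto

lemma polygon_length_append:
  "polygon_length \<gamma> (xs @ y # ys) = polygon_length \<gamma> (xs @ [y]) + polygon_length \<gamma> (y # ys)"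
proof (induction xs)
  case (Cons x xs)
  then show ?case by (cases xs) auto
qed simp

lemma polygon_length_Cons_mono: "polygon_length \<gamma> xs \<le> polygon_length \<gamma> (x # xs)"
  by (cases xs) auto

lemma polygon_length_snoc_mono: "polygon_length \<gamma> xs \<le> polygon_length \<gamma> (xs @ [x])"
proof (induction xs)
  case (Cons a xs)
  then show ?case by (cases xs) auto
qed simp

lemma polygon_length_append_mono:
  "polygon_length \<gamma> xs + polygon_length \<gamma> ys \<le> polygon_length \<gamma> (xs @ ys)"
proof (cases ys)
  case (Cons y zs)
  then show ?thesis
    using polygon_length_append[of \<gamma> xs y zs] polygon_length_snoc_mono[of \<gamma> xs y] by simp
qed simp

lemma polygon_length_insert:
  "polygon_length \<gamma> (xs @ ys) \<le> polygon_length \<gamma> (xs @ y # ys)"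
proof (induction xs)
  case Nil
  show ?case by (simp add: polygon_length_Cons_mono)
next
  case (Cons x xs)
  show ?case
  proof (cases xs)
    case Nil
    show ?thesis
    proof (cases ys)
      case (Cons z zs)
      have "dist (\<gamma> x) (\<gamma> z) \<le> dist (\<gamma> x) (\<gamma> y) + dist (\<gamma> y) (\<gamma> z)"
        by (rule dist_triangle)
      then show ?thesis using Cons Nil by simp
    qed (simp add: Nil)
  qed (use Cons in auto)
qed

lemma polygon_length_bound:
  assumes "\<And>s t. s \<in> set ts \<Longrightarrow> t \<in> set ts \<Longrightarrow> dist (\<gamma> s) (\<gamma> t) \<le> e" "0 \<le> e"
  shows "polygon_length \<gamma> ts \<le> real (length ts) * e"
  using assms(1)
proof (induction \<gamma> ts rule: polygon_length.induct)
  case (1 \<gamma> x y zs)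
  have "polygon_length \<gamma> (y # zs) \<le> real (length (y # zs)) * e"
    by (rule 1(1)) (use 1(2) in auto)
  moreover have "dist (\<gamma> x) (\<gamma> y) \<le> e" by (rule 1(2)) auto
  ultimately show ?case by (simp add: algebra_simps)
qed (use \<open>0 \<le> e\<close> in auto)

lemma curve_length_alt:
  "curve_length \<gamma> a b = (SUP ts \<in> {ts. sorted ts \<and> set ts \<subseteq> {a..b}}. ennreal (polygon_length \<gamma> ts))"
  unfolding curve_length_def polygon_length_eq_sum ..

lemma polygon_length_le_curve_length:
  assumes "sorted ts" "set ts \<subseteq> {a..b}"
  shows "ennreal (polygon_length \<gamma> ts) \<le> curve_length \<gamma> a b"
  unfolding curve_length_alt by (rule SUP_upper) (use assms in auto)

lemma dist_le_curve_length:
  assumes "a \<le> b"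
  shows "ennreal (dist (\<gamma> a) (\<gamma> b)) \<le> curve_length \<gamma> a b"
  using polygon_length_le_curve_length[of "[a, b]" a b \<gamma>] assms by simp

lemma curve_length_mono:
  assumes "a \<le> a'" "b' \<le> b"
  shows "curve_length \<gamma> a' b' \<le> curve_length \<gamma> a b"
  unfolding curve_length_alt by (rule SUP_subset_mono) (use assms in force)+

lemma curve_length_refl [simp]: "curve_length \<gamma> a a = 0"
proof -
  have "polygon_length \<gamma> ts = 0" if "set ts \<subseteq> {a}" for ts
    using that by (induction \<gamma> ts rule: polygon_length.induct) auto
  then have "ennreal (polygon_length \<gamma> ts) \<le> 0" if "ts \<in> {ts. sorted ts \<and> set ts \<subseteq> {a..a}}" for ts
    using that by auto
  then have "curve_length \<gamma> a a \<le> 0"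
    unfolding curve_length_alt by (intro SUP_least) blast
  then show ?thesis by simp
qed

lemma sorted_split: "sorted ts \<Longrightarrow> ts = filter (\<lambda>t. t \<le> b) ts @ filter (\<lambda>t. \<not> t \<le> b) ts"
  for b :: real
proof (induction ts)
  case (Cons t ts)
  show ?case
  proof (cases "t \<le> b")
    case False
    then have "filter (\<lambda>t. t \<le> b) (t # ts) = []" "filter (\<lambda>t. \<not> t \<le> b) (t # ts) = t # ts"
      using Cons.prems by (force simp: filter_empty_conv filter_id_conv)+
    then show ?thesis by simp
  qed (use Cons in auto)
qed simp

text \<open>Partitions can be concatenated, which gives one inequality.  For the other one, insert \<open>b\<close> into a partition.\<close>

lemma curve_length_add:
  assumes "a \<le> b" "b \<le> c"
  shows "curve_length \<gamma> a c = curve_length \<gamma> a b + curve_length \<gamma> b c"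
proof (rule antisym)
  show "curve_length \<gamma> a c \<le> curve_length \<gamma> a b + curve_length \<gamma> b c"
    unfolding curve_length_alt[of \<gamma> a c]
  proof (rule SUP_least)
    fix ts assume "ts \<in> {ts. sorted ts \<and> set ts \<subseteq> {a..c}}"
    then have ts: "sorted ts" "set ts \<subseteq> {a..c}" by auto
    define xs ys where "xs = filter (\<lambda>t. t \<le> b) ts" and "ys = filter (\<lambda>t. \<not> t \<le> b) ts"
    have eq: "ts = xs @ ys" using sorted_split[OF ts(1)] by (simp add: xs_def ys_def)
    have "polygon_length \<gamma> ts \<le> polygon_length \<gamma> (xs @ b # ys)"
      unfolding eq by (rule polygon_length_insert)
    also have "\<dots> = polygon_length \<gamma> (xs @ [b]) + polygon_length \<gamma> (b # ys)"
      by (rule polygon_length_append)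
    finally have "ennreal (polygon_length \<gamma> ts)
        \<le> ennreal (polygon_length \<gamma> (xs @ [b])) + ennreal (polygon_length \<gamma> (b # ys))"
      by (metis ennreal_leI ennreal_plus polygon_length_nonneg)
    also have "\<dots> \<le> curve_length \<gamma> a b + curve_length \<gamma> b c"
    proof (intro add_mono polygon_length_le_curve_length)
      show "sorted (xs @ [b])" "set (xs @ [b]) \<subseteq> {a..b}" "sorted (b # ys)" "set (b # ys) \<subseteq> {b..c}"
        using ts assms by (auto simp: xs_def ys_def sorted_append intro: sorted_wrt_filter)
    qed
    finally show "ennreal (polygon_length \<gamma> ts) \<le> curve_length \<gamma> a b + curve_length \<gamma> b c" .
  qed
  let ?S = "\<lambda>a b. {ts. sorted ts \<and> set ts \<subseteq> {a..b::real}}"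
  show "curve_length \<gamma> a b + curve_length \<gamma> b c \<le> curve_length \<gamma> a c"
  proof -
    have ne: "?S s t \<noteq> {}" for s t
      by (auto intro: exI[of _ "[]"])
    have "ennreal (polygon_length \<gamma> xs) + ennreal (polygon_length \<gamma> ys) \<le> curve_length \<gamma> a c"
      if "xs \<in> ?S a b" "ys \<in> ?S b c" for xs ys
    proof -
      have "ennreal (polygon_length \<gamma> xs) + ennreal (polygon_length \<gamma> ys)
          = ennreal (polygon_length \<gamma> xs + polygon_length \<gamma> ys)"
        by (simp add: polygon_length_nonneg)
      also have "\<dots> \<le> ennreal (polygon_length \<gamma> (xs @ ys))"
        by (intro ennreal_leI polygon_length_append_mono)
      also have "\<dots> \<le> curve_length \<gamma> a c"
        by (rule polygon_length_le_curve_length) (use that assms in \<open>force simp: sorted_append\<close>)+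
      finally show ?thesis .
    qed
    then have "ennreal (polygon_length \<gamma> xs) + curve_length \<gamma> b c \<le> curve_length \<gamma> a c"
      if "xs \<in> ?S a b" for xs
      unfolding curve_length_alt[of \<gamma> b c] ennreal_SUP_add_right[OF ne]
      using that by (intro SUP_least)
    then show ?thesis
      unfolding curve_length_alt[of \<gamma> a b] ennreal_SUP_add_left[OF ne, symmetric]
      by (intro SUP_least)
  qed
qed

text \<open>Fix a partition that misses at most \<open>e / 2\<close> of the length, and insert \<open>t\<close> and \<open>t'\<close>.  The pieces outside \<open>[t, t']\<close> are
  bounded by the lengths of the two outer subcurves, and the pieces inside are few and short by uniform continuity.  So
  little is left for the length of the middle subcurve.\<close>

lemma curve_length_small:
  assumes "continuous_on {a..b} \<gamma>" "curve_length \<gamma> a b < \<infinity>" "a \<le> b" "0 < e"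
  obtains h where "0 < h"
    "\<And>t t'. a \<le> t \<Longrightarrow> t \<le> t' \<Longrightarrow> t' \<le> b \<Longrightarrow> t' - t < h \<Longrightarrow> curve_length \<gamma> t t' < ennreal e"
proof -
  define L where "L = enn2real (curve_length \<gamma> a b)"
  have L: "curve_length \<gamma> a b = ennreal L"
    using assms(2) by (simp add: L_def)
  have L0: "0 \<le> L" by (simp add: L_def)
  have "\<exists>ts. sorted ts \<and> set ts \<subseteq> {a..b} \<and> L - e / 2 \<le> polygon_length \<gamma> ts"
  proof (rule ccontr)
    assume none: "\<not> ?thesis"
    then have "curve_length \<gamma> a b \<le> ennreal (L - e / 2)"
      unfolding curve_length_alt by (intro SUP_least ennreal_leI) force
    moreover have "0 \<le> L - e / 2" using none by (auto dest!: spec[of _ "[]"])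
    ultimately show False using L L0 assms(4) by simp
  qed
  then obtain ts where ts: "sorted ts" "set ts \<subseteq> {a..b}" "L - e / 2 \<le> polygon_length \<gamma> ts" by blast
  define n where "n = length ts + 2"
  have "uniformly_continuous_on {a..b} \<gamma>"
    by (intro compact_uniformly_continuous assms) auto
  moreover have "0 < e / (4 * real n)" using assms(4) by (simp add: n_def)
  ultimately obtain h where h: "0 < h"
    "\<And>t t'. t \<in> {a..b} \<Longrightarrow> t' \<in> {a..b} \<Longrightarrow> dist t' t < h \<Longrightarrow> dist (\<gamma> t') (\<gamma> t) < e / (4 * real n)"
    unfolding uniformly_continuous_on_def by meson
  \<comment> \<open>a partition with \<open>t\<close> and \<open>t'\<close> inserted has at most \<open>n\<close> points in \<open>[t, t']\<close>\<close>
  show thesis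
  proof (rule that[OF h(1)])
    fix t t' assume t: "a \<le> t" "t \<le> t'" "t' \<le> b" "t' - t < h"
    define xs zs where "xs = filter (\<lambda>s. s \<le> t) ts" and "zs = filter (\<lambda>s. \<not> s \<le> t) ts"
    define ys us where "ys = filter (\<lambda>s. s \<le> t') zs" and "us = filter (\<lambda>s. \<not> s \<le> t') zs"
    have "sorted zs" by (simp add: zs_def ts(1) sorted_wrt_filter)
    then have eq: "ts = xs @ ys @ us"
      using sorted_split[OF ts(1), of t] sorted_split[of zs t'] by (simp add: xs_def ys_def zs_def us_def)
    let ?f = "\<lambda>ts. ennreal (polygon_length \<gamma> ts)"
    have "polygon_length \<gamma> ts \<le> polygon_length \<gamma> (xs @ t # ys @ us)"
      unfolding eq by (rule polygon_length_insert)
    also have "\<dots> \<le> polygon_length \<gamma> ((xs @ t # ys) @ t' # us)"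
      using polygon_length_insert[of \<gamma> "xs @ t # ys" us t'] by simp
    also have "\<dots> = polygon_length \<gamma> (xs @ [t]) + polygon_length \<gamma> (t # ys @ [t']) + polygon_length \<gamma> (t' # us)"
      using polygon_length_append[of \<gamma> "xs @ t # ys" t' us] polygon_length_append[of \<gamma> xs t "ys @ [t']"] by simp
    finally have le: "polygon_length \<gamma> ts \<le> \<dots>" .
    have 1: "?f (xs @ [t]) \<le> curve_length \<gamma> a t" "?f (t' # us) \<le> curve_length \<gamma> t' b"
      by (rule polygon_length_le_curve_length;
          use ts t in \<open>auto simp: xs_def zs_def us_def sorted_append intro: sorted_wrt_filter\<close>)+
    have "set (t # ys @ [t']) \<subseteq> {t..t'}" by (use t in \<open>auto simp: ys_def zs_def\<close>)
    then have "dist (\<gamma> r) (\<gamma> s) \<le> e / (4 * real n)" if "r \<in> set (t # ys @ [t'])" "s \<in> set (t # ys @ [t'])" for r s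
    proof -
      have "r \<in> {t..t'}" "s \<in> {t..t'}"
        using that \<open>set (t # ys @ [t']) \<subseteq> {t..t'}\<close> by blast+
      then have "dist r s < h" using t(4) by (auto simp: dist_real_def)
      then show ?thesis
        using h(2)[of s r] \<open>r \<in> {t..t'}\<close> \<open>s \<in> {t..t'}\<close> t(1,3) by auto
    qed
    then have "polygon_length \<gamma> (t # ys @ [t']) \<le> real (length (t # ys @ [t'])) * (e / (4 * real n))"
      by (rule polygon_length_bound) (use \<open>0 < e / (4 * real n)\<close> in \<open>auto intro: less_imp_le\<close>)
    also have "\<dots> \<le> real n * (e / (4 * real n))"
      by (intro mult_right_mono) (use assms(4) in \<open>auto simp: n_def eq\<close>)
    also have "\<dots> = e / 4" using \<open>0 < e / (4 * real n)\<close> by (auto simp: zero_less_divide_iff)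
    finally have 2: "polygon_length \<gamma> (t # ys @ [t']) \<le> e / 4" .
    have sum: "curve_length \<gamma> a b = curve_length \<gamma> a t + curve_length \<gamma> t t' + curve_length \<gamma> t' b"
      using curve_length_add[of a t b \<gamma>] curve_length_add[of t t' b \<gamma>] t by (simp add: add.assoc)
    then obtain p q r where pqr: "curve_length \<gamma> a t = ennreal p" "curve_length \<gamma> t t' = ennreal q"
        "curve_length \<gamma> t' b = ennreal r" "0 \<le> p" "0 \<le> q" "0 \<le> r"
      using assms(2) by (cases "curve_length \<gamma> a t"; cases "curve_length \<gamma> t t'"; cases "curve_length \<gamma> t' b") auto
    have "L = p + q + r" 
    proof -
      have "ennreal L = ennreal (p + q + r)" using sum L pqr by (simp add: ennreal_plus)
      then show ?thesis using L0 pqr by (subst (asm) ennreal_inj) auto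
    qed
    moreover have "polygon_length \<gamma> (xs @ [t]) \<le> p" "polygon_length \<gamma> (t' # us) \<le> r"
      using 1 pqr by simp_all
    ultimately have "q < e" using le 2 ts(3) assms(4) by simp
    then show "curve_length \<gamma> t t' < ennreal e" using pqr by (simp add: ennreal_lessI assms(4))
  qed
qed

text \<open>The length is continuous in the end point by \<open>curve_length_small\<close>, so the intermediate value theorem applies.\<close>

lemma ex_curve_length_eq:
  assumes "continuous_on {a..b} \<gamma>" "curve_length \<gamma> a b < \<infinity>" "a \<le> b"
    "0 \<le> s" "s \<le> enn2real (curve_length \<gamma> a b)"
  obtains t where "a \<le> t" "t \<le> b" "curve_length \<gamma> a t = ennreal s"
proof -
  define l where "l t = enn2real (curve_length \<gamma> a t)" for t
  have fin: "curve_length \<gamma> a t < \<infinity>" if "t \<le> b" for t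
    using curve_length_mono[of a a t b \<gamma>] that assms(2) by auto
  then have l: "curve_length \<gamma> a t = ennreal (l t)" if "t \<le> b" for t
    using that by (simp add: l_def)
  have diff: "ennreal (l t' - l t) = curve_length \<gamma> t t'" if "a \<le> t" "t \<le> t'" "t' \<le> b" for t t'
  proof -
    have "ennreal (l t') = ennreal (l t) + curve_length \<gamma> t t'"
      using curve_length_add[of a t t' \<gamma>] that l[of t] l[of t'] by simp
    then show ?thesis
      using fin[of t'] fin[of t] that by (metis ennreal_add_diff_cancel_left ennreal_minus ennreal_neq_top enn2real_nonneg l_def)
  qed
  have "continuous_on {a..b} l"
    unfolding continuous_on_iff
  proof safe
    fix t e :: real assume t: "t \<in> {a..b}" "0 < e"
    obtain h where h: "0 < h"
      "\<And>t t'. a \<le> t \<Longrightarrow> t \<le> t' \<Longrightarrow> t' \<le> b \<Longrightarrow> t' - t < h \<Longrightarrow> curve_length \<gamma> t t' < ennreal e"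
      using curve_length_small[OF assms(1-3) t(2)] by blast
    have *: "\<bar>l s' - l s\<bar> < e" if s: "a \<le> s" "s \<le> s'" "s' \<le> b" "s' - s < h" for s s'
    proof -
      have "ennreal (l s' - l s) < ennreal e" using h(2)[OF s] diff[OF s(1-3)] by simp
      then have "l s' - l s < e" using ennreal_less_iff t(2)
        by (metis ennreal_neg ennreal_less_iff linorder_not_less order_less_le_trans nle_le)
      moreover have "l s \<le> l s'"
        unfolding l_def using s fin[of s'] curve_length_mono[of a a s s' \<gamma>]
        by (intro enn2real_mono) auto
      ultimately show ?thesis by simp
    qed
    show "\<exists>d>0. \<forall>x'\<in>{a..b}. dist x' t < d \<longrightarrow> dist (l x') (l t) < e"
    proof (intro exI[of _ h] conjI ballI impI)
      fix x' assume "x' \<in> {a..b}" "dist x' t < h"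
      then show "dist (l x') (l t) < e"
        using *[of t x'] *[of x' t] t(1) by (cases "t \<le> x'") (auto simp: dist_real_def abs_minus_commute)
    qed (rule h)
  qed
  moreover have "l a \<le> s" "s \<le> l b" using assms by (auto simp: l_def)
  ultimately obtain t where "a \<le> t" "t \<le> b" "l t = s"
    using IVT'[of l a s b] assms(3) by blast
  then show thesis using that l by blast
qed

text \<open>The time chosen in the definition of the parametrization does not matter, because the curve is constant between two
  times at which the length is the same.\<close>

lemma arc_param_eq:
  assumes "a \<le> t" "t \<le> b" "curve_length \<gamma> a t = ennreal s"
  shows "arc_param \<gamma> a b s = \<gamma> t"
proof -
  have eq: "\<gamma> t = \<gamma> t'" if "a \<le> t" "t \<le> t'" "curve_length \<gamma> a t = ennreal s" "curve_length \<gamma> a t' = ennreal s" for t t'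
  proof -
    have "ennreal s = ennreal s + curve_length \<gamma> t t'"
      using curve_length_add[of a t t' \<gamma>] that by simp
    then have "curve_length \<gamma> t t' = 0"
      by simp
    then have "ennreal (dist (\<gamma> t) (\<gamma> t')) \<le> 0"
      using dist_le_curve_length[of t t' \<gamma>] that(2) by simp
    then have "dist (\<gamma> t) (\<gamma> t') \<le> 0" by (metis ennreal_eq_0_iff le_zero_eq)
    then show ?thesis by simp
  qed
  define t' where "t' = (SOME t. t \<in> {a..b} \<and> curve_length \<gamma> a t = ennreal s)"
  have "t' \<in> {a..b} \<and> curve_length \<gamma> a t' = ennreal s"
    unfolding t'_def by (rule someI[of _ t]) (use assms in auto)
  then have t': "a \<le> t'" "curve_length \<gamma> a t' = ennreal s" by auto
  have "\<gamma> t' = \<gamma> t"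
  proof (cases "t \<le> t'")
    case True
    show ?thesis using eq[OF assms(1) True assms(3) t'(2)] by (rule sym)
  next
    case False
    then have "t' \<le> t" by simp
    then show ?thesis using eq[OF t'(1) _ t'(2) assms(3)] by blast
  qed
  then show ?thesis by (simp add: arc_param_def t'_def)
qed

definition arc_of :: "'a::metric_space curve \<Rightarrow> real \<Rightarrow> 'a" where
  "arc_of = (\<lambda>(\<gamma>, a, b). arc_param \<gamma> a b)"

definition arc_len :: "'a::metric_space curve \<Rightarrow> real" where
  "arc_len = (\<lambda>(\<gamma>, a, b). enn2real (curve_length \<gamma> a b))"

lemma line_integral_arc: "line_integral g c = (\<integral>\<^sup>+ s \<in> {0..arc_len c}. g (arc_of c s) \<partial>lborel)"
  by (auto simp: line_integral_def arc_of_def arc_len_def split: prod.split)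

lemma arc_len_nonneg [simp]: "0 \<le> arc_len c"
  by (auto simp: arc_len_def split: prod.split)

lemma ug_along_arc:
  assumes "c \<in> rect_curves X"
  shows "ug_along (\<lambda>x. ereal (u x)) g c \<longleftrightarrow>
     ennreal \<bar>u (arc_of c (arc_len c)) - u (arc_of c 0)\<bar> \<le> line_integral g c"
proof -
  obtain \<gamma> a b where c: "c = (\<gamma>, a, b)" by (cases c)
  have ab: "a < b" "curve_length \<gamma> a b < \<infinity>" using assms by (auto simp: c rect_curves_def)
  have "arc_of c 0 = \<gamma> a" "arc_of c (arc_len c) = \<gamma> b"
    by (auto simp: c arc_of_def arc_len_def intro!: arc_param_eq) (use ab in auto)
  then show ?thesis by (simp add: ug_along_def c)
qed

lemma arc_of_lipschitz:
  assumes "c \<in> rect_curves X"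
  shows "1-lipschitz_on {0..arc_len c} (arc_of c)"
proof -
  obtain \<gamma> a b where c: "c = (\<gamma>, a, b)" by (cases c)
  have ab: "a \<le> b" "curve_length \<gamma> a b < \<infinity>" "continuous_on {a..b} \<gamma>"
    using assms by (auto simp: c rect_curves_def)
  have *: "dist (arc_of c s) (arc_of c s') \<le> s' - s" if s: "0 \<le> s" "s \<le> s'" "s' \<le> arc_len c" for s s'
  proof (cases "s = s'")
    case False
    obtain t where t: "a \<le> t" "t \<le> b" "curve_length \<gamma> a t = ennreal s"
      using ex_curve_length_eq[OF ab(3,2,1), of s] s by (auto simp: c arc_len_def)
    obtain t' where t': "a \<le> t'" "t' \<le> b" "curve_length \<gamma> a t' = ennreal s'"
      using ex_curve_length_eq[OF ab(3,2,1), of s'] s by (auto simp: c arc_len_def)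
    have "t \<le> t'"
    proof (rule ccontr)
      assume "\<not> t \<le> t'"
      then have "ennreal s' \<le> ennreal s" using curve_length_mono[of a a t' t \<gamma>] t t' by simp
      then show False using False s by simp
    qed
    then have "ennreal s' = ennreal s + curve_length \<gamma> t t'"
      using curve_length_add[of a t t' \<gamma>] t t' by simp
    then have "ennreal s + ennreal (dist (\<gamma> t) (\<gamma> t')) \<le> ennreal s'"
      using dist_le_curve_length[OF \<open>t \<le> t'\<close>, of \<gamma>] by (simp add: add_left_mono)
    then have "dist (\<gamma> t) (\<gamma> t') \<le> s' - s" using s by (simp flip: ennreal_plus)
    then show ?thesis using arc_param_eq[OF t] arc_param_eq[OF t'] by (simp add: c arc_of_def)
  qed auto
  show ?thesis
  proof (rule lipschitz_onI)
    fix s s' assume "s \<in> {0..arc_len c}" "s' \<in> {0..arc_len c}"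
    then show "dist (arc_of c s) (arc_of c s') \<le> 1 * dist s s'"
      using *[of s s'] *[of s' s] by (cases "s \<le> s'") (auto simp: dist_real_def dist_commute)
  qed simp
qed

lemma arc_of_continuous:
  assumes "c \<in> rect_curves X"
  shows "continuous_on {0..arc_len c} (arc_of c)"
  using arc_of_lipschitz[OF assms] by (rule lipschitz_on_continuous_on)

lemma arc_of_in:
  assumes "c \<in> rect_curves X" "s \<in> {0..arc_len c}"
  shows "arc_of c s \<in> X"
proof -
  obtain \<gamma> a b where c: "c = (\<gamma>, a, b)" by (cases c)
  have ab: "a \<le> b" "curve_length \<gamma> a b < \<infinity>" "continuous_on {a..b} \<gamma>" "\<gamma> ` {a..b} \<subseteq> X"
    using assms by (auto simp: c rect_curves_def)
  obtain t where t: "a \<le> t" "t \<le> b" "curve_length \<gamma> a t = ennreal s"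
    using ex_curve_length_eq[OF ab(3,2,1), of s] assms by (auto simp: c arc_len_def)
  then show ?thesis using arc_param_eq[OF t] ab(4) by (auto simp: c arc_of_def)
qed

text \<open>Every piece of a curve that does not return to its starting point is a curve, and its
  parametrization by arc length is the restriction of that of the whole curve.  This gives the
  upper gradient inequality on subintervals.\<close>

lemma subcurve:
  assumes "c \<in> rect_curves X" "0 \<le> s" "s \<le> s'" "s' \<le> arc_len c"
    "arc_of c ` {s..s'} \<subseteq> Y" "arc_of c s \<noteq> arc_of c s'"
  obtains c' where "c' \<in> rect_curves Y" "arc_len c' = s' - s"
    "\<And>r. 0 \<le> r \<Longrightarrow> r \<le> s' - s \<Longrightarrow> arc_of c' r = arc_of c (s + r)"
proof -
  obtain \<gamma> a b where c: "c = (\<gamma>, a, b)" by (cases c)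
  have ab: "a \<le> b" "curve_length \<gamma> a b < \<infinity>" "continuous_on {a..b} \<gamma>"
    using assms by (auto simp: c rect_curves_def)
  obtain t where t: "a \<le> t" "t \<le> b" "curve_length \<gamma> a t = ennreal s"
    using ex_curve_length_eq[OF ab(3,2,1), of s] assms by (auto simp: c arc_len_def)
  obtain t' where t': "a \<le> t'" "t' \<le> b" "curve_length \<gamma> a t' = ennreal s'"
    using ex_curve_length_eq[OF ab(3,2,1), of s'] assms by (auto simp: c arc_len_def)
  have ne: "\<gamma> t \<noteq> \<gamma> t'" using assms(6) arc_param_eq[OF t] arc_param_eq[OF t'] by (simp add: c arc_of_def)
  have tt': "t < t'"
  proof (rule ccontr)
    assume "\<not> t < t'"
    then have "ennreal s' \<le> ennreal s" using curve_length_mono[of a a t' t \<gamma>] t t' by simp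
    then show False using assms by simp
  qed
  have len: "ennreal s' = ennreal s + curve_length \<gamma> t t'"
    using curve_length_add[of a t t' \<gamma>] t t' tt' by simp
  have len': "curve_length \<gamma> t t' = ennreal (s' - s)"
    using len assms by (metis ennreal_add_diff_cancel_left ennreal_minus ennreal_neq_top)
  have img: "\<gamma> ` {t..t'} \<subseteq> Y"
  proof
    fix y assume "y \<in> \<gamma> ` {t..t'}"
    then obtain r where r: "r \<in> {t..t'}" "y = \<gamma> r" by auto
    have "curve_length \<gamma> a r \<le> ennreal s'" "ennreal s \<le> curve_length \<gamma> a r"
      using curve_length_mono[of a a r t' \<gamma>] curve_length_mono[of a a t r \<gamma>] t t' r by auto
    then obtain q where q: "curve_length \<gamma> a r = ennreal q" "s \<le> q" "q \<le> s'"
      using assms by (cases "curve_length \<gamma> a r") (auto simp: top_unique)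
    have "arc_of c q = y"
      using arc_param_eq[of a r b \<gamma> q] q r t t' by (simp add: c arc_of_def)
    then show "y \<in> Y" using assms(5) q by auto
  qed
  show thesis
  proof (rule that[of "(\<gamma>, t, t')"])
    show "(\<gamma>, t, t') \<in> rect_curves Y"
      unfolding rect_curves_def using tt' img len' ne ab(3) t t' 
      by (auto intro: continuous_on_subset intro!: bexI[of _ t'])
    show "arc_len (\<gamma>, t, t') = s' - s" using len' assms by (simp add: arc_len_def)
    fix r assume r: "0 \<le> r" "r \<le> s' - s"
    then obtain q where q: "t \<le> q" "q \<le> t'" "curve_length \<gamma> t q = ennreal r"
      using ex_curve_length_eq[of t t' \<gamma> r, OF continuous_on_subset[OF ab(3)]] tt' len' t t'
      by (metis atLeastatMost_subset_iff ennreal_less_top enn2real_ennreal infinity_ennreal_def less_imp_le order_trans)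
    have "curve_length \<gamma> a q = ennreal (s + r)"
      using curve_length_add[of a t q \<gamma>] q t r assms by simp
    then show "arc_of (\<gamma>, t, t') r = arc_of c (s + r)"
      using arc_param_eq[OF q] arc_param_eq[of a q b \<gamma> "s + r"] q t t' by (simp add: c arc_of_def)
  qed
qed

lemma measurable_along_arc:
  assumes "c \<in> rect_curves X" "g \<in> borel_measurable (restrict_space borel X)" "S \<subseteq> {0..arc_len c}" "S \<in> sets borel"
  shows "(\<lambda>s. (g (arc_of c s) :: ennreal) * indicator S s) \<in> borel_measurable borel"
proof -
  have "arc_of c \<in> measurable (restrict_space borel S) (restrict_space borel X)"
  proof (rule measurable_restrict_space2)
    show "arc_of c \<in> space (restrict_space borel S) \<rightarrow> X"
      using arc_of_in[OF assms(1)] assms(3) by (auto simp: space_restrict_space)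
    show "arc_of c \<in> borel_measurable (restrict_space borel S)"
      by (intro borel_measurable_continuous_on_restrict continuous_on_subset[OF arc_of_continuous[OF assms(1)]] assms)
  qed
  then have "(\<lambda>s. g (arc_of c s)) \<in> borel_measurable (restrict_space borel S)"
    using assms(2) by (rule measurable_compose)
  then show ?thesis
    by (subst (asm) borel_measurable_restrict_space_iff_ennreal) (use assms(4) in auto)
qed

lemma line_integral_subcurve:
  assumes "c \<in> rect_curves X" "0 \<le> s" "s \<le> s'" "s' \<le> arc_len c"
    "c' \<in> rect_curves Y" "arc_len c' = s' - s"
    "\<And>r. 0 \<le> r \<Longrightarrow> r \<le> s' - s \<Longrightarrow> arc_of c' r = arc_of c (s + r)"
    "g \<in> borel_measurable (restrict_space borel Y)"
  shows "line_integral g c' = (\<integral>\<^sup>+ r \<in> {s..s'}. g (arc_of c r) \<partial>lborel)"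
proof -
  have m: "(\<lambda>r. g (arc_of c' r) * indicator {0..arc_len c'} r) \<in> borel_measurable borel"
    by (rule measurable_along_arc[OF assms(5,8)]) auto
  have "line_integral g c' = (\<integral>\<^sup>+ r. g (arc_of c' (- s + 1 * r)) * indicator {0..arc_len c'} (- s + 1 * r) \<partial>lborel)"
    unfolding line_integral_arc by (subst nn_integral_real_affine[where c=1 and t="-s"]) (use m in auto)
  also have "\<dots> = (\<integral>\<^sup>+ r \<in> {s..s'}. g (arc_of c r) \<partial>lborel)"
    by (intro nn_integral_cong) (use assms(6,7) in \<open>auto split: split_indicator\<close>)
  finally show ?thesis .
qed

section \<open>Upper gradients along curves\<close>

lemma nn_integral_interval_add:
  fixes f :: "real \<Rightarrow> ennreal"
  assumes "f \<in> borel_measurable borel" "a \<le> b" "b \<le> c"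
  shows "(\<integral>\<^sup>+ r \<in> {a..c}. f r \<partial>lborel) = (\<integral>\<^sup>+ r \<in> {a..b}. f r \<partial>lborel) + (\<integral>\<^sup>+ r \<in> {b..c}. f r \<partial>lborel)"
proof -
  have "AE r in lborel. r \<noteq> b" by (rule AE_lborel_singleton)
  then have "(\<integral>\<^sup>+ r \<in> {a..c}. f r \<partial>lborel) = (\<integral>\<^sup>+ r. f r * indicator {a..b} r + f r * indicator {b..c} r \<partial>lborel)"
    by (intro nn_integral_cong_AE) (use assms(2,3) in \<open>auto elim!: eventually_mono split: split_indicator\<close>)
  also have "\<dots> = (\<integral>\<^sup>+ r \<in> {a..b}. f r \<partial>lborel) + (\<integral>\<^sup>+ r \<in> {b..c}. f r \<partial>lborel)"
    by (intro nn_integral_add) (use assms(1) in simp_all)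
  finally show ?thesis .
qed

text \<open>An increment bounded locally by an integral is bounded by it globally: both sides are
  (sub)additive in the interval, so Bolzano's bisection principle applies.\<close>

lemma increment_le_nn_integral:
  fixes F :: "real \<Rightarrow> real" and f :: "real \<Rightarrow> ennreal"
  assumes "f \<in> borel_measurable borel" "a \<le> b"
    and local: "\<And>x. a \<le> x \<Longrightarrow> x \<le> b \<Longrightarrow> \<exists>d>0. \<forall>s t. a \<le> s \<and> s \<le> x \<and> x \<le> t \<and> t \<le> b \<and> t - s < d \<longrightarrow>
       ennreal \<bar>F t - F s\<bar> \<le> (\<integral>\<^sup>+ r \<in> {s..t}. f r \<partial>lborel)"
  shows "ennreal \<bar>F b - F a\<bar> \<le> (\<integral>\<^sup>+ r \<in> {a..b}. f r \<partial>lborel)"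
proof -
  let ?P = "\<lambda>s t. a \<le> s \<and> t \<le> b \<longrightarrow> ennreal \<bar>F t - F s\<bar> \<le> (\<integral>\<^sup>+ r \<in> {s..t}. f r \<partial>lborel)"
  have "?P a b"
  proof (rule Bolzano[of a b ?P])
    fix s t u assume IH: "?P s t" "?P t u" "s \<le> t" "t \<le> u"
    show "?P s u"
    proof
      assume *: "a \<le> s \<and> u \<le> b"
      have "ennreal \<bar>F u - F s\<bar> \<le> ennreal (\<bar>F t - F s\<bar> + \<bar>F u - F t\<bar>)" by (intro ennreal_leI) simp
      also have "\<dots> = ennreal \<bar>F t - F s\<bar> + ennreal \<bar>F u - F t\<bar>" by (intro ennreal_plus) auto
      also have "\<dots> \<le> (\<integral>\<^sup>+ r \<in> {s..t}. f r \<partial>lborel) + (\<integral>\<^sup>+ r \<in> {t..u}. f r \<partial>lborel)"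
        by (intro add_mono) (use IH * in auto)
      also have "\<dots> = (\<integral>\<^sup>+ r \<in> {s..u}. f r \<partial>lborel)"
        using nn_integral_interval_add[OF assms(1), of s t u] IH by simp
      finally show "ennreal \<bar>F u - F s\<bar> \<le> (\<integral>\<^sup>+ r \<in> {s..u}. f r \<partial>lborel)" .
    qed
  next
    fix x assume "a \<le> x" "x \<le> b"
    then obtain d where "d > 0" "\<forall>s t. a \<le> s \<and> s \<le> x \<and> x \<le> t \<and> t \<le> b \<and> t - s < d \<longrightarrow>
       ennreal \<bar>F t - F s\<bar> \<le> (\<integral>\<^sup>+ r \<in> {s..t}. f r \<partial>lborel)"
      using local by blast
    then show "\<exists>d>0. \<forall>s t. s \<le> x \<and> x \<le> t \<and> t - s < d \<longrightarrow> ?P s t"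
      by (intro exI[of _ d]) auto
  qed fact
  then show ?thesis by simp
qed

text \<open>The upper gradient inequality along all curves on which \<open>\<rho>\<close> is integrable.  With \<open>\<rho> = 0\<close>
  this is an upper gradient; with \<open>\<rho>\<close> in \<open>L\<^sup>p\<close> it is a \<open>p\<close>-weak upper gradient, and the
  exceptional family is automatically closed under passing to longer curves.\<close>

definition ug_off :: "'a::metric_space set \<Rightarrow> ('a \<Rightarrow> ennreal) \<Rightarrow> ('a \<Rightarrow> real) \<Rightarrow> ('a \<Rightarrow> ennreal) \<Rightarrow> bool" where
  "ug_off X \<rho> u g \<longleftrightarrow>
     (\<forall>c\<in>rect_curves X. line_integral \<rho> c < \<infinity> \<longrightarrow> ug_along (\<lambda>x. ereal (u x)) g c)"

lemma line_integral_zero [simp]: "line_integral (\<lambda>_. 0) c = 0"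
  by (simp add: line_integral_arc)

lemma upper_gradient_iff_ug_off:
  "upper_gradient X (\<lambda>x. ereal (u x)) g \<longleftrightarrow>
     g \<in> borel_measurable (restrict_space borel X) \<and> ug_off X (\<lambda>_. 0) u g"
  by (simp add: upper_gradient_def ug_off_def)

lemma line_integral_mono: 
  assumes "c \<in> rect_curves X" "\<And>x. x \<in> X \<Longrightarrow> f x \<le> g x" shows "line_integral f c \<le> line_integral g c"
  unfolding line_integral_arc
  by (intro nn_integral_mono) (use assms arc_of_in[OF assms(1)] in \<open>auto split: split_indicator\<close>)

lemma ug_off_mono:
  assumes "ug_off X \<rho> u g" "\<And>x. x \<in> X \<Longrightarrow> g x \<le> g' x" "\<And>x. x \<in> X \<Longrightarrow> \<rho> x \<le> \<rho>' x"
  shows "ug_off X \<rho>' u g'"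
  unfolding ug_off_def
proof (intro ballI impI)
  fix c assume c: "c \<in> rect_curves X" "line_integral \<rho>' c < \<infinity>"
  have "line_integral \<rho> c < \<infinity>" using line_integral_mono[OF c(1), of \<rho> \<rho>'] assms(3) c(2) by (auto intro: le_less_trans)
  then have "ug_along (\<lambda>x. ereal (u x)) g c" using assms(1) c by (auto simp: ug_off_def)
  then show "ug_along (\<lambda>x. ereal (u x)) g' c"
    using line_integral_mono[OF c(1), of g g'] assms(2) by (auto simp: ug_along_arc[OF c(1)] intro: order_trans)
qed

lemma ug_off_interval:
  assumes "ug_off Y \<rho> u g" "g \<in> borel_measurable (restrict_space borel Y)"
    "\<rho> \<in> borel_measurable (restrict_space borel Y)"
    "c \<in> rect_curves X" "0 \<le> s" "s \<le> t" "t \<le> arc_len c" "arc_of c ` {s..t} \<subseteq> Y"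
    "(\<integral>\<^sup>+ r \<in> {s..t}. \<rho> (arc_of c r) \<partial>lborel) < \<infinity>"
  shows "ennreal \<bar>u (arc_of c t) - u (arc_of c s)\<bar> \<le> (\<integral>\<^sup>+ r \<in> {s..t}. g (arc_of c r) \<partial>lborel)"
proof (cases "arc_of c s = arc_of c t")
  case False
  obtain c' where c': "c' \<in> rect_curves Y" "arc_len c' = t - s"
    "\<And>r. 0 \<le> r \<Longrightarrow> r \<le> t - s \<Longrightarrow> arc_of c' r = arc_of c (s + r)"
    using subcurve[OF assms(4-8) False] by blast
  have li: "line_integral h c' = (\<integral>\<^sup>+ r \<in> {s..t}. h (arc_of c r) \<partial>lborel)"
    if "h \<in> borel_measurable (restrict_space borel Y)" for h
    by (rule line_integral_subcurve[OF assms(4-7) c'(1,2) _ that]) (rule c'(3))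
  have "ug_along (\<lambda>x. ereal (u x)) g c'"
    using assms(1,9) c'(1) li[OF assms(3)] by (auto simp: ug_off_def)
  then show ?thesis
    using ug_along_arc[OF c'(1), of u g] li[OF assms(2)] c'(2) c'(3)[of 0] c'(3)[of "t - s"] assms(6) by simp
qed simp

lemma ug_offI_local:
  assumes "g \<in> borel_measurable (restrict_space borel X)"
    and "\<And>c x. c \<in> rect_curves X \<Longrightarrow> line_integral \<rho> c < \<infinity> \<Longrightarrow> 0 \<le> x \<Longrightarrow> x \<le> arc_len c \<Longrightarrow>
      \<exists>d>0. \<forall>s t. 0 \<le> s \<and> s \<le> x \<and> x \<le> t \<and> t \<le> arc_len c \<and> t - s < d \<longrightarrow>
        ennreal \<bar>u (arc_of c t) - u (arc_of c s)\<bar> \<le> (\<integral>\<^sup>+ r \<in> {s..t}. g (arc_of c r) \<partial>lborel)"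
  shows "ug_off X \<rho> u g"
  unfolding ug_off_def
proof (intro ballI impI)
  fix c assume c: "c \<in> rect_curves X" "line_integral \<rho> c < \<infinity>"
  let ?f = "\<lambda>s. g (arc_of c s) * indicator {0..arc_len c} s"
  have eq: "(\<integral>\<^sup>+ r \<in> {s..t}. ?f r \<partial>lborel) = (\<integral>\<^sup>+ r \<in> {s..t}. g (arc_of c r) \<partial>lborel)"
    if "0 \<le> s" "t \<le> arc_len c" for s t
    by (intro nn_integral_cong) (use that in \<open>auto split: split_indicator\<close>)
  have "ennreal \<bar>u (arc_of c (arc_len c)) - u (arc_of c 0)\<bar> \<le> (\<integral>\<^sup>+ r \<in> {0..arc_len c}. ?f r \<partial>lborel)"
  proof (rule increment_le_nn_integral)
    show "?f \<in> borel_measurable borel" by (rule measurable_along_arc[OF c(1) assms(1)]) auto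
    fix x assume x: "0 \<le> x" "x \<le> arc_len c"
    show "\<exists>d>0. \<forall>s t. 0 \<le> s \<and> s \<le> x \<and> x \<le> t \<and> t \<le> arc_len c \<and> t - s < d \<longrightarrow>
         ennreal \<bar>u (arc_of c t) - u (arc_of c s)\<bar> \<le> (\<integral>\<^sup>+ r \<in> {s..t}. ?f r \<partial>lborel)"
      using assms(2)[OF c x] eq by (simp del: arc_len_nonneg) 
  qed simp
  then show "ug_along (\<lambda>x. ereal (u x)) g c"
    unfolding ug_along_arc[OF c(1)] line_integral_arc using eq[of 0 "arc_len c"] by simp
qed

lemma arc_near:
  assumes "c \<in> rect_curves X" "0 \<le> x" "x \<le> arc_len c" "0 < e" "0 \<le> s" "s \<le> x" "x \<le> t" "t \<le> arc_len c" "t - s < e"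
    "r \<in> {s..t}"
  shows "arc_of c r \<in> ball_in X (arc_of c x) e"
proof -
  have "dist (arc_of c x) (arc_of c r) \<le> 1 * dist x r"
    by (rule lipschitz_onD[OF arc_of_lipschitz[OF assms(1)]]) (use assms in auto)
  also have "\<dots> < e" using assms by (auto simp: dist_real_def)
  finally show ?thesis using arc_of_in[OF assms(1), of r] assms by (simp add: ball_in_def)
qed

text \<open>On a short subcurve the increment of \<open>u\<close> is at most the local Lipschitz constant times the length, hence at most the line
  integral of any function that dominates this constant near the point.\<close>

lemma ug_off_of_locally_lipschitz:
  assumes "g \<in> borel_measurable (restrict_space borel X)"
    and "\<And>x. x \<in> X \<Longrightarrow> \<exists>e>0. \<exists>a\<ge>0. (\<forall>y\<in>ball_in X x e. ennreal a \<le> g y) \<and>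
      (\<forall>y\<in>ball_in X x e. \<forall>z\<in>ball_in X x e. \<bar>u y - u z\<bar> \<le> a * dist y z)"
  shows "ug_off X \<rho> u g"
proof (rule ug_offI_local[OF assms(1)])
  fix c x assume c: "c \<in> rect_curves X" "0 \<le> x" "x \<le> arc_len c"
  then obtain e a where e: "e > 0" "a \<ge> 0" "\<And>y. y \<in> ball_in X (arc_of c x) e \<Longrightarrow> ennreal a \<le> g y"
    "\<And>y z. y \<in> ball_in X (arc_of c x) e \<Longrightarrow> z \<in> ball_in X (arc_of c x) e \<Longrightarrow> \<bar>u y - u z\<bar> \<le> a * dist y z"
    using assms(2)[OF arc_of_in[OF c(1), of x]] by auto
  show "\<exists>d>0. \<forall>s t. 0 \<le> s \<and> s \<le> x \<and> x \<le> t \<and> t \<le> arc_len c \<and> t - s < d \<longrightarrow>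
        ennreal \<bar>u (arc_of c t) - u (arc_of c s)\<bar> \<le> (\<integral>\<^sup>+ r \<in> {s..t}. g (arc_of c r) \<partial>lborel)"
  proof (intro exI[of _ e] conjI allI impI e(1))
    fix s t assume st: "0 \<le> s \<and> s \<le> x \<and> x \<le> t \<and> t \<le> arc_len c \<and> t - s < e"
    then have near: "arc_of c r \<in> ball_in X (arc_of c x) e" if "r \<in> {s..t}" for r
      using arc_near[OF c e(1), of s t r] that by blast
    have "\<bar>u (arc_of c t) - u (arc_of c s)\<bar> \<le> a * dist (arc_of c t) (arc_of c s)"
      by (rule e(4)) (use st near in auto)
    also have "\<dots> \<le> a * (1 * dist t s)"
      by (intro mult_left_mono lipschitz_onD[OF arc_of_lipschitz[OF c(1)]]) (use st e(2) in auto)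
    also have "\<dots> = a * (t - s)" using st by (simp add: dist_real_def)
    finally have "ennreal \<bar>u (arc_of c t) - u (arc_of c s)\<bar> \<le> ennreal (a * (t - s))" by (rule ennreal_leI)
    also have "\<dots> = (\<integral>\<^sup>+ r \<in> {s..t}. ennreal a \<partial>lborel)"
      using st e(2) by (simp add: nn_integral_cmult_indicator ennreal_mult')
    also have "\<dots> \<le> (\<integral>\<^sup>+ r \<in> {s..t}. g (arc_of c r) \<partial>lborel)"
      by (intro nn_integral_mono) (use near e(3) in \<open>auto split: split_indicator\<close>)
    finally show "ennreal \<bar>u (arc_of c t) - u (arc_of c s)\<bar> \<le> (\<integral>\<^sup>+ r \<in> {s..t}. g (arc_of c r) \<partial>lborel)" .
  qed
qed

text \<open>Two integrable bounds for the increments of \<open>F\<close> on all intervals give a bound by the integral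
  of their minimum.  With \<open>K \<subseteq> {f \<le> g} \<subseteq> U\<close>, \<open>K\<close> compact, \<open>U\<close> open and \<open>U - K\<close> small for the
  measure \<open>(f + g) dt\<close>, every point has a neighbourhood on which either \<open>f\<close> may be used inside \<open>U\<close>
  or \<open>g\<close> may be used off \<open>K\<close>.\<close>

lemma increment_le_nn_integral_min:
  fixes F :: "real \<Rightarrow> real" and f g :: "real \<Rightarrow> ennreal"
  assumes m [measurable]: "f \<in> borel_measurable borel" "g \<in> borel_measurable borel" and "a \<le> b"
    and f: "\<And>s t. a \<le> s \<Longrightarrow> s \<le> t \<Longrightarrow> t \<le> b \<Longrightarrow> ennreal \<bar>F t - F s\<bar> \<le> (\<integral>\<^sup>+ r \<in> {s..t}. f r \<partial>lborel)"
    and g: "\<And>s t. a \<le> s \<Longrightarrow> s \<le> t \<Longrightarrow> t \<le> b \<Longrightarrow> ennreal \<bar>F t - F s\<bar> \<le> (\<integral>\<^sup>+ r \<in> {s..t}. g r \<partial>lborel)"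
    and fin: "(\<integral>\<^sup>+ r \<in> {a..b}. f r \<partial>lborel) < \<infinity>" "(\<integral>\<^sup>+ r \<in> {a..b}. g r \<partial>lborel) < \<infinity>"
  shows "ennreal \<bar>F b - F a\<bar> \<le> (\<integral>\<^sup>+ r \<in> {a..b}. min (f r) (g r) \<partial>lborel)"
proof (rule ennreal_le_epsilon)
  fix e :: real assume e: "0 < e"
  define M where "M = density lborel (\<lambda>r. (f r + g r) * indicator {a..b} r)"
  have sets_M: "sets M = sets borel" by (simp add: M_def)
  have emM: "emeasure M S = (\<integral>\<^sup>+ r \<in> S. (f r + g r) * indicator {a..b} r \<partial>lborel)" if "S \<in> sets borel" for S
    unfolding M_def by (subst emeasure_density) (use that in auto)
  have "emeasure M (space M) = (\<integral>\<^sup>+ r. f r * indicator {a..b} r + g r * indicator {a..b} r \<partial>lborel)"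
    by (subst emM) (auto simp: M_def distrib_right intro!: nn_integral_cong)
  also have "\<dots> = (\<integral>\<^sup>+ r \<in> {a..b}. f r \<partial>lborel) + (\<integral>\<^sup>+ r \<in> {a..b}. g r \<partial>lborel)"
    by (rule nn_integral_add) simp_all
  also have "\<dots> \<noteq> \<infinity>" using fin by (simp add: less_top)
  finally have finM: "emeasure M (space M) \<noteq> \<infinity>" .
  then interpret M: finite_measure M by (rule finite_measureI)
  define A where "A = {r. f r \<le> g r}"
  have A: "A \<in> sets borel" by (simp add: A_def)
  have "emeasure M A < emeasure M A + ennreal (e / 2)"
    using finM e A M.emeasure_finite[of A] by (auto simp: ennreal_zero_less_divide less_top ennreal_less_zero_iff intro!: ennreal_lessI)
  then have "\<exists>U. open U \<and> A \<subseteq> U \<and> emeasure M U < emeasure M A + ennreal (e / 2)"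
    using outer_regular[OF sets_M finM A] by (auto simp: INF_less_iff)
  then obtain U where U: "open U" "A \<subseteq> U" "emeasure M U < emeasure M A + ennreal (e / 2)" by blast
  have "\<exists>K. compact K \<and> K \<subseteq> A \<and> emeasure M A \<le> emeasure M K + ennreal (e / 2)"
  proof (cases "measure M A \<le> e / 2")
    case True
    then show ?thesis by (intro exI[of _ "{}"]) (simp add: M.emeasure_eq_measure ennreal_leI)
  next
    case False
    then have "ennreal (measure M A - e / 2) < emeasure M A"
      using e by (simp add: M.emeasure_eq_measure ennreal_less_iff)
    also have "\<dots> = (SUP K \<in> {K. K \<subseteq> A \<and> compact K}. emeasure M K)"
      by (rule inner_regular[OF sets_M finM A])
    finally obtain K where K: "K \<subseteq> A" "compact K" "ennreal (measure M A - e / 2) < emeasure M K"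
      by (auto simp: less_SUP_iff)
    then have "measure M A - e / 2 < measure M K"
      using False by (simp add: M.emeasure_eq_measure ennreal_less_iff)
    then have "emeasure M A \<le> ennreal (measure M K + e / 2)"
      by (simp add: M.emeasure_eq_measure ennreal_leI)
    also have "\<dots> = emeasure M K + ennreal (e / 2)"
      using e by (simp add: M.emeasure_eq_measure)
    finally show ?thesis using K by blast
  qed
  then obtain K where K: "compact K" "K \<subseteq> A" "emeasure M A \<le> emeasure M K + ennreal (e / 2)" by blast
  have sU: "U \<in> sets borel" and sK: "K \<in> sets borel" using U K by (auto intro: borel_compact)
  define h where "h r = f r * indicator U r + g r * indicator (- K) r" for r
  have [measurable]: "U \<in> sets borel" "K \<in> sets borel" by fact+
  have "ennreal \<bar>F b - F a\<bar> \<le> (\<integral>\<^sup>+ r \<in> {a..b}. h r \<partial>lborel)"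
  proof (rule increment_le_nn_integral)
    show "h \<in> borel_measurable borel" unfolding h_def by measurable
    fix x assume x: "a \<le> x" "x \<le> b"
    show "\<exists>d>0. \<forall>s t. a \<le> s \<and> s \<le> x \<and> x \<le> t \<and> t \<le> b \<and> t - s < d \<longrightarrow>
       ennreal \<bar>F t - F s\<bar> \<le> (\<integral>\<^sup>+ r \<in> {s..t}. h r \<partial>lborel)"
    proof (cases "x \<in> U")
      case True
      then obtain d where d: "d > 0" "ball x d \<subseteq> U" using U(1) by (auto simp: open_contains_ball)
      show ?thesis
      proof (intro exI[of _ d] conjI allI impI d(1))
        fix s t assume st: "a \<le> s \<and> s \<le> x \<and> x \<le> t \<and> t \<le> b \<and> t - s < d"
        have "{s..t} \<subseteq> U" using d st by (force simp: dist_real_def)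
        then show "ennreal \<bar>F t - F s\<bar> \<le> (\<integral>\<^sup>+ r \<in> {s..t}. h r \<partial>lborel)"
          by (intro order_trans[OF f] nn_integral_mono) (use st in \<open>auto simp: h_def split: split_indicator\<close>)
      qed
    next
      case False
      then have "x \<in> - K" "open (- K)" using U K by (auto intro: compact_imp_closed)
      then obtain d where d: "d > 0" "ball x d \<subseteq> - K" by (auto simp: open_contains_ball)
      show ?thesis
      proof (intro exI[of _ d] conjI allI impI d(1))
        fix s t assume st: "a \<le> s \<and> s \<le> x \<and> x \<le> t \<and> t \<le> b \<and> t - s < d"
        have "{s..t} \<subseteq> - K" using d st by (force simp: dist_real_def)
        then show "ennreal \<bar>F t - F s\<bar> \<le> (\<integral>\<^sup>+ r \<in> {s..t}. h r \<partial>lborel)"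
          by (intro order_trans[OF g] nn_integral_mono) (use st in \<open>auto simp: h_def split: split_indicator\<close>)
      qed
    qed
  qed fact
  also have "\<dots> \<le> (\<integral>\<^sup>+ r. min (f r) (g r) * indicator {a..b} r + (f r + g r) * indicator {a..b} r * indicator (U - K) r \<partial>lborel)"
  proof (rule nn_integral_mono)
    fix r show "h r * indicator {a..b} r \<le> min (f r) (g r) * indicator {a..b} r + (f r + g r) * indicator {a..b} r * indicator (U - K) r"
      using U(2) K(2) by (auto simp: h_def A_def min_def add_increasing split: split_indicator)
  qed
  also have "\<dots> = (\<integral>\<^sup>+ r \<in> {a..b}. min (f r) (g r) \<partial>lborel) + emeasure M (U - K)"
    by (subst nn_integral_add) (auto simp: emM)
  also have "emeasure M (U - K) \<le> ennreal e"
  proof -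
    have "emeasure M (U - K) = emeasure M U - emeasure M K"
      by (rule emeasure_Diff) (use U K sets_M in auto)
    also have "\<dots> \<le> ennreal e"
    proof -
      have "emeasure M U \<le> emeasure M A + ennreal (e / 2)" using U(3) by simp
      also have "\<dots> \<le> emeasure M K + ennreal (e / 2) + ennreal (e / 2)" using K(3) by (rule add_right_mono)
      also have "\<dots> = emeasure M K + ennreal e" using e by (simp add: add.assoc flip: ennreal_plus)
      finally show ?thesis by (simp add: ennreal_minus_le_iff)
    qed
    finally show ?thesis .
  qed
  finally show "ennreal \<bar>F b - F a\<bar> \<le> (\<integral>\<^sup>+ r \<in> {a..b}. min (f r) (g r) \<partial>lborel) + ennreal e"
    by (simp add: add_left_mono)
qed

text \<open>Curves along which \<open>f\<close> or \<open>g\<close> is not integrable have to be exceptional: the inequality for \<open>f\<close> or \<open>g\<close> may then be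
  void on every subcurve, while the minimum is small.\<close>

lemma ug_off_min:
  assumes "ug_off X \<rho> u f" "ug_off X \<rho> u g"
    and m: "f \<in> borel_measurable (restrict_space borel X)" "g \<in> borel_measurable (restrict_space borel X)"
      "\<rho> \<in> borel_measurable (restrict_space borel X)"
    and fin: "\<And>c. c \<in> rect_curves X \<Longrightarrow> line_integral \<rho> c < \<infinity> \<Longrightarrow> line_integral f c < \<infinity> \<and> line_integral g c < \<infinity>"
  shows "ug_off X \<rho> u (\<lambda>x. min (f x) (g x))"
  unfolding ug_off_def
proof (intro ballI impI)
  fix c assume c: "c \<in> rect_curves X" "line_integral \<rho> c < \<infinity>"
  let ?L = "arc_len c"
  let ?i = "\<lambda>s. indicator {0..?L} s :: ennreal"
  have eq: "(\<integral>\<^sup>+ r \<in> {s..t}. h (arc_of c r) * ?i r \<partial>lborel) = (\<integral>\<^sup>+ r \<in> {s..t}. h (arc_of c r) \<partial>lborel)"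
    if "0 \<le> s" "t \<le> ?L" for s t h
    by (intro nn_integral_cong) (use that in \<open>auto split: split_indicator\<close>)
  have sub: "(\<integral>\<^sup>+ r \<in> {s..t}. \<rho> (arc_of c r) \<partial>lborel) < \<infinity>" if "0 \<le> s" "t \<le> ?L" for s t
  proof -
    have "(\<integral>\<^sup>+ r \<in> {s..t}. \<rho> (arc_of c r) \<partial>lborel) \<le> line_integral \<rho> c"
      unfolding line_integral_arc by (intro nn_integral_mono) (use that in \<open>auto split: split_indicator\<close>)
    then show ?thesis using c(2) by (rule le_less_trans)
  qed
  have "ennreal \<bar>u (arc_of c ?L) - u (arc_of c 0)\<bar>
      \<le> (\<integral>\<^sup>+ r \<in> {0..?L}. min (f (arc_of c r) * ?i r) (g (arc_of c r) * ?i r) \<partial>lborel)"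
  proof (rule increment_le_nn_integral_min)
    show "(\<lambda>r. f (arc_of c r) * ?i r) \<in> borel_measurable borel" "(\<lambda>r. g (arc_of c r) * ?i r) \<in> borel_measurable borel"
      by (intro measurable_along_arc[OF c(1)] m; simp)+
    show "(\<integral>\<^sup>+ r \<in> {0..?L}. f (arc_of c r) * ?i r \<partial>lborel) < \<infinity>" "(\<integral>\<^sup>+ r \<in> {0..?L}. g (arc_of c r) * ?i r \<partial>lborel) < \<infinity>"
      using fin[OF c] eq[of 0 ?L] by (simp_all add: line_integral_arc)
    fix s t assume st: "0 \<le> s" "s \<le> t" "t \<le> ?L"
    have img: "arc_of c ` {s..t} \<subseteq> X" using arc_of_in[OF c(1)] st by auto
    show "ennreal \<bar>u (arc_of c t) - u (arc_of c s)\<bar> \<le> (\<integral>\<^sup>+ r \<in> {s..t}. f (arc_of c r) * ?i r \<partial>lborel)"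
      "ennreal \<bar>u (arc_of c t) - u (arc_of c s)\<bar> \<le> (\<integral>\<^sup>+ r \<in> {s..t}. g (arc_of c r) * ?i r \<partial>lborel)"
      unfolding eq[OF st(1,3)]
      by (rule ug_off_interval[OF assms(1) m(1,3) c(1) st img sub[OF st(1,3)]],
          rule ug_off_interval[OF assms(2) m(2,3) c(1) st img sub[OF st(1,3)]])
  qed simp
  also have "\<dots> = line_integral (\<lambda>x. min (f x) (g x)) c"
    unfolding line_integral_arc by (intro nn_integral_cong) (auto split: split_indicator)
  finally show "ug_along (\<lambda>x. ereal (u x)) (\<lambda>x. min (f x) (g x)) c"
    unfolding ug_along_arc[OF c(1)] .
qed

section \<open>Exceptional families and weak upper gradients\<close>

lemma enn_powr_ennreal [simp]: "0 \<le> a \<Longrightarrow> enn_powr (ennreal a) q = ennreal (a powr q)"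
  by (simp add: enn_powr_def)

lemma enn_powr_top [simp]: "enn_powr top q = top"
  by (simp add: enn_powr_def)

lemma enn_powr_zero [simp]: "enn_powr 0 q = 0"
  by (simp add: enn_powr_def)

lemma enn_powr_mono:
  assumes "x \<le> y" "0 \<le> q" shows "enn_powr x q \<le> enn_powr y q"
proof (cases y)
  case (real b)
  then obtain a where "x = ennreal a" "0 \<le> a" using assms by (cases x) (auto simp: top_unique)
  then show ?thesis using assms real by (auto intro!: ennreal_leI powr_mono2)
qed simp

lemma enn_powr_mult:
  assumes "0 < q" shows "enn_powr (x * y) q = enn_powr x q * enn_powr y q"
proof -
  have zero: "enn_powr a q = 0 \<longleftrightarrow> a = 0" for a
    by (cases a) auto
  show ?thesis
  proof (cases "x = top \<or> y = top")
    case True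
    then show ?thesis
    proof
      assume "x = top"
      then show ?thesis using zero[of y] by (cases "y = 0") (simp_all add: ennreal_top_mult)
    next
      assume "y = top"
      then show ?thesis using zero[of x] by (cases "x = 0") (simp_all add: ennreal_mult_top)
    qed
  next
    case False
    then obtain a b where "x = ennreal a" "y = ennreal b" "0 \<le> a" "0 \<le> b"
      by (cases x; cases y) auto
    then show ?thesis by (simp add: powr_mult flip: ennreal_mult')
  qed
qed

lemma enn_powr_powr:
  assumes "0 < q" "0 < r" shows "enn_powr (enn_powr x q) r = enn_powr x (q * r)"
  by (cases x) (auto simp: powr_powr)

lemma enn_powr_one [simp]: "enn_powr x 1 = x"
  by (cases x) auto

lemma enn_powr_inverse:
  assumes "0 < q" shows "enn_powr (enn_powr x q) (1 / q) = x" "enn_powr (enn_powr x (1 / q)) q = x"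
  using assms by (simp_all add: enn_powr_powr)

lemma enn_powr_measurable [measurable]: "(\<lambda>t. enn_powr t q) \<in> borel_measurable borel"
  unfolding enn_powr_def by measurable

lemma enn_powr_add_le:
  assumes "0 < p"
  shows "enn_powr (x + y) p \<le> ennreal (2 powr p) * (enn_powr x p + enn_powr y p)"
proof -
  have "x + y \<le> 2 * max x y"
    by (auto simp: max_def mult_2 intro: add_mono)
  then have "enn_powr (x + y) p \<le> enn_powr (2 * max x y) p"
    by (rule enn_powr_mono) (use assms in simp)
  also have "\<dots> = ennreal (2 powr p) * enn_powr (max x y) p"
    using enn_powr_ennreal[of 2 p] by (simp add: enn_powr_mult[OF assms])
  also have "\<dots> \<le> ennreal (2 powr p) * (enn_powr x p + enn_powr y p)"
    by (intro mult_left_mono) (auto simp: max_def add_increasing add_increasing2)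
  finally show ?thesis .
qed

lemma suminf_geometric_half: "(\<Sum>k. ennreal ((1 / 2) ^ k)) = 2"
proof -
  have "(\<lambda>k. (1 / 2 :: real) ^ k) sums (1 / (1 - 1 / 2))" by (rule geometric_sums) simp
  then have "(\<lambda>k. ennreal ((1 / 2) ^ k)) sums ennreal 2" by (subst sums_ennreal) auto
  then show ?thesis by (simp add: sums_iff)
qed

text \<open>A substitute for Jensen's inequality for geometrically weighted sums: every \<open>2\<^sup>-\<^sup>k a\<^sub>k\<close> is at most
  the \<open>1/p\<close>-th power of the sum on the right, and a second factor \<open>2\<^sup>-\<^sup>k\<close> is left to be summed.\<close>

lemma enn_powr_geometric_suminf:
  assumes "1 \<le> p"
  shows "enn_powr (\<Sum>k. ennreal ((1 / 4) ^ k) * a k) p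
     \<le> ennreal (2 powr p) * (\<Sum>k. ennreal ((1 / 2) ^ k) * enn_powr (a k) p)"
proof -
  define S where "S = (\<Sum>k. ennreal ((1 / 2) ^ k) * enn_powr (a k) p)"
  have p: "0 < p" using assms by simp
  have k: "ennreal ((1 / 2) ^ k) * a k \<le> enn_powr S (1 / p)" for k
  proof -
    have "((1 / 2) ^ k) powr p \<le> ((1 / 2 :: real) ^ k) powr 1"
      by (rule powr_mono') (use assms in \<open>auto simp: power_le_one\<close>)
    then have "enn_powr (ennreal ((1 / 2) ^ k) * a k) p \<le> ennreal ((1 / 2) ^ k) * enn_powr (a k) p"
      by (auto simp: enn_powr_mult[OF p] intro!: mult_right_mono ennreal_leI)
    also have "\<dots> \<le> S" unfolding S_def
      using sum_le_suminf[of "\<lambda>k. ennreal ((1 / 2) ^ k) * enn_powr (a k) p" "{k}"] by simp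
    finally have "enn_powr (enn_powr (ennreal ((1 / 2) ^ k) * a k) p) (1 / p) \<le> enn_powr S (1 / p)"
      by (rule enn_powr_mono) (use p in simp)
    then show ?thesis by (simp add: enn_powr_inverse[OF p])
  qed
  have "(\<Sum>k. ennreal ((1 / 4) ^ k) * a k) \<le> (\<Sum>k. ennreal ((1 / 2) ^ k) * enn_powr S (1 / p))"
  proof (intro suminf_le summableI)
    fix n
    have "(1 / 4 :: real) ^ n = (1 / 2) ^ n * (1 / 2) ^ n" by (simp flip: power_mult_distrib)
    then have "ennreal ((1 / 4) ^ n) * a n = ennreal ((1 / 2) ^ n) * (ennreal ((1 / 2) ^ n) * a n)"
      by (simp add: ennreal_mult mult.assoc)
    then show "ennreal ((1 / 4) ^ n) * a n \<le> ennreal ((1 / 2) ^ n) * enn_powr S (1 / p)"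
      using k[of n] by (simp add: mult_left_mono)
  qed
  also have "\<dots> = ennreal 2 * enn_powr S (1 / p)"
    by (simp add: suminf_geometric_half)
  finally have "enn_powr (\<Sum>k. ennreal ((1 / 4) ^ k) * a k) p \<le> enn_powr (ennreal 2 * enn_powr S (1 / p)) p"
    by (rule enn_powr_mono) (use p in simp)
  also have "\<dots> = ennreal (2 powr p) * S"
    using enn_powr_ennreal[of 2 p] by (simp add: enn_powr_mult[OF p] enn_powr_inverse[OF p])
  finally show ?thesis unfolding S_def .
qed

lemma line_integral_cmult:
  assumes "c \<in> rect_curves X" "g \<in> borel_measurable (restrict_space borel X)"
  shows "line_integral (\<lambda>x. a * g x) c = a * line_integral g c"
  unfolding line_integral_arc
  using nn_integral_cmult[of "\<lambda>s. g (arc_of c s) * indicator {0..arc_len c} s" lborel a]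
    measurable_along_arc[OF assms order_refl] by (simp add: mult.assoc)

lemma line_integral_suminf:
  assumes "c \<in> rect_curves X" "\<And>n. g n \<in> borel_measurable (restrict_space borel X)"
  shows "line_integral (\<lambda>x. \<Sum>n. g n x) c = (\<Sum>n. line_integral (g n) c)"
proof -
  have "(\<Sum>n. g n (arc_of c s)) * indicator {0..arc_len c} s = (\<Sum>n. g n (arc_of c s) * indicator {0..arc_len c} s)" for s
    by simp
  then show ?thesis
    unfolding line_integral_arc
    using nn_integral_suminf[of "\<lambda>n s. g n (arc_of c s) * indicator {0..arc_len c} s" lborel]
      measurable_along_arc[OF assms(1) assms(2) order_refl] by simp
qed

lemma Lp_suminf:
  fixes b :: "nat \<Rightarrow> 'a \<Rightarrow> ennreal"
  assumes "1 \<le> p" "\<And>n. b n \<in> borel_measurable m" "\<And>n. (\<integral>\<^sup>+ x. enn_powr (b n x) p \<partial>m) \<le> 1"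
  shows "(\<integral>\<^sup>+ x. enn_powr (\<Sum>n. ennreal ((1 / 4) ^ n) * b n x) p \<partial>m) < \<infinity>"
proof -
  have [measurable]: "(\<lambda>x. enn_powr (b n x) p) \<in> borel_measurable m" for n
    using assms(2)[of n] by measurable
  have "(\<integral>\<^sup>+ x. enn_powr (\<Sum>n. ennreal ((1 / 4) ^ n) * b n x) p \<partial>m)
      \<le> (\<integral>\<^sup>+ x. ennreal (2 powr p) * (\<Sum>n. ennreal ((1 / 2) ^ n) * enn_powr (b n x) p) \<partial>m)"
    by (intro nn_integral_mono enn_powr_geometric_suminf assms)
  also have "\<dots> = ennreal (2 powr p) * (\<Sum>n. ennreal ((1 / 2) ^ n) * (\<integral>\<^sup>+ x. enn_powr (b n x) p \<partial>m))"
    by (subst nn_integral_cmult) (auto simp: nn_integral_suminf nn_integral_cmult)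
  also have "\<dots> \<le> ennreal (2 powr p) * (\<Sum>n. ennreal ((1 / 2) ^ n) * 1)"
    by (intro mult_left_mono suminf_le summableI assms) auto
  also have "\<dots> < \<infinity>"
    by (simp add: suminf_geometric_half ennreal_mult_less_top)
  finally show ?thesis .
qed

text \<open>Countably many exceptional families are contained in a single one: normalize and sum.\<close>

lemma Lp_dominate_sequence:
  fixes \<rho> :: "nat \<Rightarrow> 'a::metric_space \<Rightarrow> ennreal"
  assumes m: "sets m = sets (restrict_space borel X)" and "1 \<le> p"
    and \<rho>: "\<And>n. \<rho> n \<in> borel_measurable m" "\<And>n. (\<integral>\<^sup>+ x. enn_powr (\<rho> n x) p \<partial>m) < \<infinity>"
  obtains \<sigma> where "\<sigma> \<in> borel_measurable m" "(\<integral>\<^sup>+ x. enn_powr (\<sigma> x) p \<partial>m) < \<infinity>"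
    "\<And>c n. c \<in> rect_curves X \<Longrightarrow> line_integral \<sigma> c < \<infinity> \<Longrightarrow> line_integral (\<rho> n) c < \<infinity>"
proof -
  have p: "0 < p" using assms by simp
  define I where "I n = enn2real (\<integral>\<^sup>+ x. enn_powr (\<rho> n x) p \<partial>m)" for n
  have I: "(\<integral>\<^sup>+ x. enn_powr (\<rho> n x) p \<partial>m) = ennreal (I n)" "0 \<le> I n" for n
    using \<rho>(2)[of n] by (auto simp: I_def)
  define t where "t n = 1 / (1 + I n)" for n
  have t: "0 < t n" "t n \<le> 1" for n using I(2)[of n] by (auto simp: t_def)
  define b where "b n x = ennreal (t n) * \<rho> n x" for n x
  define \<sigma> where "\<sigma> x = (\<Sum>n. ennreal ((1 / 4) ^ n) * b n x)" for x
  have bm [measurable]: "b n \<in> borel_measurable m" for n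
    unfolding b_def using \<rho>(1)[of n] by measurable
  have cong: "borel_measurable m = (borel_measurable (restrict_space borel X) :: ('a \<Rightarrow> ennreal) set)"
    by (rule measurable_cong_sets) (use m in auto)
  show thesis
  proof (rule that[of \<sigma>])
    show "\<sigma> \<in> borel_measurable m" unfolding \<sigma>_def by measurable
    show "(\<integral>\<^sup>+ x. enn_powr (\<sigma> x) p \<partial>m) < \<infinity>"
      unfolding \<sigma>_def
    proof (rule Lp_suminf[OF \<open>1 \<le> p\<close> bm])
      fix n
      have "(\<integral>\<^sup>+ x. enn_powr (b n x) p \<partial>m) = (\<integral>\<^sup>+ x. ennreal (t n powr p) * enn_powr (\<rho> n x) p \<partial>m)"
        using t[of n] by (intro nn_integral_cong) (simp add: b_def enn_powr_mult[OF p])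
      also have "\<dots> = ennreal (t n powr p * I n)"
        using \<rho>(1)[of n] by (subst nn_integral_cmult) (auto simp: I ennreal_mult')
      also have "\<dots> \<le> ennreal (t n * I n)"
        using powr_mono'[of 1 p "t n"] t[of n] I(2)[of n] assms(2) by (intro ennreal_leI mult_right_mono) auto
      also have "\<dots> \<le> 1" using I(2)[of n] by (simp add: t_def ennreal_le_1)
      finally show "(\<integral>\<^sup>+ x. enn_powr (b n x) p \<partial>m) \<le> 1" .
    qed
    fix c n assume c: "c \<in> rect_curves X" "line_integral \<sigma> c < \<infinity>"
    have meas: "b n \<in> borel_measurable (restrict_space borel X)" "\<rho> n \<in> borel_measurable (restrict_space borel X)" for n
      using bm[of n] \<rho>(1)[of n] cong by auto
    have "line_integral \<sigma> c = (\<Sum>n. ennreal ((1 / 4) ^ n) * line_integral (b n) c)"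
      unfolding \<sigma>_def
      by (subst line_integral_suminf[OF c(1)]) (auto simp: line_integral_cmult[OF c(1)] meas intro!: borel_measurable_times_ennreal)
    then have "ennreal ((1 / 4) ^ n) * line_integral (b n) c < \<infinity>"
      using c(2) ennreal_suminf_lessD[of "\<lambda>n. ennreal ((1 / 4) ^ n) * line_integral (b n) c"] by simp
    moreover have "line_integral (b n) c = ennreal (t n) * line_integral (\<rho> n) c"
      unfolding b_def by (rule line_integral_cmult[OF c(1)]) (rule meas)
    ultimately show "line_integral (\<rho> n) c < \<infinity>"
      using t(1)[of n] by (auto simp: ennreal_mult_less_top less_top)
  qed
qed

text \<open>The exceptional family has admissible functions with norms at most \<open>4\<^sup>-\<^sup>n\<close>.  Their sum is \<open>p\<close>-integrable, and its line
  integrals over exceptional curves are infinite.\<close>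

lemma weak_upper_gradientD:
  assumes m: "sets m = sets (restrict_space borel X)" and "1 \<le> p"
    and "weak_upper_gradient p X m (\<lambda>x. ereal (u x)) g"
  obtains \<rho> where "\<rho> \<in> borel_measurable m" "(\<integral>\<^sup>+ x. enn_powr (\<rho> x) p \<partial>m) < \<infinity>" "ug_off X \<rho> u g"
proof -
  have p: "0 < p" using assms by simp
  obtain \<Gamma> where \<Gamma>: "\<Gamma> \<subseteq> rect_curves X" "modulus p m \<Gamma> = 0" "\<forall>c \<in> rect_curves X - \<Gamma>. ug_along (\<lambda>x. ereal (u x)) g c"
    using assms(3) unfolding weak_upper_gradient_def by blast
  have "\<exists>\<rho> \<in> borel_measurable m. (\<forall>c\<in>\<Gamma>. 1 \<le> line_integral \<rho> c) \<and> (\<integral>\<^sup>+ x. enn_powr (\<rho> x) p \<partial>m) < ennreal ((1 / 4 ^ n) powr p)" for n :: nat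
  proof -
    have "modulus p m \<Gamma> < ennreal ((1 / 4 ^ n) powr p)" using \<Gamma>(2) by simp
    then show ?thesis unfolding modulus_def INF_less_iff by auto
  qed
  then obtain \<rho> where \<rho>: "\<And>n. \<rho> n \<in> borel_measurable m" "\<And>n c. c \<in> \<Gamma> \<Longrightarrow> 1 \<le> line_integral (\<rho> n) c"
    "\<And>n. (\<integral>\<^sup>+ x. enn_powr (\<rho> n x) p \<partial>m) < ennreal ((1 / 4 ^ n) powr p)"
    by metis
  define b where "b n x = ennreal (4 ^ n) * \<rho> n x" for n x
  define \<sigma> where "\<sigma> x = (\<Sum>n. ennreal ((1 / 4) ^ n) * b n x)" for x
  have bm [measurable]: "b n \<in> borel_measurable m" for n
    unfolding b_def using \<rho>(1)[of n] by measurable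
  have cong: "borel_measurable m = (borel_measurable (restrict_space borel X) :: ('a \<Rightarrow> ennreal) set)"
    by (rule measurable_cong_sets) (use m in auto)
  have \<sigma>: "\<sigma> x = (\<Sum>n. \<rho> n x)" for x
  proof -
    have "ennreal ((1 / 4) ^ n) * b n x = \<rho> n x" for n
      by (simp add: b_def power_one_over flip: mult.assoc ennreal_mult)
    then show ?thesis by (simp add: \<sigma>_def)
  qed
  show thesis
  proof (rule that[of \<sigma>])
    show "\<sigma> \<in> borel_measurable m" unfolding \<sigma>_def by measurable
    show "(\<integral>\<^sup>+ x. enn_powr (\<sigma> x) p \<partial>m) < \<infinity>"
      unfolding \<sigma>_def
    proof (rule Lp_suminf[OF \<open>1 \<le> p\<close> bm])
      fix n
      have "(\<integral>\<^sup>+ x. enn_powr (b n x) p \<partial>m) = (\<integral>\<^sup>+ x. ennreal ((4 ^ n) powr p) * enn_powr (\<rho> n x) p \<partial>m)"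
        by (intro nn_integral_cong) (simp add: b_def enn_powr_mult[OF p])
      also have "\<dots> = ennreal ((4 ^ n) powr p) * (\<integral>\<^sup>+ x. enn_powr (\<rho> n x) p \<partial>m)"
        using \<rho>(1)[of n] by (subst nn_integral_cmult) auto
      also have "\<dots> \<le> ennreal ((4 ^ n) powr p) * ennreal ((1 / 4 ^ n) powr p)"
        using \<rho>(3)[of n] by (intro mult_left_mono) auto
      also have "\<dots> = 1" by (simp flip: ennreal_mult powr_mult)
      finally show "(\<integral>\<^sup>+ x. enn_powr (b n x) p \<partial>m) \<le> 1" .
    qed
    show "ug_off X \<sigma> u g"
      unfolding ug_off_def
    proof (intro ballI impI)
      fix c assume c: "c \<in> rect_curves X" "line_integral \<sigma> c < \<infinity>"
      have li: "line_integral \<sigma> c = (\<Sum>n. line_integral (\<rho> n) c)"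
        unfolding \<sigma> by (rule line_integral_suminf[OF c(1)]) (use \<rho>(1) cong in auto)
      have "c \<notin> \<Gamma>"
      proof
        assume "c \<in> \<Gamma>"
        have "(\<Sum>n. (1::ennreal)) \<le> (\<Sum>n. line_integral (\<rho> n) c)"
          by (intro suminf_le summableI \<rho>(2) \<open>c \<in> \<Gamma>\<close>)
        moreover have "(\<Sum>n. (1::ennreal)) = top"
          using summable_iff_suminf_neq_top[of "\<lambda>_. 1"] by (simp add: summable_const_iff)
        ultimately show False using c(2) li by (simp add: top_unique)
      qed
      then show "ug_along (\<lambda>x. ereal (u x)) g c" using \<Gamma>(3) c(1) by blast
    qed
  qed
qed

text \<open>Every positive multiple of \<open>\<rho>\<close> is admissible for the family of curves along which \<open>\<rho>\<close> is not integrable.\<close>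

lemma weak_upper_gradientI:
  assumes m: "sets m = sets (restrict_space borel X)" and "1 \<le> p"
    and g: "g \<in> borel_measurable m"
    and \<rho>: "\<rho> \<in> borel_measurable m" "(\<integral>\<^sup>+ x. enn_powr (\<rho> x) p \<partial>m) < \<infinity>" "ug_off X \<rho> u g"
  shows "weak_upper_gradient p X m (\<lambda>x. ereal (u x)) g"
proof -
  have p: "0 < p" using assms by simp
  define \<Gamma> where "\<Gamma> = {c \<in> rect_curves X. line_integral \<rho> c = \<infinity>}"
  have cong: "borel_measurable m = (borel_measurable (restrict_space borel X) :: ('a \<Rightarrow> ennreal) set)"
    by (rule measurable_cong_sets) (use m in auto)
  have \<rho>p [measurable]: "(\<lambda>x. enn_powr (\<rho> x) p) \<in> borel_measurable m" using \<rho>(1) by measurable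
  define I where "I = enn2real (\<integral>\<^sup>+ x. enn_powr (\<rho> x) p \<partial>m)"
  have I: "(\<integral>\<^sup>+ x. enn_powr (\<rho> x) p \<partial>m) = ennreal I" "0 \<le> I"
    using \<rho>(2) by (auto simp: I_def)
  have "modulus p m \<Gamma> \<le> 0 + ennreal e" if e: "0 < e" for e :: real
  proof -
    define t where "t = (e / (1 + I)) powr (1 / p)"
    have t: "0 < t" "t powr p = e / (1 + I)" using e I p by (auto simp: t_def powr_powr)
    have "modulus p m \<Gamma> \<le> (\<integral>\<^sup>+ x. enn_powr (ennreal t * \<rho> x) p \<partial>m)"
      unfolding modulus_def
    proof (rule INF_lower, safe)
      show "(\<lambda>x. ennreal t * \<rho> x) \<in> borel_measurable m" using \<rho>(1) by measurable
      fix \<gamma> a b assume c: "(\<gamma>, a, b) \<in> \<Gamma>"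
      have "line_integral (\<lambda>x. ennreal t * \<rho> x) (\<gamma>, a, b) = ennreal t * line_integral \<rho> (\<gamma>, a, b)"
        by (rule line_integral_cmult) (use c \<rho>(1) cong in \<open>auto simp: \<Gamma>_def\<close>)
      also have "\<dots> = top" using c t(1) by (simp add: \<Gamma>_def ennreal_mult_top)
      finally show "1 \<le> line_integral (\<lambda>x. ennreal t * \<rho> x) (\<gamma>, a, b)" by simp
    qed
    also have "\<dots> = (\<integral>\<^sup>+ x. ennreal (e / (1 + I)) * enn_powr (\<rho> x) p \<partial>m)"
      using t by (intro nn_integral_cong) (simp add: enn_powr_mult[OF p])
    also have "\<dots> = ennreal (e / (1 + I)) * ennreal I"
      by (subst nn_integral_cmult) (simp_all add: I)
    also have "\<dots> = ennreal (e / (1 + I) * I)"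
      using I e by (intro ennreal_mult'[symmetric]) simp
    also have "\<dots> \<le> ennreal e" using I e by (intro ennreal_leI) (simp add: field_simps)
    finally show ?thesis by simp
  qed
  then have "modulus p m \<Gamma> \<le> 0" by (rule ennreal_le_epsilon)
  then have "modulus p m \<Gamma> = 0" by simp
  moreover have "\<Gamma> \<subseteq> rect_curves X" by (auto simp: \<Gamma>_def)
  moreover have "\<forall>c\<in>rect_curves X - \<Gamma>. ug_along (\<lambda>x. ereal (u x)) g c"
    using \<rho>(3) by (auto simp: \<Gamma>_def ug_off_def less_top)
  ultimately show ?thesis unfolding weak_upper_gradient_def using g by blast
qed

section \<open>Existence of minimal weak upper gradients\<close>

text \<open>Takes the place of separability: it yields countable covers by balls of prescribed radii, although the ambient
  type is an arbitrary metric space.\<close>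

definition sigma_compact :: "'a::metric_space set \<Rightarrow> bool" where
  "sigma_compact X \<longleftrightarrow> (\<exists>K :: nat \<Rightarrow> 'a set. (\<forall>n. compact (K n)) \<and> X = (\<Union>n. K n))"

lemma countable_ball_cover:
  assumes "sigma_compact X" "X \<noteq> {}" "\<And>x. x \<in> X \<Longrightarrow> 0 < r x"
  obtains c :: "nat \<Rightarrow> 'a::metric_space" where "range c \<subseteq> X" "X \<subseteq> (\<Union>k. ball (c k) (r (c k)))"
proof -
  obtain K :: "nat \<Rightarrow> 'a set" where K: "\<And>n. compact (K n)" "X = (\<Union>n. K n)"
    using assms(1) by (auto simp: sigma_compact_def)
  have "\<exists>F. finite F \<and> F \<subseteq> K n \<and> K n \<subseteq> (\<Union>x\<in>F. ball x (r x))" for n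
  proof -
    have "K n \<subseteq> (\<Union>x\<in>K n. ball x (r x))"
      using assms(3) K(2) by force
    then obtain F where "F \<subseteq> K n" "finite F" "K n \<subseteq> (\<Union>x\<in>F. ball x (r x))"
      using compactE_image[OF K(1), of "K n" "\<lambda>x. ball x (r x)"] by blast
    then show ?thesis by blast
  qed
  then obtain F where F: "\<And>n. finite (F n)" "\<And>n. F n \<subseteq> K n" "\<And>n. K n \<subseteq> (\<Union>x\<in>F n. ball x (r x))"
    by metis
  define D where "D = (\<Union>n. F n)"
  have "countable D" by (auto simp: D_def intro: countable_finite F)
  moreover have cov: "X \<subseteq> (\<Union>x\<in>D. ball x (r x))" using F(3) K(2) by (fastforce simp: D_def)
  moreover have "D \<noteq> {}" using cov assms(2) by auto
  ultimately have range: "range (from_nat_into D) = D" by (simp add: range_from_nat_into)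
  have "D \<subseteq> X" using F(2) K(2) by (auto simp: D_def)
  moreover have "(\<Union>k. ball (from_nat_into D k) (r (from_nat_into D k))) = (\<Union>x\<in>range (from_nat_into D). ball x (r x))"
    by blast
  ultimately show thesis using that[of "from_nat_into D"] cov range by simp
qed

lemma ball_in_sets:
  assumes "sets m = sets (restrict_space borel X)"
  shows "ball_in X x r \<in> sets m"
  unfolding assms sets_restrict_space ball_in_def by (rule image_eqI[of _ _ "ball x r"]) auto

lemma sigma_finite_of_locally_finite:
  assumes m: "sets m = sets (restrict_space borel X)" and "sigma_compact X"
    and fin: "\<And>x. x \<in> X \<Longrightarrow> \<exists>r>0. emeasure m (ball_in X x r) < \<infinity>"
  shows "sigma_finite_measure m"
proof (cases "X = {}")
  case True
  have sp: "space m = X" using sets_eq_imp_space_eq[OF m] by (simp add: space_restrict_space)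
  show ?thesis by standard (use sp True in \<open>auto intro!: exI[of _ "{}"]\<close>)
next
  case False
  have sp: "space m = X" using sets_eq_imp_space_eq[OF m] by (simp add: space_restrict_space)
  obtain r where r: "\<And>x. x \<in> X \<Longrightarrow> 0 < r x \<and> emeasure m (ball_in X x (r x)) < \<infinity>"
    using fin by metis
  obtain c :: "nat \<Rightarrow> 'a" where c: "range c \<subseteq> X" "X \<subseteq> (\<Union>k. ball (c k) (r (c k)))"
    using countable_ball_cover[OF assms(2) False, of r] r by blast
  show ?thesis
  proof (standard, intro exI[of _ "range (\<lambda>k. ball_in X (c k) (r (c k)))"] conjI)
    show "range (\<lambda>k. ball_in X (c k) (r (c k))) \<subseteq> sets m" using ball_in_sets[OF m] by auto
    show "\<Union> (range (\<lambda>k. ball_in X (c k) (r (c k)))) = space m" using c sp by (auto simp: ball_in_def)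
    show "\<forall>a\<in>range (\<lambda>k. ball_in X (c k) (r (c k))). emeasure m a \<noteq> \<infinity>" 
    proof
      fix a assume "a \<in> range (\<lambda>k. ball_in X (c k) (r (c k)))"
      then obtain k where "a = ball_in X (c k) (r (c k))" by blast
      moreover have "c k \<in> X" using c(1) by auto
      ultimately show "emeasure m a \<noteq> \<infinity>" using r[of "c k"] by (simp add: less_top)
    qed
  qed simp
qed

text \<open>A locally \<open>p\<close>-integrable function is integrable along all curves off a \<open>p\<close>-exceptional family:
  cut it to countably many balls and use that curves are compact.\<close>

lemma Lp_loc_dominate:
  assumes m: "sets m = sets (restrict_space borel X)" and "1 \<le> p" and "sigma_compact X" "Lp_loc p X m h"
  obtains \<rho> where "\<rho> \<in> borel_measurable m" "(\<integral>\<^sup>+ x. enn_powr (\<rho> x) p \<partial>m) < \<infinity>"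
    "\<And>c. c \<in> rect_curves X \<Longrightarrow> line_integral \<rho> c < \<infinity> \<Longrightarrow> line_integral h c < \<infinity>"
proof (cases "X = {}")
  case True
  then have "rect_curves X = {}" by (auto simp: rect_curves_def)
  then show ?thesis using that[of "\<lambda>_. 0"] by simp
next
  case False
  have p: "0 < p" using assms by simp
  obtain r where r: "\<And>x. x \<in> X \<Longrightarrow> 0 < r x \<and> (\<integral>\<^sup>+ y \<in> ball_in X x (r x). enn_powr (h y) p \<partial>m) < \<infinity>"
    using assms(4) unfolding Lp_loc_def by metis
  obtain c0 :: "nat \<Rightarrow> 'a" where c0: "range c0 \<subseteq> X" "X \<subseteq> (\<Union>k. ball (c0 k) (r (c0 k)))"
    using countable_ball_cover[OF assms(3) False, of r] r by blast
  define h' where "h' k x = h x * indicator (ball_in X (c0 k) (r (c0 k))) x" for k x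
  have h [measurable]: "h \<in> borel_measurable m" using assms(4) by (simp add: Lp_loc_def)
  have [measurable]: "ball_in X x s \<in> sets m" for x s by (rule ball_in_sets[OF m])
  have h'm: "h' k \<in> borel_measurable m" for k unfolding h'_def by measurable
  have cong: "borel_measurable m = (borel_measurable (restrict_space borel X) :: ('a \<Rightarrow> ennreal) set)"
    by (rule measurable_cong_sets) (use m in auto)
  have h'fin: "(\<integral>\<^sup>+ x. enn_powr (h' k x) p \<partial>m) < \<infinity>" for k
  proof -
    have "(\<integral>\<^sup>+ x. enn_powr (h' k x) p \<partial>m) = (\<integral>\<^sup>+ y \<in> ball_in X (c0 k) (r (c0 k)). enn_powr (h y) p \<partial>m)"
      by (intro nn_integral_cong) (auto simp: h'_def split: split_indicator)
    then show ?thesis using r[of "c0 k"] c0(1) by auto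
  qed
  obtain \<rho> where \<rho>: "\<rho> \<in> borel_measurable m" "(\<integral>\<^sup>+ x. enn_powr (\<rho> x) p \<partial>m) < \<infinity>"
    "\<And>c n. c \<in> rect_curves X \<Longrightarrow> line_integral \<rho> c < \<infinity> \<Longrightarrow> line_integral (h' n) c < \<infinity>"
    by (rule Lp_dominate_sequence[of m X p h', OF m \<open>1 \<le> p\<close> h'm h'fin]) blast
  show ?thesis
  proof (rule that[OF \<rho>(1,2)])
    fix c assume c: "c \<in> rect_curves X" "line_integral \<rho> c < \<infinity>"
    have "compact (arc_of c ` {0..arc_len c})"
      by (intro compact_continuous_image arc_of_continuous[OF c(1)]) simp
    moreover have img: "arc_of c ` {0..arc_len c} \<subseteq> X" using arc_of_in[OF c(1)] by auto
    ultimately have "compact (arc_of c ` {0..arc_len c})" "\<And>k. k \<in> UNIV \<Longrightarrow> open (ball (c0 k) (r (c0 k)))"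
      "arc_of c ` {0..arc_len c} \<subseteq> (\<Union>k\<in>UNIV. ball (c0 k) (r (c0 k)))"
      using c0(2) by (simp, simp, intro subset_trans[OF img])
    then obtain F where F: "finite F" "arc_of c ` {0..arc_len c} \<subseteq> (\<Union>k\<in>F. ball (c0 k) (r (c0 k)))"
      by (rule compactE_image) blast
    have "line_integral h c \<le> (\<integral>\<^sup>+ s. (\<Sum>k\<in>F. h' k (arc_of c s) * indicator {0..arc_len c} s) \<partial>lborel)"
      unfolding line_integral_arc
    proof (rule nn_integral_mono)
      fix s show "h (arc_of c s) * indicator {0..arc_len c} s \<le> (\<Sum>k\<in>F. h' k (arc_of c s) * indicator {0..arc_len c} s)"
      proof (cases "s \<in> {0..arc_len c}")
        case True
        then obtain k where k: "k \<in> F" "arc_of c s \<in> ball (c0 k) (r (c0 k))" using F(2) by blast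
        then have "h (arc_of c s) = h' k (arc_of c s)" using arc_of_in[OF c(1) True] by (simp add: h'_def ball_in_def)
        also have "\<dots> \<le> (\<Sum>k\<in>F. h' k (arc_of c s))" using F(1) k(1) by (intro member_le_sum) auto
        finally show ?thesis using True by simp
      qed simp
    qed
    also have "\<dots> = (\<Sum>k\<in>F. line_integral (h' k) c)"
      unfolding line_integral_arc
      by (rule nn_integral_sum) (use measurable_along_arc[OF c(1) _ order_refl] h'm cong in auto)
    also have "\<dots> < \<infinity>" using \<rho>(3)[OF c] F(1) by (simp add: less_top)
    finally show "line_integral h c < \<infinity>" .
  qed
qed

lemma line_integral_of_continuous_finite:
  assumes "c \<in> rect_curves X" "continuous_on X k"
  shows "line_integral (\<lambda>x. ennreal (k x)) c < \<infinity>"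
proof -
  have "compact ((\<lambda>s. k (arc_of c s)) ` {0..arc_len c})"
    by (intro compact_continuous_image continuous_on_compose2[OF assms(2) arc_of_continuous[OF assms(1)]])
      (use arc_of_in[OF assms(1)] in auto)
  then obtain B where B: "\<And>s. s \<in> {0..arc_len c} \<Longrightarrow> norm (k (arc_of c s)) \<le> B"
    by (meson bounded_iff compact_imp_bounded image_eqI)
  have "line_integral (\<lambda>x. ennreal (k x)) c \<le> (\<integral>\<^sup>+ s \<in> {0..arc_len c}. ennreal B \<partial>lborel)"
    unfolding line_integral_arc
    by (intro nn_integral_mono) (use B in \<open>force intro: ennreal_leI split: split_indicator\<close>)
  also have "\<dots> < \<infinity>" by (simp add: nn_integral_cmult_indicator ennreal_mult_less_top)
  finally show ?thesis .
qed

lemma AE_le_of_nn_integral_le: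
  assumes m: "f \<in> borel_measurable M" "g \<in> borel_measurable M"
    and le: "\<And>x. x \<in> space M \<Longrightarrow> g x \<le> f x" and fin: "(\<integral>\<^sup>+ x. g x \<partial>M) < \<infinity>" and int: "(\<integral>\<^sup>+ x. f x \<partial>M) \<le> (\<integral>\<^sup>+ x. g x \<partial>M)"
  shows "AE x in M. f x \<le> (g x :: ennreal)"
proof -
  have "(\<integral>\<^sup>+ x. f x - g x \<partial>M) = (\<integral>\<^sup>+ x. f x \<partial>M) - (\<integral>\<^sup>+ x. g x \<partial>M)"
    by (rule nn_integral_diff) (use assms in auto)
  also have "\<dots> = 0" by (rule diff_eq_0_ennreal[OF _ int]) (use fin int in \<open>auto intro: le_less_trans\<close>)
  finally have "AE x in M. f x - g x = 0"
    by (subst (asm) nn_integral_0_iff_AE) (use m in measurable)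
  moreover have "AE x in M. g x \<noteq> \<infinity>" by (rule nn_integral_PInf_AE) (use fin m in auto)
  ultimately show ?thesis
  proof eventually_elim
    case (elim x)
    then show ?case by (cases "f x"; cases "g x") (auto simp: ennreal_minus ennreal_eq_0_iff intro!: ennreal_leI)
  qed
qed

lemma Lp_loc_of_le_continuous:
  fixes k :: "'a::metric_space \<Rightarrow> real"
  assumes m: "sets m = sets (restrict_space borel X)" and p: "0 < p"
    and gm: "g \<in> borel_measurable m"
    and k: "continuous_on X k" "\<And>x. x \<in> X \<Longrightarrow> 0 \<le> k x"
    and gk: "\<And>x. x \<in> X \<Longrightarrow> g x \<le> ennreal (k x)"
    and fin: "\<And>x. x \<in> X \<Longrightarrow> \<exists>r>0. emeasure m (ball_in X x r) < \<infinity>"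
  shows "Lp_loc p X m g"
  unfolding Lp_loc_def
proof (intro conjI ballI gm)
    fix x assume x: "x \<in> X"
    obtain r where r: "r > 0" "emeasure m (ball_in X x r) < \<infinity>" using fin[OF x] by blast
    obtain s where s: "s > 0" "\<And>y. y \<in> X \<Longrightarrow> dist y x < s \<Longrightarrow> dist (k y) (k x) < 1"
      using k(1) x unfolding continuous_on_iff by (metis zero_less_one)
    have "(\<integral>\<^sup>+ y \<in> ball_in X x (min r s). enn_powr (g y) p \<partial>m) \<le> (\<integral>\<^sup>+ y. ennreal ((k x + 1) powr p) * indicator (ball_in X x r) y \<partial>m)"
    proof (rule nn_integral_mono)
      fix y
      show "enn_powr (g y) p * indicator (ball_in X x (min r s)) y \<le> ennreal ((k x + 1) powr p) * indicator (ball_in X x r) y"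
      proof (cases "y \<in> ball_in X x (min r s)")
        case True
        then have y: "y \<in> X" "y \<in> ball_in X x r" "dist y x < s" by (auto simp: ball_in_def dist_commute)
        then have "k y \<le> k x + 1" using s(2)[OF y(1,3)] by (auto simp: dist_real_def)
        then have "g y \<le> ennreal (k x + 1)" using gk[OF y(1)] by (auto intro: order_trans ennreal_leI)
        then have "enn_powr (g y) p \<le> enn_powr (ennreal (k x + 1)) p" using p by (intro enn_powr_mono) auto
        also have "\<dots> = ennreal ((k x + 1) powr p)" by (rule enn_powr_ennreal) (use k(2)[OF x] in simp)
        finally show ?thesis using True y by simp
      qed simp
    qed
    also have "\<dots> < \<infinity>"
      using r(2) ball_in_sets[OF m] by (simp add: nn_integral_cmult_indicator ennreal_mult_less_top)
    finally show "\<exists>r>0. (\<integral>\<^sup>+ y \<in> ball_in X x r. enn_powr (g y) p \<partial>m) < \<infinity>"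
      using r(1) s(1) by (intro exI[of _ "min r s"]) auto
qed

text \<open>Functions with a continuous upper gradient \<open>k\<close> have a minimal \<open>p\<close>-weak upper gradient.  Among
  the \<open>p\<close>-weak upper gradients bounded by \<open>k\<close> one minimizes the integral against a finite measure
  with positive density; the class is closed under minima, and under decreasing
  limits by monotone convergence along curves.  The presence of \<open>k\<close> makes all line integrals
  finite.\<close>

lemma minimal_wug_exists:
  fixes u k :: "'a::metric_space \<Rightarrow> real"
  assumes m: "sets m = sets (restrict_space borel X)" and p1: "1 \<le> p" and sc: "sigma_compact X"
    and fin: "\<And>x. x \<in> X \<Longrightarrow> \<exists>r>0. emeasure m (ball_in X x r) < \<infinity>"
    and k: "continuous_on X k" "\<And>x. x \<in> X \<Longrightarrow> 0 \<le> k x" "ug_off X (\<lambda>_. 0) u (\<lambda>x. ennreal (k x))"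
  obtains g \<rho> where "minimal_wug p X m (\<lambda>x. ereal (u x)) g" "g \<in> borel_measurable m"
    "\<And>x. x \<in> X \<Longrightarrow> g x \<le> ennreal (k x)"
    "\<rho> \<in> borel_measurable m" "(\<integral>\<^sup>+ x. enn_powr (\<rho> x) p \<partial>m) < \<infinity>" "ug_off X \<rho> u g"
proof -
  have p: "0 < p" using p1 by simp
  have sp: "space m = X" using sets_eq_imp_space_eq[OF m] by (simp add: space_restrict_space)
  have cong: "borel_measurable m = (borel_measurable (restrict_space borel X) :: ('a \<Rightarrow> ennreal) set)"
    by (rule measurable_cong_sets) (use m in auto)
  have congr: "borel_measurable m = (borel_measurable (restrict_space borel X) :: ('a \<Rightarrow> real) set)"
    by (rule measurable_cong_sets) (use m in auto)
  have km [measurable]: "k \<in> borel_measurable m"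
    unfolding congr by (rule borel_measurable_continuous_on_restrict[OF k(1)])
  define Lp where "Lp = {\<rho> \<in> borel_measurable m. (\<integral>\<^sup>+ x. enn_powr (\<rho> x) p \<partial>m) < \<infinity>}"
  have Lp_add: "(\<lambda>x. \<rho> x + \<sigma> x) \<in> Lp" if "\<rho> \<in> Lp" "\<sigma> \<in> Lp" for \<rho> \<sigma>
  proof -
    have [measurable]: "\<rho> \<in> borel_measurable m" "\<sigma> \<in> borel_measurable m" using that by (auto simp: Lp_def)
    have "(\<integral>\<^sup>+ x. enn_powr (\<rho> x + \<sigma> x) p \<partial>m) \<le> (\<integral>\<^sup>+ x. ennreal (2 powr p) * (enn_powr (\<rho> x) p + enn_powr (\<sigma> x) p) \<partial>m)"
      by (intro nn_integral_mono enn_powr_add_le p)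
    also have "\<dots> = ennreal (2 powr p) * ((\<integral>\<^sup>+ x. enn_powr (\<rho> x) p \<partial>m) + (\<integral>\<^sup>+ x. enn_powr (\<sigma> x) p \<partial>m))"
      by (subst nn_integral_cmult) (auto simp: nn_integral_add)
    also have "\<dots> < \<infinity>" using that by (auto simp: Lp_def ennreal_mult_less_top)
    finally show ?thesis using that by (simp add: Lp_def)
  qed
  \<comment> \<open>the class in which the infimum is taken\<close>
  define T where "T = {G \<in> borel_measurable m. (\<forall>x\<in>X. G x \<le> ennreal (k x)) \<and> (\<exists>\<rho>\<in>Lp. ug_off X \<rho> u G)}"
  have kT: "(\<lambda>x. ennreal (k x)) \<in> T"
  proof -
    have "(\<lambda>_. 0) \<in> Lp" by (simp add: Lp_def)
    then show ?thesis using k(3) by (auto simp: T_def)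
  qed
  have kfin: "line_integral G c < \<infinity>" if "\<And>x. x \<in> X \<Longrightarrow> G x \<le> ennreal (k x)" "c \<in> rect_curves X" for G c
    using line_integral_mono[of c X G "\<lambda>x. ennreal (k x)"] that line_integral_of_continuous_finite[OF that(2) k(1)]
    by (auto intro: le_less_trans)
  have T_min: "(\<lambda>x. min (G x) (H x)) \<in> T"
    if G: "G \<in> T" and H: "H \<in> borel_measurable m" "\<sigma> \<in> Lp" "ug_off X \<sigma> u H"
      and Hfin: "\<And>c. c \<in> rect_curves X \<Longrightarrow> line_integral \<sigma> c < \<infinity> \<Longrightarrow> line_integral H c < \<infinity>" for G H \<sigma>
  proof -
    obtain \<rho> where \<rho>: "\<rho> \<in> Lp" "ug_off X \<rho> u G" and Gm: "G \<in> borel_measurable m" and Gk: "\<And>x. x \<in> X \<Longrightarrow> G x \<le> ennreal (k x)"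
      using G by (auto simp: T_def)
    have "ug_off X (\<lambda>x. \<rho> x + \<sigma> x) u (\<lambda>x. min (G x) (H x))"
    proof (rule ug_off_min)
      show "ug_off X (\<lambda>x. \<rho> x + \<sigma> x) u G" by (rule ug_off_mono[OF \<rho>(2)]) auto
      show "ug_off X (\<lambda>x. \<rho> x + \<sigma> x) u H" by (rule ug_off_mono[OF H(3)]) auto
      show "G \<in> borel_measurable (restrict_space borel X)" "H \<in> borel_measurable (restrict_space borel X)"
        "(\<lambda>x. \<rho> x + \<sigma> x) \<in> borel_measurable (restrict_space borel X)"
        using Gm H(1) Lp_add[OF \<rho>(1) H(2)] cong by (auto simp: Lp_def)
      fix c assume c: "c \<in> rect_curves X" "line_integral (\<lambda>x. \<rho> x + \<sigma> x) c < \<infinity>"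
      have "line_integral \<sigma> c \<le> line_integral (\<lambda>x. \<rho> x + \<sigma> x) c" by (rule line_integral_mono[OF c(1)]) simp
      then have "line_integral \<sigma> c < \<infinity>" using c(2) by (rule le_less_trans)
      then show "line_integral G c < \<infinity> \<and> line_integral H c < \<infinity>" using kfin[OF Gk c(1)] Hfin[OF c(1)] by simp
    qed
    then show ?thesis
      using Gm H(1) Gk Lp_add[OF \<rho>(1) H(2)] by (auto simp: T_def min_le_iff_disj)
  qed
  interpret sigma_finite_measure m by (rule sigma_finite_of_locally_finite[OF m sc fin])
  obtain \<eta> :: "'a \<Rightarrow> real" where \<eta>: "\<eta> \<in> borel_measurable m" "\<And>x. \<eta> x > 0" "integrable m \<eta>"
    using obtain_positive_integrable_function by metis
  \<comment> \<open>the division by \<open>1 + k\<close> makes the functional finite on \<open>T\<close>\<close>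
  define w where "w x = ennreal (\<eta> x / (1 + k x))" for x
  have w [measurable]: "w \<in> borel_measurable m" unfolding w_def using \<eta>(1) by measurable
  have wpos: "w x \<noteq> 0" "w x \<noteq> \<infinity>" if "x \<in> X" for x
    using \<eta>(2)[of x] k(2)[OF that] by (auto simp: w_def ennreal_eq_0_iff not_le)
  define \<Phi> where "\<Phi> G = (\<integral>\<^sup>+ x. G x * w x \<partial>m)" for G
  have \<Phi>fin: "\<Phi> G < \<infinity>" if "G \<in> T" for G
  proof -
    have "\<Phi> G \<le> (\<integral>\<^sup>+ x. ennreal (\<eta> x) \<partial>m)"
      unfolding \<Phi>_def
    proof (rule nn_integral_mono)
      fix x assume x: "x \<in> space m"
      then have "G x * w x \<le> ennreal (k x) * w x" using that sp by (intro mult_right_mono) (auto simp: T_def)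
      also have "\<dots> = ennreal (k x * (\<eta> x / (1 + k x)))"
        unfolding w_def by (rule ennreal_mult'[symmetric]) (use x sp k(2)[of x] in simp)
      also have "\<dots> \<le> ennreal (\<eta> x)"
        using x sp k(2)[of x] \<eta>(2)[of x] by (intro ennreal_leI) (simp add: field_simps)
      finally show "G x * w x \<le> ennreal (\<eta> x)" .
    qed
    also have "\<dots> < \<infinity>" using \<eta>(2,3) by (simp add: nn_integral_eq_integral less_imp_le)
    finally show ?thesis .
  qed
  obtain f where f: "range f \<subseteq> \<Phi> ` T" "Inf (\<Phi> ` T) = (INF n::nat. f n)"
    using ennreal_Inf_countable_INF[of "\<Phi> ` T"] kT by blast
  then have "\<forall>n. \<exists>G. G \<in> T \<and> f n = \<Phi> G" by blast
  then obtain G where G: "\<And>n. G n \<in> T" "\<And>n. f n = \<Phi> (G n)" by metis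
  \<comment> \<open>a decreasing minimizing sequence\<close>
  define H where "H = rec_nat (G 0) (\<lambda>n h x. min (h x) (G (Suc n) x))"
  have H0: "H 0 = G 0" and HS: "H (Suc n) = (\<lambda>x. min (H n x) (G (Suc n) x))" for n by (simp_all add: H_def)
  have HT: "H n \<in> T" for n
  proof (induction n)
    case (Suc n)
    obtain \<sigma> where "\<sigma> \<in> Lp" "ug_off X \<sigma> u (G (Suc n))" using G(1)[of "Suc n"] by (auto simp: T_def)
    then show ?case unfolding HS using G(1)[of "Suc n"] kfin
      by (intro T_min[OF Suc, of "G (Suc n)" \<sigma>]) (auto simp: T_def)
  qed (simp add: H0 G)
  have HG: "H n x \<le> G n x" for n x by (cases n) (auto simp: H0 HS)
  have Hdec: "decseq H" by (rule decseq_SucI) (auto simp: HS le_fun_def)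
  define g where "g x = (INF n. H n x)" for x
  have "\<exists>\<rho>. \<rho> \<in> Lp \<and> ug_off X \<rho> u (H n)" for n using HT[of n] by (auto simp: T_def)
  then obtain \<rho>' where \<rho>': "\<And>n. \<rho>' n \<in> Lp" "\<And>n. ug_off X (\<rho>' n) u (H n)" by metis
  obtain \<rho> where \<rho>: "\<rho> \<in> borel_measurable m" "(\<integral>\<^sup>+ x. enn_powr (\<rho> x) p \<partial>m) < \<infinity>"
    "\<And>c n. c \<in> rect_curves X \<Longrightarrow> line_integral \<rho> c < \<infinity> \<Longrightarrow> line_integral (\<rho>' n) c < \<infinity>"
    by (rule Lp_dominate_sequence[OF m p1, of \<rho>']) (use \<rho>'(1) in \<open>auto simp: Lp_def\<close>)
  have Hm: "H n \<in> borel_measurable m" and Hk: "x \<in> X \<Longrightarrow> H n x \<le> ennreal (k x)" for n x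
    using HT[of n] by (auto simp: T_def)
  have gm [measurable]: "g \<in> borel_measurable m" unfolding g_def using Hm by measurable
  have gk: "g x \<le> ennreal (k x)" if "x \<in> X" for x
    unfolding g_def by (rule INF_lower2[of 0]) (use Hk that in auto)
  have gug: "ug_off X \<rho> u g"
    unfolding ug_off_def
  proof (intro ballI impI)
    fix c assume c: "c \<in> rect_curves X" "line_integral \<rho> c < \<infinity>"
    let ?h = "\<lambda>n s. H n (arc_of c s) * indicator {0..arc_len c} s"
    have "line_integral g c = (\<integral>\<^sup>+ s. (INF n. ?h n s) \<partial>lborel)"
      unfolding line_integral_arc g_def
      by (intro nn_integral_cong) (auto split: split_indicator)
    also have "\<dots> = (INF n. integral\<^sup>N lborel (?h n))"
    proof (rule nn_integral_monotone_convergence_INF_decseq[where i=0])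
      show "decseq ?h" by (rule decseq_SucI) (auto simp: HS le_fun_def split: split_indicator)
      show "?h n \<in> borel_measurable lborel" for n
        using measurable_along_arc[OF c(1) _ order_refl, of "H n"] Hm[of n] cong by simp
      show "integral\<^sup>N lborel (?h 0) < \<infinity>"
        using kfin[of "H 0" c] Hk[of _ 0] c(1) by (simp add: line_integral_arc)
    qed
    also have "\<dots> = (INF n. line_integral (H n) c)" by (simp add: line_integral_arc)
    finally have li: "line_integral g c = (INF n. line_integral (H n) c)" .
    show "ug_along (\<lambda>x. ereal (u x)) g c"
      unfolding ug_along_arc[OF c(1)] li
    proof (rule INF_greatest)
      fix n
      have "ug_along (\<lambda>x. ereal (u x)) (H n) c"
        using \<rho>'(2)[of n] \<rho>(3)[OF c, of n] c(1) by (auto simp: ug_off_def)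
      then show "ennreal \<bar>u (arc_of c (arc_len c)) - u (arc_of c 0)\<bar> \<le> line_integral (H n) c"
        unfolding ug_along_arc[OF c(1)] .
    qed
  qed
  have gT: "g \<in> T" using gm gk gug \<rho>(1,2) by (auto simp: T_def Lp_def)
  have gmin: "\<Phi> g \<le> \<Phi> G'" if "G' \<in> T" for G'
  proof -
    have gG: "g x \<le> G n x" for n x
      unfolding g_def using HG[of n x] by (rule INF_lower2[OF UNIV_I])
    have "\<Phi> g \<le> f n" for n
      unfolding G(2) \<Phi>_def by (rule nn_integral_mono) (use gG[of _ n] in \<open>simp add: mult_right_mono\<close>)
    then have "\<Phi> g \<le> Inf (\<Phi> ` T)" unfolding f(2) by (rule INF_greatest)
    also have "\<dots> \<le> \<Phi> G'" using that by (rule INF_lower)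
    finally show ?thesis .
  qed
  have loc: "Lp_loc p X m g"
    by (rule Lp_loc_of_le_continuous[OF m p gm k(1,2) gk fin])
  have minimal: "AE x in m. g x \<le> h x" if h: "weak_upper_gradient p X m (\<lambda>x. ereal (u x)) h" "Lp_loc p X m h" for h
  proof -
    have hm [measurable]: "h \<in> borel_measurable m" using h(2) by (simp add: Lp_loc_def)
    obtain \<sigma> where \<sigma>: "\<sigma> \<in> borel_measurable m" "(\<integral>\<^sup>+ x. enn_powr (\<sigma> x) p \<partial>m) < \<infinity>" "ug_off X \<sigma> u h"
      using weak_upper_gradientD[OF m p1 h(1)] by blast
    obtain \<tau> where \<tau>: "\<tau> \<in> borel_measurable m" "(\<integral>\<^sup>+ x. enn_powr (\<tau> x) p \<partial>m) < \<infinity>"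
        "\<And>c. c \<in> rect_curves X \<Longrightarrow> line_integral \<tau> c < \<infinity> \<Longrightarrow> line_integral h c < \<infinity>"
      by (rule Lp_loc_dominate[OF m p1 sc h(2)]) blast
    have st: "(\<lambda>x. \<sigma> x + \<tau> x) \<in> Lp" by (rule Lp_add) (use \<sigma> \<tau> in \<open>auto simp: Lp_def\<close>)
    have T: "(\<lambda>x. min (g x) (h x)) \<in> T"
    proof (rule T_min[OF gT hm st])
      show "ug_off X (\<lambda>x. \<sigma> x + \<tau> x) u h" by (rule ug_off_mono[OF \<sigma>(3)]) auto
      fix c assume c: "c \<in> rect_curves X" "line_integral (\<lambda>x. \<sigma> x + \<tau> x) c < \<infinity>"
      have "line_integral \<tau> c \<le> line_integral (\<lambda>x. \<sigma> x + \<tau> x) c" by (rule line_integral_mono[OF c(1)]) simp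
      then show "line_integral h c < \<infinity>" using c(2) \<tau>(3)[OF c(1)] by (auto intro: le_less_trans)
    qed
    have "AE x in m. g x * w x \<le> min (g x) (h x) * w x"
    proof (rule AE_le_of_nn_integral_le)
      show "(\<integral>\<^sup>+ x. min (g x) (h x) * w x \<partial>m) < \<infinity>" using \<Phi>fin[OF T] by (simp add: \<Phi>_def)
      show "(\<integral>\<^sup>+ x. g x * w x \<partial>m) \<le> (\<integral>\<^sup>+ x. min (g x) (h x) * w x \<partial>m)"
        using gmin[OF T] by (simp add: \<Phi>_def)
      show "min (g x) (h x) * w x \<le> g x * w x" for x by (rule mult_right_mono) auto
    qed measurable
    then show ?thesis
    proof (rule AE_mp, intro AE_I2 impI)
      fix x assume x: "x \<in> space m" "g x * w x \<le> min (g x) (h x) * w x"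
      have "g x \<le> min (g x) (h x)"
        using x(2) wpos[of x] x(1) sp by (simp add: ennreal_mult_le_mult_iff mult.commute[of _ "w x"])
      then show "g x \<le> h x" by simp
    qed
  qed
  show thesis
  proof (rule that[of g \<rho>])
    show "minimal_wug p X m (\<lambda>x. ereal (u x)) g"
      unfolding minimal_wug_def
      using weak_upper_gradientI[OF m p1 gm \<rho>(1,2) gug] loc minimal by blast
  qed (use gm gk \<rho> gug in auto)
qed

section \<open>Doubling measures\<close>

lemma ball_in_iff: "y \<in> ball_in X x r \<longleftrightarrow> y \<in> X \<and> dist x y < r"
  by (auto simp: ball_in_def)

lemma doubling_sets: "doubling X m C \<Longrightarrow> sets m = sets (restrict_space borel X)"
  by (simp add: doubling_def)

lemma doubling_ge_1: "doubling X m C \<Longrightarrow> 1 \<le> C"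
  by (simp add: doubling_def)

lemma doubling_ball_finite:
  assumes "doubling X m C" "x \<in> X"
  shows "emeasure m (ball_in X x r) < \<infinity>"
proof (cases "0 < r")
  case True
  have "1 \<le> C" "ennreal C * emeasure m (ball_in X x r) < \<infinity>" using assms True by (auto simp: doubling_def)
  then show ?thesis by (auto simp: ennreal_mult_less_top)
next
  case False
  then have "ball_in X x r = {}" using zero_le_dist[of x] by (auto simp: ball_in_iff) (metis less_le_trans not_le zero_le_dist)
  then show ?thesis by simp
qed

lemma doubling_emeasure: 
  assumes "doubling X m C" "x \<in> X"
  shows "emeasure m (ball_in X x r) = ennreal (measure m (ball_in X x r))"
  using doubling_ball_finite[OF assms, of r] by (intro emeasure_eq_ennreal_measure) (auto simp: less_top)

lemma doubling_measure_pos: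
  assumes "doubling X m C" "x \<in> X" "0 < r"
  shows "0 < measure m (ball_in X x r)"
proof -
  have "0 < emeasure m (ball_in X x (2 * (r / 2)))"
    using assms unfolding doubling_def by (metis half_gt_zero)
  then have "0 < emeasure m (ball_in X x r)" by simp
  then show ?thesis using doubling_emeasure[OF assms(1,2), of r] by (metis ennreal_less_zero_iff)
qed

lemma doubling_measure_mono:
  assumes "doubling X m C" "x \<in> X" "A \<subseteq> ball_in X x r" "A \<in> sets m"
  shows "measure m A \<le> measure m (ball_in X x r)"
  by (rule measure_mono_fmeasurable)
     (use assms doubling_ball_finite[OF assms(1,2), of r] ball_in_sets[OF doubling_sets[OF assms(1)]] in \<open>auto simp: fmeasurable_def\<close>)

text \<open>A ball is contained in \<open>B(y, 2\<^sup>k s)\<close>, and \<open>k\<close> doublings lead from there to \<open>B(y, s)\<close>.\<close>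

lemma doubling_compare:
  assumes "doubling X m C" "x \<in> X" "y \<in> X" "0 < s" "dist x y + r \<le> 2 ^ k * s"
  shows "measure m (ball_in X x r) \<le> C ^ k * measure m (ball_in X y s)"
proof -
  have step: "measure m (ball_in X y (2 * t)) \<le> C * measure m (ball_in X y t)" if "0 < t" for t
  proof -
    have "emeasure m (ball_in X y (2 * t)) \<le> ennreal C * emeasure m (ball_in X y t)" "1 \<le> C"
      using assms that by (auto simp: doubling_def)
    then have "ennreal (measure m (ball_in X y (2 * t))) \<le> ennreal (C * measure m (ball_in X y t))"
      unfolding doubling_emeasure[OF assms(1,3)] by (simp add: ennreal_mult)
    then show ?thesis using \<open>1 \<le> C\<close> by (subst (asm) ennreal_le_iff) auto
  qed
  have "measure m (ball_in X y (2 ^ k * s)) \<le> C ^ k * measure m (ball_in X y s)"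
  proof (induction k)
    case (Suc k)
    have "measure m (ball_in X y (2 ^ Suc k * s)) \<le> C * measure m (ball_in X y (2 ^ k * s))"
      using step[of "2 ^ k * s"] assms(4) by (simp add: mult.assoc)
    also have "\<dots> \<le> C * (C ^ k * measure m (ball_in X y s))"
      using Suc doubling_ge_1[OF assms(1)] by (intro mult_left_mono) auto
    finally show ?case by (simp add: mult.assoc)
  qed simp
  moreover have "measure m (ball_in X x r) \<le> measure m (ball_in X y (2 ^ k * s))"
  proof (rule doubling_measure_mono[OF assms(1,3)])
    show "ball_in X x r \<subseteq> ball_in X y (2 ^ k * s)"
    proof
      fix z assume z: "z \<in> ball_in X x r"
      have "dist y z \<le> dist x y + dist x z" by (metis dist_commute dist_triangle)
      then show "z \<in> ball_in X y (2 ^ k * s)" using z assms(5) by (auto simp: ball_in_iff)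
    qed
    show "ball_in X x r \<in> sets m" by (rule ball_in_sets[OF doubling_sets[OF assms(1)]])
  qed
  ultimately show ?thesis by simp
qed

text \<open>The balls of radius \<open>\<rho> / 2\<close> about the points are disjoint, lie in one ball, and each carries a fixed fraction of its measure.\<close>

lemma separated_packing:
  assumes d: "doubling X m C" and z: "z \<in> X" and T: "T \<subseteq> ball_in X z R" and "0 < \<rho>"
    and sep: "\<And>x y. x \<in> T \<Longrightarrow> y \<in> T \<Longrightarrow> x \<noteq> y \<Longrightarrow> \<rho> \<le> dist x y"
    and k: "2 * R + \<rho> / 2 \<le> 2 ^ k * (\<rho> / 2)"
  shows "finite T \<and> real (card T) \<le> C ^ k"
proof -
  define M where "M = measure m (ball_in X z (R + \<rho> / 2))"
  have fin: "real (card F) \<le> C ^ k" if F: "finite F" "F \<subseteq> T" for F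
  proof (cases "F = {}")
    case False
    then obtain x0 where x0: "x0 \<in> F" by blast
    then have "x0 \<in> ball_in X z R" using F T by blast
    then have R: "0 < R" by (auto simp: ball_in_iff intro: le_less_trans[OF zero_le_dist])
    have M: "0 < M" unfolding M_def by (rule doubling_measure_pos[OF d z]) (use R \<open>0 < \<rho>\<close> in simp)
    have ge: "M \<le> C ^ k * measure m (ball_in X x (\<rho> / 2))" if "x \<in> F" for x
    proof -
      have "x \<in> ball_in X z R" using that F T by blast
      then show ?thesis unfolding M_def
        using k \<open>0 < \<rho>\<close> by (intro doubling_compare[OF d z]) (auto simp: ball_in_iff)
    qed
    have "real (card F) * M = (\<Sum>x\<in>F. M)" by simp
    also have "\<dots> \<le> (\<Sum>x\<in>F. C ^ k * measure m (ball_in X x (\<rho> / 2)))" by (intro sum_mono ge)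
    also have "\<dots> = C ^ k * (\<Sum>x\<in>F. measure m (ball_in X x (\<rho> / 2)))" by (simp add: sum_distrib_left)
    also have "(\<Sum>x\<in>F. measure m (ball_in X x (\<rho> / 2))) = measure m (\<Union>x\<in>F. ball_in X x (\<rho> / 2))"
    proof (rule measure_finite_Union[symmetric])
      show "disjoint_family_on (\<lambda>x. ball_in X x (\<rho> / 2)) F"
        unfolding disjoint_family_on_def
      proof (intro ballI impI)
        fix x y assume xy: "x \<in> F" "y \<in> F" "x \<noteq> y"
        have "\<rho> \<le> dist x y" using sep xy F by blast
        moreover have "dist x y < \<rho>" if "w \<in> ball_in X x (\<rho> / 2)" "w \<in> ball_in X y (\<rho> / 2)" for w
          using that dist_triangle2[of x y w] by (simp add: ball_in_iff)
        ultimately show "ball_in X x (\<rho> / 2) \<inter> ball_in X y (\<rho> / 2) = {}"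
          by (meson disjoint_iff not_le)
      qed
      show "emeasure m (ball_in X x (\<rho> / 2)) \<noteq> \<infinity>" if "x \<in> F" for x
      proof -
        have "x \<in> X" using that F T by (auto simp: ball_in_iff)
        then show ?thesis using doubling_ball_finite[OF d, of x "\<rho> / 2"] by simp
      qed
    qed (use F ball_in_sets[OF doubling_sets[OF d]] in auto)
    also have "measure m (\<Union>x\<in>F. ball_in X x (\<rho> / 2)) \<le> M"
      unfolding M_def
    proof (rule doubling_measure_mono[OF d z])
      show "(\<Union>x\<in>F. ball_in X x (\<rho> / 2)) \<subseteq> ball_in X z (R + \<rho> / 2)"
      proof safe
        fix x w assume x: "x \<in> F" "w \<in> ball_in X x (\<rho> / 2)"
        have "x \<in> ball_in X z R" using x F T by blast
        then show "w \<in> ball_in X z (R + \<rho> / 2)"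
          using x dist_triangle[of z w x] by (auto simp: ball_in_iff)
      qed
      show "(\<Union>x\<in>F. ball_in X x (\<rho> / 2)) \<in> sets m"
        using F ball_in_sets[OF doubling_sets[OF d]] by (intro sets.finite_UN) auto
    qed
    finally have "real (card F) * M \<le> C ^ k * M" using doubling_ge_1[OF d] by (simp add: mult_left_mono)
    then show ?thesis using M by simp
  qed (use doubling_ge_1[OF d] in simp)
  have "finite T"
  proof (rule ccontr)
    assume "infinite T"
    obtain n :: nat where n: "C ^ k < real n" using reals_Archimedean2 by blast
    obtain F where "F \<subseteq> T" "finite F" "card F = n" using infinite_arbitrarily_large[OF \<open>infinite T\<close>, of n] by blast
    then show False using fin n by force
  qed
  then show ?thesis using fin by blast
qed

text \<open>A separated set with the largest possible number of points is a net.\<close>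

lemma finite_net:
  assumes d: "doubling X m C" and z: "z \<in> X" and S: "S \<subseteq> ball_in X z R" and "0 < \<rho>"
  obtains F where "finite F" "F \<subseteq> S" "S \<subseteq> (\<Union>x\<in>F. ball_in X x \<rho>)"
    "\<And>x y. x \<in> F \<Longrightarrow> y \<in> F \<Longrightarrow> x \<noteq> y \<Longrightarrow> \<rho> \<le> dist x y"
proof -
  let ?sep = "\<lambda>F. finite F \<and> F \<subseteq> S \<and> (\<forall>x\<in>F. \<forall>y\<in>F. x \<noteq> y \<longrightarrow> \<rho> \<le> dist x y)"
  obtain k :: nat where k: "(2 * R + \<rho> / 2) / (\<rho> / 2) < 2 ^ k" using real_arch_pow[of 2] by auto
  then have k: "2 * R + \<rho> / 2 \<le> 2 ^ k * (\<rho> / 2)" using \<open>0 < \<rho>\<close> by (simp add: divide_less_eq)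
  obtain N :: nat where N: "C ^ k < real N" using reals_Archimedean2 by blast
  have "card F < N" if "?sep F" for F
    using separated_packing[OF d z, of F R \<rho> k] that S \<open>0 < \<rho>\<close> k N by force
  then obtain F where F: "?sep F" "\<And>G. ?sep G \<Longrightarrow> card G \<le> card F"
    using ex_has_greatest_nat[of ?sep "{}" card N] by auto
  show thesis
  proof (rule that)
    show "S \<subseteq> (\<Union>x\<in>F. ball_in X x \<rho>)"
    proof
      fix y assume y: "y \<in> S"
      show "y \<in> (\<Union>x\<in>F. ball_in X x \<rho>)"
      proof (rule ccontr)
        assume no: "y \<notin> (\<Union>x\<in>F. ball_in X x \<rho>)"
        have "y \<in> X" using y S by (auto simp: ball_in_iff)
        then have far: "\<rho> \<le> dist x y" if "x \<in> F" for x using no that by (auto simp: ball_in_iff not_less)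
        then have "y \<notin> F" using \<open>0 < \<rho>\<close> by force
        moreover have "?sep (insert y F)" using F(1) y far by (auto simp: dist_commute)
        ultimately show False using F(2)[of "insert y F"] F(1) by simp
      qed
    qed
  qed (use F in auto)
qed

lemma doubling_proper:
  assumes d: "doubling X m C" and "complete X" and z: "z \<in> X" and S: "S \<subseteq> ball_in X z R" "closed S"
  shows "compact S"
  unfolding compact_eq_totally_bounded
proof (intro conjI allI impI)
  have "S = X \<inter> S" using S by (auto simp: ball_in_def)
  then show "complete S" using complete_Int_closed[OF \<open>complete X\<close> S(2)] by simp
  fix e :: real assume "0 < e"
  then obtain F where "finite F" "S \<subseteq> (\<Union>x\<in>F. ball_in X x e)" by (rule finite_net[OF d z S(1)])
  then show "\<exists>k. finite k \<and> S \<subseteq> (\<Union>x\<in>k. ball x e)" by (intro exI[of _ F]) (auto simp: ball_in_def)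
qed

text \<open>Stated with closed sets of the ambient type, so that the distance function detects the points of \<open>\<Omega>\<close>.\<close>

definition proper_open :: "'a::metric_space set \<Rightarrow> 'a set \<Rightarrow> bool" where
  "proper_open X \<Omega> \<longleftrightarrow> \<Omega> \<subseteq> X \<and> \<Omega> \<noteq> X \<and> closed (X - \<Omega>) \<and> closed X"

lemma proper_openI:
  assumes "complete X" "openin (top_of_set X) \<Omega>" "\<Omega> \<noteq> X"
  shows "proper_open X \<Omega>"
proof -
  have X: "closed X" using assms(1) by (rule complete_imp_closed)
  moreover have "\<Omega> \<subseteq> X" using assms(2) by (rule openin_imp_subset)
  moreover have "closedin (top_of_set X) (X - \<Omega>)" using assms(2) by (simp add: closedin_def openin_imp_subset double_diff)
  then have "closed (X - \<Omega>)" using X by (rule closedin_closed_trans)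
  ultimately show ?thesis using assms(3) by (simp add: proper_open_def)
qed

context
  fixes X \<Omega> :: "'a::metric_space set"
  assumes po: "proper_open X \<Omega>"
begin

lemma d_compl_pos: "x \<in> \<Omega> \<Longrightarrow> 0 < d_compl X \<Omega> x"
proof -
  assume "x \<in> \<Omega>"
  moreover have "closed (X - \<Omega>)" "X - \<Omega> \<noteq> {}" using po by (auto simp: proper_open_def)
  ultimately have "infdist x (X - \<Omega>) \<noteq> 0" using in_closed_iff_infdist_zero by blast
  then show ?thesis unfolding d_compl_def using infdist_nonneg[of x "X - \<Omega>"] by linarith
qed

lemma d_compl_diff: "\<bar>d_compl X \<Omega> x - d_compl X \<Omega> y\<bar> \<le> dist x y"
  unfolding d_compl_def
  using infdist_triangle[of x "X - \<Omega>" y] infdist_triangle[of y "X - \<Omega>" x] by (simp add: dist_commute abs_le_iff)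

lemma d_compl_ball: "ball_in X x (d_compl X \<Omega> x) \<subseteq> \<Omega>"
proof
  fix y assume y: "y \<in> ball_in X x (d_compl X \<Omega> x)"
  show "y \<in> \<Omega>"
  proof (rule ccontr)
    assume "y \<notin> \<Omega>"
    then have "infdist x (X - \<Omega>) \<le> dist x y" using y by (intro infdist_le) (auto simp: ball_in_iff)
    then show False using y by (simp add: ball_in_iff d_compl_def)
  qed
qed

lemma d_compl_pos_in: "x \<in> X \<Longrightarrow> 0 < d_compl X \<Omega> x \<Longrightarrow> x \<in> \<Omega>"
proof -
  assume "x \<in> X" "0 < d_compl X \<Omega> x"
  then have "x \<in> ball_in X x (d_compl X \<Omega> x)" by (simp add: ball_in_iff)
  then show ?thesis using d_compl_ball[of x] by blast
qed

lemma proper_open_sets: "sets m = sets (restrict_space borel X) \<Longrightarrow> \<Omega> \<in> sets m"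
proof -
  assume m: "sets m = sets (restrict_space borel X)"
  have "\<Omega> = X \<inter> (- (X - \<Omega>))" using po by (auto simp: proper_open_def)
  moreover have "- (X - \<Omega>) \<in> sets borel" using po unfolding proper_open_def by (intro borel_open open_Compl) simp
  ultimately show "\<Omega> \<in> sets m" unfolding m sets_restrict_space by blast
qed

end

lemma d_compl_continuous: "continuous_on S (d_compl X \<Omega>)"
  unfolding d_compl_def by (intro continuous_intros)

lemma doubling_sigma_compact:
  assumes d: "doubling X m C" and "complete X"
  shows "sigma_compact X"
proof (cases "X = {}")
  case False
  then obtain z where z: "z \<in> X" by blast
  have "compact (X \<inter> cball z (real n))" for n
    by (rule doubling_proper[OF d \<open>complete X\<close> z, of _ "real n + 1"])
       (auto simp: ball_in_iff intro: closed_Int complete_imp_closed[OF \<open>complete X\<close>])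
  moreover have "X = (\<Union>n. X \<inter> cball z (real n))" using real_arch_simple by auto
  ultimately show ?thesis unfolding sigma_compact_def by (intro exI[of _ "\<lambda>n. X \<inter> cball z (real n)"]) simp
qed (auto simp: sigma_compact_def intro: exI[of _ "\<lambda>_. {}"])

lemma proper_open_sigma_compact:
  assumes d: "doubling X m C" and "complete X" and po: "proper_open X \<Omega>"
  shows "sigma_compact \<Omega>"
proof (cases "X = {}")
  case False
  then obtain z where z: "z \<in> X" by blast
  define K where "K n = {x \<in> X \<inter> cball z (real n). 1 / (real n + 1) \<le> d_compl X \<Omega> x}" for n :: nat
  have "compact (K n)" for n
  proof (rule doubling_proper[OF d \<open>complete X\<close> z, of _ "real n + 1"])
    show "K n \<subseteq> ball_in X z (real n + 1)" by (auto simp: K_def ball_in_iff)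
    have "K n = (X \<inter> cball z (real n)) \<inter> d_compl X \<Omega> -` {1 / (real n + 1)..}" by (auto simp: K_def)
    also have "closed \<dots>"
      by (intro continuous_closed_preimage d_compl_continuous closed_Int complete_imp_closed[OF \<open>complete X\<close>]) auto
    finally show "closed (K n)" .
  qed
  moreover have "\<Omega> = (\<Union>n. K n)"
  proof safe
    fix x assume x: "x \<in> \<Omega>"
    obtain n :: nat where n: "max (dist z x) (1 / d_compl X \<Omega> x) \<le> real n" using real_arch_simple by blast
    have "1 / (real n + 1) \<le> d_compl X \<Omega> x"
      using n d_compl_pos[OF po x] by (simp add: field_simps)
    then show "x \<in> (\<Union>n. K n)" using x n po by (auto simp: K_def proper_open_def intro!: exI[of _ n])
  next
    fix x n assume "x \<in> K n"
    then have "x \<in> X" "0 < 1 / (real n + 1)" "1 / (real n + 1) \<le> d_compl X \<Omega> x" by (auto simp: K_def)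
    then have "0 < d_compl X \<Omega> x" by linarith
    then show "x \<in> \<Omega>" using d_compl_pos_in[OF po \<open>x \<in> X\<close>] by simp
  qed
  ultimately show ?thesis unfolding sigma_compact_def by (intro exI[of _ K]) simp
next
  case True
  then show ?thesis using po by (auto simp: proper_open_def)
qed

section \<open>Whitney partitions\<close>

text \<open>Whitney data at relative scale \<open>\<kappa>\<close>: the balls have radii \<open>\<kappa> d(x\<^sub>i, X - \<Omega>)\<close>, but the
  overlap is controlled for the balls of radius \<open>3/4 d(x\<^sub>i, X - \<Omega>)\<close>, however small \<open>\<kappa>\<close> is.  Small \<open>\<kappa>\<close> is
  needed because the dilated balls in the Poincare inequality must stay inside \<open>\<Omega>\<close>.\<close>

definition whitney_at ::
  "'a::metric_space set \<Rightarrow> 'a set \<Rightarrow> real \<Rightarrow> real \<Rightarrow> nat set \<Rightarrow> (nat \<Rightarrow> 'a) \<Rightarrow> (nat \<Rightarrow> 'a \<Rightarrow> real) \<Rightarrow> bool" where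
  "whitney_at X \<Omega> \<kappa> C I x \<phi> \<longleftrightarrow>
     0 < C \<and> x ` I \<subseteq> \<Omega> \<and>
     \<Omega> = (\<Union>i\<in>I. ball_in X (x i) (\<kappa> * d_compl X \<Omega> (x i))) \<and>
     (\<forall>y\<in>X. finite {i\<in>I. y \<in> ball_in X (x i) (3 / 4 * d_compl X \<Omega> (x i))} \<and>
            real (card {i\<in>I. y \<in> ball_in X (x i) (3 / 4 * d_compl X \<Omega> (x i))}) \<le> C) \<and>
     (\<forall>i\<in>I. (C / (\<kappa> * d_compl X \<Omega> (x i)))-lipschitz_on X (\<phi> i) \<and>
        (\<forall>y\<in>X. 0 \<le> \<phi> i y \<and> \<phi> i y \<le> indicator (ball_in X (x i) (2 * \<kappa> * d_compl X \<Omega> (x i))) y) \<and>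
        (\<forall>y\<in>ball_in X (x i) (\<kappa> * d_compl X \<Omega> (x i)). 1 / C \<le> \<phi> i y)) \<and>
     (\<forall>y\<in>\<Omega>. ((\<lambda>i. \<phi> i y) has_sum 1) I)"

lemma whitney_partition_iff: "whitney_partition X \<Omega> C I x \<phi> \<longleftrightarrow> whitney_at X \<Omega> (1 / 8) C I x \<phi>"
  unfolding whitney_partition_def whitney_at_def wball_def by (simp add: mult.assoc)

text \<open>The minimum in the separation condition is what makes a maximal set cover \<open>\<Omega>\<close>: a point that cannot be added is closer to some
  \<open>x\<close> than both radii, in particular than the radius of \<open>x\<close>.\<close>

lemma maximal_separated_set:
  fixes r :: "'a::metric_space \<Rightarrow> real"
  shows "\<exists>S\<subseteq>\<Omega>. (\<forall>x\<in>S. \<forall>y\<in>S. x \<noteq> y \<longrightarrow> min (r x) (r y) \<le> dist x y) \<and>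
    (\<forall>y\<in>\<Omega>. 0 < r y \<longrightarrow> (\<exists>x\<in>S. dist x y < r x))"
proof -
  let ?A = "{S. S \<subseteq> \<Omega> \<and> (\<forall>x\<in>S. \<forall>y\<in>S. x \<noteq> y \<longrightarrow> min (r x) (r y) \<le> dist x y)}"
  have "\<exists>M\<in>?A. \<forall>S\<in>?A. M \<subseteq> S \<longrightarrow> S = M"
  proof (rule subset_Zorn_nonempty)
    show "?A \<noteq> {}" by blast
    fix \<C> assume "\<C> \<noteq> {}" and ch: "subset.chain ?A \<C>"
    show "\<Union>\<C> \<in> ?A"
    proof (intro CollectI conjI ballI impI)
      show "\<Union>\<C> \<subseteq> \<Omega>" using ch by (auto simp: subset.chain_def)
      fix x y assume "x \<in> \<Union>\<C>" "y \<in> \<Union>\<C>" "x \<noteq> y"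
      then obtain A B where AB: "A \<in> \<C>" "B \<in> \<C>" "x \<in> A" "y \<in> B" by blast
      have "A \<subseteq> B \<or> B \<subseteq> A" using ch AB(1,2) by (auto simp: subset_chain_def)
      then obtain S where "S \<in> \<C>" "x \<in> S" "y \<in> S" using AB by blast
      then show "min (r x) (r y) \<le> dist x y" using ch \<open>x \<noteq> y\<close> by (auto simp: subset.chain_def)
    qed
  qed
  then obtain S where S: "S \<in> ?A" "\<forall>T\<in>?A. S \<subseteq> T \<longrightarrow> T = S" by (rule bexE)
  have max: "\<exists>x\<in>S. dist x y < r x" if y: "y \<in> \<Omega>" "0 < r y" for y
  proof -
    show "\<exists>x\<in>S. dist x y < r x"
    proof (cases "y \<in> S")
      case True
      then show ?thesis using y by (intro bexI[of _ y]) auto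
    next
      case False
      have "\<exists>x\<in>S. dist x y < min (r x) (r y)"
      proof (rule ccontr)
        assume "\<not> ?thesis"
        then have "insert y S \<in> ?A" using S(1) y by (auto simp: not_less dist_commute min.commute)
        then have "S \<subseteq> insert y S \<longrightarrow> insert y S = S" by (rule bspec[OF S(2)])
        then have "insert y S = S" by blast
        then show False using False by blast
      qed
      then show ?thesis by auto
    qed
  qed
  show ?thesis using S(1) max by (intro exI[of _ S]) auto
qed

lemma d_compl_comparable:
  assumes "proper_open X \<Omega>" "dist x y < t * d_compl X \<Omega> x"
  shows "(1 - t) * d_compl X \<Omega> x \<le> d_compl X \<Omega> y" "d_compl X \<Omega> y \<le> (1 + t) * d_compl X \<Omega> x"
  using d_compl_diff[OF assms(1), of x y] assms(2) by (auto simp: algebra_simps)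

text \<open>The overlap of the big balls: their centres are separated by a fixed fraction of the
  distance of the common point to the complement of \<open>\<Omega>\<close>.\<close>

lemma whitney_overlap:
  assumes d: "doubling X m C" and po: "proper_open X \<Omega>" and "0 < \<kappa>" "\<kappa> \<le> 1"
    and k: "32 / \<kappa> + 1 \<le> 2 ^ k" and "S \<subseteq> \<Omega>" and y: "y \<in> X"
    and sep: "\<And>x z. x \<in> S \<Longrightarrow> z \<in> S \<Longrightarrow> x \<noteq> z \<Longrightarrow> min (\<kappa> * d_compl X \<Omega> x) (\<kappa> * d_compl X \<Omega> z) \<le> dist x z"
  shows "finite {x\<in>S. y \<in> ball_in X x (3 / 4 * d_compl X \<Omega> x)} \<and>
     real (card {x\<in>S. y \<in> ball_in X x (3 / 4 * d_compl X \<Omega> x)}) \<le> C ^ k"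
proof (cases "{x\<in>S. y \<in> ball_in X x (3 / 4 * d_compl X \<Omega> x)} = {}")
  case False
  define J where "J = {x\<in>S. y \<in> ball_in X x (3 / 4 * d_compl X \<Omega> x)}"
  define e where "e = d_compl X \<Omega> y"
  have J: "1 / 4 * d_compl X \<Omega> x \<le> e" "e \<le> 7 / 4 * d_compl X \<Omega> x" "dist x y < 3 / 4 * d_compl X \<Omega> x"
    "0 < d_compl X \<Omega> x" "x \<in> X" "x \<in> S" if "x \<in> J" for x
    using that d_compl_comparable[OF po, of x y "3 / 4"] d_compl_pos[OF po, of x] \<open>S \<subseteq> \<Omega>\<close> po
    by (auto simp: J_def e_def ball_in_iff proper_open_def)
  have e: "0 < e" using False J(1,4) unfolding J_def[symmetric] by (metis ex_in_conv less_le_trans mult_pos_pos zero_less_divide_1_iff zero_less_numeral)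
  have "finite J \<and> real (card J) \<le> C ^ k"
  proof (rule separated_packing[OF d y, of J "4 * e" "\<kappa> * e / 2"])
    show "J \<subseteq> ball_in X y (4 * e)"
    proof
      fix x assume x: "x \<in> J"
      show "x \<in> ball_in X y (4 * e)" using J[OF x] by (auto simp: ball_in_iff dist_commute)
    qed
    show "0 < \<kappa> * e / 2" using e \<open>0 < \<kappa>\<close> by simp
    fix x z assume xz: "x \<in> J" "z \<in> J" "x \<noteq> z"
    have "\<kappa> * (e / 2) \<le> \<kappa> * d_compl X \<Omega> x" "\<kappa> * (e / 2) \<le> \<kappa> * d_compl X \<Omega> z"
      using J(2,4)[OF xz(1)] J(2,4)[OF xz(2)] \<open>0 < \<kappa>\<close> by (auto intro!: mult_left_mono)
    then show "\<kappa> * e / 2 \<le> dist x z" using sep[OF J(6)[OF xz(1)] J(6)[OF xz(2)] xz(3)] by simp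
  next
    have "(32 / \<kappa> + 1) * (\<kappa> * e / 4) \<le> 2 ^ k * (\<kappa> * e / 4)"
      using k e \<open>0 < \<kappa>\<close> by (intro mult_right_mono) auto
    then show "2 * (4 * e) + \<kappa> * e / 2 / 2 \<le> 2 ^ k * (\<kappa> * e / 2 / 2)"
      using \<open>0 < \<kappa>\<close> by (simp add: distrib_right)
  qed
  then show ?thesis unfolding J_def .
next
  case True
  show ?thesis unfolding True using doubling_ge_1[OF d] by simp
qed

text \<open>Only finitely many centres lie in a given ball if their distances from the complement of \<open>\<Omega>\<close> are bounded
  below by a given positive number.\<close>

lemma whitney_countable:
  assumes d: "doubling X m C" and po: "proper_open X \<Omega>" and "0 < \<kappa>" and "S \<subseteq> \<Omega>"
    and sep: "\<And>x z. x \<in> S \<Longrightarrow> z \<in> S \<Longrightarrow> x \<noteq> z \<Longrightarrow> min (\<kappa> * d_compl X \<Omega> x) (\<kappa> * d_compl X \<Omega> z) \<le> dist x z"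
  shows "countable S"
proof (cases "S = {}")
  case False
  then obtain z where z: "z \<in> X" using \<open>S \<subseteq> \<Omega>\<close> po by (auto simp: proper_open_def)
  define T where "T n = {x \<in> S \<inter> ball_in X z (real n). 1 / real (Suc n) \<le> d_compl X \<Omega> x}" for n
  have "finite (T n)" for n
  proof -
    define \<rho> where "\<rho> = \<kappa> / real (Suc n)"
    have \<rho>: "0 < \<rho>" using \<open>0 < \<kappa>\<close> by (simp add: \<rho>_def)
    obtain k :: nat where "(2 * real n + \<rho> / 2) / (\<rho> / 2) < 2 ^ k" using real_arch_pow[of 2] by auto
    then have k: "2 * real n + \<rho> / 2 \<le> 2 ^ k * (\<rho> / 2)" using \<rho> by (simp add: divide_less_eq)
    have "\<rho> \<le> dist x y" if xy: "x \<in> T n" "y \<in> T n" "x \<noteq> y" for x y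
    proof -
      have "\<rho> \<le> \<kappa> * d_compl X \<Omega> x" "\<rho> \<le> \<kappa> * d_compl X \<Omega> y"
        using xy \<open>0 < \<kappa>\<close> mult_left_mono[of "1 / real (Suc n)" _ \<kappa>] by (auto simp: \<rho>_def T_def)
      then show ?thesis using sep[of x y] xy by (auto simp: T_def)
    qed
    then show ?thesis
      using separated_packing[OF d z, of "T n" "real n" \<rho> k] \<rho> k by (auto simp: T_def)
  qed
  moreover have "S = (\<Union>n. T n)"
  proof (intro equalityI subsetI)
    fix x assume x: "x \<in> S"
    then have dx: "0 < d_compl X \<Omega> x" "x \<in> X" using d_compl_pos[OF po] \<open>S \<subseteq> \<Omega>\<close> po by (auto simp: proper_open_def)
    obtain n :: nat where n: "max (dist z x) (1 / d_compl X \<Omega> x) < real n" using reals_Archimedean2 by blast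
    have "1 / real (Suc n) \<le> d_compl X \<Omega> x" using n dx by (simp add: field_simps)
    then show "x \<in> (\<Union>n. T n)" using x n dx by (auto simp: T_def ball_in_iff intro!: exI[of _ n])
  qed (auto simp: T_def)
  ultimately show ?thesis by (metis countable_UN countable_finite countableI_type)
qed simp

lemma quotient_diff_le:
  fixes a b a' b' :: real
  assumes "1 \<le> b" "1 \<le> b'" "0 \<le> a'" "a' \<le> 1"
  shows "\<bar>a / b - a' / b'\<bar> \<le> \<bar>a - a'\<bar> + \<bar>b - b'\<bar>"
proof -
  have "a / b - a' / b' = (a - a') / b + a' * ((b' - b) / (b * b'))"
    using assms by (simp add: field_simps)
  also have "\<bar>\<dots>\<bar> \<le> \<bar>(a - a') / b\<bar> + \<bar>a' * ((b' - b) / (b * b'))\<bar>" by (rule abs_triangle_ineq)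
  also have "\<bar>(a - a') / b\<bar> \<le> \<bar>a - a'\<bar>" using assms mult_left_mono[of 1 b "\<bar>a - a'\<bar>"] by (simp add: abs_mult divide_le_eq)
  also have "\<bar>a' * ((b' - b) / (b * b'))\<bar> \<le> 1 * \<bar>(b' - b) / (b * b')\<bar>"
    unfolding abs_mult using assms by (intro mult_right_mono) auto
  also have "\<bar>(b' - b) / (b * b')\<bar> \<le> \<bar>b' - b\<bar>"
  proof -
    have "1 * 1 \<le> b * b'" by (rule mult_mono) (use assms in auto)
    then show ?thesis using assms mult_left_mono[of 1 "b * b'" "\<bar>b' - b\<bar>"] by (simp add: abs_mult divide_le_eq)
  qed
  finally show ?thesis by (simp add: abs_minus_commute)
qed

text \<open>Tent functions on a maximal separated set, divided by their sum.  The sum is at least \<open>1\<close> on \<open>\<Omega>\<close>; replacing it by its maximum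
  with \<open>1\<close> changes nothing there and keeps the quotients Lipschitz on all of \<open>X\<close>.  If \<open>N\<close> bounds the overlap, then a tent
  contributes \<open>1 / r\<^sub>i\<close> to the Lipschitz constant and the sum contributes \<open>8 N / r\<^sub>i\<close>.\<close>

lemma whitney_at_exists:
  assumes d: "doubling X m C" and po: "proper_open X \<Omega>" and \<kappa>: "0 < \<kappa>" "\<kappa> \<le> 1 / 8"
    and k: "32 / \<kappa> + 1 \<le> 2 ^ k"
  shows "\<exists>I x \<phi>. whitney_at X \<Omega> \<kappa> (9 * C ^ k) I x \<phi>"
proof -
  let ?d = "d_compl X \<Omega>"
  obtain S where S: "S \<subseteq> \<Omega>" "\<And>x y. x \<in> S \<Longrightarrow> y \<in> S \<Longrightarrow> x \<noteq> y \<Longrightarrow> min (\<kappa> * ?d x) (\<kappa> * ?d y) \<le> dist x y"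
    "\<And>y. y \<in> \<Omega> \<Longrightarrow> 0 < \<kappa> * ?d y \<Longrightarrow> \<exists>x\<in>S. dist x y < \<kappa> * ?d x"
    using maximal_separated_set[of \<Omega> "\<lambda>x. \<kappa> * ?d x"] by meson
  have "countable S" by (rule whitney_countable[OF d po \<kappa>(1) S(1,2)])
  then obtain f :: "'a \<Rightarrow> nat" where f: "inj_on f S" by (rule countableE)
  define I where "I = f ` S"
  define x where "x = inv_into S f"
  have bij: "bij_betw x I S" unfolding I_def x_def using f by (intro bij_betw_inv_into inj_on_imp_bij_betw)
  have xI: "x i \<in> S" if "i \<in> I" for i using bij that by (auto simp: bij_betw_def)
  have x\<Omega>: "x i \<in> \<Omega>" "x i \<in> X" "0 < ?d (x i)" if "i \<in> I" for i
    using xI[OF that] S(1) po d_compl_pos[OF po] by (auto simp: proper_open_def)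
  define r where "r i = \<kappa> * ?d (x i)" for i
  have r: "0 < r i" if "i \<in> I" for i using x\<Omega>(3)[OF that] \<kappa>(1) by (simp add: r_def)
  define N where "N = C ^ k"
  have N: "1 \<le> N" using doubling_ge_1[OF d] by (simp add: N_def)
  define J where "J y = {i\<in>I. y \<in> ball_in X (x i) (3 / 4 * ?d (x i))}" for y
  have J: "finite (J y)" "real (card (J y)) \<le> N" if "y \<in> X" for y
  proof -
    have b: "bij_betw x (J y) {z\<in>S. y \<in> ball_in X z (3 / 4 * ?d z)}"
      using bij by (auto simp: bij_betw_def J_def inj_on_def)
    have *: "finite {z\<in>S. y \<in> ball_in X z (3 / 4 * ?d z)} \<and>
        real (card {z\<in>S. y \<in> ball_in X z (3 / 4 * ?d z)}) \<le> C ^ k"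
      by (rule whitney_overlap[OF d po \<kappa>(1) _ k S(1) that S(2)]) (use \<kappa>(2) in auto)
    show "finite (J y)" using bij_betw_finite[OF b] * by blast
    show "real (card (J y)) \<le> N" using bij_betw_same_card[OF b] * by (simp add: N_def)
  qed
  define \<psi> where "\<psi> i y = max 0 (min 1 (2 - dist (x i) y / r i))" for i y
  have \<psi>: "0 \<le> \<psi> i y" "\<psi> i y \<le> 1" for i y by (auto simp: \<psi>_def)
  have \<psi>1: "\<psi> i y = 1" if "i \<in> I" "dist (x i) y \<le> r i" for i y
    using that r[OF that(1)] by (simp add: \<psi>_def field_simps)
  have \<psi>0: "\<psi> i y = 0" if "i \<in> I" "2 * r i \<le> dist (x i) y" for i y
    using that r[OF that(1)] by (simp add: \<psi>_def field_simps)
  have \<psi>lip: "\<bar>\<psi> i y - \<psi> i z\<bar> \<le> dist y z / r i" if "i \<in> I" for i y z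
  proof -
    have "\<bar>\<psi> i y - \<psi> i z\<bar> \<le> \<bar>dist (x i) y / r i - dist (x i) z / r i\<bar>" 
    proof -
      have "\<bar>max 0 (min 1 (2 - a)) - max 0 (min 1 (2 - b))\<bar> \<le> \<bar>a - b\<bar>" for a b :: real
      proof -
        have "\<bar>max 0 u - max 0 v\<bar> \<le> \<bar>u - v\<bar>" "\<bar>min 1 u - min 1 v\<bar> \<le> \<bar>u - v\<bar>" for u v :: real
          by (simp_all add: max_def min_def)
        from order_trans[OF this(1) this(2)[of "2 - a" "2 - b"]] show ?thesis by (simp add: abs_minus_commute)
      qed
      then show ?thesis unfolding \<psi>_def .
    qed
    also have "\<dots> = \<bar>dist (x i) y - dist (x i) z\<bar> / r i"
      using r[OF that] by (simp add: diff_divide_distrib[symmetric])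
    also have "\<dots> \<le> dist y z / r i"
      using abs_dist_diff_le[of y "x i" z] r[OF that] by (intro divide_right_mono) (auto simp: dist_commute)
    finally show ?thesis .
  qed
  have \<psi>J: "i \<in> J y" if "i \<in> I" "y \<in> X" "\<psi> i y \<noteq> 0" for i y
  proof -
    have "dist (x i) y < 2 * r i" using \<psi>0[of i y] that by force
    also have "\<dots> \<le> 3 / 4 * ?d (x i)" using mult_right_mono[OF \<kappa>(2), of "?d (x i)"] x\<Omega>(3)[OF that(1)] by (simp add: r_def)
    finally show ?thesis using that by (simp add: J_def ball_in_iff)
  qed
  define \<Sigma> where "\<Sigma> y = (\<Sum>i\<in>J y. \<psi> i y)" for y
  have \<Sigma>N: "\<Sigma> y \<le> N" if "y \<in> X" for y
  proof -
    have "\<Sigma> y \<le> (\<Sum>i\<in>J y. 1)" unfolding \<Sigma>_def by (intro sum_mono \<psi>)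
    then show ?thesis using J[OF that] by simp
  qed
  have \<Sigma>F: "\<Sigma> y = (\<Sum>i\<in>F. \<psi> i y)" if "finite F" "J y \<subseteq> F" "F \<subseteq> I" "y \<in> X" for y F
    unfolding \<Sigma>_def by (rule sum.mono_neutral_left) (use that \<psi>J in auto)
  define \<phi> where "\<phi> i y = \<psi> i y / max 1 (\<Sigma> y)" for i y
  have \<phi>: "0 \<le> \<phi> i y" "\<phi> i y \<le> \<psi> i y" for i y
    using \<psi>[of i y] mult_left_mono[of 1 "max 1 (\<Sigma> y)" "\<psi> i y"] by (auto simp: \<phi>_def divide_le_eq)
  have lip: "\<bar>\<phi> i y - \<phi> i z\<bar> \<le> 9 * N / r i * dist y z" if i: "i \<in> I" and yz: "y \<in> X" "z \<in> X" and y: "\<psi> i y \<noteq> 0" for i y z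
  proof (cases "r i \<le> dist y z")
    case True
    have "\<bar>\<phi> i y - \<phi> i z\<bar> \<le> 1" using \<phi>[of i y] \<phi>[of i z] \<psi>[of i y] \<psi>[of i z] by linarith
    also have "\<dots> \<le> dist y z / r i" using True r[OF i] by simp
    also have "\<dots> \<le> 9 * N * (dist y z / r i)" using N r[OF i] mult_right_mono[of 1 "9 * N" "dist y z / r i"] by simp
    finally show ?thesis by simp
  next
    case False
    have di: "dist (x i) y < 2 * r i" using \<psi>0[OF i, of y] y by force
    then have "dist (x i) z < 3 * r i" using False dist_triangle[of "x i" z y] by simp
    have \<kappa>d: "r i \<le> 1 / 8 * ?d (x i)" unfolding r_def using \<kappa>(2) x\<Omega>(3)[OF i] by (intro mult_right_mono) auto
    have dy: "3 / 4 * ?d (x i) \<le> ?d y" "5 / 8 * ?d (x i) \<le> ?d z"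
      using d_compl_comparable(1)[OF po, of "x i" y "1 / 4"] d_compl_comparable(1)[OF po, of "x i" z "3 / 8"] di \<open>dist (x i) z < 3 * r i\<close> \<kappa>d by auto
    define F where "F = J y \<union> J z"
    have F: "finite F" "real (card F) \<le> 2 * N" "F \<subseteq> I"
      using J[OF yz(1)] J[OF yz(2)] card_Un_le[of "J y" "J z"] by (auto simp: F_def J_def)
    have rj: "r i / 4 \<le> r j" if "j \<in> F" for j
    proof -
      have "?d (x i) / 4 \<le> ?d (x j)"
        using that dy d_compl_comparable(2)[OF po, of "x j" y "3 / 4"] d_compl_comparable(2)[OF po, of "x j" z "3 / 4"] x\<Omega>(3)[OF i]
        by (auto simp: F_def J_def ball_in_iff)
      then have "\<kappa> * (?d (x i) / 4) \<le> \<kappa> * ?d (x j)" using \<kappa>(1) by (intro mult_left_mono) auto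
      then show ?thesis by (simp add: r_def)
    qed
    have "\<bar>\<Sigma> y - \<Sigma> z\<bar> = \<bar>\<Sum>j\<in>F. \<psi> j y - \<psi> j z\<bar>"
      using \<Sigma>F[OF F(1) _ F(3) yz(1)] \<Sigma>F[OF F(1) _ F(3) yz(2)] by (simp add: F_def sum_subtractf)
    also have "\<dots> \<le> (\<Sum>j\<in>F. \<bar>\<psi> j y - \<psi> j z\<bar>)" by (rule sum_abs)
    also have "\<dots> \<le> (\<Sum>j\<in>F. 4 * dist y z / r i)"
    proof (rule sum_mono)
      fix j assume j: "j \<in> F"
      have "\<bar>\<psi> j y - \<psi> j z\<bar> \<le> dist y z / r j" by (rule \<psi>lip) (use j F(3) in auto)
      also have "\<dots> \<le> dist y z / (r i / 4)" using rj[OF j] r[OF i] by (intro divide_left_mono mult_pos_pos) auto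
      finally show "\<bar>\<psi> j y - \<psi> j z\<bar> \<le> 4 * dist y z / r i" by (simp add: mult.commute)
    qed
    also have "\<dots> = real (card F) * (4 * dist y z / r i)" by simp
    also have "\<dots> \<le> 2 * N * (4 * dist y z / r i)" using F(2) r[OF i] by (intro mult_right_mono) auto
    finally have \<Sigma>: "\<bar>\<Sigma> y - \<Sigma> z\<bar> \<le> 8 * N * (dist y z / r i)" by simp
    have "\<bar>\<phi> i y - \<phi> i z\<bar> \<le> \<bar>\<psi> i y - \<psi> i z\<bar> + \<bar>max 1 (\<Sigma> y) - max 1 (\<Sigma> z)\<bar>"
      unfolding \<phi>_def by (rule quotient_diff_le) (use \<psi> in auto)
    also have "\<dots> \<le> dist y z / r i + 8 * N * (dist y z / r i)"
      by (intro add_mono \<psi>lip i order_trans[OF _ \<Sigma>]) (auto simp: max_def)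
    also have "\<dots> \<le> N * (dist y z / r i) + 8 * N * (dist y z / r i)"
      using N r[OF i] mult_right_mono[of 1 N "dist y z / r i"] by simp
    finally show ?thesis by simp
  qed
  have "whitney_at X \<Omega> \<kappa> (9 * N) I x \<phi>"
    unfolding whitney_at_def
  proof (intro conjI ballI)
    show "0 < 9 * N" using N by simp
    show "x ` I \<subseteq> \<Omega>" using x\<Omega>(1) by auto
    have "y \<in> (\<Union>i\<in>I. ball_in X (x i) (\<kappa> * ?d (x i)))" if y: "y \<in> \<Omega>" for y
    proof -
      have "0 < \<kappa> * ?d y" using d_compl_pos[OF po y] \<kappa>(1) by simp
      then obtain z where "z \<in> S" "dist z y < \<kappa> * ?d z" using S(3)[OF y] by blast
      moreover have "x ` I = S" using bij by (simp add: bij_betw_def)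
      moreover have "y \<in> X" using y po by (auto simp: proper_open_def)
      ultimately show ?thesis by (auto simp: ball_in_iff)
    qed
    moreover have "ball_in X (x i) (\<kappa> * ?d (x i)) \<subseteq> \<Omega>" if "i \<in> I" for i
    proof -
      have "\<kappa> * ?d (x i) \<le> 1 * ?d (x i)" using \<kappa> x\<Omega>(3)[OF that] by (intro mult_right_mono) auto
      then have "ball_in X (x i) (\<kappa> * ?d (x i)) \<subseteq> ball_in X (x i) (?d (x i))" by (auto simp: ball_in_iff)
      then show ?thesis using d_compl_ball[OF po, of "x i"] by blast
    qed
    ultimately show cover: "\<Omega> = (\<Union>i\<in>I. ball_in X (x i) (\<kappa> * ?d (x i)))" by blast
    show "finite {i \<in> I. y \<in> ball_in X (x i) (3 / 4 * ?d (x i))}" if "y \<in> X" for y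
      using J(1)[OF that] by (simp add: J_def)
    show "real (card {i \<in> I. y \<in> ball_in X (x i) (3 / 4 * ?d (x i))}) \<le> 9 * N" if "y \<in> X" for y
      using J(2)[OF that] N by (simp add: J_def)
    show "(9 * N / (\<kappa> * ?d (x i)))-lipschitz_on X (\<phi> i)" if i: "i \<in> I" for i
    proof (rule lipschitz_onI)
      fix y z assume yz: "y \<in> X" "z \<in> X"
      consider "\<psi> i y \<noteq> 0" | "\<psi> i z \<noteq> 0" | "\<psi> i y = 0" "\<psi> i z = 0" by blast
      then show "dist (\<phi> i y) (\<phi> i z) \<le> 9 * N / (\<kappa> * ?d (x i)) * dist y z"
      proof cases
        case 1
        then show ?thesis using lip[OF i yz] by (simp add: dist_real_def r_def)
      next
        case 2
        then show ?thesis using lip[OF i yz(2,1)] by (simp add: dist_real_def r_def abs_minus_commute dist_commute)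
      next
        case 3
        then show ?thesis using N r[OF i] by (simp add: \<phi>_def r_def)
      qed
    qed (use N r[OF i] in \<open>simp add: r_def\<close>)
    show "0 \<le> \<phi> i y" for i y by (rule \<phi>)
    show "\<phi> i y \<le> indicator (ball_in X (x i) (2 * \<kappa> * ?d (x i))) y" if "i \<in> I" "y \<in> X" for i y
      using \<phi>(2)[of i y] \<psi>(2)[of i y] \<psi>0[OF that(1), of y] that
      by (auto simp: r_def ball_in_iff mult.assoc not_less split: split_indicator)
    show "1 / (9 * N) \<le> \<phi> i y" if "i \<in> I" "y \<in> ball_in X (x i) (\<kappa> * ?d (x i))" for i y
    proof -
      have "y \<in> X" "\<psi> i y = 1" using that by (auto simp: ball_in_iff r_def intro!: \<psi>1)
      then have "\<phi> i y = 1 / max 1 (\<Sigma> y)" by (simp add: \<phi>_def)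
      moreover have "max 1 (\<Sigma> y) \<le> 9 * N" using \<Sigma>N[OF \<open>y \<in> X\<close>] N by auto
      ultimately show ?thesis by (simp add: frac_le)
    qed
    show "((\<lambda>i. \<phi> i y) has_sum 1) I" if y: "y \<in> \<Omega>" for y
    proof -
      have yX: "y \<in> X" using y po by (auto simp: proper_open_def)
      obtain j where j: "j \<in> I" "y \<in> ball_in X (x j) (\<kappa> * ?d (x j))" using y cover by blast
      then have "\<psi> j y = 1" by (intro \<psi>1) (auto simp: ball_in_iff r_def)
      moreover have "j \<in> J y" using \<psi>J[OF j(1) yX] \<open>\<psi> j y = 1\<close> by simp
      ultimately have "1 \<le> \<Sigma> y" unfolding \<Sigma>_def using member_le_sum[of j "J y" "\<lambda>i. \<psi> i y"] \<psi> J(1)[OF yX] by auto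
      then have "(\<Sum>i\<in>J y. \<phi> i y) = 1" by (simp add: \<phi>_def \<Sigma>_def flip: sum_divide_distrib)
      then have "((\<lambda>i. \<phi> i y) has_sum 1) (J y)" using has_sum_finite[OF J(1)[OF yX], of "\<lambda>i. \<phi> i y"] by simp
      then show ?thesis
        by (rule has_sum_cong_neutral[THEN iffD1, rotated -1]) (use \<psi>J yX in \<open>auto simp: \<phi>_def J_def\<close>)
    qed
  qed
  then show ?thesis unfolding N_def by blast
qed

section \<open>Discrete convolutions and the gradient estimate\<close>

locale whitney =
  fixes X \<Omega> :: "'a::metric_space set" and \<kappa> C :: real and I :: "nat set"
    and x :: "nat \<Rightarrow> 'a" and \<phi> :: "nat \<Rightarrow> 'a \<Rightarrow> real"
  assumes po: "proper_open X \<Omega>" and W: "whitney_at X \<Omega> \<kappa> C I x \<phi>" and \<kappa>: "0 < \<kappa>" "\<kappa> \<le> 1 / 8"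
begin

abbreviation d :: "'a \<Rightarrow> real" where "d \<equiv> d_compl X \<Omega>"

definition B :: "real \<Rightarrow> nat \<Rightarrow> 'a set" where "B t i = ball_in X (x i) (t * d (x i))"

lemma C_pos: "0 < C" using W by (simp add: whitney_at_def)

lemma \<Omega>_subset: "\<Omega> \<subseteq> X" using po by (simp add: proper_open_def)

lemma centre: "i \<in> I \<Longrightarrow> x i \<in> \<Omega>" "i \<in> I \<Longrightarrow> x i \<in> X" "i \<in> I \<Longrightarrow> 0 < d (x i)"
proof -
  show 1: "i \<in> I \<Longrightarrow> x i \<in> \<Omega>" using W by (auto simp: whitney_at_def)
  then show "i \<in> I \<Longrightarrow> x i \<in> X" "i \<in> I \<Longrightarrow> 0 < d (x i)" using \<Omega>_subset d_compl_pos[OF po] by auto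
qed

lemma cover: "\<Omega> = (\<Union>i\<in>I. B \<kappa> i)"
  using W by (simp add: whitney_at_def B_def)

lemma B_mono: "s \<le> t \<Longrightarrow> i \<in> I \<Longrightarrow> B s i \<subseteq> B t i"
proof -
  assume "s \<le> t" "i \<in> I"
  then have "s * d (x i) \<le> t * d (x i)" using centre(3)[of i] by (intro mult_right_mono) auto
  then show "B s i \<subseteq> B t i" by (auto simp: B_def ball_in_iff)
qed

lemma B_subset: "i \<in> I \<Longrightarrow> t \<le> 1 \<Longrightarrow> B t i \<subseteq> \<Omega>"
  using B_mono[of t 1 i] d_compl_ball[OF po, of "x i"] by (auto simp: B_def)

lemma B_subset_X: "B t i \<subseteq> X" by (auto simp: B_def ball_in_iff)

lemma overlap:
  assumes "y \<in> X"
  shows "finite {i\<in>I. y \<in> B (3 / 4) i}" "real (card {i\<in>I. y \<in> B (3 / 4) i}) \<le> C"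
  using W assms by (auto simp: whitney_at_def B_def)

lemma \<phi>_lipschitz: "i \<in> I \<Longrightarrow> y \<in> X \<Longrightarrow> z \<in> X \<Longrightarrow> \<bar>\<phi> i y - \<phi> i z\<bar> \<le> C / (\<kappa> * d (x i)) * dist y z"
  using W lipschitz_onD[of "C / (\<kappa> * d (x i))" X "\<phi> i" y z] by (auto simp: whitney_at_def dist_real_def)

lemma \<phi>_nonneg: "i \<in> I \<Longrightarrow> y \<in> X \<Longrightarrow> 0 \<le> \<phi> i y"
  using W by (auto simp: whitney_at_def)

lemma \<phi>_le_indicator: "i \<in> I \<Longrightarrow> y \<in> X \<Longrightarrow> \<phi> i y \<le> indicator (B (2 * \<kappa>) i) y"
  using W by (auto simp: whitney_at_def B_def)

lemma \<phi>_support: "i \<in> I \<Longrightarrow> y \<in> X \<Longrightarrow> \<phi> i y \<noteq> 0 \<Longrightarrow> y \<in> B (2 * \<kappa>) i"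
  using \<phi>_nonneg[of i y] \<phi>_le_indicator[of i y] by (auto split: split_indicator_asm)

lemma \<phi>_ge: "i \<in> I \<Longrightarrow> y \<in> B \<kappa> i \<Longrightarrow> 1 / C \<le> \<phi> i y"
  using W by (auto simp: whitney_at_def B_def)

lemma \<phi>_has_sum: "y \<in> \<Omega> \<Longrightarrow> ((\<lambda>i. \<phi> i y) has_sum 1) I"
  using W by (simp add: whitney_at_def)

text \<open>Only these indices enter the values of \<open>\<Sum> a\<^sub>i \<phi>\<^sub>i\<close> on the core ball \<open>j\<close>.\<close>

definition nbrs :: "nat \<Rightarrow> nat set" where "nbrs j = {i\<in>I. B (2 * \<kappa>) i \<inter> B \<kappa> j \<noteq> {}}"

lemma nbrs_comparable:
  assumes "j \<in> I" "i \<in> nbrs j"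
  shows "d (x j) / 2 \<le> d (x i)" "d (x i) \<le> 2 * d (x j)" "dist (x i) (x j) < 5 * \<kappa> * d (x j)" "x j \<in> B (3 / 4) i"
proof -
  obtain q where q: "q \<in> B (2 * \<kappa>) i" "q \<in> B \<kappa> j" and i: "i \<in> I" using assms(2) by (auto simp: nbrs_def)
  have "2 * \<kappa> * d (x i) \<le> 1 / 4 * d (x i)" "\<kappa> * d (x j) \<le> 1 / 8 * d (x j)"
    using \<kappa> centre(3)[OF i] centre(3)[OF assms(1)] by (auto intro!: mult_right_mono)
  then have q': "dist (x i) q < 1 / 4 * d (x i)" "dist (x j) q < 1 / 8 * d (x j)"
    using q by (auto simp: B_def ball_in_iff)
  have e: "(1 - 1 / 4) * d (x i) \<le> d q" "d q \<le> (1 + 1 / 4) * d (x i)" "(1 - 1 / 8) * d (x j) \<le> d q" "d q \<le> (1 + 1 / 8) * d (x j)"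
    using d_compl_comparable[OF po q'(1)] d_compl_comparable[OF po q'(2)] by auto
  show "d (x j) / 2 \<le> d (x i)" using e centre(3)[OF i] by simp
  have "d (x i) \<le> 3 / 2 * d (x j)" using e centre(3)[OF assms(1)] by simp
  then show "d (x i) \<le> 2 * d (x j)" using centre(3)[OF assms(1)] by simp
  have "dist (x i) (x j) \<le> dist (x i) q + dist (x j) q" by (rule dist_triangle2)
  also have "\<dots> < 2 * \<kappa> * d (x i) + \<kappa> * d (x j)" using q by (auto simp: B_def ball_in_iff)
  finally have lt: "dist (x i) (x j) < 2 * \<kappa> * d (x i) + \<kappa> * d (x j)" .
  also have "\<dots> \<le> 2 * \<kappa> * (2 * d (x j)) + \<kappa> * d (x j)"
    using \<kappa> \<open>d (x i) \<le> 2 * d (x j)\<close> by (intro add_mono mult_left_mono) auto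
  finally show "dist (x i) (x j) < 5 * \<kappa> * d (x j)" by simp
  have "\<kappa> * d (x j) \<le> 1 / 8 * (2 * d (x i))"
    using \<kappa> \<open>d (x j) / 2 \<le> d (x i)\<close> centre(3)[OF assms(1)] by (intro mult_mono) auto
  then have "dist (x i) (x j) < 3 / 4 * d (x i)"
    using lt \<open>2 * \<kappa> * d (x i) \<le> 1 / 4 * d (x i)\<close> centre(3)[OF i] by linarith
  then show "x j \<in> B (3 / 4) i" using centre(2)[OF assms(1)] by (simp add: B_def ball_in_iff)
qed

lemma nbrs_finite: "j \<in> I \<Longrightarrow> finite (nbrs j)" 
  by (rule finite_subset[OF _ overlap(1)[of "x j"]]) (use nbrs_comparable(4) centre(2) in \<open>auto simp: nbrs_def\<close>)

lemma self_nbr: "j \<in> I \<Longrightarrow> j \<in> nbrs j"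
proof -
  assume j: "j \<in> I"
  then have "x j \<in> B (2 * \<kappa>) j \<inter> B \<kappa> j" using centre[of j] \<kappa> by (simp add: B_def ball_in_iff)
  then show "j \<in> nbrs j" using j by (auto simp: nbrs_def)
qed

lemma support_nbr: "i \<in> I \<Longrightarrow> y \<in> B (2 * \<kappa>) i \<Longrightarrow> y \<in> B \<kappa> j \<Longrightarrow> i \<in> nbrs j"
  by (auto simp: nbrs_def)

definition smooth :: "(nat \<Rightarrow> real) \<Rightarrow> 'a \<Rightarrow> real" where
  "smooth a y = (\<Sum>\<^sub>\<infinity>i\<in>I. a i * \<phi> i y)"

lemma smooth_eq:
  assumes "finite F" "F \<subseteq> I" "\<And>i. i \<in> I \<Longrightarrow> \<phi> i y \<noteq> 0 \<Longrightarrow> i \<in> F"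
  shows "smooth a y = (\<Sum>i\<in>F. a i * \<phi> i y)"
proof -
  have "smooth a y = (\<Sum>\<^sub>\<infinity>i\<in>F. a i * \<phi> i y)"
    unfolding smooth_def by (rule infsum_cong_neutral) (use assms in auto)
  then show ?thesis using assms(1) by simp
qed

lemma partition_sum:
  assumes "y \<in> \<Omega>" "finite F" "F \<subseteq> I" "\<And>i. i \<in> I \<Longrightarrow> \<phi> i y \<noteq> 0 \<Longrightarrow> i \<in> F"
  shows "(\<Sum>i\<in>F. \<phi> i y) = 1"
  using smooth_eq[OF assms(2-4), where a = "\<lambda>_. 1"] infsumI[OF \<phi>_has_sum[OF assms(1)]] by (simp add: smooth_def)

definition active :: "'a \<Rightarrow> nat set" where "active y = {i\<in>I. y \<in> B (2 * \<kappa>) i}"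

lemma active_subset: "active y \<subseteq> {i\<in>I. y \<in> B (3 / 4) i}"
  using B_mono[of "2 * \<kappa>" "3 / 4"] \<kappa> by (auto simp: active_def)

lemma active_finite: "y \<in> X \<Longrightarrow> finite (active y)" "y \<in> X \<Longrightarrow> real (card (active y)) \<le> C"
proof -
  assume y: "y \<in> X"
  show "finite (active y)" by (rule finite_subset[OF active_subset overlap(1)[OF y]])
  have "card (active y) \<le> card {i\<in>I. y \<in> B (3 / 4) i}" by (rule card_mono[OF overlap(1)[OF y] active_subset])
  then show "real (card (active y)) \<le> C" using overlap(2)[OF y] by linarith
qed

lemma smooth_active: "y \<in> X \<Longrightarrow> smooth a y = (\<Sum>i\<in>active y. a i * \<phi> i y)"
  by (rule smooth_eq) (use active_finite[of y] in \<open>auto simp: active_def \<phi>_support\<close>)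

lemma active_sum: "y \<in> \<Omega> \<Longrightarrow> (\<Sum>i\<in>active y. \<phi> i y) = 1"
  by (rule partition_sum) (use \<Omega>_subset active_finite[of y] in \<open>auto simp: active_def \<phi>_support\<close>)

lemma smooth_le:
  assumes "y \<in> \<Omega>" "\<And>i. i \<in> active y \<Longrightarrow> a i \<le> c" shows "smooth a y \<le> c"
proof -
  have yX: "y \<in> X" using assms(1) \<Omega>_subset by auto
  have "smooth a y \<le> (\<Sum>i\<in>active y. c * \<phi> i y)"
    unfolding smooth_active[OF yX] by (intro sum_mono mult_right_mono assms \<phi>_nonneg yX) (auto simp: active_def)
  then show ?thesis using active_sum[OF assms(1)] by (simp flip: sum_distrib_left)
qed

lemma smooth_uminus: "y \<in> X \<Longrightarrow> smooth (\<lambda>i. - a i) y = - smooth a y"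
  by (simp add: smooth_active sum_negf)

lemma smooth_ge:
  assumes "y \<in> \<Omega>" "\<And>i. i \<in> active y \<Longrightarrow> c \<le> a i" shows "c \<le> smooth a y"
proof -
  have yX: "y \<in> X" using assms(1) \<Omega>_subset by auto
  show ?thesis using smooth_le[OF assms(1), of "\<lambda>i. - a i" "- c"] assms(2) smooth_uminus[OF yX] by simp
qed

lemma smooth_dist_le:
  assumes "j \<in> I" "y \<in> B \<kappa> j" "\<And>i. i \<in> nbrs j \<Longrightarrow> \<bar>a i - a j\<bar> \<le> E"
  shows "\<bar>smooth a y - a j\<bar> \<le> E"
proof -
  have y: "y \<in> \<Omega>" using assms(1,2) cover by blast
  have nbr: "i \<in> nbrs j" if "i \<in> active y" for i using that assms(2) support_nbr by (auto simp: active_def)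
  have "smooth a y \<le> a j + E" using assms(3) nbr by (intro smooth_le[OF y]) (force simp: abs_le_iff)
  moreover have "a j - E \<le> smooth a y" using assms(3) nbr by (intro smooth_ge[OF y]) (force simp: abs_le_iff)
  ultimately show ?thesis by (simp add: abs_le_iff)
qed

lemma smooth_ge_core:
  assumes "j \<in> I" "y \<in> B \<kappa> j" "\<And>i. i \<in> I \<Longrightarrow> 0 \<le> a i"
  shows "a j \<le> C * smooth a y"
proof -
  have y: "y \<in> X" using assms(2) B_subset_X by blast
  have j: "j \<in> active y" using assms(1,2) B_mono[of \<kappa> "2 * \<kappa>" j] \<kappa> by (auto simp: active_def)
  have "a j * (1 / C) \<le> a j * \<phi> j y" using \<phi>_ge[OF assms(1,2)] assms(1,3) by (intro mult_left_mono) auto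
  also have "\<dots> \<le> (\<Sum>i\<in>active y. a i * \<phi> i y)"
    by (rule member_le_sum[OF j]) (use assms(3) \<phi>_nonneg y active_finite[OF y] in \<open>auto simp: active_def\<close>)
  finally show ?thesis unfolding smooth_active[OF y] using C_pos by (simp add: field_simps)
qed

text \<open>On a core ball the oscillation of \<open>\<Sum> a\<^sub>i \<phi>\<^sub>i\<close> sees only differences of neighbouring coefficients,
  since \<open>\<Sum> \<phi>\<^sub>i = 1\<close>.\<close>

lemma smooth_osc:
  assumes "j \<in> I" "y \<in> B \<kappa> j" "z \<in> B \<kappa> j" "\<And>i. i \<in> nbrs j \<Longrightarrow> \<bar>a i - a j\<bar> \<le> E"
  shows "\<bar>smooth a y - smooth a z\<bar> \<le> 4 * C\<^sup>2 * E / (\<kappa> * d (x j)) * dist y z"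
proof -
  have y: "y \<in> \<Omega>" "y \<in> X" and z: "z \<in> \<Omega>" "z \<in> X" using assms cover B_subset_X by blast+
  define F where "F = active y \<union> active z"
  have F: "finite F" "F \<subseteq> I" "real (card F) \<le> 2 * C" "F \<subseteq> nbrs j"
    using active_finite[OF y(2)] active_finite[OF z(2)] card_Un_le[of "active y" "active z"] support_nbr assms(2,3)
    by (auto simp: F_def active_def)
  have E: "0 \<le> E" using assms(4)[OF self_nbr[OF assms(1)]] by simp
  have sy: "smooth a y = (\<Sum>i\<in>F. a i * \<phi> i y)" and sz: "smooth a z = (\<Sum>i\<in>F. a i * \<phi> i z)"
    by (rule smooth_eq; use F y z \<phi>_support in \<open>auto simp: F_def active_def\<close>)+
  have 1: "(\<Sum>i\<in>F. \<phi> i y) = 1" "(\<Sum>i\<in>F. \<phi> i z) = 1"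
    by (rule partition_sum; use F y z \<phi>_support in \<open>auto simp: F_def active_def\<close>)+
  have "(\<Sum>i\<in>F. (a i - a j) * (\<phi> i y - \<phi> i z))
      = (\<Sum>i\<in>F. a i * \<phi> i y) - (\<Sum>i\<in>F. a i * \<phi> i z) - (a j * (\<Sum>i\<in>F. \<phi> i y) - a j * (\<Sum>i\<in>F. \<phi> i z))"
    by (simp add: sum_distrib_left sum_subtractf sum.distrib algebra_simps)
  then have "smooth a y - smooth a z = (\<Sum>i\<in>F. (a i - a j) * (\<phi> i y - \<phi> i z))"
    using 1 sy sz by simp
  also have "\<bar>\<dots>\<bar> \<le> (\<Sum>i\<in>F. \<bar>(a i - a j) * (\<phi> i y - \<phi> i z)\<bar>)" by (rule sum_abs)
  also have "\<dots> \<le> (\<Sum>i\<in>F. E * (2 * C / (\<kappa> * d (x j)) * dist y z))"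
  proof (rule sum_mono)
    fix i assume i: "i \<in> F"
    then have iI: "i \<in> I" and nb: "i \<in> nbrs j" using F by auto
    have "\<bar>\<phi> i y - \<phi> i z\<bar> \<le> C / (\<kappa> * d (x i)) * dist y z" by (rule \<phi>_lipschitz[OF iI y(2) z(2)])
    also have "\<dots> \<le> C / (\<kappa> * (d (x j) / 2)) * dist y z"
      using nbrs_comparable(1)[OF assms(1) nb] C_pos \<kappa> centre(3)[OF iI] centre(3)[OF assms(1)]
      by (intro mult_right_mono divide_left_mono mult_left_mono mult_pos_pos) auto
    finally have "\<bar>\<phi> i y - \<phi> i z\<bar> \<le> 2 * C / (\<kappa> * d (x j)) * dist y z" by (simp add: field_simps)
    then show "\<bar>(a i - a j) * (\<phi> i y - \<phi> i z)\<bar> \<le> E * (2 * C / (\<kappa> * d (x j)) * dist y z)"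
      unfolding abs_mult using assms(4)[OF nb] E by (intro mult_mono) auto
  qed
  also have "\<dots> = real (card F) * (E * (2 * C / (\<kappa> * d (x j)) * dist y z))" by simp
  also have "\<dots> \<le> 2 * C * (E * (2 * C / (\<kappa> * d (x j)) * dist y z))"
    using F(3) E C_pos \<kappa> centre(3)[OF assms(1)] by (intro mult_right_mono mult_nonneg_nonneg divide_nonneg_nonneg) auto
  also have "\<dots> = 4 * C\<^sup>2 * E / (\<kappa> * d (x j)) * dist y z" by (simp add: power2_eq_square)
  finally show ?thesis .
qed

lemma core_nhd:
  assumes "y \<in> \<Omega>"
  obtains j e where "j \<in> I" "y \<in> B \<kappa> j" "0 < e" "ball_in X y e \<subseteq> B \<kappa> j"
proof -
  obtain j where j: "j \<in> I" "y \<in> B \<kappa> j" using assms cover by blast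
  have "ball_in X y (\<kappa> * d (x j) - dist (x j) y) \<subseteq> B \<kappa> j"
  proof
    fix z assume "z \<in> ball_in X y (\<kappa> * d (x j) - dist (x j) y)"
    then show "z \<in> B \<kappa> j" using dist_triangle[of "x j" z y] by (auto simp: B_def ball_in_iff)
  qed
  moreover have "0 < \<kappa> * d (x j) - dist (x j) y" using j by (simp add: B_def ball_in_iff)
  ultimately show thesis using that[OF j] by blast
qed

lemma smooth_locally_lipschitz:
  assumes "y \<in> \<Omega>"
  obtains e L where "0 < e" "0 \<le> L" "ball_in X y e \<subseteq> \<Omega>"
    "\<And>z z'. z \<in> ball_in X y e \<Longrightarrow> z' \<in> ball_in X y e \<Longrightarrow> \<bar>smooth a z - smooth a z'\<bar> \<le> L * dist z z'"
proof -
  obtain j e where j: "j \<in> I" "y \<in> B \<kappa> j" "0 < e" "ball_in X y e \<subseteq> B \<kappa> j" using core_nhd[OF assms] by blast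
  define E where "E = (\<Sum>i\<in>nbrs j. \<bar>a i - a j\<bar>)"
  have E: "\<bar>a i - a j\<bar> \<le> E" if "i \<in> nbrs j" for i
    unfolding E_def using that nbrs_finite[OF j(1)] by (intro member_le_sum) auto
  define L where "L = 4 * C\<^sup>2 * E / (\<kappa> * d (x j))"
  have "0 \<le> E" by (simp add: E_def sum_nonneg)
  then have "0 \<le> L" unfolding L_def using \<kappa> centre(3)[OF j(1)] by (intro divide_nonneg_pos) auto
  moreover have "ball_in X y e \<subseteq> \<Omega>" using j cover by blast
  moreover have "\<bar>smooth a z - smooth a z'\<bar> \<le> L * dist z z'" if "z \<in> ball_in X y e" "z' \<in> ball_in X y e" for z z'
    unfolding L_def by (rule smooth_osc[OF j(1)]) (use that j E in auto)
  ultimately show thesis using that[of e L] j(3) by blast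
qed

lemma smooth_continuous: "continuous_on \<Omega> (smooth a)"
  unfolding continuous_on_iff
proof (intro ballI allI impI)
  fix y \<epsilon> :: real and y' assume y: "y' \<in> \<Omega>" and \<epsilon>: "0 < \<epsilon>"
  obtain e L where e: "0 < e" "0 \<le> L" 
    "\<And>z z'. z \<in> ball_in X y' e \<Longrightarrow> z' \<in> ball_in X y' e \<Longrightarrow> \<bar>smooth a z - smooth a z'\<bar> \<le> L * dist z z'"
    using smooth_locally_lipschitz[OF y, of a] by metis
  show "\<exists>\<delta>>0. \<forall>z\<in>\<Omega>. dist z y' < \<delta> \<longrightarrow> dist (smooth a z) (smooth a y') < \<epsilon>"
  proof (intro exI[of _ "min e (\<epsilon> / (L + 1))"] conjI ballI impI)
    show "0 < min e (\<epsilon> / (L + 1))" using e \<epsilon> by simp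
    fix z assume z: "z \<in> \<Omega>" "dist z y' < min e (\<epsilon> / (L + 1))"
    have "dist (smooth a z) (smooth a y') \<le> L * dist z y'"
      unfolding dist_real_def by (rule e(3)) (use z y \<Omega>_subset e(1) in \<open>auto simp: ball_in_iff dist_commute\<close>)
    also have "\<dots> \<le> (L + 1) * dist z y'" by (intro mult_right_mono) auto
    also have "\<dots> < \<epsilon>" using z(2) e(2) by (simp add: pos_less_divide_eq mult.commute)
    finally show "dist (smooth a z) (smooth a y') < \<epsilon>" .
  qed
qed

end

lemma restrict_to_open:
  assumes m: "sets m = sets (restrict_space borel X)" and po: "proper_open X \<Omega>"
  shows "sets (restrict_space m \<Omega>) = sets (restrict_space borel \<Omega>)"
    "\<And>A. A \<subseteq> \<Omega> \<Longrightarrow> emeasure (restrict_space m \<Omega>) A = emeasure m A"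
    "\<And>y r. ball_in \<Omega> y r \<subseteq> ball_in X y r"
proof -
  have sub: "\<Omega> \<subseteq> X" using po by (simp add: proper_open_def)
  have "sets (restrict_space m \<Omega>) = (\<inter>) \<Omega> ` (\<inter>) X ` sets borel"
    unfolding sets_restrict_space m ..
  also have "\<dots> = (\<inter>) \<Omega> ` sets borel" unfolding image_image using sub by (intro image_cong) auto
  finally show "sets (restrict_space m \<Omega>) = sets (restrict_space borel \<Omega>)" by (simp add: sets_restrict_space)
  have sp: "space m = X" using sets_eq_imp_space_eq[OF m] by (simp add: space_restrict_space)
  show "emeasure (restrict_space m \<Omega>) A = emeasure m A" if "A \<subseteq> \<Omega>" for A
    by (rule emeasure_restrict_space) (use that proper_open_sets[OF po m] sub sp in \<open>auto simp: Int_absorb2\<close>)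
  show "ball_in \<Omega> y r \<subseteq> ball_in X y r" for y r using sub by (auto simp: ball_in_iff)
qed

lemma avg_eq_ratio:
  assumes m: "sets \<mu> = sets (restrict_space borel X)" and w: "weight X \<mu> w" and A: "A \<in> sets \<mu>"
  shows "avg \<mu> A w = measure (weighted w \<mu>) A / measure \<mu> A"
proof -
  have sp: "space \<mu> = X" using sets_eq_imp_space_eq[OF m] by (simp add: space_restrict_space)
  have wm [measurable]: "w \<in> borel_measurable \<mu>" and w0: "\<And>x. x \<in> X \<Longrightarrow> 0 \<le> w x" using w by (auto simp: weight_def)
  have [measurable]: "A \<in> sets \<mu>" by fact
  have "(LINT x:A|\<mu>. w x) = enn2real (\<integral>\<^sup>+ x. ennreal (indicator A x * w x) \<partial>\<mu>)"
    unfolding set_lebesgue_integral_def real_scaleR_def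
    by (rule integral_eq_nn_integral) (use w0 sp in auto)
  also have "(\<integral>\<^sup>+ x. ennreal (indicator A x * w x) \<partial>\<mu>) = (\<integral>\<^sup>+ x. ennreal (w x) * indicator A x \<partial>\<mu>)"
    by (intro nn_integral_cong) (auto split: split_indicator)
  also have "\<dots> = emeasure (weighted w \<mu>) A"
    by (subst emeasure_density) auto
  finally show ?thesis by (simp add: avg_def measure_def)
qed

text \<open>The gradient estimate for discrete convolutions of regularizable weights, for any Whitney
  partition; the bound is a continuous upper gradient in \<open>\<Omega>\<close>.\<close>

lemma discrete_convolution_gradient:
  assumes d\<mu>: "doubling X \<mu> C\<^sub>\<mu>" and po: "proper_open X \<Omega>" and wp: "whitney_partition X \<Omega> C I x \<phi>"
    and reg: "regularizable X \<mu> \<Omega> \<delta> w"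
  defines "W \<equiv> discrete_convolution X \<mu> \<Omega> I x \<phi> w"
  defines "k \<equiv> \<lambda>y. 64 * C ^ 3 * \<delta> / d_compl X \<Omega> y * W y"
  shows "\<And>y. y \<in> \<Omega> \<Longrightarrow> 0 < W y" "continuous_on \<Omega> W" "0 \<le> \<delta> \<Longrightarrow> continuous_on \<Omega> k" "0 \<le> \<delta> \<Longrightarrow> y \<in> \<Omega> \<Longrightarrow> 0 \<le> k y"
    "0 \<le> \<delta> \<Longrightarrow> ug_off \<Omega> (\<lambda>_. 0) W (\<lambda>y. ennreal (k y))"
proof -
  interpret whitney X \<Omega> "1 / 8" C I x \<phi>
    by unfold_locales (use po wp in \<open>auto simp: whitney_partition_iff\<close>)
  have m: "sets \<mu> = sets (restrict_space borel X)" by (rule doubling_sets[OF d\<mu>])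
  have w: "weight X \<mu> w" using reg by (simp add: regularizable_def)
  obtain C' where dw: "doubling X (weighted w \<mu>) C'" using reg by (auto simp: regularizable_def)
  define a where "a i = avg \<mu> (wball X \<Omega> 1 (x i)) w" for i
  have wb: "wball X \<Omega> 1 (x i) = B (1 / 8) i" "wball X \<Omega> 2 (x i) = B (2 * (1 / 8)) i" for i
    by (simp_all add: wball_def B_def)
  have W: "W = smooth a"
    by (simp add: W_def discrete_convolution_def smooth_def a_def fun_eq_iff)
  have a_pos: "0 < a i" if "i \<in> I" for i
  proof -
    have "wball X \<Omega> 1 (x i) \<in> sets \<mu>" unfolding wball_def by (rule ball_in_sets[OF m])
    then have "a i = measure (weighted w \<mu>) (wball X \<Omega> 1 (x i)) / measure \<mu> (wball X \<Omega> 1 (x i))"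
      unfolding a_def by (rule avg_eq_ratio[OF m w])
    then show ?thesis unfolding wball_def
      using doubling_measure_pos[OF dw centre(2)[OF that]] doubling_measure_pos[OF d\<mu> centre(2)[OF that]] centre(3)[OF that] by simp
  qed
  show W_pos: "0 < W y" if y: "y \<in> \<Omega>" for y
  proof -
    have yX: "y \<in> X" using y \<Omega>_subset by blast
    have "(\<Sum>i\<in>active y. \<phi> i y) = 1" by (rule active_sum[OF y])
    then have ne: "active y \<noteq> {}" by auto
    have "Min (a ` active y) \<le> smooth a y"
      by (rule smooth_ge[OF y]) (use active_finite[OF yX] in auto)
    moreover have "0 < Min (a ` active y)"
      using ne active_finite[OF yX] a_pos by (subst Min_gr_iff) (auto simp: active_def)
    ultimately show ?thesis by (simp add: W)
  qed
  show contW: "continuous_on \<Omega> W" unfolding W by (rule smooth_continuous)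
  show contk: "continuous_on \<Omega> k" if "0 \<le> \<delta>"
    unfolding k_def using d_compl_pos[OF po] by (intro continuous_intros contW d_compl_continuous) force
  show k0: "0 \<le> k y" if "0 \<le> \<delta>" "y \<in> \<Omega>" for y
    unfolding k_def using that W_pos d_compl_pos[OF po] C_pos by (intro mult_nonneg_nonneg divide_nonneg_pos) (auto intro: less_imp_le)
  show "ug_off \<Omega> (\<lambda>_. 0) W (\<lambda>y. ennreal (k y))" if \<delta>: "0 \<le> \<delta>"
  proof (rule ug_off_of_locally_lipschitz)
    show "(\<lambda>y. ennreal (k y)) \<in> borel_measurable (restrict_space borel \<Omega>)"
      by (intro measurable_compose[OF borel_measurable_continuous_on_restrict[OF contk[OF \<delta>]] measurable_ennreal])
    fix y assume y: "y \<in> \<Omega>"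
    obtain j e where j: "j \<in> I" "y \<in> B (1 / 8) j" "0 < e" "ball_in X y e \<subseteq> B (1 / 8) j" using core_nhd[OF y] by blast
    define L where "L = 32 * C\<^sup>2 * \<delta> * a j / d (x j)"
    have L0: "0 \<le> L" using a_pos[OF j(1)] \<delta> centre(3)[OF j(1)] by (simp add: L_def)
    have E: "\<bar>a i - a j\<bar> \<le> \<delta> * a j" if "i \<in> nbrs j" for i
    proof -
      have "i \<in> I" "wball X \<Omega> 2 (x i) \<inter> wball X \<Omega> 1 (x j) \<noteq> {}" using that by (auto simp: nbrs_def wb)
      then have "\<bar>a j - a i\<bar> \<le> \<delta> * a j"
        using reg centre(1) j(1) unfolding regularizable_def a_def by blast
      then show ?thesis by (simp add: abs_minus_commute)
    qed
    have lip: "\<bar>W z - W z'\<bar> \<le> L * dist z z'" if "z \<in> B (1 / 8) j" "z' \<in> B (1 / 8) j" for z z'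
      using smooth_osc[OF j(1) that, of a "\<delta> * a j"] E by (simp add: W L_def mult.assoc)
    have Lk: "L \<le> k z" if z: "z \<in> B (1 / 8) j" for z
    proof -
      have z\<Omega>: "z \<in> \<Omega>" using z j(1) cover by blast
      have "d z \<le> (1 + 1 / 8) * d (x j)"
        using d_compl_comparable(2)[OF po, of "x j" z "1 / 8"] z by (simp add: B_def ball_in_iff)
      then have dz: "d z \<le> 2 * d (x j)" using centre(3)[OF j(1)] by simp
      have "1 / d (x j) \<le> 2 / d z" using dz d_compl_pos[OF po z\<Omega>] centre(3)[OF j(1)] by (simp add: field_simps)
      moreover have "a j \<le> C * W z" unfolding W by (rule smooth_ge_core[OF j(1) z]) (use a_pos in \<open>auto intro: less_imp_le\<close>)
      ultimately have "32 * C\<^sup>2 * \<delta> * (a j * (1 / d (x j))) \<le> 32 * C\<^sup>2 * \<delta> * (C * W z * (2 / d z))"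
        using \<delta> a_pos[OF j(1)] W_pos[OF z\<Omega>] C_pos centre(3)[OF j(1)]
        by (intro mult_left_mono mult_mono mult_nonneg_nonneg) auto
      then show ?thesis by (simp add: L_def k_def power2_eq_square power3_eq_cube mult_ac)
    qed
    have sub: "ball_in \<Omega> y e \<subseteq> B (1 / 8) j" using j(4) restrict_to_open(3)[OF m po, of y e] by blast
    show "\<exists>e>0. \<exists>L\<ge>0. (\<forall>z\<in>ball_in \<Omega> y e. ennreal L \<le> ennreal (k z)) \<and>
      (\<forall>z\<in>ball_in \<Omega> y e. \<forall>z'\<in>ball_in \<Omega> y e. \<bar>W z - W z'\<bar> \<le> L * dist z z')"
      using sub L0 j(3) by (intro exI[of _ e] exI[of _ L] conjI ballI lip ennreal_leI Lk) auto
  qed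
qed

text \<open>The continuous upper gradient found above is a competitor for the minimal one.\<close>

lemma gradient_constant_exists:
  assumes "1 \<le> C\<^sub>\<mu>"
  shows "\<exists>C\<^sub>0\<ge>1. \<forall>p>1. gradient_constant TYPE('a::metric_space) p C\<^sub>\<mu> C\<^sub>0"
proof -
  \<comment> \<open>the exponent: \<open>32 / \<kappa> + 1 \<le> 2\<^sup>9\<close> for \<open>\<kappa> = 1 / 8\<close>\<close>
  define C where "C = 9 * C\<^sub>\<mu> ^ 9"
  have C: "1 \<le> C" using one_le_power[OF assms, of 9] by (simp add: C_def)
  show ?thesis
  proof (intro exI[of _ "64 * C ^ 3"] conjI allI impI)
    show "1 \<le> 64 * C ^ 3" using one_le_power[OF C, of 3] by simp
    fix p :: real assume p: "1 < p"
    show "gradient_constant TYPE('a) p C\<^sub>\<mu> (64 * C ^ 3)"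
      unfolding gradient_constant_def
    proof (intro exI[of _ C] allI impI)
      fix X \<Omega> :: "'a set" and \<mu>
      assume A: "complete X \<and> doubling X \<mu> C\<^sub>\<mu> \<and> openin (top_of_set X) \<Omega> \<and> \<Omega> \<noteq> X"
      then have po: "proper_open X \<Omega>" by (intro proper_openI) auto
      have d\<mu>: "doubling X \<mu> C\<^sub>\<mu>" using A by simp
      have m: "sets \<mu> = sets (restrict_space borel X)" by (rule doubling_sets[OF d\<mu>])
      let ?n = "restrict_space \<mu> \<Omega>"
      have n: "sets ?n = sets (restrict_space borel \<Omega>)" by (rule restrict_to_open[OF m po])
      have nsp: "space ?n = \<Omega>" using sets_eq_imp_space_eq[OF n] by (simp add: space_restrict_space)
      obtain I x \<phi> where wh: "whitney_at X \<Omega> (1 / 8) (9 * C\<^sub>\<mu> ^ 9) I x \<phi>"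
        using whitney_at_exists[OF d\<mu> po, of "1 / 8" 9] by auto
      then have wp: "whitney_partition X \<Omega> C I x \<phi>" by (simp add: whitney_partition_iff C_def)
      show "\<exists>I x \<phi>. whitney_partition X \<Omega> C I x \<phi> \<and>
          (\<forall>\<delta>>0. \<forall>w g. regularizable X \<mu> \<Omega> \<delta> w \<and>
              minimal_wug p \<Omega> ?n (\<lambda>y. ereal (discrete_convolution X \<mu> \<Omega> I x \<phi> w y)) g \<longrightarrow>
              (AE y in ?n. g y \<le> ennreal (64 * C ^ 3 * \<delta> / d_compl X \<Omega> y * discrete_convolution X \<mu> \<Omega> I x \<phi> w y)))"
      proof (intro exI[of _ I] exI[of _ x] exI[of _ \<phi>] conjI allI impI wp)
        fix \<delta> :: real and w g
        assume \<delta>: "0 < \<delta>" and "regularizable X \<mu> \<Omega> \<delta> w \<and>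
              minimal_wug p \<Omega> ?n (\<lambda>y. ereal (discrete_convolution X \<mu> \<Omega> I x \<phi> w y)) g"
        then have reg: "regularizable X \<mu> \<Omega> \<delta> w"
          and min: "minimal_wug p \<Omega> ?n (\<lambda>y. ereal (discrete_convolution X \<mu> \<Omega> I x \<phi> w y)) g" by auto
        let ?k = "\<lambda>y. 64 * C ^ 3 * \<delta> / d_compl X \<Omega> y * discrete_convolution X \<mu> \<Omega> I x \<phi> w y"
        note grad = discrete_convolution_gradient[OF d\<mu> po wp reg]
        have km: "(\<lambda>y. ennreal (?k y)) \<in> borel_measurable ?n"
          unfolding measurable_cong_sets[OF n refl]
          by (intro measurable_compose[OF borel_measurable_continuous_on_restrict[OF grad(3)] measurable_ennreal]) (use \<delta> in simp)
        have fin: "\<exists>r>0. emeasure ?n (ball_in \<Omega> y r) < \<infinity>" if "y \<in> \<Omega>" for y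
        proof (intro exI[of _ 1] conjI)
          have "y \<in> X" using that po by (auto simp: proper_open_def)
          have "emeasure ?n (ball_in \<Omega> y 1) = emeasure \<mu> (ball_in \<Omega> y 1)"
            by (rule restrict_to_open(2)[OF m po]) (auto simp: ball_in_iff)
          also have "\<dots> \<le> emeasure \<mu> (ball_in X y 1)"
            by (intro emeasure_mono restrict_to_open(3)[OF m po] ball_in_sets[OF m])
          also have "\<dots> < \<infinity>" by (rule doubling_ball_finite[OF d\<mu> \<open>y \<in> X\<close>])
          finally show "emeasure ?n (ball_in \<Omega> y 1) < \<infinity>" .
        qed simp
        have "weak_upper_gradient p \<Omega> ?n (\<lambda>y. ereal (discrete_convolution X \<mu> \<Omega> I x \<phi> w y)) (\<lambda>y. ennreal (?k y))"
          by (rule weak_upper_gradientI[OF n _ km, of p "\<lambda>_. 0"]) (use p \<delta> grad(5) in auto)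
        moreover have "Lp_loc p \<Omega> ?n (\<lambda>y. ennreal (?k y))"
          by (rule Lp_loc_of_le_continuous[OF n _ km grad(3) grad(4) order_refl fin]) (use p \<delta> in auto)
        ultimately show "AE y in ?n. g y \<le> ennreal (?k y)"
          using min unfolding minimal_wug_def by blast
      qed
    qed
  qed
qed

section \<open>The Poincare inequality in the same exponent\<close>

lemma ball_in_mono: "r \<le> s \<Longrightarrow> ball_in X x r \<subseteq> ball_in X x s"
  by (auto simp: ball_in_iff)

lemma abs_avg_diff_le:
  assumes "set_integrable m B u" "B \<in> sets m" "emeasure m B = ennreal b" "0 < b"
  shows "ennreal \<bar>avg m B u - k\<bar> \<le> (\<integral>\<^sup>+ y \<in> B. ennreal \<bar>u y - k\<bar> \<partial>m) * ennreal (1 / b)"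
proof -
  have b: "measure m B = b" using assms(3,4) by (simp add: measure_def)
  have ik: "set_integrable m B (\<lambda>_. k)"
    unfolding set_integrable_def using assms(2,3) by (intro integrable_scaleR_left) (auto simp: integrable_indicator_iff)
  have int: "set_integrable m B (\<lambda>y. u y - k)" by (rule set_integral_diff(1)[OF assms(1) ik])
  have "(LINT y:B|m. u y - k) = (LINT y:B|m. u y) - (LINT y:B|m. k)" by (rule set_integral_diff(2)[OF assms(1) ik])
  also have "(LINT y:B|m. k) = b * k" using set_integral_const[of B m k] assms(2,3) b by simp
  finally have eq: "avg m B u - k = (LINT y:B|m. u y - k) * (1 / b)"
    using assms(4) by (simp add: avg_def b field_simps)
  have "ennreal (norm (\<integral>y. indicator B y *\<^sub>R (u y - k) \<partial>m)) \<le> (\<integral>\<^sup>+ y. ennreal (norm (indicator B y *\<^sub>R (u y - k))) \<partial>m)"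
    by (rule integral_norm_bound_ennreal) (use int in \<open>simp add: set_integrable_def\<close>)
  also have "\<dots> = (\<integral>\<^sup>+ y \<in> B. ennreal \<bar>u y - k\<bar> \<partial>m)"
    by (intro nn_integral_cong) (auto split: split_indicator)
  finally have le: "ennreal \<bar>LINT y:B|m. u y - k\<bar> \<le> (\<integral>\<^sup>+ y \<in> B. ennreal \<bar>u y - k\<bar> \<partial>m)"
    by (simp add: set_lebesgue_integral_def)
  have "ennreal \<bar>avg m B u - k\<bar> = ennreal (\<bar>LINT y:B|m. u y - k\<bar> * (1 / b))"
    unfolding eq abs_mult using assms(4) by simp
  also have "\<dots> = ennreal \<bar>LINT y:B|m. u y - k\<bar> * ennreal (1 / b)"
    by (rule ennreal_mult'') (use assms(4) in simp)
  also have "\<dots> \<le> (\<integral>\<^sup>+ y \<in> B. ennreal \<bar>u y - k\<bar> \<partial>m) * ennreal (1 / b)"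
    by (rule mult_right_mono[OF le]) simp
  finally show ?thesis .
qed

lemma ennreal_telescope:
  fixes a :: "nat \<Rightarrow> real"
  assumes "a \<longlonglongrightarrow> l"
  shows "ennreal \<bar>l - a 0\<bar> \<le> (\<Sum>k. ennreal \<bar>a (Suc k) - a k\<bar>)"
proof (rule LIMSEQ_le_const2)
  show "(\<lambda>n. ennreal \<bar>a n - a 0\<bar>) \<longlonglongrightarrow> ennreal \<bar>l - a 0\<bar>"
    by (intro tendsto_intros assms)
  have "ennreal \<bar>a n - a 0\<bar> \<le> (\<Sum>k. ennreal \<bar>a (Suc k) - a k\<bar>)" for n
  proof -
    have "ennreal \<bar>a n - a 0\<bar> \<le> (\<Sum>k<n. ennreal \<bar>a (Suc k) - a k\<bar>)"
    proof (induction n)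
      case (Suc n)
      have "ennreal \<bar>a (Suc n) - a 0\<bar> \<le> ennreal (\<bar>a n - a 0\<bar> + \<bar>a (Suc n) - a n\<bar>)" by (intro ennreal_leI) simp
      also have "\<dots> = ennreal \<bar>a n - a 0\<bar> + ennreal \<bar>a (Suc n) - a n\<bar>" by (intro ennreal_plus) auto
      finally show ?case using Suc by (simp add: add_right_mono order_trans)
    qed simp
    also have "\<dots> \<le> (\<Sum>k. ennreal \<bar>a (Suc k) - a k\<bar>)" by (rule sum_le_suminf) auto
    finally show ?thesis .
  qed
  then show "\<exists>N. \<forall>n\<ge>N. ennreal \<bar>a n - a 0\<bar> \<le> (\<Sum>k. ennreal \<bar>a (Suc k) - a k\<bar>)" by blast
qed

locale poincare_space =
  fixes X :: "'a::metric_space set" and m :: "'a measure" and C p CP \<Lambda> :: real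
    and u :: "'a \<Rightarrow> real" and G :: "'a \<Rightarrow> ennreal" and M :: real
  assumes dbl: "doubling X m C" and pi: "poincare p X m CP \<Lambda>" and p1: "1 \<le> p"
    and u_cont: "continuous_on X u" and u_bdd: "\<And>y. y \<in> X \<Longrightarrow> \<bar>u y\<bar> \<le> M"
    and G_meas: "G \<in> borel_measurable (restrict_space borel X)" and G_ug: "ug_off X (\<lambda>_. 0) u G"
begin

lemma sets_m: "sets m = sets (restrict_space borel X)" by (rule doubling_sets[OF dbl])
lemma space_m: "space m = X" using sets_eq_imp_space_eq[OF sets_m] by (simp add: space_restrict_space)
lemma C1: "1 \<le> C" by (rule doubling_ge_1[OF dbl])
lemma CP1: "1 \<le> CP" and \<Lambda>1: "1 \<le> \<Lambda>" using pi by (auto simp: poincare_def)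
lemma p0: "0 < p" using p1 by simp

lemma G_m [measurable]: "G \<in> borel_measurable m"
  using G_meas by (simp add: measurable_cong_sets[OF sets_m refl])

lemma u_m [measurable]: "u \<in> borel_measurable m"
  using borel_measurable_continuous_on_restrict[OF u_cont] by (simp add: measurable_cong_sets[OF sets_m refl])

lemma ball_m [measurable]: "ball_in X x r \<in> sets m" by (rule ball_in_sets[OF sets_m])

abbreviation "mu x r \<equiv> measure m (ball_in X x r)"
abbreviation "mean x r \<equiv> avg m (ball_in X x r) u"

definition energy :: "'a \<Rightarrow> real \<Rightarrow> ennreal" where
  "energy x r = (\<integral>\<^sup>+ y \<in> ball_in X x r. enn_powr (G y) p \<partial>m)"

lemma energy_mono: "ball_in X x r \<subseteq> ball_in X y s \<Longrightarrow> energy x r \<le> energy y s"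
  unfolding energy_def by (intro nn_integral_mono) (auto split: split_indicator)

lemma mu_pos: "x \<in> X \<Longrightarrow> 0 < r \<Longrightarrow> 0 < mu x r"
  by (rule doubling_measure_pos[OF dbl])

lemma emeasure_ball: "x \<in> X \<Longrightarrow> emeasure m (ball_in X x r) = ennreal (mu x r)"
  by (rule doubling_emeasure[OF dbl])

lemma u_integrable: "x \<in> X \<Longrightarrow> set_integrable m (ball_in X x r) u"
  unfolding set_integrable_def
proof (rule integrableI_bounded_set[where A = "ball_in X x r" and B = M])
  assume x: "x \<in> X"
  show "emeasure m (ball_in X x r) < \<infinity>" by (rule doubling_ball_finite[OF dbl x])
  show "AE y in m. y \<in> ball_in X x r \<longrightarrow> norm (indicator (ball_in X x r) y *\<^sub>R u y) \<le> M"
    using u_bdd by (auto simp: ball_in_iff)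
qed auto

text \<open>The right-hand side of the Poincare inequality on \<open>B(x, r)\<close>.\<close>

definition osc :: "'a \<Rightarrow> real \<Rightarrow> ennreal" where
  "osc x r = ennreal (CP * r) * enn_powr (energy x (\<Lambda> * r) * ennreal (1 / mu x (\<Lambda> * r))) (1 / p)"

lemma ennreal_divide_ball:
  assumes "x \<in> X" "0 < r" shows "a / emeasure m (ball_in X x r) = a * ennreal (1 / mu x r)"
  using mu_pos[OF assms] by (simp add: emeasure_ball[OF assms(1)] divide_ennreal_def inverse_ennreal inverse_eq_divide)

lemma poincare_osc:
  assumes "x \<in> X" "0 < r"
  shows "(\<integral>\<^sup>+ y \<in> ball_in X x r. ennreal \<bar>u y - mean x r\<bar> \<partial>m) * ennreal (1 / mu x r) \<le> osc x r"
proof -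
  have fin: "(\<integral>\<^sup>+ y \<in> ball_in X x r. e2ennreal \<bar>ereal (u y)\<bar> \<partial>m) < \<infinity>"
  proof -
    have "(\<integral>\<^sup>+ y \<in> ball_in X x r. e2ennreal \<bar>ereal (u y)\<bar> \<partial>m) \<le> (\<integral>\<^sup>+ y. ennreal M * indicator (ball_in X x r) y \<partial>m)"
      by (intro nn_integral_mono) (auto simp: ball_in_iff intro: ennreal_leI u_bdd split: split_indicator)
    also have "\<dots> < \<infinity>"
      using doubling_ball_finite[OF dbl assms(1), of r] by (simp add: nn_integral_cmult_indicator ennreal_mult_less_top)
    finally show ?thesis .
  qed
  have ug: "upper_gradient X (\<lambda>y. ereal (u y)) G"
    using G_meas G_ug by (simp add: upper_gradient_iff_ug_off)
  have "(\<lambda>y. ereal (u y)) \<in> borel_measurable m" by measurable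
  with pi fin ug assms have
    "(\<integral>\<^sup>+ y \<in> ball_in X x r. e2ennreal \<bar>ereal (u y) - ereal (avg m (ball_in X x r) (\<lambda>z. real_of_ereal (ereal (u z))))\<bar> \<partial>m)
          / emeasure m (ball_in X x r)
        \<le> ennreal (CP * r) * enn_powr ((\<integral>\<^sup>+ y \<in> ball_in X x (\<Lambda> * r). enn_powr (G y) p \<partial>m) / emeasure m (ball_in X x (\<Lambda> * r))) (1 / p)"
    unfolding poincare_def by blast
  moreover have "0 < \<Lambda> * r" using \<Lambda>1 assms(2) by simp
  ultimately show ?thesis
    by (simp add: ennreal_divide_ball assms osc_def energy_def)
qed

lemma mean_diff_le:
  assumes "x \<in> X" "y \<in> X" "0 < s" "0 < t" "ball_in X x s \<subseteq> ball_in X y t" "mu y t \<le> c * mu x s"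
  shows "ennreal \<bar>mean x s - mean y t\<bar> \<le> ennreal c * osc y t"
proof -
  let ?i = "\<lambda>A. \<integral>\<^sup>+ z \<in> A. ennreal \<bar>u z - mean y t\<bar> \<partial>m"
  have "ennreal \<bar>mean x s - mean y t\<bar> \<le> ?i (ball_in X x s) * ennreal (1 / mu x s)"
    by (rule abs_avg_diff_le) (use assms u_integrable emeasure_ball mu_pos in auto)
  also have "\<dots> \<le> ?i (ball_in X y t) * ennreal (c * (1 / mu y t))"
  proof (rule mult_mono)
    show "?i (ball_in X x s) \<le> ?i (ball_in X y t)"
      using assms(5) by (intro nn_integral_mono) (auto split: split_indicator)
    show "ennreal (1 / mu x s) \<le> ennreal (c * (1 / mu y t))"
      using assms(6) mu_pos[OF assms(1,3)] mu_pos[OF assms(2,4)] by (intro ennreal_leI) (simp add: field_simps)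
  qed auto
  also have "\<dots> = ennreal c * (?i (ball_in X y t) * ennreal (1 / mu y t))"
    using mu_pos[OF assms(2,4)] ennreal_mult''[of "1 / mu y t" c] by (simp add: mult_ac)
  also have "\<dots> \<le> ennreal c * osc y t" by (intro mult_left_mono poincare_osc assms) auto
  finally show ?thesis .
qed

lemma osc_powr:
  assumes "0 \<le> r" shows "enn_powr (osc x r) p = ennreal ((CP * r) powr p) * (energy x (\<Lambda> * r) * ennreal (1 / mu x (\<Lambda> * r)))"
  unfolding osc_def using CP1 assms by (simp add: enn_powr_mult[OF p0] enn_powr_inverse[OF p0])

lemma mean_tendsto:
  assumes x: "x \<in> X" and "0 < R"
  shows "(\<lambda>k. mean x (R * (1 / 4) ^ k)) \<longlonglongrightarrow> u x"
proof (rule LIMSEQ_I)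
  fix e :: real assume "0 < e"
  then have "0 < e / 2" by simp
  then obtain h where h: "0 < h" "\<And>y. y \<in> X \<Longrightarrow> dist y x < h \<Longrightarrow> dist (u y) (u x) < e / 2"
    using u_cont x unfolding continuous_on_iff by meson
  have "(\<lambda>k. R * (1 / 4 :: real) ^ k) \<longlonglongrightarrow> R * 0" by (intro tendsto_intros LIMSEQ_power_zero) simp
  then obtain N where N: "\<And>k. k \<ge> N \<Longrightarrow> R * (1 / 4) ^ k < h"
    using h(1) order_tendstoD(2)[of "\<lambda>k. R * (1 / 4 :: real) ^ k" 0 sequentially h] by (auto simp: eventually_sequentially)
  show "\<exists>no. \<forall>n\<ge>no. norm (mean x (R * (1 / 4) ^ n) - u x) < e"
  proof (intro exI[of _ N] allI impI)
    fix n assume "N \<le> n"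
    define s where "s = R * (1 / 4) ^ n"
    have s: "0 < s" "s < h" using \<open>0 < R\<close> N[OF \<open>N \<le> n\<close>] by (auto simp: s_def)
    have "ennreal \<bar>mean x s - u x\<bar> \<le> (\<integral>\<^sup>+ y \<in> ball_in X x s. ennreal \<bar>u y - u x\<bar> \<partial>m) * ennreal (1 / mu x s)"
      by (rule abs_avg_diff_le) (use x s u_integrable emeasure_ball mu_pos in auto)
    also have "\<dots> \<le> (\<integral>\<^sup>+ y \<in> ball_in X x s. ennreal (e / 2) \<partial>m) * ennreal (1 / mu x s)"
    proof (rule mult_right_mono, rule nn_integral_mono)
      fix y show "ennreal \<bar>u y - u x\<bar> * indicator (ball_in X x s) y \<le> ennreal (e / 2) * indicator (ball_in X x s) y"
        using h(2)[of y] s(2) by (auto simp: ball_in_iff dist_commute dist_real_def abs_minus_commute intro!: ennreal_leI split: split_indicator)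
    qed simp
    also have "\<dots> = ennreal (e / 2) * (ennreal (mu x s) * ennreal (1 / mu x s))"
      by (simp add: nn_integral_cmult_indicator emeasure_ball[OF x] mult.assoc)
    also have "ennreal (mu x s) * ennreal (1 / mu x s) = ennreal (mu x s * (1 / mu x s))"
      by (rule ennreal_mult'[symmetric]) simp
    also have "ennreal (e / 2) * \<dots> = ennreal (e / 2)" using mu_pos[OF x s(1)] by simp
    finally have "\<bar>mean x s - u x\<bar> \<le> e / 2" using \<open>0 < e\<close> by (subst (asm) ennreal_le_iff) auto
    then show "norm (mean x (R * (1 / 4) ^ n) - u x) < e" using \<open>0 < e\<close> by (simp add: s_def)
  qed
qed

text \<open>Telescoping over the concentric balls of radii \<open>4\<^sup>-\<^sup>k R\<close>.\<close>

lemma pointwise_bound: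
  assumes x: "x \<in> X" and R: "0 < R"
  shows "enn_powr (ennreal \<bar>u x - mean x R\<bar>) p \<le>
    ennreal (2 powr p * (C\<^sup>2 * CP * R) powr p) *
      (\<Sum>k. ennreal ((1 / 2) ^ k) * (energy x (\<Lambda> * R * (1 / 4) ^ k) * ennreal (1 / mu x (\<Lambda> * R * (1 / 4) ^ k))))"
proof -
  define s where "s k = R * (1 / 4) ^ k" for k :: nat
  have s: "0 < s k" for k using R by (simp add: s_def)
  have s0: "s 0 = R" and sS: "s (Suc k) = s k / 4" for k by (simp_all add: s_def)
  define b where "b k = ennreal (C\<^sup>2 * CP * R) * enn_powr (energy x (\<Lambda> * s k) * ennreal (1 / mu x (\<Lambda> * s k))) (1 / p)" for k
  have step: "ennreal \<bar>mean x (s (Suc k)) - mean x (s k)\<bar> \<le> ennreal ((1 / 4) ^ k) * b k" for k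
  proof -
    have "ennreal \<bar>mean x (s (Suc k)) - mean x (s k)\<bar> \<le> ennreal (C\<^sup>2) * osc x (s k)"
    proof (rule mean_diff_le[OF x x s s])
      show "ball_in X x (s (Suc k)) \<subseteq> ball_in X x (s k)" using s[of k] by (auto simp: ball_in_iff sS)
      show "mu x (s k) \<le> C\<^sup>2 * mu x (s (Suc k))"
        by (rule doubling_compare[OF dbl x x s]) (simp add: sS)
    qed
    also have "\<dots> = ennreal ((1 / 4) ^ k) * b k"
    proof -
      have "C\<^sup>2 * (CP * s k) = (1 / 4) ^ k * (C\<^sup>2 * CP * R)" by (simp add: s_def)
      then have "ennreal (C\<^sup>2 * (CP * s k)) = ennreal ((1 / 4) ^ k * (C\<^sup>2 * CP * R))" by (rule arg_cong)
      moreover have "ennreal (C\<^sup>2 * (CP * s k)) = ennreal (C\<^sup>2) * ennreal (CP * s k)" by (rule ennreal_mult') simp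
      moreover have "ennreal ((1 / 4) ^ k * (C\<^sup>2 * CP * R)) = ennreal ((1 / 4) ^ k) * ennreal (C\<^sup>2 * CP * R)"
        by (rule ennreal_mult') simp
      ultimately show ?thesis by (simp add: osc_def b_def mult.assoc[symmetric])
    qed
    finally show ?thesis .
  qed
  have "(\<lambda>k. mean x (s k)) \<longlonglongrightarrow> u x" unfolding s_def by (rule mean_tendsto[OF x R])
  then have "ennreal \<bar>u x - mean x (s 0)\<bar> \<le> (\<Sum>k. ennreal \<bar>mean x (s (Suc k)) - mean x (s k)\<bar>)" by (rule ennreal_telescope)
  also have "\<dots> \<le> (\<Sum>k. ennreal ((1 / 4) ^ k) * b k)" by (intro suminf_le step summableI)
  finally have "enn_powr (ennreal \<bar>u x - mean x R\<bar>) p \<le> enn_powr (\<Sum>k. ennreal ((1 / 4) ^ k) * b k) p"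
    unfolding s0 by (rule enn_powr_mono) (use p0 in simp)
  also have "\<dots> \<le> ennreal (2 powr p) * (\<Sum>k. ennreal ((1 / 2) ^ k) * enn_powr (b k) p)"
    by (rule enn_powr_geometric_suminf[OF p1])
  also have "\<dots> = ennreal (2 powr p) * (\<Sum>k. ennreal ((C\<^sup>2 * CP * R) powr p) * (ennreal ((1 / 2) ^ k) * (energy x (\<Lambda> * s k) * ennreal (1 / mu x (\<Lambda> * s k)))))"
  proof -
    have "0 \<le> C\<^sup>2 * CP * R" using CP1 R by simp
    then have "enn_powr (b k) p = ennreal ((C\<^sup>2 * CP * R) powr p) * (energy x (\<Lambda> * s k) * ennreal (1 / mu x (\<Lambda> * s k)))" for k
      unfolding b_def by (simp add: enn_powr_mult[OF p0] enn_powr_inverse[OF p0])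
    then show ?thesis by (simp add: mult_ac)
  qed
  also have "\<dots> = ennreal (2 powr p * (C\<^sup>2 * CP * R) powr p) * (\<Sum>k. ennreal ((1 / 2) ^ k) * (energy x (\<Lambda> * s k) * ennreal (1 / mu x (\<Lambda> * s k))))"
    by (subst ennreal_suminf_cmult) (simp add: ennreal_mult mult.assoc)
  finally show ?thesis by (simp add: s_def mult.assoc)
qed

text \<open>Fubini's theorem for averages, in discrete form: on a net of mesh \<open>s\<close> the average over
  \<open>B(x, s)\<close> is dominated by the average over a ball centred at the net.\<close>

lemma average_dominated:
  assumes x0: "x0 \<in> X" and R: "0 < R" and s: "0 < s" "s \<le> t"
  obtains f where "f \<in> borel_measurable m"
    "\<And>x. x \<in> ball_in X x0 R \<Longrightarrow> energy x s * ennreal (1 / mu x s) \<le> f x"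
    "(\<integral>\<^sup>+ x. f x \<partial>m) \<le> ennreal (C ^ 6) * energy x0 (R + 2 * t)"
proof -
  obtain F where F: "finite F" "F \<subseteq> ball_in X x0 R" "ball_in X x0 R \<subseteq> (\<Union>x\<in>F. ball_in X x s)"
    and sep: "\<And>x y. x \<in> F \<Longrightarrow> y \<in> F \<Longrightarrow> x \<noteq> y \<Longrightarrow> s \<le> dist x y"
    using finite_net[OF dbl x0 order_refl s(1)] by metis
  have FX: "z \<in> X" if "z \<in> F" for z using F(2) that by (auto simp: ball_in_iff)
  define c where "c z = ennreal (C\<^sup>2) * (energy z (2 * s) * ennreal (1 / mu z (2 * s)))" for z
  define f where "f x = (\<Sum>z\<in>F. c z * indicator (ball_in X z s) x)" for x
  show thesis
  proof (rule that[of f])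
    show "f \<in> borel_measurable m" unfolding f_def by measurable
    fix x assume x: "x \<in> ball_in X x0 R"
    then obtain z where z: "z \<in> F" "x \<in> ball_in X z s" using F(3) by blast
    have xX: "x \<in> X" using x by (simp add: ball_in_iff)
    have "energy x s * ennreal (1 / mu x s) \<le> energy z (2 * s) * ennreal (C\<^sup>2 * (1 / mu z (2 * s)))"
    proof (intro mult_mono energy_mono ennreal_leI)
      show "ball_in X x s \<subseteq> ball_in X z (2 * s)"
      proof
        fix y assume "y \<in> ball_in X x s"
        then show "y \<in> ball_in X z (2 * s)" using z(2) dist_triangle[of z y x] by (simp add: ball_in_iff)
      qed
      have "mu z (2 * s) \<le> C\<^sup>2 * mu x s"
        by (rule doubling_compare[OF dbl FX[OF z(1)] xX s(1)]) (use z(2) s(1) in \<open>simp add: ball_in_iff\<close>)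
      then show "1 / mu x s \<le> C\<^sup>2 * (1 / mu z (2 * s))"
        using mu_pos[OF xX s(1)] mu_pos[OF FX[OF z(1)], of "2 * s"] s(1) by (simp add: field_simps)
    qed auto
    also have "\<dots> = c z" using mu_pos[OF FX[OF z(1)], of "2 * s"] s(1) C1
      unfolding c_def by (subst ennreal_mult'[of "C\<^sup>2"]) (simp_all add: mult_ac)
    also have "\<dots> = c z * indicator (ball_in X z s) x" using z by simp
    also have "\<dots> \<le> f x" unfolding f_def by (rule member_le_sum[OF z(1)]) (use F(1) in auto)
    finally show "energy x s * ennreal (1 / mu x s) \<le> f x" .
  next
    have "(\<integral>\<^sup>+ x. f x \<partial>m) = (\<Sum>z\<in>F. c z * emeasure m (ball_in X z s))"
      unfolding f_def by (subst nn_integral_sum) (auto simp: nn_integral_cmult_indicator)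
    also have "\<dots> \<le> (\<Sum>z\<in>F. ennreal (C\<^sup>2) * energy z (2 * s))"
    proof (rule sum_mono)
      fix z assume z: "z \<in> F"
      have le: "1 / mu z (2 * s) * mu z s \<le> 1"
      proof -
        have "mu z s \<le> mu z (2 * s)"
          by (rule doubling_measure_mono[OF dbl FX[OF z]]) (use s(1) in \<open>auto simp: ball_in_iff\<close>)
        then show ?thesis using mu_pos[OF FX[OF z], of "2 * s"] s(1) by simp
      qed
      have "c z * emeasure m (ball_in X z s) = ennreal (C\<^sup>2) * energy z (2 * s) * ennreal (1 / mu z (2 * s) * mu z s)"
        unfolding c_def emeasure_ball[OF FX[OF z]]
        by (subst ennreal_mult'[of "1 / mu z (2 * s)"]) (simp_all add: mult.assoc)
      also have "\<dots> \<le> ennreal (C\<^sup>2) * energy z (2 * s) * 1"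
        using le by (intro mult_left_mono) (auto simp: ennreal_le_1)
      finally show "c z * emeasure m (ball_in X z s) \<le> ennreal (C\<^sup>2) * energy z (2 * s)" by simp
    qed
    also have "\<dots> = ennreal (C\<^sup>2) * (\<integral>\<^sup>+ y. (\<Sum>z\<in>F. enn_powr (G y) p * indicator (ball_in X z (2 * s)) y) \<partial>m)"
      unfolding energy_def by (subst nn_integral_sum) (auto simp: sum_distrib_left)
    also have "\<dots> \<le> ennreal (C\<^sup>2) * (\<integral>\<^sup>+ y. ennreal (C ^ 4) * (enn_powr (G y) p * indicator (ball_in X x0 (R + 2 * t)) y) \<partial>m)"
    proof (intro mult_left_mono nn_integral_mono)
      fix y assume "y \<in> space m"
      then have y: "y \<in> X" by (simp add: space_m)
      define T where "T = {z\<in>F. y \<in> ball_in X z (2 * s)}"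
      have "T \<subseteq> ball_in X y (2 * s)" using FX by (auto simp: T_def ball_in_iff dist_commute)
      then have T: "finite T \<and> real (card T) \<le> C ^ 4"
        by (rule separated_packing[OF dbl y _ s(1)]) (use sep s in \<open>auto simp: T_def\<close>)
      have sub: "y \<in> ball_in X x0 (R + 2 * t)" if "z \<in> T" for z
      proof -
        have "dist x0 z < R" "dist z y < 2 * s" using that F(2) by (auto simp: T_def ball_in_iff)
        then show ?thesis using dist_triangle[of x0 y z] s y by (simp add: ball_in_iff)
      qed
      have "(\<Sum>z\<in>F. enn_powr (G y) p * indicator (ball_in X z (2 * s)) y) = (\<Sum>z\<in>T. enn_powr (G y) p)"
        unfolding T_def using F(1) by (intro sum.mono_neutral_cong_right) auto
      also have "\<dots> = of_nat (card T) * enn_powr (G y) p" by simp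
      also have "\<dots> \<le> ennreal (C ^ 4) * (enn_powr (G y) p * indicator (ball_in X x0 (R + 2 * t)) y)"
      proof (cases "T = {}")
        case False
        then have "y \<in> ball_in X x0 (R + 2 * t)" using sub by blast
        then show ?thesis using T by (auto simp: ennreal_of_nat_eq_real_of_nat intro!: mult_right_mono ennreal_leI)
      qed simp
      finally show "(\<Sum>z\<in>F. enn_powr (G y) p * indicator (ball_in X z (2 * s)) y)
         \<le> ennreal (C ^ 4) * (enn_powr (G y) p * indicator (ball_in X x0 (R + 2 * t)) y)" .
    qed simp
    also have "\<dots> = ennreal (C\<^sup>2) * (ennreal (C ^ 4) * energy x0 (R + 2 * t))"
      by (subst nn_integral_cmult) (auto simp: energy_def)
    also have "\<dots> = ennreal (C ^ 6) * energy x0 (R + 2 * t)"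
    proof -
      have "C ^ 6 = C\<^sup>2 * C ^ 4" by (simp flip: power_add)
      then have "ennreal (C ^ 6) = ennreal (C\<^sup>2 * C ^ 4)" by (rule arg_cong)
      also have "\<dots> = ennreal (C\<^sup>2) * ennreal (C ^ 4)" by (rule ennreal_mult') simp
      finally show ?thesis by (simp add: mult.assoc)
    qed
    finally show "(\<integral>\<^sup>+ x. f x \<partial>m) \<le> ennreal (C ^ 6) * energy x0 (R + 2 * t)" .
  qed
qed

text \<open>The \<open>(p, p)\<close>-Poincare inequality.  The pointwise bound compares \<open>u x\<close> with the average over \<open>B(x, R)\<close>, and this average is
  compared with the one over \<open>B(x0, R)\<close> through the ball \<open>B(x0, 2 R)\<close>.  The averages of the energy at scale
  \<open>4\<^sup>-\<^sup>k R\<close> have integrals that are bounded uniformly in \<open>k\<close>, and their weights \<open>2\<^sup>-\<^sup>k\<close> are summable.\<close>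

lemma poincare_p_p:
  assumes x0: "x0 \<in> X" and R: "0 < R"
  shows "(\<integral>\<^sup>+ x \<in> ball_in X x0 R. ennreal (\<bar>u x - mean x0 R\<bar> powr p) \<partial>m)
    \<le> ennreal (2 powr p * (2 powr p * 2 * C ^ 6 + 4 powr p) * (C\<^sup>2 * CP) powr p * R powr p) * energy x0 (3 * \<Lambda> * R)"
proof -
  define D where "D = (C\<^sup>2 * CP * R) powr p"
  have D0: "0 \<le> D" by (simp add: D_def)
  define s where "s k = \<Lambda> * R * (1 / 4) ^ k" for k :: nat
  have \<Lambda>R: "0 < \<Lambda> * R" "R \<le> \<Lambda> * R" using \<Lambda>1 R by auto
  have s: "0 < s k" "s k \<le> \<Lambda> * R" for k
    using \<Lambda>R mult_left_mono[of "(1 / 4) ^ k" 1 "\<Lambda> * R"] by (auto simp: s_def power_le_one)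
  have "\<exists>f. f \<in> borel_measurable m \<and> (\<forall>x\<in>ball_in X x0 R. energy x (s k) * ennreal (1 / mu x (s k)) \<le> f x)
    \<and> (\<integral>\<^sup>+ x. f x \<partial>m) \<le> ennreal (C ^ 6) * energy x0 (R + 2 * (\<Lambda> * R))" for k
    by (rule average_dominated[OF x0 R s[of k]]) blast
  then obtain f where f: "\<And>k. f k \<in> borel_measurable m"
    "\<And>k x. x \<in> ball_in X x0 R \<Longrightarrow> energy x (s k) * ennreal (1 / mu x (s k)) \<le> f k x"
    "\<And>k. (\<integral>\<^sup>+ x. f k x \<partial>m) \<le> ennreal (C ^ 6) * energy x0 (R + 2 * (\<Lambda> * R))"
    by metis
  have [measurable]: "f k \<in> borel_measurable m" for k by (rule f)
  define E where "E = energy x0 (3 * \<Lambda> * R)"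
  have EE: "energy x0 (R + 2 * (\<Lambda> * R)) \<le> E"
    unfolding E_def by (rule energy_mono[OF ball_in_mono]) (use \<Lambda>R in linarith)
  have far: "ennreal \<bar>mean x R - mean x0 R\<bar> \<le> ennreal (2 * C\<^sup>2) * osc x0 (2 * R)" if x: "x \<in> ball_in X x0 R" for x
  proof -
    have xX: "x \<in> X" using x by (simp add: ball_in_iff)
    have R2: "0 < 2 * R" using R by simp
    have 1: "ennreal \<bar>mean x R - mean x0 (2 * R)\<bar> \<le> ennreal (C\<^sup>2) * osc x0 (2 * R)"
    proof (rule mean_diff_le[OF xX x0 R R2])
      show "ball_in X x R \<subseteq> ball_in X x0 (2 * R)"
      proof
        fix y assume "y \<in> ball_in X x R"
        then show "y \<in> ball_in X x0 (2 * R)" using x dist_triangle[of x0 y x] by (simp add: ball_in_iff)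
      qed
      show "mu x0 (2 * R) \<le> C\<^sup>2 * mu x R"
        by (rule doubling_compare[OF dbl x0 xX R]) (use x R in \<open>simp add: ball_in_iff\<close>)
    qed
    have 2: "ennreal \<bar>mean x0 R - mean x0 (2 * R)\<bar> \<le> ennreal (C\<^sup>2) * osc x0 (2 * R)"
    proof (rule mean_diff_le[OF x0 x0 R R2])
      show "ball_in X x0 R \<subseteq> ball_in X x0 (2 * R)" using R by (auto simp: ball_in_iff)
      show "mu x0 (2 * R) \<le> C\<^sup>2 * mu x0 R"
        by (rule doubling_compare[OF dbl x0 x0 R]) (use R in simp)
    qed
    have "ennreal \<bar>mean x R - mean x0 R\<bar> \<le> ennreal (\<bar>mean x R - mean x0 (2 * R)\<bar> + \<bar>mean x0 R - mean x0 (2 * R)\<bar>)"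
      by (intro ennreal_leI) simp
    also have "\<dots> = ennreal \<bar>mean x R - mean x0 (2 * R)\<bar> + ennreal \<bar>mean x0 R - mean x0 (2 * R)\<bar>"
      by (intro ennreal_plus) auto
    also have "\<dots> \<le> ennreal (C\<^sup>2) * osc x0 (2 * R) + ennreal (C\<^sup>2) * osc x0 (2 * R)" by (intro add_mono 1 2)
    also have "\<dots> = (ennreal (C\<^sup>2) + ennreal (C\<^sup>2)) * osc x0 (2 * R)" by (rule distrib_right[symmetric])
    also have "ennreal (C\<^sup>2) + ennreal (C\<^sup>2) = ennreal (C\<^sup>2 + C\<^sup>2)" by (rule ennreal_plus[symmetric]) simp_all
    also have "C\<^sup>2 + C\<^sup>2 = 2 * C\<^sup>2" by simp
    finally show ?thesis .
  qed
  define Z where "Z = ennreal (4 powr p * D) * (energy x0 (\<Lambda> * (2 * R)) * ennreal (1 / mu x0 (\<Lambda> * (2 * R))))"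
  have farp: "enn_powr (ennreal \<bar>mean x R - mean x0 R\<bar>) p \<le> Z" if x: "x \<in> ball_in X x0 R" for x
  proof -
    have "enn_powr (ennreal \<bar>mean x R - mean x0 R\<bar>) p \<le> enn_powr (ennreal (2 * C\<^sup>2) * osc x0 (2 * R)) p"
      by (rule enn_powr_mono[OF far[OF x]]) (use p0 in simp)
    also have "\<dots> = ennreal ((2 * C\<^sup>2) powr p * (CP * (2 * R)) powr p) * (energy x0 (\<Lambda> * (2 * R)) * ennreal (1 / mu x0 (\<Lambda> * (2 * R))))"
    proof -
      have e: "enn_powr (ennreal (2 * C\<^sup>2)) p = ennreal ((2 * C\<^sup>2) powr p)" by (rule enn_powr_ennreal) simp
      have R2: "0 \<le> 2 * R" using R by simp
      show ?thesis
        unfolding enn_powr_mult[OF p0] e osc_powr[OF R2] by (subst ennreal_mult') (simp_all add: mult.assoc)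
    qed
    also have "(2 * C\<^sup>2) powr p * (CP * (2 * R)) powr p = 4 powr p * D"
    proof -
      have "(2 * C\<^sup>2) * (CP * (2 * R)) = 4 * (C\<^sup>2 * CP * R)" by simp
      then show ?thesis unfolding D_def by (metis powr_mult)
    qed
    finally show ?thesis unfolding Z_def .
  qed
  have near: "enn_powr (ennreal \<bar>u x - mean x R\<bar>) p \<le> ennreal (2 powr p * D) * (\<Sum>k. ennreal ((1 / 2) ^ k) * f k x)"
    if x: "x \<in> ball_in X x0 R" for x
  proof -
    have xX: "x \<in> X" using x by (simp add: ball_in_iff)
    show ?thesis unfolding D_def
      by (rule order_trans[OF pointwise_bound[OF xX R]], intro mult_left_mono suminf_le summableI)
        (use f(2)[OF x] in \<open>simp_all add: s_def\<close>)
  qed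
  have "(\<integral>\<^sup>+ x \<in> ball_in X x0 R. ennreal (\<bar>u x - mean x0 R\<bar> powr p) \<partial>m)
    \<le> (\<integral>\<^sup>+ x. ennreal (2 powr p) * (ennreal (2 powr p * D) * (\<Sum>k. ennreal ((1 / 2) ^ k) * f k x) + Z * indicator (ball_in X x0 R) x) \<partial>m)"
  proof (rule nn_integral_mono)
    fix x
    show "ennreal (\<bar>u x - mean x0 R\<bar> powr p) * indicator (ball_in X x0 R) x
      \<le> ennreal (2 powr p) * (ennreal (2 powr p * D) * (\<Sum>k. ennreal ((1 / 2) ^ k) * f k x) + Z * indicator (ball_in X x0 R) x)"
    proof (cases "x \<in> ball_in X x0 R")
      case True
      have "ennreal (\<bar>u x - mean x0 R\<bar> powr p) = enn_powr (ennreal \<bar>u x - mean x0 R\<bar>) p" by simp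
      also have "\<dots> \<le> enn_powr (ennreal \<bar>u x - mean x R\<bar> + ennreal \<bar>mean x R - mean x0 R\<bar>) p"
        by (rule enn_powr_mono) (use p0 in \<open>auto simp flip: ennreal_plus intro!: ennreal_leI\<close>)
      also have "\<dots> \<le> ennreal (2 powr p) * (enn_powr (ennreal \<bar>u x - mean x R\<bar>) p + enn_powr (ennreal \<bar>mean x R - mean x0 R\<bar>) p)"
        by (rule enn_powr_add_le[OF p0])
      also have "\<dots> \<le> ennreal (2 powr p) * (ennreal (2 powr p * D) * (\<Sum>k. ennreal ((1 / 2) ^ k) * f k x) + Z)"
        by (intro mult_left_mono add_mono near farp True) auto
      finally show ?thesis using True by simp
    qed simp
  qed
  also have "\<dots> = ennreal (2 powr p) * (ennreal (2 powr p * D) * (\<Sum>k. ennreal ((1 / 2) ^ k) * (\<integral>\<^sup>+ x. f k x \<partial>m)) + Z * emeasure m (ball_in X x0 R))"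
    by (simp add: nn_integral_cmult nn_integral_add nn_integral_suminf nn_integral_cmult_indicator)
  also have "\<dots> \<le> ennreal (2 powr p) * (ennreal (2 powr p * D) * (\<Sum>k. ennreal ((1 / 2) ^ k) * (ennreal (C ^ 6) * E)) + ennreal (4 powr p * D) * E)"
  proof (intro mult_left_mono add_mono suminf_le summableI)
    show "(\<integral>\<^sup>+ x. f k x \<partial>m) \<le> ennreal (C ^ 6) * E" for k
      by (rule order_trans[OF f(3)]) (intro mult_left_mono EE, simp)
    have le: "1 / mu x0 (\<Lambda> * (2 * R)) * mu x0 R \<le> 1"
    proof -
      have "mu x0 R \<le> mu x0 (\<Lambda> * (2 * R))"
        by (rule doubling_measure_mono[OF dbl x0 ball_in_mono ball_m]) (use \<Lambda>R in linarith)
      moreover have "0 < mu x0 (\<Lambda> * (2 * R))" by (rule mu_pos[OF x0]) (use \<Lambda>R in linarith)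
      ultimately show ?thesis by simp
    qed
    have "Z * emeasure m (ball_in X x0 R) = ennreal (4 powr p * D) * energy x0 (\<Lambda> * (2 * R)) * ennreal (1 / mu x0 (\<Lambda> * (2 * R)) * mu x0 R)"
      unfolding Z_def emeasure_ball[OF x0]
      by (subst ennreal_mult'[of "1 / mu x0 (\<Lambda> * (2 * R))"]) (simp_all add: mult.assoc)
    also have "\<dots> \<le> ennreal (4 powr p * D) * energy x0 (\<Lambda> * (2 * R)) * 1"
      using le by (intro mult_left_mono) (auto simp: ennreal_le_1)
    also have "energy x0 (\<Lambda> * (2 * R)) \<le> E"
      unfolding E_def by (rule energy_mono[OF ball_in_mono]) (use \<Lambda>R in linarith)
    finally show "Z * emeasure m (ball_in X x0 R) \<le> ennreal (4 powr p * D) * E" by (simp add: mult_left_mono)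
  qed auto
  also have "\<dots> = ennreal (2 powr p) * (ennreal (2 powr p * D) * (2 * (ennreal (C ^ 6) * E)) + ennreal (4 powr p * D) * E)"
    by (simp only: ennreal_suminf_multc suminf_geometric_half)
  also have "\<dots> = ennreal (2 powr p * (2 powr p * 2 * C ^ 6 + 4 powr p) * D) * E"
  proof -
    have e2: "(2 :: ennreal) = ennreal 2" by simp
    have "ennreal (2 powr p * (2 powr p * 2 * C ^ 6 + 4 powr p) * D)
        = ennreal (2 powr p * (2 powr p * D * (2 * C ^ 6) + 4 powr p * D))" by (simp add: algebra_simps)
    also have "\<dots> = ennreal (2 powr p) * (ennreal (2 powr p * D) * (ennreal 2 * ennreal (C ^ 6)) + ennreal (4 powr p * D))"
      using D0 C1 by (simp only: ennreal_mult ennreal_plus zero_le_power powr_ge_zero mult_nonneg_nonneg add_nonneg_nonneg zero_le_numeral order_trans[OF zero_le_one])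
    finally show ?thesis unfolding e2 by (simp add: distrib_right mult.assoc)
  qed
  also have "2 powr p * (2 powr p * 2 * C ^ 6 + 4 powr p) * D = 2 powr p * (2 powr p * 2 * C ^ 6 + 4 powr p) * (C\<^sup>2 * CP) powr p * R powr p"
    unfolding D_def by (simp add: powr_mult)
  finally show ?thesis unfolding E_def .
qed

end

section \<open>A Leibniz rule\<close>

text \<open>The local bounds have a common constant and a common radius on the compact set; for points farther apart the bound for \<open>|v|\<close> suffices.\<close>

lemma lipschitz_of_compact_support:
  fixes v :: "'a::metric_space \<Rightarrow> real"
  assumes K: "compact K" "K \<subseteq> X" and v0: "\<And>y. y \<in> X - K \<Longrightarrow> v y = 0" and vM: "\<And>y. y \<in> X \<Longrightarrow> \<bar>v y\<bar> \<le> M"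
    and loc: "\<And>x. x \<in> K \<Longrightarrow> \<exists>e>0. \<exists>L\<ge>0. \<forall>y\<in>ball_in X x e. \<forall>z\<in>ball_in X x e. \<bar>v y - v z\<bar> \<le> L * dist y z"
  shows "\<exists>L. L-lipschitz_on X v"
proof (cases "K = {}")
  case True
  then show ?thesis using v0 by (intro exI[of _ 0] lipschitz_onI) auto
next
  case False
  obtain e L where eL: "\<And>x. x \<in> K \<Longrightarrow> 0 < e x" "\<And>x. x \<in> K \<Longrightarrow> 0 \<le> L x"
    "\<And>x y z. x \<in> K \<Longrightarrow> y \<in> ball_in X x (e x) \<Longrightarrow> z \<in> ball_in X x (e x) \<Longrightarrow> \<bar>v y - v z\<bar> \<le> L x * dist y z"
    using loc by metis
  have "K \<subseteq> (\<Union>x\<in>K. ball x (e x / 2))" using eL(1) by force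
  then obtain F where F: "F \<subseteq> K" "finite F" "K \<subseteq> (\<Union>x\<in>F. ball x (e x / 2))"
    using compactE_image[OF K(1), of K "\<lambda>x. ball x (e x / 2)"] by (metis open_ball)
  have F0: "F \<noteq> {}" using F(3) False by auto
  define r where "r = Min ((\<lambda>x. e x / 2) ` F)"
  have r: "0 < r" "\<And>x. x \<in> F \<Longrightarrow> r \<le> e x / 2"
  proof -
    have "0 < e x / 2" if "x \<in> F" for x using eL(1)[of x] F(1) that by auto
    then show "0 < r" unfolding r_def using F(2) F0 by (subst Min_gr_iff) auto
    show "r \<le> e x / 2" if "x \<in> F" for x unfolding r_def by (rule Min_le) (use F(2) that in auto)
  qed
  define A where "A = (\<Sum>x\<in>F. L x)"
  have A: "L x \<le> A" if "x \<in> F" for x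
    unfolding A_def using F(1,2) that eL(2) by (intro member_le_sum) auto
  have A0: "0 \<le> A" unfolding A_def using F(1) eL(2) by (intro sum_nonneg) auto
  have M0: "0 \<le> M" using vM False K(2) by (meson abs_ge_zero ex_in_conv order_trans subsetD)
  have main: "\<bar>v y - v z\<bar> \<le> (A + 2 * M / r) * dist y z" if yz: "y \<in> X" "z \<in> X" and y: "y \<in> K" for y z
  proof (cases "dist y z < r")
    case True
    obtain x where x: "x \<in> F" "y \<in> ball x (e x / 2)" using F(3) y by blast
    have "dist x z \<le> dist x y + dist y z" by (rule dist_triangle)
    then have "dist x z < e x" using x True r(2)[OF x(1)] by simp
    then have "\<bar>v y - v z\<bar> \<le> L x * dist y z"
      using x yz F(1) eL(1)[of x] by (intro eL(3)) (auto simp: ball_in_iff)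
    also have "\<dots> \<le> (A + 2 * M / r) * dist y z"
      using A[OF x(1)] M0 r(1) by (intro mult_right_mono) (auto intro: add_increasing2)
    finally show ?thesis .
  next
    case False
    have "\<bar>v y - v z\<bar> \<le> 2 * M" using vM[OF yz(1)] vM[OF yz(2)] by linarith
    also have "\<dots> \<le> 2 * M / r * dist y z" using False r(1) M0 by (simp add: pos_le_divide_eq mult_left_mono)
    also have "\<dots> \<le> (A + 2 * M / r) * dist y z" using A0 by (intro mult_right_mono) auto
    finally show ?thesis .
  qed
  show ?thesis
  proof (intro exI[of _ "A + 2 * M / r"] lipschitz_onI)
    fix y z assume yz: "y \<in> X" "z \<in> X"
    show "dist (v y) (v z) \<le> (A + 2 * M / r) * dist y z"
    proof (cases "y \<in> K \<or> z \<in> K")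
      case True
      then show ?thesis using main[OF yz] main[OF yz(2,1)] by (auto simp: dist_real_def abs_minus_commute dist_commute)
    next
      case False
      then show ?thesis using v0 yz A0 M0 r(1) by simp
    qed
  qed (use A0 M0 r(1) in simp)
qed

lemma powr_diff_le:
  fixes a b c q :: real
  assumes "0 < c" "c \<le> a" "c \<le> b" "0 < q" "q \<le> 1"
  shows "\<bar>a powr q - b powr q\<bar> \<le> q * c powr (q - 1) * \<bar>a - b\<bar>"
proof -
  have *: "\<bar>b powr q - a powr q\<bar> \<le> q * c powr (q - 1) * \<bar>b - a\<bar>" if ab: "c \<le> a" "a < b" for a b
  proof -
    have "\<exists>z>a. z < b \<and> b powr q - a powr q = (b - a) * (q * z powr (q - 1))"
      by (rule MVT2[OF ab(2)]) (use ab assms(1) in \<open>auto intro!: has_real_derivative_powr\<close>)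
    then obtain z where z: "a < z" "b powr q - a powr q = (b - a) * (q * z powr (q - 1))" by blast
    have "z powr (q - 1) \<le> c powr (q - 1)" by (rule powr_mono2') (use z ab assms in auto)
    then have "(b - a) * (q * z powr (q - 1)) \<le> (b - a) * (q * c powr (q - 1))"
      using ab assms by (intro mult_left_mono) auto
    moreover have "0 \<le> (b - a) * (q * z powr (q - 1))" using ab assms by simp
    ultimately show ?thesis using z(2) ab by (simp add: mult_ac)
  qed
  consider "a < b" | "b < a" | "a = b" by linarith
  then show ?thesis using *[of a b] *[of b a] assms by cases (auto simp: abs_minus_commute)
qed

lemma proper_open_borel: "proper_open X \<Omega> \<Longrightarrow> \<Omega> \<in> sets borel"
proof -
  assume po: "proper_open X \<Omega>"
  then have "\<Omega> = X \<inter> - (X - \<Omega>)" by (auto simp: proper_open_def)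
  moreover have "X \<in> sets borel" using po unfolding proper_open_def by (intro borel_closed) simp
  moreover have "- (X - \<Omega>) \<in> sets borel" using po unfolding proper_open_def by (intro borel_open open_Compl) simp
  ultimately show "\<Omega> \<in> sets borel" by (metis sets.Int)
qed

lemma measurable_cut:
  fixes F :: "'a::metric_space \<Rightarrow> ennreal"
  assumes "F \<in> borel_measurable (restrict_space borel \<Omega>)" "\<Omega> \<in> sets borel" "N \<in> sets borel" "N \<subseteq> \<Omega>"
  shows "(\<lambda>y. F y * indicator N y) \<in> borel_measurable borel"
proof -
  have [measurable]: "(\<lambda>y. F y * indicator \<Omega> y) \<in> borel_measurable borel"
    using assms(1,2) by (subst (asm) borel_measurable_restrict_space_iff_ennreal) auto
  have [measurable]: "N \<in> sets borel" by fact
  have "(\<lambda>y. F y * indicator N y) = (\<lambda>y. F y * indicator \<Omega> y * indicator N y)"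
    using assms(4) by (auto simp: fun_eq_iff split: split_indicator)
  then show ?thesis by simp
qed

lemma continuous_near:
  fixes f :: "'a::metric_space \<Rightarrow> real"
  assumes po: "proper_open X \<Omega>" and f: "continuous_on \<Omega> f" and x: "x \<in> \<Omega>" and lu: "l < f x" "f x < b"
  obtains e where "0 < e" "ball_in X x e \<subseteq> \<Omega>" "\<And>y. y \<in> ball_in X x e \<Longrightarrow> l < f y \<and> f y < b"
proof -
  define t where "t = min (f x - l) (b - f x)"
  have "0 < t" using lu by (simp add: t_def)
  then obtain e where e: "0 < e" "\<And>y. y \<in> \<Omega> \<Longrightarrow> dist y x < e \<Longrightarrow> dist (f y) (f x) < t"
    using f x unfolding continuous_on_iff by meson
  define e' where "e' = min e (d_compl X \<Omega> x)"
  have "0 < e'" using e(1) d_compl_pos[OF po x] by (simp add: e'_def)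
  moreover have sub: "ball_in X x e' \<subseteq> \<Omega>"
    using d_compl_ball[OF po, of x] by (auto simp: e'_def ball_in_iff)
  moreover have "l < f y \<and> f y < b" if "y \<in> ball_in X x e'" for y
  proof -
    have "y \<in> \<Omega>" "dist y x < e" using that sub by (auto simp: e'_def ball_in_iff dist_commute)
    then show ?thesis using e(2)[of y] by (auto simp: t_def dist_real_def abs_less_iff)
  qed
  ultimately show thesis using that by blast
qed

text \<open>The Leibniz and chain rules for \<open>u W\<^sup>q\<close>, up to the factor \<open>\<theta> > 1\<close> and the summand \<open>\<epsilon>\<close>, which pay for
  the variation of the coefficients on short subcurves.\<close>

lemma leibniz_powr:
  fixes u W :: "'a::metric_space \<Rightarrow> real" and h g \<rho> :: "'a \<Rightarrow> ennreal"
  assumes po: "proper_open X \<Omega>" and u: "L-lipschitz_on X u"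
    and K: "closed K" "K \<subseteq> \<Omega>" "\<And>y. y \<in> X - K \<Longrightarrow> u y = 0"
    and N: "N \<in> sets borel" "N \<subseteq> \<Omega>" "\<And>x. x \<in> K \<Longrightarrow> \<exists>e>0. ball_in X x e \<subseteq> N"
    and W: "continuous_on \<Omega> W" "\<And>y. y \<in> \<Omega> \<Longrightarrow> 0 < W y"
    and h: "ug_off X (\<lambda>_. 0) u h" "h \<in> borel_measurable (restrict_space borel X)"
    and g: "ug_off \<Omega> \<rho> W g" "g \<in> borel_measurable (restrict_space borel \<Omega>)" "\<rho> \<in> borel_measurable (restrict_space borel \<Omega>)"
    and q: "0 < q" "q \<le> 1" and \<theta>: "1 < \<theta>" and \<epsilon>: "0 < \<epsilon>"
  defines "H \<equiv> \<lambda>y. (ennreal (\<theta> * W y powr q) * h y + ennreal (\<theta> * (\<bar>u y\<bar> + \<epsilon>) * (q * W y powr (q - 1))) * g y) * indicator N y"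
  shows "H \<in> borel_measurable (restrict_space borel X)"
    "ug_off X (\<lambda>y. \<rho> y * indicator \<Omega> y) (\<lambda>y. u y * W y powr q) H"
proof -
  have \<Omega>b: "\<Omega> \<in> sets borel" by (rule proper_open_borel[OF po])
  have \<Omega>X: "\<Omega> \<subseteq> X" using po by (simp add: proper_open_def)
  have Wm [measurable]: "W \<in> borel_measurable (restrict_space borel \<Omega>)"
    by (rule borel_measurable_continuous_on_restrict[OF W(1)])
  have um [measurable]: "u \<in> borel_measurable (restrict_space borel \<Omega>)"
    by (rule borel_measurable_continuous_on_restrict[OF continuous_on_subset[OF lipschitz_on_continuous_on[OF u] \<Omega>X]])
  have hm [measurable]: "h \<in> borel_measurable (restrict_space borel \<Omega>)"
    by (rule measurable_restrict_mono[OF h(2) \<Omega>X])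
  have gm [measurable]: "g \<in> borel_measurable (restrict_space borel \<Omega>)" by (rule g)
  have "H \<in> borel_measurable borel"
    unfolding H_def by (rule measurable_cut[OF _ \<Omega>b N(1,2)]) measurable
  then show Hm: "H \<in> borel_measurable (restrict_space borel X)" by (rule measurable_restrict_space1)
  have L0: "0 \<le> L" using u by (rule lipschitz_on_nonneg)
  define \<tau> where "\<tau> = sqrt \<theta>"
  have \<tau>: "1 < \<tau>" "\<tau> * \<tau> = \<theta>" using \<theta> by (auto simp: \<tau>_def)
  show "ug_off X (\<lambda>y. \<rho> y * indicator \<Omega> y) (\<lambda>y. u y * W y powr q) H"
  proof (rule ug_offI_local[OF Hm])
    fix c x0 assume c: "c \<in> rect_curves X" and \<rho>c: "line_integral (\<lambda>y. \<rho> y * indicator \<Omega> y) c < \<infinity>"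
      and x0: "0 \<le> x0" "x0 \<le> arc_len c"
    define x where "x = arc_of c x0"
    have xX: "x \<in> X" using arc_of_in[OF c, of x0] x0 by (simp add: x_def)
    show "\<exists>d>0. \<forall>s t. 0 \<le> s \<and> s \<le> x0 \<and> x0 \<le> t \<and> t \<le> arc_len c \<and> t - s < d \<longrightarrow>
        ennreal \<bar>u (arc_of c t) * W (arc_of c t) powr q - u (arc_of c s) * W (arc_of c s) powr q\<bar>
          \<le> (\<integral>\<^sup>+ r \<in> {s..t}. H (arc_of c r) \<partial>lborel)"
    proof (cases "x \<in> K")
      case False
      then obtain e where e: "0 < e" "ball x e \<subseteq> - K" using K(1) open_contains_ball[of "- K"] by auto
      show ?thesis
      proof (intro exI[of _ e] conjI allI impI e(1))
        fix s t assume st: "0 \<le> s \<and> s \<le> x0 \<and> x0 \<le> t \<and> t \<le> arc_len c \<and> t - s < e"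
        have "arc_of c r \<in> X - K" if "r \<in> {s..t}" for r
          using arc_near[OF c x0 e(1), of s t r] st that e(2) by (auto simp: x_def ball_in_def)
        then have "u (arc_of c s) = 0" "u (arc_of c t) = 0" using st by (auto intro!: K(3))
        then show "ennreal \<bar>u (arc_of c t) * W (arc_of c t) powr q - u (arc_of c s) * W (arc_of c s) powr q\<bar>
          \<le> (\<integral>\<^sup>+ r \<in> {s..t}. H (arc_of c r) \<partial>lborel)" by simp
      qed
    next
      case True
      then have x\<Omega>: "x \<in> \<Omega>" using K(2) by blast
      have Wx: "0 < W x" by (rule W(2)[OF x\<Omega>])
      obtain e1 where e1: "0 < e1" "ball_in X x e1 \<subseteq> N" using N(3)[OF True] by blast
      \<comment> \<open>near a point of the support, all coefficients vary by a factor of at most \<open>\<tau>\<close>\<close>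
      define f where "f y = W y powr q" for y
      define A where "A y = q * W y powr (q - 1)" for y
      have fc: "continuous_on \<Omega> f" and Ac: "continuous_on \<Omega> A"
        unfolding f_def A_def using W(2) by (intro continuous_intros W(1); force)+
      have f0: "0 < f x" and A0: "0 < A x" using Wx q by (auto simp: f_def A_def)
      have shrink: "a / \<tau> < a \<and> a < a * \<tau>" if "0 < a" for a using that \<tau>(1) by (simp add: divide_less_eq)
      obtain e2 where e2: "0 < e2" "\<And>y. y \<in> ball_in X x e2 \<Longrightarrow> f x / \<tau> < f y \<and> f y < f x * \<tau>"
        using continuous_near[OF po fc x\<Omega>, of "f x / \<tau>" "f x * \<tau>"] shrink[OF f0] by metis
      obtain e3 where e3: "0 < e3" "\<And>y. y \<in> ball_in X x e3 \<Longrightarrow> A x / \<tau> < A y \<and> A y < A x * \<tau>"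
        using continuous_near[OF po Ac x\<Omega>, of "A x / \<tau>" "A x * \<tau>"] shrink[OF A0] by metis
      have "\<exists>b>0. b < W x \<and> q * b powr (q - 1) < A x * \<tau>"
      proof -
        have "isCont (\<lambda>b. q * b powr (q - 1)) (W x)" using Wx by (intro continuous_intros) auto
        moreover have "q * W x powr (q - 1) < A x * \<tau>" using shrink[OF A0] by (simp add: A_def)
        ultimately have "\<forall>\<^sub>F b in at (W x). q * b powr (q - 1) < A x * \<tau>"
          by (metis isCont_def order_tendstoD(2))
        then obtain d where d: "0 < d" "\<And>b. b \<noteq> W x \<Longrightarrow> dist b (W x) < d \<Longrightarrow> q * b powr (q - 1) < A x * \<tau>"
          unfolding eventually_at by auto
        define b where "b = W x - min (d / 2) (W x / 2)"
        show ?thesis using d(2)[of b] d(1) Wx by (intro exI[of _ b]) (auto simp: b_def dist_real_def min_def)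
      qed
      then obtain b where b: "0 < b" "b < W x" "q * b powr (q - 1) < A x * \<tau>" by blast
      obtain e4 where e4: "0 < e4" "ball_in X x e4 \<subseteq> \<Omega>" "\<And>y. y \<in> ball_in X x e4 \<Longrightarrow> b < W y \<and> W y < W x + 1"
        using continuous_near[OF po W(1) x\<Omega> b(2), of "W x + 1"] by auto
      define e where "e = Min {e1, e2, e3, e4, \<epsilon> / (L + 1)}"
      have e: "0 < e" "e \<le> e1" "e \<le> e2" "e \<le> e3" "e \<le> e4" "e \<le> \<epsilon> / (L + 1)"
        using e1(1) e2(1) e3(1) e4(1) \<epsilon> L0 by (auto simp: e_def)
      show ?thesis
      proof (intro exI[of _ e] conjI allI impI e(1))
        fix s t assume st: "0 \<le> s \<and> s \<le> x0 \<and> x0 \<le> t \<and> t \<le> arc_len c \<and> t - s < e"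
        let ?\<gamma> = "arc_of c"
        have near: "?\<gamma> r \<in> ball_in X x e" if "r \<in> {s..t}" for r
          using arc_near[OF c x0 e(1), of s t r] st that by (simp add: x_def)
        have bi: "?\<gamma> r \<in> N" "?\<gamma> r \<in> \<Omega>" "?\<gamma> r \<in> X" "f x / \<tau> < f (?\<gamma> r)" "f (?\<gamma> r) < f x * \<tau>" "A x / \<tau> < A (?\<gamma> r)" "b < W (?\<gamma> r)"
          if "r \<in> {s..t}" for r
        proof -
          have i1: "?\<gamma> r \<in> ball_in X x e1" using near[OF that] ball_in_mono[OF e(2)] by (rule subsetD[rotated])
          have i2: "?\<gamma> r \<in> ball_in X x e2" using near[OF that] ball_in_mono[OF e(3)] by (rule subsetD[rotated])
          have i3: "?\<gamma> r \<in> ball_in X x e3" using near[OF that] ball_in_mono[OF e(4)] by (rule subsetD[rotated])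
          have i4: "?\<gamma> r \<in> ball_in X x e4" using near[OF that] ball_in_mono[OF e(5)] by (rule subsetD[rotated])
          show "?\<gamma> r \<in> N" using i1 e1(2) by (rule subsetD[rotated])
          show "?\<gamma> r \<in> \<Omega>" using i4 e4(2) by (rule subsetD[rotated])
          show "?\<gamma> r \<in> X" using i1 by (simp add: ball_in_iff)
          show "f x / \<tau> < f (?\<gamma> r)" "f (?\<gamma> r) < f x * \<tau>" using e2(2)[OF i2] by blast+
          show "A x / \<tau> < A (?\<gamma> r)" using e3(2)[OF i3] by blast
          show "b < W (?\<gamma> r)" using e4(3)[OF i4] by blast
        qed
        have sI: "s \<in> {s..t}" and tI: "t \<in> {s..t}" using st by auto
        have f_le: "f (?\<gamma> t) \<le> \<theta> * f (?\<gamma> r)" if "r \<in> {s..t}" for r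
        proof -
          have "f x < f (?\<gamma> r) * \<tau>" using bi(4)[OF that] \<tau>(1) by (simp add: divide_less_eq)
          then have "f x * \<tau> \<le> f (?\<gamma> r) * \<tau> * \<tau>" using \<tau>(1) by (intro mult_right_mono) auto
          then show ?thesis unfolding \<tau>(2)[symmetric] using bi(5)[OF tI] by (simp add: mult_ac)
        qed
        have A_le: "q * b powr (q - 1) \<le> \<theta> * A (?\<gamma> r)" if "r \<in> {s..t}" for r
        proof -
          have "A x < A (?\<gamma> r) * \<tau>" using bi(6)[OF that] \<tau>(1) by (simp add: divide_less_eq)
          then have "A x * \<tau> \<le> A (?\<gamma> r) * \<tau> * \<tau>" using \<tau>(1) by (intro mult_right_mono) auto
          then show ?thesis unfolding \<tau>(2)[symmetric] using b(3) by (simp add: mult_ac)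
        qed
        have u_le: "\<bar>u (?\<gamma> s)\<bar> \<le> \<bar>u (?\<gamma> r)\<bar> + \<epsilon>" if r: "r \<in> {s..t}" for r
        proof -
          have "\<bar>u (?\<gamma> s) - u (?\<gamma> r)\<bar> \<le> L * dist (?\<gamma> s) (?\<gamma> r)"
            using lipschitz_onD[OF u bi(3)[OF sI] bi(3)[OF r]] by (simp add: dist_real_def)
          also have "\<dots> \<le> L * (1 * dist s r)"
            using L0 st r by (intro mult_left_mono lipschitz_onD[OF arc_of_lipschitz[OF c]]) auto
          also have "\<dots> \<le> (L + 1) * e" using L0 st r by (intro mult_mono) (auto simp: dist_real_def)
          also have "\<dots> \<le> \<epsilon>" using e(6) L0 by (simp add: pos_le_divide_eq mult.commute)
          finally show ?thesis by linarith
        qed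
        have st': "0 \<le> s" "s \<le> t" "t \<le> arc_len c" using st by auto
        let ?I = "\<lambda>F. \<integral>\<^sup>+ r \<in> {s..t}. F (?\<gamma> r) \<partial>lborel"
        have du: "ennreal \<bar>u (?\<gamma> t) - u (?\<gamma> s)\<bar> \<le> ?I h"
          by (rule ug_off_interval[OF h(1,2) _ c st']) (use bi in auto)
        have \<rho>fin: "?I \<rho> < \<infinity>"
        proof -
          have "?I \<rho> \<le> line_integral (\<lambda>y. \<rho> y * indicator \<Omega> y) c"
            unfolding line_integral_arc by (intro nn_integral_mono) (use bi(2) st' in \<open>auto split: split_indicator\<close>)
          then show ?thesis using \<rho>c by (rule le_less_trans)
        qed
        have dW: "ennreal \<bar>W (?\<gamma> t) - W (?\<gamma> s)\<bar> \<le> ?I g"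
          by (rule ug_off_interval[OF g c st' _ \<rho>fin]) (use bi in auto)
        have "\<bar>u (?\<gamma> t) * f (?\<gamma> t) - u (?\<gamma> s) * f (?\<gamma> s)\<bar>
            = \<bar>f (?\<gamma> t) * (u (?\<gamma> t) - u (?\<gamma> s)) + u (?\<gamma> s) * (f (?\<gamma> t) - f (?\<gamma> s))\<bar>" by (simp add: algebra_simps)
        also have "\<dots> \<le> \<bar>f (?\<gamma> t) * (u (?\<gamma> t) - u (?\<gamma> s))\<bar> + \<bar>u (?\<gamma> s) * (f (?\<gamma> t) - f (?\<gamma> s))\<bar>" by (rule abs_triangle_ineq)
        also have "\<dots> \<le> f (?\<gamma> t) * \<bar>u (?\<gamma> t) - u (?\<gamma> s)\<bar> + \<bar>u (?\<gamma> s)\<bar> * (q * b powr (q - 1) * \<bar>W (?\<gamma> t) - W (?\<gamma> s)\<bar>)"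
        proof (intro add_mono)
          show "\<bar>f (?\<gamma> t) * (u (?\<gamma> t) - u (?\<gamma> s))\<bar> \<le> f (?\<gamma> t) * \<bar>u (?\<gamma> t) - u (?\<gamma> s)\<bar>"
            by (simp add: abs_mult f_def)
          have "\<bar>f (?\<gamma> t) - f (?\<gamma> s)\<bar> \<le> q * b powr (q - 1) * \<bar>W (?\<gamma> t) - W (?\<gamma> s)\<bar>"
            unfolding f_def by (rule powr_diff_le) (use b bi(7)[OF sI] bi(7)[OF tI] q in auto)
          then show "\<bar>u (?\<gamma> s) * (f (?\<gamma> t) - f (?\<gamma> s))\<bar> \<le> \<bar>u (?\<gamma> s)\<bar> * (q * b powr (q - 1) * \<bar>W (?\<gamma> t) - W (?\<gamma> s)\<bar>)"
            unfolding abs_mult by (rule mult_left_mono) simp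
        qed
        finally have "ennreal \<bar>u (?\<gamma> t) * f (?\<gamma> t) - u (?\<gamma> s) * f (?\<gamma> s)\<bar>
            \<le> ennreal (f (?\<gamma> t) * \<bar>u (?\<gamma> t) - u (?\<gamma> s)\<bar> + (\<bar>u (?\<gamma> s)\<bar> * (q * b powr (q - 1))) * \<bar>W (?\<gamma> t) - W (?\<gamma> s)\<bar>)"
          by (intro ennreal_leI) (simp add: mult.assoc)
        also have "\<dots> = ennreal (f (?\<gamma> t)) * ennreal \<bar>u (?\<gamma> t) - u (?\<gamma> s)\<bar>
            + ennreal (\<bar>u (?\<gamma> s)\<bar> * (q * b powr (q - 1))) * ennreal \<bar>W (?\<gamma> t) - W (?\<gamma> s)\<bar>"
          using q by (subst ennreal_plus) (auto simp: ennreal_mult f_def)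
        also have "\<dots> \<le> ennreal (f (?\<gamma> t)) * ?I h + ennreal (\<bar>u (?\<gamma> s)\<bar> * (q * b powr (q - 1))) * ?I g"
          by (intro add_mono mult_left_mono du dW) auto
        also have "\<dots> = (\<integral>\<^sup>+ r. ennreal (f (?\<gamma> t)) * (h (?\<gamma> r) * indicator {s..t} r)
            + ennreal (\<bar>u (?\<gamma> s)\<bar> * (q * b powr (q - 1))) * (g (?\<gamma> r) * indicator \<Omega> (?\<gamma> r) * indicator {s..t} r) \<partial>lborel)"
        proof -
          have m1: "(\<lambda>r. h (?\<gamma> r) * indicator {s..t} r) \<in> borel_measurable lborel"
            using measurable_along_arc[OF c h(2), of "{s..t}"] st' by simp
          have "(\<lambda>y. g y * indicator \<Omega> y) \<in> borel_measurable (restrict_space borel X)"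
            by (intro measurable_restrict_space1 measurable_cut[OF g(2) \<Omega>b \<Omega>b]) simp
          then have m2: "(\<lambda>r. g (?\<gamma> r) * indicator \<Omega> (?\<gamma> r) * indicator {s..t} r) \<in> borel_measurable lborel"
            using measurable_along_arc[OF c, of "\<lambda>y. g y * indicator \<Omega> y" "{s..t}"] st' by simp
          have "?I g = (\<integral>\<^sup>+ r. g (?\<gamma> r) * indicator \<Omega> (?\<gamma> r) * indicator {s..t} r \<partial>lborel)"
            by (intro nn_integral_cong) (use bi(2) in \<open>auto split: split_indicator\<close>)
          then show ?thesis using m1 m2 by (simp add: nn_integral_add nn_integral_cmult)
        qed
        also have "\<dots> \<le> (\<integral>\<^sup>+ r \<in> {s..t}. H (?\<gamma> r) \<partial>lborel)"
        proof (rule nn_integral_mono)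
          fix r
          show "ennreal (f (?\<gamma> t)) * (h (?\<gamma> r) * indicator {s..t} r)
            + ennreal (\<bar>u (?\<gamma> s)\<bar> * (q * b powr (q - 1))) * (g (?\<gamma> r) * indicator \<Omega> (?\<gamma> r) * indicator {s..t} r)
            \<le> H (?\<gamma> r) * indicator {s..t} r"
          proof (cases "r \<in> {s..t}")
            case True
            have "\<bar>u (?\<gamma> s)\<bar> * (q * b powr (q - 1)) \<le> (\<bar>u (?\<gamma> r)\<bar> + \<epsilon>) * (\<theta> * A (?\<gamma> r))"
              by (rule mult_mono[OF u_le[OF True] A_le[OF True]]) (use \<epsilon> q in auto)
            then have "\<bar>u (?\<gamma> s)\<bar> * (q * b powr (q - 1)) \<le> \<theta> * (\<bar>u (?\<gamma> r)\<bar> + \<epsilon>) * A (?\<gamma> r)" by (simp add: mult_ac)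
            then have "ennreal (f (?\<gamma> t)) * h (?\<gamma> r) + ennreal (\<bar>u (?\<gamma> s)\<bar> * (q * b powr (q - 1))) * g (?\<gamma> r)
              \<le> ennreal (\<theta> * f (?\<gamma> r)) * h (?\<gamma> r) + ennreal (\<theta> * (\<bar>u (?\<gamma> r)\<bar> + \<epsilon>) * A (?\<gamma> r)) * g (?\<gamma> r)"
              using f_le[OF True] by (intro add_mono mult_right_mono ennreal_leI) auto
            then show ?thesis using True bi(1,2)[OF True] by (simp add: H_def f_def A_def)
          qed simp
        qed
        finally show "ennreal \<bar>u (?\<gamma> t) * W (?\<gamma> t) powr q - u (?\<gamma> s) * W (?\<gamma> s) powr q\<bar>
          \<le> (\<integral>\<^sup>+ r \<in> {s..t}. H (?\<gamma> r) \<partial>lborel)" by (simp add: f_def)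
      qed
    qed
  qed
qed

section \<open>Hardy inequality for the regularized weight\<close>

lemma AE_restrict_open:
  assumes m: "sets m = sets (restrict_space borel X)" and po: "proper_open X \<Omega>"
  shows "(AE y in restrict_space m \<Omega>. P y) \<longleftrightarrow> (AE y in m. y \<in> \<Omega> \<longrightarrow> P y)"
proof (rule AE_restrict_space_iff)
  have "space m = X" using sets_eq_imp_space_eq[OF m] by (simp add: space_restrict_space)
  moreover have "\<Omega> \<subseteq> X" using po by (simp add: proper_open_def)
  ultimately have "\<Omega> \<inter> space m = \<Omega>" by blast
  then show "\<Omega> \<inter> space m \<in> sets m" using proper_open_sets[OF po m] by simp
qed

text \<open>Letting \<open>\<theta>\<close> tend to \<open>1\<close> and \<open>\<epsilon>\<close> to \<open>0\<close> in the Leibniz rule.\<close>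

lemma leibniz_limit:
  fixes f h w a g :: real
  assumes le: "\<And>n. z \<le> ennreal ((1 + 1 / real (Suc n)) * f) * ennreal h
      + ennreal ((1 + 1 / real (Suc n)) * (a + 1 / real (Suc n)) * w) * ennreal g"
    and "0 \<le> f" "0 \<le> h" "0 \<le> a" "0 \<le> w" "0 \<le> g"
  shows "z \<le> ennreal (f * h + a * w * g)"
proof (rule LIMSEQ_le_const)
  have t: "(\<lambda>n. 1 / real (Suc n)) \<longlonglongrightarrow> 0" using LIMSEQ_inverse_real_of_nat by (simp add: inverse_eq_divide)
  have "(\<lambda>n. (1 + 1 / real (Suc n)) * f * h + (1 + 1 / real (Suc n)) * (a + 1 / real (Suc n)) * w * g)
      \<longlonglongrightarrow> (1 + 0) * f * h + (1 + 0) * (a + 0) * w * g"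
    by (intro tendsto_intros t)
  then show "(\<lambda>n. ennreal ((1 + 1 / real (Suc n)) * f * h + (1 + 1 / real (Suc n)) * (a + 1 / real (Suc n)) * w * g))
      \<longlonglongrightarrow> ennreal (f * h + a * w * g)" by (intro tendsto_ennrealI) simp
  show "\<exists>N. \<forall>n\<ge>N. z \<le> ennreal ((1 + 1 / real (Suc n)) * f * h + (1 + 1 / real (Suc n)) * (a + 1 / real (Suc n)) * w * g)"
  proof (intro exI allI impI)
    fix n :: nat
    let ?t = "1 / real (Suc n)"
    have t0: "0 \<le> ?t" by simp
    have "ennreal ((1 + ?t) * f) * ennreal h = ennreal ((1 + ?t) * f * h)"
      by (rule ennreal_mult''[symmetric]) fact
    moreover have "ennreal ((1 + ?t) * (a + ?t) * w) * ennreal g = ennreal ((1 + ?t) * (a + ?t) * w * g)"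
      by (rule ennreal_mult''[symmetric]) fact
    moreover have "ennreal ((1 + ?t) * f * h) + ennreal ((1 + ?t) * (a + ?t) * w * g)
        = ennreal ((1 + ?t) * f * h + (1 + ?t) * (a + ?t) * w * g)"
      by (rule ennreal_plus[symmetric]) (use assms(2-) t0 in auto)
    ultimately show "z \<le> ennreal ((1 + ?t) * f * h + (1 + ?t) * (a + ?t) * w * g)" using le[of n] by simp
  qed
qed

text \<open>The heart of the transfer.  Test the Hardy inequality for \<open>\<mu>\<close> with \<open>u W\<^sup>1\<^sup>/\<^sup>p\<close>: since
  \<open>g\<^sub>W \<le> c W / d\<close>, the gradient of the second factor contributes \<open>c/p\<close> times the left-hand side,
  which is finite and is absorbed if \<open>c\<close> is small.\<close>

lemma weighted_hardy:
  fixes u W k :: "'a::metric_space \<Rightarrow> real" and g h \<rho> :: "'a \<Rightarrow> ennreal"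
  assumes X: "complete X" and d\<mu>: "doubling X \<mu> C\<^sub>\<mu>" and po: "proper_open X \<Omega>" and p: "1 < p" and hardy: "hardy p X \<Omega> \<mu> C\<^sub>p"
    and W: "continuous_on \<Omega> W" "\<And>y. y \<in> \<Omega> \<Longrightarrow> 0 < W y"
    and Wlip: "\<And>x. x \<in> \<Omega> \<Longrightarrow> \<exists>e>0. \<exists>L\<ge>0. \<forall>y\<in>ball_in X x e. \<forall>z\<in>ball_in X x e. \<bar>W y - W z\<bar> \<le> L * dist y z"
    and k: "continuous_on \<Omega> k" "\<And>y. y \<in> \<Omega> \<Longrightarrow> 0 \<le> k y"
    and g: "g \<in> borel_measurable (restrict_space borel \<Omega>)" "\<And>y. y \<in> \<Omega> \<Longrightarrow> g y \<le> ennreal (k y)"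
    and \<rho>: "\<rho> \<in> borel_measurable (restrict_space borel \<Omega>)" "(\<integral>\<^sup>+ y. enn_powr (\<rho> y) p \<partial>restrict_space \<mu> \<Omega>) < \<infinity>" "ug_off \<Omega> \<rho> W g"
    and gc: "AE y in restrict_space \<mu> \<Omega>. g y \<le> ennreal (c / d_compl X \<Omega> y * W y)"
    and c: "0 \<le> c" "C\<^sub>p * 2 powr p * (c / p) powr p \<le> 1 / 2"
    and u: "u \<in> Lip_c X \<Omega>" and h: "ug_off X (\<lambda>_. 0) u h" "h \<in> borel_measurable (restrict_space borel X)"
    and hb: "\<And>y. y \<in> X \<Longrightarrow> h y \<le> ennreal b" "0 \<le> b"
  shows "(\<integral>\<^sup>+ y \<in> \<Omega>. ennreal (\<bar>u y\<bar> powr p / d_compl X \<Omega> y powr p * W y) \<partial>\<mu>)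
    \<le> ennreal (2 * (C\<^sub>p * 2 powr p)) * (\<integral>\<^sup>+ y \<in> \<Omega>. enn_powr (h y) p * ennreal (W y) \<partial>\<mu>)"
proof -
  let ?d = "d_compl X \<Omega>"
  define q where "q = 1 / p"
  have q: "0 < q" "q \<le> 1" using p by (auto simp: q_def)
  have p0: "0 < p" using p by simp
  have m: "sets \<mu> = sets (restrict_space borel X)" by (rule doubling_sets[OF d\<mu>])
  have sp: "space \<mu> = X" using sets_eq_imp_space_eq[OF m] by (simp add: space_restrict_space)
  have \<Omega>X: "\<Omega> \<subseteq> X" and Xc: "closed X" using po by (auto simp: proper_open_def)
  have \<Omega>m [measurable]: "\<Omega> \<in> sets \<mu>" by (rule proper_open_sets[OF po m])
  have \<Omega>b: "\<Omega> \<in> sets borel" by (rule proper_open_borel[OF po])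
  have cong: "borel_measurable \<mu> = (borel_measurable (restrict_space borel X) :: ('a \<Rightarrow> ennreal) set)"
    by (rule measurable_cong_sets) (use m in auto)
  obtain L where L: "L-lipschitz_on X u" and K: "compact (closure {y \<in> X. u y \<noteq> 0})" "closure {y \<in> X. u y \<noteq> 0} \<subseteq> \<Omega>"
    using u by (auto simp: Lip_c_def)
  define K where "K = closure {y \<in> X. u y \<noteq> 0}"
  have Kc: "compact K" "K \<subseteq> \<Omega>" "closed K" using K by (auto simp: K_def)
  have u0: "u y = 0" if "y \<in> X - K" for y using that closure_subset[of "{y \<in> X. u y \<noteq> 0}"] by (auto simp: K_def)
  have L0: "0 \<le> L" using L by (rule lipschitz_on_nonneg)
  have uc: "continuous_on X u" by (rule lipschitz_on_continuous_on[OF L])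
  have bnd: "\<exists>B>0. \<forall>y\<in>K. F y < B" if "continuous_on \<Omega> F" for F :: "'a \<Rightarrow> real"
  proof -
    have "compact (F ` K)" by (intro compact_continuous_image continuous_on_subset[OF that] Kc)
    then obtain B where "\<forall>z\<in>F ` K. norm z \<le> B" using compact_imp_bounded bounded_iff by blast
    then show ?thesis by (intro exI[of _ "\<bar>B\<bar> + 1"]) force
  qed
  obtain M where M0: "0 < M" and M: "\<forall>y\<in>K. \<bar>u y\<bar> < M"
    using bnd[of "\<lambda>y. \<bar>u y\<bar>"] uc \<Omega>X by (metis continuous_on_rabs continuous_on_subset)
  have uM: "\<bar>u y\<bar> \<le> M" if "y \<in> X" for y using u0[of y] M M0 that by (cases "y \<in> K") (auto intro: less_imp_le)
  define f where "f y = W y powr q" for y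
  define A where "A y = q * W y powr (q - 1)" for y
  have fc: "continuous_on \<Omega> f" and Ac: "continuous_on \<Omega> A"
    unfolding f_def A_def using W(2) by (intro continuous_intros W(1); force)+
  have A0: "0 \<le> A y" for y using q by (simp add: A_def)
  have f0: "0 \<le> f y" for y by (simp add: f_def)
  define v where "v y = u y * W y powr q" for y
  have v0: "v y = 0" if "y \<in> X - K" for y using u0[OF that] by (simp add: v_def)
  obtain Bf where Bf: "0 < Bf" "\<forall>y\<in>K. f y < Bf" using bnd[OF fc] by blast
  have vM: "\<bar>v y\<bar> \<le> M * Bf" if "y \<in> X" for y
  proof (cases "y \<in> K")
    case True
    have "\<bar>v y\<bar> = \<bar>u y\<bar> * f y" by (simp add: v_def f_def abs_mult)
    also have "\<dots> \<le> M * Bf" using M Bf True f0[of y] by (intro mult_mono) (auto intro: less_imp_le)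
    finally show ?thesis .
  next
    case False
    then show ?thesis using v0[of y] that M0 Bf(1) by simp
  qed
  have "\<exists>Lv. Lv-lipschitz_on X v"
  proof (rule lipschitz_of_compact_support[OF Kc(1) _ v0 vM])
    show "K \<subseteq> X" using Kc(2) \<Omega>X by blast
    fix x assume "x \<in> K"
    then have x: "x \<in> \<Omega>" using Kc(2) by blast
    obtain e1 L1 where e1: "0 < e1" "0 \<le> L1" "\<And>y z. y \<in> ball_in X x e1 \<Longrightarrow> z \<in> ball_in X x e1 \<Longrightarrow> \<bar>W y - W z\<bar> \<le> L1 * dist y z"
      using Wlip[OF x] by blast
    obtain e2 where e2: "0 < e2" "\<And>y. y \<in> ball_in X x e2 \<Longrightarrow> W x / 2 < W y \<and> W y < W x + 1"
    proof -
      have "W x / 2 < W x" "W x < W x + 1" using W(2)[OF x] by auto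
      then show thesis using continuous_near[OF po W(1) x] that by metis
    qed
    define D where "D = q * (W x / 2) powr (q - 1)"
    have D0: "0 \<le> D" using q by (simp add: D_def)
    define F where "F = (W x + 1) powr q"
    show "\<exists>e>0. \<exists>L\<ge>0. \<forall>y\<in>ball_in X x e. \<forall>z\<in>ball_in X x e. \<bar>v y - v z\<bar> \<le> L * dist y z"
    proof (rule exI[of _ "min e1 e2"], rule conjI[rotated], rule exI[of _ "F * L + M * (D * L1)"], intro conjI ballI)
      show "0 < min e1 e2" using e1 e2 by simp
      show "0 \<le> F * L + M * (D * L1)" using L0 M0 D0 e1 by (simp add: F_def)
      fix y z assume "y \<in> ball_in X x (min e1 e2)" "z \<in> ball_in X x (min e1 e2)"
      then have y: "y \<in> X" "y \<in> ball_in X x e1" "y \<in> ball_in X x e2" and z: "z \<in> X" "z \<in> ball_in X x e1" "z \<in> ball_in X x e2"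
        by (auto simp: ball_in_iff)
      have "\<bar>f y - f z\<bar> \<le> D * \<bar>W y - W z\<bar>"
        unfolding f_def D_def by (rule powr_diff_le) (use e2(2)[OF y(3)] e2(2)[OF z(3)] W(2)[OF x] q in auto)
      also have "\<dots> \<le> D * (L1 * dist y z)" by (intro mult_left_mono e1(3) y z D0)
      finally have df: "\<bar>f y - f z\<bar> \<le> D * (L1 * dist y z)" .
      have fy: "f y \<le> F" unfolding f_def F_def
        by (rule powr_mono2) (use e2(2)[OF y(3)] W(2)[OF x] q in auto)
      have "\<bar>v y - v z\<bar> = \<bar>f y * (u y - u z) + u z * (f y - f z)\<bar>" by (simp add: v_def f_def algebra_simps)
      also have "\<dots> \<le> \<bar>f y * (u y - u z)\<bar> + \<bar>u z * (f y - f z)\<bar>" by (rule abs_triangle_ineq)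
      also have "\<dots> \<le> F * (L * dist y z) + M * (D * (L1 * dist y z))"
        unfolding abs_mult
        by (intro add_mono mult_mono df uM z) (use fy f0[of y] lipschitz_onD[OF L y(1) z(1)] M0 in \<open>auto simp: dist_real_def F_def\<close>)
      finally show "\<bar>v y - v z\<bar> \<le> (F * L + M * (D * L1)) * dist y z" by (simp add: algebra_simps)
    qed
  qed
  then obtain Lv where Lv: "Lv-lipschitz_on X v" by blast
  have Lv0: "0 \<le> Lv" using Lv by (rule lipschitz_on_nonneg)
  have vsub: "closure {y \<in> X. v y \<noteq> 0} \<subseteq> K"
    unfolding K_def by (rule closure_mono) (auto simp: v_def)
  have vLip: "v \<in> Lip_c X \<Omega>"
    unfolding Lip_c_def
  proof (intro CollectI conjI exI[of _ Lv] Lv)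
    have "closure {y \<in> X. v y \<noteq> 0} = K \<inter> closure {y \<in> X. v y \<noteq> 0}" using vsub by blast
    moreover have "compact (K \<inter> closure {y \<in> X. v y \<noteq> 0})" by (rule compact_Int_closed[OF Kc(1)]) simp
    ultimately show "compact (closure {y \<in> X. v y \<noteq> 0})" by simp
    show "closure {y \<in> X. v y \<noteq> 0} \<subseteq> \<Omega>" using vsub Kc(2) by blast
  qed
  have fin: "\<exists>r>0. emeasure \<mu> (ball_in X x r) < \<infinity>" if "x \<in> X" for x
    using doubling_ball_finite[OF d\<mu> that, of 1] by (intro exI[of _ 1]) simp
  have vug: "ug_off X (\<lambda>_. 0) v (\<lambda>_. ennreal Lv)"
  proof (rule ug_off_of_locally_lipschitz)
    show "\<exists>e>0. \<exists>a\<ge>0. (\<forall>y\<in>ball_in X x e. ennreal a \<le> ennreal Lv) \<and>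
        (\<forall>y\<in>ball_in X x e. \<forall>z\<in>ball_in X x e. \<bar>v y - v z\<bar> \<le> a * dist y z)" for x
      using lipschitz_onD[OF Lv] Lv0 by (intro exI[of _ 1] conjI exI[of _ Lv]) (auto simp: ball_in_iff dist_real_def)
  qed simp
  obtain gv where gv: "minimal_wug p X \<mu> (\<lambda>x. ereal (v x)) gv" "gv \<in> borel_measurable \<mu>"
    using minimal_wug_exists[OF m _ doubling_sigma_compact[OF d\<mu> X] fin _ _ vug, of p] p Lv0 by (metis continuous_on_const less_imp_le)
  \<comment> \<open>a neighbourhood of the support on which all coefficients of the Leibniz rule are bounded\<close>
  define F where "F y = 2 * f y * b + 2 * (M + 1) * A y * k y" for y
  have Fc: "continuous_on \<Omega> F" unfolding F_def by (intro continuous_intros fc Ac k(1))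
  obtain B where B: "0 < B" "\<forall>y\<in>K. F y < B" using bnd[OF Fc] by blast
  define N where "N = {y \<in> \<Omega>. F y < B}"
  have N\<Omega>: "N \<subseteq> \<Omega>" by (auto simp: N_def)
  have Nb: "N \<in> sets borel"
  proof -
    have "F \<in> borel_measurable (restrict_space borel \<Omega>)" by (rule borel_measurable_continuous_on_restrict[OF Fc])
    then have "{y \<in> space (restrict_space borel \<Omega>). F y < B} \<in> sets (restrict_space borel \<Omega>)" by measurable
    then have "N \<in> sets (restrict_space borel \<Omega>)" by (simp add: N_def space_restrict_space)
    then show ?thesis using \<Omega>b by (auto simp: sets_restrict_space)
  qed
  have Nnhd: "\<exists>e>0. ball_in X x e \<subseteq> N" if "x \<in> K" for x
  proof -
    have x: "x \<in> \<Omega>" "F x < B" using that Kc(2) B(2) by auto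
    obtain e where "0 < e" "ball_in X x e \<subseteq> \<Omega>" "\<And>y. y \<in> ball_in X x e \<Longrightarrow> F x - 1 < F y \<and> F y < B"
      using continuous_near[OF po Fc x(1) _ x(2), of "F x - 1"] by auto
    then show ?thesis by (intro exI[of _ e]) (auto simp: N_def)
  qed
  define \<theta> where "\<theta> n = 1 + 1 / real (Suc n)" for n
  define \<epsilon> where "\<epsilon> n = 1 / real (Suc n)" for n
  have \<theta>: "1 < \<theta> n" "\<theta> n \<le> 2" and \<epsilon>: "0 < \<epsilon> n" "\<epsilon> n \<le> 1" for n by (auto simp: \<theta>_def \<epsilon>_def)
  define H where "H n y = (ennreal (\<theta> n * W y powr q) * h y + ennreal (\<theta> n * (\<bar>u y\<bar> + \<epsilon> n) * (q * W y powr (q - 1))) * g y) * indicator N y" for n y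
  note leib = leibniz_powr[OF po L Kc(3,2) u0 Nb N\<Omega> Nnhd W h \<rho>(3) g(1) \<rho>(1) q \<theta>(1) \<epsilon>(1), folded H_def]
  have Hm: "H n \<in> borel_measurable \<mu>" for n using leib(1)[of n n] unfolding cong H_def by simp
  have Hug: "ug_off X (\<lambda>y. \<rho> y * indicator \<Omega> y) v (H n)" for n
    using leib(2)[of n n] unfolding v_def H_def by simp
  have \<rho>'m: "(\<lambda>y. \<rho> y * indicator \<Omega> y) \<in> borel_measurable \<mu>"
    unfolding cong by (intro measurable_restrict_space1 measurable_cut[OF \<rho>(1) \<Omega>b \<Omega>b]) simp
  have \<rho>'p: "(\<integral>\<^sup>+ y. enn_powr (\<rho> y * indicator \<Omega> y) p \<partial>\<mu>) < \<infinity>"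
  proof -
    have "(\<integral>\<^sup>+ y. enn_powr (\<rho> y * indicator \<Omega> y) p \<partial>\<mu>) = (\<integral>\<^sup>+ y \<in> \<Omega>. enn_powr (\<rho> y) p \<partial>\<mu>)"
      by (intro nn_integral_cong) (auto split: split_indicator)
    also have "\<dots> = (\<integral>\<^sup>+ y. enn_powr (\<rho> y) p \<partial>restrict_space \<mu> \<Omega>)"
      by (rule nn_integral_restrict_space[symmetric]) (use \<Omega>m sp \<Omega>X in \<open>simp add: Int_absorb2\<close>)
    finally show ?thesis using \<rho>(2) by simp
  qed
  have HB: "H n y \<le> ennreal B" if "y \<in> X" for n y
  proof (cases "y \<in> N")
    case True
    then have y: "y \<in> \<Omega>" "F y < B" by (auto simp: N_def)
    have "H n y \<le> ennreal (\<theta> n * f y) * ennreal b + ennreal (\<theta> n * (\<bar>u y\<bar> + \<epsilon> n) * A y) * ennreal (k y)"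
      using True hb(1)[OF that] g(2)[OF y(1)] by (auto simp: H_def f_def A_def intro!: add_mono mult_left_mono)
    also have "\<dots> \<le> ennreal (2 * f y) * ennreal b + ennreal (2 * (M + 1) * A y) * ennreal (k y)"
      using \<theta>[of n] \<epsilon>[of n] uM[OF that] M0 f0[of y] A0[of y]
      by (intro add_mono mult_right_mono ennreal_leI mult_mono) auto
    also have "\<dots> = ennreal (F y)"
      using hb(2) k(2)[OF y(1)] f0[of y] A0[of y] M0 by (simp add: F_def ennreal_mult ennreal_plus)
    also have "\<dots> \<le> ennreal B" using y(2) by (intro ennreal_leI) simp
    finally show ?thesis .
  qed (simp add: H_def)
  have gvH: "AE y in \<mu>. gv y \<le> H n y" for n
  proof -
    have "weak_upper_gradient p X \<mu> (\<lambda>x. ereal (v x)) (H n)"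
      by (rule weak_upper_gradientI[OF m _ Hm \<rho>'m \<rho>'p Hug]) (use p in simp)
    moreover have "Lp_loc p X \<mu> (H n)"
      by (rule Lp_loc_of_le_continuous[OF m p0 Hm continuous_on_const _ HB fin]) (use B(1) in simp)
    ultimately show ?thesis using gv(1) by (auto simp: minimal_wug_def)
  qed
  define Fu where "Fu y = ennreal (\<bar>u y\<bar> powr p / ?d y powr p * W y)" for y
  define Fh where "Fh y = enn_powr (h y) p * ennreal (W y)" for y
  have Wq: "W y powr (q - 1) * W y = f y" if "y \<in> \<Omega>" for y
    using W(2)[OF that] powr_add[of "W y" "q - 1" 1] by (simp add: f_def)
  have bound: "gv y \<le> ennreal (f y) * (h y + ennreal (c / p * (\<bar>u y\<bar> / ?d y)))"
    if y: "y \<in> \<Omega>" and le: "\<And>n. gv y \<le> H n y" and gy: "g y \<le> ennreal (c / ?d y * W y)" for y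
  proof (cases "y \<in> N")
    case False
    then show ?thesis using le[of 0] by (simp add: H_def)
  next
    case True
    have dy: "0 < ?d y" by (rule d_compl_pos[OF po y])
    have yX: "y \<in> X" using y \<Omega>X by blast
    obtain h' where h': "h y = ennreal h'" "0 \<le> h'" using hb(1)[OF yX] by (cases "h y") (auto simp: top_unique)
    obtain g' where g': "g y = ennreal g'" "0 \<le> g'" using g(2)[OF y] by (cases "g y") (auto simp: top_unique)
    have g'le: "g' \<le> c / ?d y * W y" using gy g' c(1) dy W(2)[OF y] by (simp add: ennreal_le_iff)
    have "gv y \<le> ennreal (f y * h' + \<bar>u y\<bar> * A y * g')"
    proof (rule leibniz_limit)
      fix n
      show "gv y \<le> ennreal ((1 + 1 / real (Suc n)) * f y) * ennreal h' + ennreal ((1 + 1 / real (Suc n)) * (\<bar>u y\<bar> + 1 / real (Suc n)) * A y) * ennreal g'"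
        using le[of n] True by (simp add: H_def \<theta>_def \<epsilon>_def f_def A_def h' g')
    qed (use f0 A0 h' g' in auto)
    also have "\<dots> \<le> ennreal (f y * (h' + c / p * (\<bar>u y\<bar> / ?d y)))"
    proof (rule ennreal_leI)
      have "\<bar>u y\<bar> * A y * g' \<le> \<bar>u y\<bar> * A y * (c / ?d y * W y)" using g'le A0[of y] by (intro mult_left_mono) auto
      also have "\<dots> = (W y powr (q - 1) * W y) * (c / p * (\<bar>u y\<bar> / ?d y))" by (simp add: A_def q_def)
      also have "\<dots> = f y * (c / p * (\<bar>u y\<bar> / ?d y))" unfolding Wq[OF y] ..
      finally show "f y * h' + \<bar>u y\<bar> * A y * g' \<le> f y * (h' + c / p * (\<bar>u y\<bar> / ?d y))" by (simp add: distrib_left)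
    qed
    also have "\<dots> = ennreal (f y) * ennreal (h' + c / p * (\<bar>u y\<bar> / ?d y))" by (rule ennreal_mult'[OF f0])
    also have "ennreal (h' + c / p * (\<bar>u y\<bar> / ?d y)) = h y + ennreal (c / p * (\<bar>u y\<bar> / ?d y))"
      unfolding h' by (rule ennreal_plus) (use h'(2) c(1) p0 dy in auto)
    finally show ?thesis .
  qed
  have bound_p: "enn_powr (gv y) p \<le> ennreal (2 powr p) * (Fh y + ennreal ((c / p) powr p) * Fu y)"
    if y: "y \<in> \<Omega>" and le: "\<And>n. gv y \<le> H n y" and gy: "g y \<le> ennreal (c / ?d y * W y)" for y
  proof -
    have dy: "0 < ?d y" by (rule d_compl_pos[OF po y])
    have "enn_powr (gv y) p \<le> enn_powr (ennreal (f y) * (h y + ennreal (c / p * (\<bar>u y\<bar> / ?d y)))) p"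
      by (rule enn_powr_mono[OF bound[OF that]]) (use p0 in auto)
    also have "\<dots> = ennreal (W y) * enn_powr (h y + ennreal (c / p * (\<bar>u y\<bar> / ?d y))) p"
      using W(2)[OF y] p0 f0[of y] by (simp add: enn_powr_mult[OF p0]) (simp add: f_def powr_powr q_def)
    also have "\<dots> \<le> ennreal (W y) * (ennreal (2 powr p) * (enn_powr (h y) p + enn_powr (ennreal (c / p * (\<bar>u y\<bar> / ?d y))) p))"
      by (intro mult_left_mono enn_powr_add_le p0) simp
    also have "enn_powr (ennreal (c / p * (\<bar>u y\<bar> / ?d y))) p = ennreal ((c / p) powr p * (\<bar>u y\<bar> powr p / ?d y powr p))"
    proof -
      have "0 \<le> c / p * (\<bar>u y\<bar> / ?d y)" using c(1) p0 dy by simp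
      then show ?thesis using c(1) p0 dy by (simp add: powr_mult powr_divide)
    qed
    also have "ennreal (W y) * (ennreal (2 powr p) * (enn_powr (h y) p + ennreal ((c / p) powr p * (\<bar>u y\<bar> powr p / ?d y powr p))))
        = ennreal (2 powr p) * (Fh y + ennreal ((c / p) powr p) * Fu y)"
    proof -
      have "ennreal ((c / p) powr p) * Fu y = ennreal ((c / p) powr p * (\<bar>u y\<bar> powr p / ?d y powr p)) * ennreal (W y)"
      proof -
        have "ennreal (\<bar>u y\<bar> powr p / ?d y powr p * W y) = ennreal (\<bar>u y\<bar> powr p / ?d y powr p) * ennreal (W y)"
          by (rule ennreal_mult'') (use W(2)[OF y] in simp)
        moreover have "ennreal ((c / p) powr p * (\<bar>u y\<bar> powr p / ?d y powr p))
            = ennreal ((c / p) powr p) * ennreal (\<bar>u y\<bar> powr p / ?d y powr p)"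
          by (rule ennreal_mult') simp
        ultimately show ?thesis by (simp only: Fu_def mult.assoc)
      qed
      then show ?thesis by (simp add: Fh_def distrib_left mult_ac)
    qed
    finally show ?thesis .
  qed
  have W\<Omega>: "W \<in> borel_measurable (restrict_space borel \<Omega>)" by (rule borel_measurable_continuous_on_restrict[OF W(1)])
  have u\<Omega>: "u \<in> borel_measurable (restrict_space borel \<Omega>)" by (rule borel_measurable_continuous_on_restrict[OF continuous_on_subset[OF uc \<Omega>X]])
  have d\<Omega>: "?d \<in> borel_measurable (restrict_space borel \<Omega>)" by (rule borel_measurable_continuous_on_restrict[OF d_compl_continuous])
  have h\<Omega>: "h \<in> borel_measurable (restrict_space borel \<Omega>)" by (rule measurable_restrict_mono[OF h(2) \<Omega>X])
  have cut: "(\<lambda>y. F y * indicator \<Omega> y) \<in> borel_measurable \<mu>" if "F \<in> borel_measurable (restrict_space borel \<Omega>)" for F :: "'a \<Rightarrow> ennreal"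
    unfolding cong by (intro measurable_restrict_space1 measurable_cut[OF that \<Omega>b \<Omega>b]) simp
  have Fum [measurable]: "(\<lambda>y. Fu y * indicator \<Omega> y) \<in> borel_measurable \<mu>"
    unfolding Fu_def by (rule cut) (use W\<Omega> u\<Omega> d\<Omega> in measurable)
  have Fhm [measurable]: "(\<lambda>y. Fh y * indicator \<Omega> y) \<in> borel_measurable \<mu>"
    unfolding Fh_def by (rule cut) (use W\<Omega> h\<Omega> in measurable)
  define I where "I = (\<integral>\<^sup>+ y \<in> \<Omega>. Fu y \<partial>\<mu>)"
  define J where "J = (\<integral>\<^sup>+ y \<in> \<Omega>. Fh y \<partial>\<mu>)"
  have "I = (\<integral>\<^sup>+ y \<in> \<Omega>. ennreal (\<bar>v y\<bar> powr p / ?d y powr p) \<partial>\<mu>)"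
    unfolding I_def
  proof (rule nn_integral_cong)
    fix y
    have "\<bar>v y\<bar> powr p = \<bar>u y\<bar> powr p * W y" if "y \<in> \<Omega>"
      using W(2)[OF that] p0 by (simp add: v_def abs_mult powr_mult powr_powr q_def)
    then show "Fu y * indicator \<Omega> y = ennreal (\<bar>v y\<bar> powr p / ?d y powr p) * indicator \<Omega> y"
      by (auto simp: Fu_def split: split_indicator)
  qed
  also have "\<dots> \<le> ennreal C\<^sub>p * (\<integral>\<^sup>+ y \<in> \<Omega>. enn_powr (gv y) p \<partial>\<mu>)"
    using hardy vLip gv(1) unfolding hardy_def by blast
  also have "(\<integral>\<^sup>+ y \<in> \<Omega>. enn_powr (gv y) p \<partial>\<mu>)
      \<le> (\<integral>\<^sup>+ y. ennreal (2 powr p) * (Fh y * indicator \<Omega> y + ennreal ((c / p) powr p) * (Fu y * indicator \<Omega> y)) \<partial>\<mu>)"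
  proof (rule nn_integral_mono_AE)
    have "AE y in \<mu>. \<forall>n. gv y \<le> H n y" using gvH by (simp add: AE_all_countable)
    moreover have "AE y in \<mu>. y \<in> \<Omega> \<longrightarrow> g y \<le> ennreal (c / ?d y * W y)" using gc by (simp add: AE_restrict_open[OF m po])
    ultimately show "AE y in \<mu>. enn_powr (gv y) p * indicator \<Omega> y
        \<le> ennreal (2 powr p) * (Fh y * indicator \<Omega> y + ennreal ((c / p) powr p) * (Fu y * indicator \<Omega> y))"
      by eventually_elim (use bound_p in \<open>auto split: split_indicator\<close>)
  qed
  also have "\<dots> = ennreal (2 powr p) * (J + ennreal ((c / p) powr p) * I)"
    unfolding I_def J_def by (subst nn_integral_cmult, measurable) (subst nn_integral_add, simp_all add: nn_integral_cmult)
  finally have abs: "I \<le> ennreal C\<^sub>p * (ennreal (2 powr p) * (J + ennreal ((c / p) powr p) * I))"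
    by (simp add: mult_left_mono)
  have Ifin: "I < \<infinity>"
  proof (cases "K = {}")
    case True
    have "I = (\<integral>\<^sup>+ y. 0 \<partial>\<mu>)"
      unfolding I_def
      by (rule nn_integral_cong) (use True u0 \<Omega>X p0 in \<open>auto simp: Fu_def split: split_indicator\<close>)
    then have "I = 0" by simp
    then show ?thesis by simp
  next
    case False
    then obtain x0 where x0: "x0 \<in> K" by blast
    then have x0X: "x0 \<in> X" using Kc(2) \<Omega>X by blast
    have "continuous_on \<Omega> (\<lambda>y. \<bar>u y\<bar> powr p / ?d y powr p * W y)"
      using d_compl_pos[OF po] p0 by (intro continuous_intros continuous_on_powr' W(1) continuous_on_subset[OF uc \<Omega>X] d_compl_continuous) force+
    then obtain B' where B': "0 < B'" "\<forall>y\<in>K. \<bar>u y\<bar> powr p / ?d y powr p * W y < B'" using bnd by blast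
    obtain R where R: "\<And>y. y \<in> K \<Longrightarrow> dist x0 y \<le> R" using compact_imp_bounded[OF Kc(1)] bounded_any_center[of K x0] by auto
    have "I \<le> (\<integral>\<^sup>+ y. ennreal B' * indicator (ball_in X x0 (R + 1)) y \<partial>\<mu>)"
      unfolding I_def
    proof (rule nn_integral_mono)
      fix y
      show "Fu y * indicator \<Omega> y \<le> ennreal B' * indicator (ball_in X x0 (R + 1)) y"
      proof (cases "y \<in> K")
        case True
        have "y \<in> ball_in X x0 (R + 1)" using R[OF True] True Kc(2) \<Omega>X by (force simp: ball_in_iff)
        moreover have "Fu y \<le> ennreal B'" unfolding Fu_def using B'(2) True by (intro ennreal_leI) force
        ultimately show ?thesis by (auto split: split_indicator)
      next
        case False
        then show ?thesis using u0[of y] \<Omega>X p0 by (auto simp: Fu_def split: split_indicator)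
      qed
    qed
    also have "\<dots> < \<infinity>"
      using doubling_ball_finite[OF d\<mu> x0X, of "R + 1"] ball_in_sets[OF m]
      by (simp add: nn_integral_cmult_indicator ennreal_mult_less_top)
    finally show ?thesis .
  qed
  have Cp: "1 \<le> C\<^sub>p" using hardy by (simp add: hardy_def)
  have "I \<le> ennreal (2 * (C\<^sub>p * 2 powr p)) * J"
  proof (cases "J = \<infinity>")
    case True
    then show ?thesis using Cp by (simp add: ennreal_mult_top)
  next
    case False
    then obtain j where j: "J = ennreal j" "0 \<le> j" by (cases J) auto
    obtain i where i: "I = ennreal i" "0 \<le> i" using Ifin by (cases I) auto
    let ?a = "(c / p) powr p"
    have "ennreal C\<^sub>p * (ennreal (2 powr p) * (J + ennreal ?a * I)) = ennreal (C\<^sub>p * (2 powr p * (j + ?a * i)))"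
      unfolding i j using i(2) j(2) Cp by (subst ennreal_mult', simp, subst ennreal_mult', simp, subst ennreal_plus, simp_all add: ennreal_mult')
    then have "i \<le> C\<^sub>p * (2 powr p * (j + ?a * i))"
      using abs i j Cp by (simp add: ennreal_le_iff)
    also have "\<dots> = C\<^sub>p * 2 powr p * j + (C\<^sub>p * 2 powr p * ?a) * i" by (simp add: algebra_simps)
    also have "\<dots> \<le> C\<^sub>p * 2 powr p * j + 1 / 2 * i" using c(2) i(2) by (intro add_left_mono mult_right_mono) auto
    finally have "i \<le> 2 * (C\<^sub>p * 2 powr p) * j" by simp
    then have "ennreal i \<le> ennreal (2 * (C\<^sub>p * 2 powr p) * j)" by (rule ennreal_leI)
    also have "\<dots> = ennreal (2 * (C\<^sub>p * 2 powr p)) * ennreal j" by (rule ennreal_mult'') (rule j)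
    finally show ?thesis unfolding i j .
  qed
  then show ?thesis unfolding I_def J_def Fu_def Fh_def .
qed

section \<open>Discretization at a Whitney scale\<close>

lemma powr_add_le:
  fixes s t p :: real
  assumes "0 < p" "0 \<le> s" "0 \<le> t" shows "(s + t) powr p \<le> 2 powr p * (s powr p + t powr p)"
proof -
  have "(s + t) powr p \<le> (2 * max s t) powr p" by (rule powr_mono2) (use assms in auto)
  also have "\<dots> = 2 powr p * max s t powr p" by (rule powr_mult)
  also have "\<dots> \<le> 2 powr p * (s powr p + t powr p)"
    using assms by (intro mult_left_mono) (auto simp: max_def)
  finally show ?thesis .
qed

context whitney
begin

text \<open>Sums over the cover, as series in the extended numbers, so that they can be exchanged with integrals.\<close>

definition isum :: "(nat \<Rightarrow> ennreal) \<Rightarrow> ennreal" where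
  "isum F = (\<Sum>j. indicator I j * F j)"

lemma isum_add: "isum (\<lambda>j. F j + G j) = isum F + isum G"
  by (simp add: isum_def distrib_left suminf_add)

lemma isum_cmult: "isum (\<lambda>j. c * F j) = c * isum F"
  by (simp add: isum_def mult.left_commute[of _ c])

lemma isum_mono: "(\<And>j. j \<in> I \<Longrightarrow> F j \<le> G j) \<Longrightarrow> isum F \<le> isum G"
  unfolding isum_def by (intro suminf_le summableI) (auto split: split_indicator)

lemma le_isum: "j \<in> I \<Longrightarrow> F j \<le> isum F"
  using sum_le_suminf[of "\<lambda>j. indicator I j * F j" "{j}"] by (simp add: isum_def)

lemma isum_nn_integral:
  assumes "\<And>j. j \<in> I \<Longrightarrow> f j \<in> borel_measurable m"
  shows "(\<integral>\<^sup>+ y. isum (\<lambda>j. f j y) \<partial>m) = isum (\<lambda>j. \<integral>\<^sup>+ y. f j y \<partial>m)"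
proof -
  have m: "(\<lambda>y. indicator I j * f j y) \<in> borel_measurable m" for j
    using assms[of j] by (cases "j \<in> I") auto
  have "(\<integral>\<^sup>+ y. indicator I j * f j y \<partial>m) = indicator I j * (\<integral>\<^sup>+ y. f j y \<partial>m)" for j
    by (auto split: split_indicator)
  then show ?thesis unfolding isum_def by (subst nn_integral_suminf[OF m]) simp
qed

lemma cover_le_isum:
  assumes "sets m = sets (restrict_space borel X)" "(\<lambda>y. f y * indicator \<Omega> y) \<in> borel_measurable m"
  shows "(\<integral>\<^sup>+ y \<in> \<Omega>. f y \<partial>m) \<le> isum (\<lambda>j. \<integral>\<^sup>+ y \<in> B \<kappa> j. f y \<partial>m)"
proof -
  have fm: "(\<lambda>y. f y * indicator (B \<kappa> j) y) \<in> borel_measurable m" if "j \<in> I" for j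
  proof -
    have [measurable]: "B \<kappa> j \<in> sets m" unfolding B_def by (rule ball_in_sets[OF assms(1)])
    have "(\<lambda>y. f y * indicator (B \<kappa> j) y) = (\<lambda>y. f y * indicator \<Omega> y * indicator (B \<kappa> j) y)"
      using cover that by (auto simp: fun_eq_iff split: split_indicator)
    then show ?thesis using assms(2) by simp
  qed
  have "(\<integral>\<^sup>+ y \<in> \<Omega>. f y \<partial>m) \<le> (\<integral>\<^sup>+ y. isum (\<lambda>j. f y * indicator (B \<kappa> j) y) \<partial>m)"
  proof (rule nn_integral_mono)
    fix y show "f y * indicator \<Omega> y \<le> isum (\<lambda>j. f y * indicator (B \<kappa> j) y)"
    proof (cases "y \<in> \<Omega>")
      case True
      then obtain j where "j \<in> I" "y \<in> B \<kappa> j" using cover by blast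
      then show ?thesis using le_isum[of j "\<lambda>j. f y * indicator (B \<kappa> j) y"] True by simp
    qed simp
  qed
  then show ?thesis by (simp add: isum_nn_integral[OF fm])
qed

lemma isum_overlap:
  assumes m: "sets m = sets (restrict_space borel X)" and f: "(\<lambda>y. f y * indicator \<Omega> y) \<in> borel_measurable m"
  shows "isum (\<lambda>j. \<integral>\<^sup>+ y \<in> B (3 / 4) j. f y \<partial>m) \<le> ennreal C * (\<integral>\<^sup>+ y \<in> \<Omega>. f y \<partial>m)"
proof -
  have sp: "space m = X" using sets_eq_imp_space_eq[OF m] by (simp add: space_restrict_space)
  have fm: "(\<lambda>y. f y * indicator (B (3 / 4) j) y) \<in> borel_measurable m" if "j \<in> I" for j
  proof -
    have [measurable]: "B (3 / 4) j \<in> sets m" unfolding B_def by (rule ball_in_sets[OF m])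
    have "(\<lambda>y. f y * indicator (B (3 / 4) j) y) = (\<lambda>y. f y * indicator \<Omega> y * indicator (B (3 / 4) j) y)"
      using B_subset[OF that, of "3 / 4"] by (auto simp: fun_eq_iff split: split_indicator)
    then show ?thesis using f by simp
  qed
  have "isum (\<lambda>j. \<integral>\<^sup>+ y \<in> B (3 / 4) j. f y \<partial>m) = (\<integral>\<^sup>+ y. isum (\<lambda>j. f y * indicator (B (3 / 4) j) y) \<partial>m)"
    by (rule isum_nn_integral[OF fm, symmetric])
  also have "\<dots> \<le> (\<integral>\<^sup>+ y. ennreal C * (f y * indicator \<Omega> y) \<partial>m)"
  proof (rule nn_integral_mono)
    fix y assume "y \<in> space m"
    then have y: "y \<in> X" by (simp add: sp)
    define T where "T = {j\<in>I. y \<in> B (3 / 4) j}"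
    have T: "finite T" "real (card T) \<le> C" using overlap[OF y] by (auto simp: T_def)
    have "isum (\<lambda>j. f y * indicator (B (3 / 4) j) y) = (\<Sum>j\<in>T. indicator I j * (f y * indicator (B (3 / 4) j) y))"
      unfolding isum_def by (rule suminf_finite[OF T(1)]) (auto simp: T_def split: split_indicator)
    also have "\<dots> = (\<Sum>j\<in>T. f y)" by (intro sum.cong) (auto simp: T_def)
    also have "\<dots> = of_nat (card T) * f y" by simp
    also have "\<dots> \<le> ennreal C * (f y * indicator \<Omega> y)"
    proof (cases "T = {}")
      case False
      then have "y \<in> \<Omega>" using B_subset[of _ "3 / 4"] by (auto simp: T_def)
      then show ?thesis using T by (auto simp: ennreal_of_nat_eq_real_of_nat intro!: mult_right_mono ennreal_leI)
    qed simp
    finally show "isum (\<lambda>j. f y * indicator (B (3 / 4) j) y) \<le> ennreal C * (f y * indicator \<Omega> y)" .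
  qed
  also have "\<dots> = ennreal C * (\<integral>\<^sup>+ y \<in> \<Omega>. f y \<partial>m)" by (rule nn_integral_cmult[OF f])
  finally show ?thesis .
qed

lemma finite_meeting_compact:
  assumes "compact K" "K \<subseteq> \<Omega>"
  shows "finite {i\<in>I. B \<kappa> i \<inter> K \<noteq> {}}"
proof -
  have "K \<subseteq> (\<Union>j\<in>I. ball (x j) (\<kappa> * d (x j)))" using assms(2) cover by (fastforce simp: B_def ball_in_def)
  then obtain F where F: "F \<subseteq> I" "finite F" "K \<subseteq> (\<Union>j\<in>F. ball (x j) (\<kappa> * d (x j)))"
    using compactE_image[OF assms(1), of I "\<lambda>j. ball (x j) (\<kappa> * d (x j))"] by (metis open_ball)
  have "{i\<in>I. B \<kappa> i \<inter> K \<noteq> {}} \<subseteq> (\<Union>j\<in>F. nbrs j)"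
  proof
    fix i assume "i \<in> {i\<in>I. B \<kappa> i \<inter> K \<noteq> {}}"
    then obtain y where i: "i \<in> I" and y: "y \<in> B \<kappa> i" "y \<in> K" by blast
    then obtain j where j: "j \<in> F" "y \<in> ball (x j) (\<kappa> * d (x j))" using F(3) by blast
    have "y \<in> B \<kappa> j" using j y B_subset_X by (auto simp: B_def ball_in_def)
    moreover have "y \<in> B (2 * \<kappa>) i" using y B_mono[of \<kappa> "2 * \<kappa>" i] i \<kappa> by auto
    ultimately show "i \<in> (\<Union>j\<in>F. nbrs j)" using i j(1) by (auto simp: nbrs_def)
  qed
  moreover have "finite (\<Union>j\<in>F. nbrs j)" using F(1,2) nbrs_finite by blast
  ultimately show ?thesis by (rule finite_subset)
qed

text \<open>The support lies in finitely many balls \<open>2 B\<^sub>i\<close>, and their closures are compact and contained in \<open>\<Omega>\<close> because \<open>X\<close> is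
  complete and doubling.\<close>

lemma smooth_Lip_c:
  assumes dbl: "doubling X m C'" and X: "complete X" and fin: "finite {i\<in>I. a i \<noteq> 0}"
  shows "smooth a \<in> Lip_c X \<Omega>"
proof -
  define F where "F = {i\<in>I. a i \<noteq> 0}"
  have F: "finite F" "F \<subseteq> I" using fin by (auto simp: F_def)
  have eq: "smooth a y = (\<Sum>i\<in>F. a i * \<phi> i y)" for y
  proof -
    have "smooth a y = (\<Sum>\<^sub>\<infinity>i\<in>F. a i * \<phi> i y)"
      unfolding smooth_def by (rule infsum_cong_neutral) (auto simp: F_def)
    then show ?thesis using F(1) by simp
  qed
  define L where "L = (\<Sum>i\<in>F. \<bar>a i\<bar> * (C / (\<kappa> * d (x i))))"
  have L: "L-lipschitz_on X (smooth a)"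
  proof (rule lipschitz_onI)
    fix y z assume yz: "y \<in> X" "z \<in> X"
    have "dist (smooth a y) (smooth a z) = \<bar>\<Sum>i\<in>F. a i * (\<phi> i y - \<phi> i z)\<bar>"
      by (simp add: eq dist_real_def sum_subtractf right_diff_distrib)
    also have "\<dots> \<le> (\<Sum>i\<in>F. \<bar>a i * (\<phi> i y - \<phi> i z)\<bar>)" by (rule sum_abs)
    also have "\<dots> \<le> (\<Sum>i\<in>F. \<bar>a i\<bar> * (C / (\<kappa> * d (x i)) * dist y z))"
      unfolding abs_mult by (intro sum_mono mult_left_mono \<phi>_lipschitz yz) (use F in auto)
    also have "\<dots> = L * dist y z" by (simp add: L_def sum_distrib_right mult.assoc)
    finally show "dist (smooth a y) (smooth a z) \<le> L * dist y z" .
  next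
    show "0 \<le> L" unfolding L_def using C_pos \<kappa> centre(3) F(2)
      by (intro sum_nonneg mult_nonneg_nonneg divide_nonneg_nonneg) (auto intro: less_imp_le)
  qed
  define S where "S = (\<Union>i\<in>F. X \<inter> cball (x i) (2 * \<kappa> * d (x i)))"
  have Xc: "closed X" using po by (simp add: proper_open_def)
  have comp: "compact S"
    unfolding S_def
  proof (rule compact_UN[OF F(1)])
    fix i assume i: "i \<in> F"
    show "compact (X \<inter> cball (x i) (2 * \<kappa> * d (x i)))"
      by (rule doubling_proper[OF dbl X centre(2), of i _ "2 * \<kappa> * d (x i) + 1"])
         (use i F Xc in \<open>auto simp: ball_in_iff closed_Int\<close>)
  qed
  have S\<Omega>: "S \<subseteq> \<Omega>"
  proof
    fix y assume "y \<in> S"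
    then obtain i where i: "i \<in> F" "y \<in> X" "dist (x i) y \<le> 2 * \<kappa> * d (x i)" by (auto simp: S_def)
    have iI: "i \<in> I" using i F by blast
    have "2 * \<kappa> * d (x i) \<le> 1 / 4 * d (x i)" using \<kappa> centre(3)[OF iI] by (intro mult_right_mono) auto
    then have "dist (x i) y < 1 * d (x i)" using i(3) centre(3)[OF iI] by linarith
    then have "y \<in> B 1 i" using i(2) by (simp add: B_def ball_in_iff)
    then show "y \<in> \<Omega>" using B_subset[OF iI, of 1] by auto
  qed
  have "{y \<in> X. smooth a y \<noteq> 0} \<subseteq> S"
  proof
    fix y assume "y \<in> {y \<in> X. smooth a y \<noteq> 0}"
    then have y: "y \<in> X" "(\<Sum>i\<in>F. a i * \<phi> i y) \<noteq> 0" by (auto simp: eq)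
    then obtain i where i: "i \<in> F" "a i * \<phi> i y \<noteq> 0" by (meson sum.neutral)
    then have "y \<in> B (2 * \<kappa>) i" using \<phi>_support[of i y] F(2) y(1) by auto
    then have "y \<in> X \<inter> cball (x i) (2 * \<kappa> * d (x i))" by (simp add: B_def ball_in_iff)
    then show "y \<in> S" unfolding S_def using i(1) by (rule UN_I[rotated])
  qed
  then have cl: "closure {y \<in> X. smooth a y \<noteq> 0} \<subseteq> S"
    using comp by (intro closure_minimal compact_imp_closed)
  show ?thesis
    unfolding Lip_c_def
  proof (intro CollectI conjI exI[of _ L] L)
    have "closure {y \<in> X. smooth a y \<noteq> 0} = S \<inter> closure {y \<in> X. smooth a y \<noteq> 0}" using cl by blast
    moreover have "compact (S \<inter> closure {y \<in> X. smooth a y \<noteq> 0})" by (rule compact_Int_closed[OF comp]) simp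
    ultimately show "compact (closure {y \<in> X. smooth a y \<noteq> 0})" by simp
    show "closure {y \<in> X. smooth a y \<noteq> 0} \<subseteq> \<Omega>" using cl S\<Omega> by blast
  qed
qed

text \<open>The \<open>\<ell>\<^sup>p\<close>-sum of the local Lipschitz constants over the core balls is an upper gradient whose \<open>p\<close>-th power
  is a plain sum.\<close>

lemma smooth_upper_gradient:
  assumes p: "0 < p" and S: "smooth a \<in> Lip_c X \<Omega>" and L: "L-lipschitz_on X (smooth a)"
    and E: "\<And>j i. j \<in> I \<Longrightarrow> i \<in> nbrs j \<Longrightarrow> \<bar>a i - a j\<bar> \<le> E j"
  defines "h \<equiv> \<lambda>y. min (ennreal L)
     (enn_powr (isum (\<lambda>j. ennreal ((4 * C\<^sup>2 * E j / (\<kappa> * d (x j))) powr p) * indicator (B \<kappa> j) y)) (1 / p))"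
  shows "h \<in> borel_measurable (restrict_space borel X)" "ug_off X (\<lambda>_. 0) (smooth a) h"
proof -
  have [measurable]: "B \<kappa> j \<in> sets (restrict_space borel X)" for j
    unfolding B_def by (rule ball_in_sets) simp
  show hm: "h \<in> borel_measurable (restrict_space borel X)"
    unfolding h_def isum_def by measurable
  have L0: "0 \<le> L" using L by (rule lipschitz_on_nonneg)
  show "ug_off X (\<lambda>_. 0) (smooth a) h"
  proof (rule ug_off_of_locally_lipschitz[OF hm])
    fix y assume y: "y \<in> X"
    show "\<exists>e>0. \<exists>b\<ge>0. (\<forall>z\<in>ball_in X y e. ennreal b \<le> h z) \<and>
      (\<forall>z\<in>ball_in X y e. \<forall>z'\<in>ball_in X y e. \<bar>smooth a z - smooth a z'\<bar> \<le> b * dist z z')"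
    proof (cases "y \<in> \<Omega>")
      case False
      have "y \<in> - closure {z \<in> X. smooth a z \<noteq> 0}" using False S by (auto simp: Lip_c_def)
      then obtain e where e: "0 < e" "ball y e \<subseteq> - closure {z \<in> X. smooth a z \<noteq> 0}"
        using open_contains_ball[of "- closure {z \<in> X. smooth a z \<noteq> 0}"] by auto
      have "smooth a z = 0" if "z \<in> ball_in X y e" for z
        using that e(2) closure_subset[of "{z \<in> X. smooth a z \<noteq> 0}"] by (auto simp: ball_in_def)
      then show ?thesis using e(1) by (intro exI[of _ e] conjI exI[of _ 0]) auto
    next
      case True
      obtain j e where j: "j \<in> I" "y \<in> B \<kappa> j" "0 < e" "ball_in X y e \<subseteq> B \<kappa> j" using core_nhd[OF True] by blast
      define c where "c = 4 * C\<^sup>2 * E j / (\<kappa> * d (x j))"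
      have "0 \<le> E j" using E[OF j(1) self_nbr[OF j(1)]] by simp
      then have c0: "0 \<le> c" unfolding c_def using \<kappa> centre(3)[OF j(1)] by (intro divide_nonneg_pos) auto
      have ch: "ennreal c \<le> enn_powr (isum (\<lambda>j. ennreal ((4 * C\<^sup>2 * E j / (\<kappa> * d (x j))) powr p) * indicator (B \<kappa> j) z)) (1 / p)"
        if z: "z \<in> B \<kappa> j" for z
      proof -
        have "ennreal c = enn_powr (ennreal (c powr p)) (1 / p)"
          using c0 enn_powr_inverse(1)[OF p, of "ennreal c"] by simp
        also have "\<dots> \<le> enn_powr (isum (\<lambda>j. ennreal ((4 * C\<^sup>2 * E j / (\<kappa> * d (x j))) powr p) * indicator (B \<kappa> j) z)) (1 / p)"
          using le_isum[OF j(1), of "\<lambda>j. ennreal ((4 * C\<^sup>2 * E j / (\<kappa> * d (x j))) powr p) * indicator (B \<kappa> j) z"] z p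
          by (intro enn_powr_mono) (auto simp: c_def)
        finally show ?thesis .
      qed
      have "ennreal (min L c) \<le> h z" if "z \<in> B \<kappa> j" for z
        unfolding h_def using ch[OF that] L0 c0 by (auto simp: min_def intro: order_trans ennreal_leI)
      moreover have "\<bar>smooth a z - smooth a z'\<bar> \<le> min L c * dist z z'" if zz: "z \<in> B \<kappa> j" "z' \<in> B \<kappa> j" for z z'
      proof -
        have "\<bar>smooth a z - smooth a z'\<bar> \<le> L * dist z z'"
          using lipschitz_onD[OF L, of z z'] zz B_subset_X by (auto simp: dist_real_def)
        moreover have "\<bar>smooth a z - smooth a z'\<bar> \<le> c * dist z z'"
          unfolding c_def by (rule smooth_osc[OF j(1) zz]) (rule E[OF j(1)])
        ultimately show ?thesis by (simp add: min_def)
      qed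
      moreover have "0 \<le> min L c" using L0 c0 by simp
      ultimately show ?thesis using j(3,4)
        by (intro exI[of _ e] conjI exI[of _ "min L c"]) (auto simp del: min_less_iff_conj)
    qed
  qed
qed

end

text \<open>The discrete convolution is a convex combination of averages of \<open>w\<close> over balls comparable to any
  ball \<open>B(z, \<kappa> d(z))\<close> containing the point.  The constants do not involve the partition.\<close>

lemma discrete_convolution_comparable:
  assumes d\<mu>: "doubling X \<mu> C\<^sub>\<mu>" and w: "weight X \<mu> w" and dw: "doubling X (weighted w \<mu>) C\<^sub>w"
    and po: "proper_open X \<Omega>" and wp: "whitney_partition X \<Omega> C I x \<phi>"
    and kb: "0 < \<kappa>" "\<kappa> \<le> 1 / 8" "1 / \<kappa> \<le> 2 ^ k"
    and z: "z \<in> \<Omega>" and y: "y \<in> ball_in X z (\<kappa> * d_compl X \<Omega> z)"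
  defines "A \<equiv> measure (weighted w \<mu>) (ball_in X z (\<kappa> * d_compl X \<Omega> z)) / measure \<mu> (ball_in X z (\<kappa> * d_compl X \<Omega> z))"
  shows "discrete_convolution X \<mu> \<Omega> I x \<phi> w y \<le> (C\<^sub>w * C\<^sub>\<mu>) ^ (k + 3) * A"
    "A \<le> (C\<^sub>w * C\<^sub>\<mu>) ^ (k + 3) * discrete_convolution X \<mu> \<Omega> I x \<phi> w y"
proof -
  interpret whitney X \<Omega> "1 / 8" C I x \<phi>
    by unfold_locales (use po wp in \<open>auto simp: whitney_partition_iff\<close>)
  let ?m = "weighted w \<mu>"
  have m: "sets \<mu> = sets (restrict_space borel X)" by (rule doubling_sets[OF d\<mu>])
  have C1: "1 \<le> C\<^sub>w" "1 \<le> C\<^sub>\<mu>" by (rule doubling_ge_1[OF dw], rule doubling_ge_1[OF d\<mu>])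
  define a where "a i = avg \<mu> (wball X \<Omega> 1 (x i)) w" for i
  have W: "discrete_convolution X \<mu> \<Omega> I x \<phi> w y = smooth a y"
    by (simp add: discrete_convolution_def smooth_def a_def)
  have zX: "z \<in> X" and dz: "0 < d z" using z \<Omega>_subset d_compl_pos[OF po z] by auto
  have yz: "dist z y < \<kappa> * d z" "y \<in> X" using y by (auto simp: ball_in_iff)
  have \<kappa>d: "\<kappa> * d z \<le> 1 / 8 * d z" using kb(2) dz by (intro mult_right_mono) auto
  then have dy: "7 / 8 * d z \<le> d y" "d y \<le> 9 / 8 * d z"
    using d_compl_comparable[OF po, of z y "1 / 8"] yz by auto
  have y\<Omega>: "y \<in> \<Omega>" using d_compl_pos_in[OF po yz(2)] dy dz by simp
  define R where "R = \<kappa> * d z"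
  have R: "0 < R" using kb(1) dz by (simp add: R_def)
  have key: "a i \<le> (C\<^sub>w * C\<^sub>\<mu>) ^ (k + 3) * A \<and> A \<le> (C\<^sub>w * C\<^sub>\<mu>) ^ (k + 3) * a i" if i: "i \<in> active y" for i
  proof -
    have iI: "i \<in> I" and yi: "dist (x i) y < 1 / 4 * d (x i)" using i by (auto simp: active_def B_def ball_in_iff)
    define r where "r = d (x i) / 8"
    have r: "0 < r" using centre(3)[OF iI] by (simp add: r_def)
    have di: "3 / 4 * d (x i) \<le> d y" "d y \<le> 5 / 4 * d (x i)" using d_compl_comparable[OF po yi] by auto
    have dist: "dist (x i) z < 1 / 4 * d (x i) + \<kappa> * d z" using dist_triangle2[of "x i" z y] yi yz by simp
    have ai: "a i = measure ?m (ball_in X (x i) r) / measure \<mu> (ball_in X (x i) r)"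
      unfolding a_def wball_def r_def using avg_eq_ratio[OF m w ball_in_sets[OF m]] by simp
    have "d z \<le> 2 ^ k * R"
    proof -
      have "1 / \<kappa> * (\<kappa> * d z) \<le> 2 ^ k * (\<kappa> * d z)" using kb dz by (intro mult_right_mono) auto
      then show ?thesis using kb(1) by (simp add: R_def)
    qed
    moreover have "dist (x i) z + r \<le> d z"
      using dist \<kappa>d di dy centre(3)[OF iI] unfolding r_def by linarith
    ultimately have 1: "dist (x i) z + r \<le> 2 ^ k * R" by simp
    have 2: "dist z (x i) + R \<le> 2 ^ 3 * r"
    proof -
      have "dist (x i) z + \<kappa> * d z \<le> d (x i)" using dist \<kappa>d di dy centre(3)[OF iI] by linarith
      then show ?thesis by (simp add: r_def R_def dist_commute)
    qed
    have cmp: "measure n (ball_in X (x i) r) \<le> D ^ k * measure n (ball_in X z R)"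
      "measure n (ball_in X z R) \<le> D ^ 3 * measure n (ball_in X (x i) r)"
      "0 < measure n (ball_in X z R)" "0 < measure n (ball_in X (x i) r)"
      if "doubling X n D" for n D
      using doubling_compare[OF that centre(2)[OF iI] zX R 1] doubling_compare[OF that zX centre(2)[OF iI] r 2]
        doubling_measure_pos[OF that zX R] doubling_measure_pos[OF that centre(2)[OF iI] r] by auto
    note c\<mu> = cmp[OF d\<mu>] and cw = cmp[OF dw]
    have pow: "C\<^sub>w ^ k * C\<^sub>\<mu> ^ 3 \<le> (C\<^sub>w * C\<^sub>\<mu>) ^ (k + 3)" "C\<^sub>w ^ 3 * C\<^sub>\<mu> ^ k \<le> (C\<^sub>w * C\<^sub>\<mu>) ^ (k + 3)"
      unfolding power_mult_distrib using C1 by (intro mult_mono power_increasing; simp)+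
    have ratio: "s / t \<le> K * (s' / t')" if "s \<le> p * s'" "t' \<le> q * t" "p * q \<le> K" "0 < s" "0 < t" "0 < s'" "0 < t'" "0 \<le> p"
      for s t s' t' p q K :: real
    proof -
      have "s * t' \<le> (p * s') * (q * t)" using that by (intro mult_mono) auto
      also have "\<dots> = (p * q) * (s' * t)" by simp
      also have "\<dots> \<le> K * (s' * t)" using that by (intro mult_right_mono) auto
      finally show ?thesis using that by (simp add: field_simps)
    qed
    have "a i \<le> (C\<^sub>w * C\<^sub>\<mu>) ^ (k + 3) * A"
      unfolding ai A_def R_def[symmetric]
      by (rule ratio[OF cw(1) c\<mu>(2) pow(1) cw(4) c\<mu>(4) cw(3) c\<mu>(3)]) (use C1 in simp)
    moreover have "A \<le> (C\<^sub>w * C\<^sub>\<mu>) ^ (k + 3) * a i"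
      unfolding ai A_def R_def[symmetric]
      by (rule ratio[OF cw(2) c\<mu>(1) pow(2) cw(3) c\<mu>(3) cw(4) c\<mu>(4)]) (use C1 in simp)
    ultimately show ?thesis by blast
  qed
  show "discrete_convolution X \<mu> \<Omega> I x \<phi> w y \<le> (C\<^sub>w * C\<^sub>\<mu>) ^ (k + 3) * A"
    unfolding W by (rule smooth_le[OF y\<Omega>]) (use key in blast)
  have pos: "0 < (C\<^sub>w * C\<^sub>\<mu>) ^ (k + 3)" using C1 by simp
  have "A / (C\<^sub>w * C\<^sub>\<mu>) ^ (k + 3) \<le> smooth a y"
    by (rule smooth_ge[OF y\<Omega>]) (use key pos in \<open>simp add: pos_divide_le_eq mult.commute\<close>)
  then show "A \<le> (C\<^sub>w * C\<^sub>\<mu>) ^ (k + 3) * discrete_convolution X \<mu> \<Omega> I x \<phi> w y"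
    unfolding W using pos by (simp add: pos_divide_le_eq mult.commute)
qed

section \<open>Transfer of the Hardy inequality\<close>

text \<open>The hypothesis on minimal weak upper gradients of \<open>W\<close> can be used because one exists; the continuous upper gradient
  of \<open>W\<close> guarantees this.  The threshold for \<open>\<delta>\<close> is exactly what makes the absorbed term at most one half.\<close>

lemma weighted_hardy_regularizable:
  assumes X: "complete X" and d\<mu>: "doubling X \<mu> C\<^sub>\<mu>" and po: "proper_open X \<Omega>" and p: "1 < p" and hardy: "hardy p X \<Omega> \<mu> C\<^sub>p"
    and wp: "whitney_partition X \<Omega> C I x \<phi>" and reg: "regularizable X \<mu> \<Omega> \<delta> w" and \<delta>: "0 < \<delta>"
    and C0: "1 \<le> C\<^sub>0" and small: "\<delta> \<le> p / (2 * C\<^sub>0) * (2 * C\<^sub>p) powr (- (1 / p))"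
  defines "W \<equiv> discrete_convolution X \<mu> \<Omega> I x \<phi> w"
  assumes gc: "\<And>g. minimal_wug p \<Omega> (restrict_space \<mu> \<Omega>) (\<lambda>y. ereal (W y)) g \<Longrightarrow>
      AE y in restrict_space \<mu> \<Omega>. g y \<le> ennreal (C\<^sub>0 * \<delta> / d_compl X \<Omega> y * W y)"
    and u: "u \<in> Lip_c X \<Omega>" and h: "ug_off X (\<lambda>_. 0) u h" "h \<in> borel_measurable (restrict_space borel X)"
    and hb: "\<And>y. y \<in> X \<Longrightarrow> h y \<le> ennreal b" "0 \<le> b"
  shows "(\<integral>\<^sup>+ y \<in> \<Omega>. ennreal (\<bar>u y\<bar> powr p / d_compl X \<Omega> y powr p * W y) \<partial>\<mu>)
    \<le> ennreal (2 * (C\<^sub>p * 2 powr p)) * (\<integral>\<^sup>+ y \<in> \<Omega>. enn_powr (h y) p * ennreal (W y) \<partial>\<mu>)"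
proof -
  have m: "sets \<mu> = sets (restrict_space borel X)" by (rule doubling_sets[OF d\<mu>])
  let ?n = "restrict_space \<mu> \<Omega>"
  have n: "sets ?n = sets (restrict_space borel \<Omega>)" by (rule restrict_to_open[OF m po])
  have \<Omega>X: "\<Omega> \<subseteq> X" using po by (simp add: proper_open_def)
  have \<delta>0: "0 \<le> \<delta>" using \<delta> by simp
  define k where "k y = 64 * C ^ 3 * \<delta> / d_compl X \<Omega> y * W y" for y
  note grad = discrete_convolution_gradient[OF d\<mu> po wp reg, folded W_def]
  have kc: "continuous_on \<Omega> k" unfolding k_def using grad(3)[OF \<delta>0] .
  have k0: "0 \<le> k y" if "y \<in> \<Omega>" for y unfolding k_def using grad(4)[OF \<delta>0 that] .
  have kug: "ug_off \<Omega> (\<lambda>_. 0) W (\<lambda>y. ennreal (k y))" unfolding k_def using grad(5)[OF \<delta>0] .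
  have fin: "\<exists>r>0. emeasure ?n (ball_in \<Omega> y r) < \<infinity>" if "y \<in> \<Omega>" for y
  proof (intro exI[of _ 1] conjI)
    have "emeasure ?n (ball_in \<Omega> y 1) = emeasure \<mu> (ball_in \<Omega> y 1)"
      by (rule restrict_to_open(2)[OF m po]) (auto simp: ball_in_iff)
    also have "\<dots> \<le> emeasure \<mu> (ball_in X y 1)"
      by (intro emeasure_mono restrict_to_open(3)[OF m po] ball_in_sets[OF m])
    also have "\<dots> < \<infinity>" using doubling_ball_finite[OF d\<mu>] that \<Omega>X by blast
    finally show "emeasure ?n (ball_in \<Omega> y 1) < \<infinity>" .
  qed simp
  have p1: "1 \<le> p" using p by simp
  obtain g \<rho> where g: "minimal_wug p \<Omega> ?n (\<lambda>y. ereal (W y)) g" "g \<in> borel_measurable ?n"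
    "\<And>y. y \<in> \<Omega> \<Longrightarrow> g y \<le> ennreal (k y)"
    "\<rho> \<in> borel_measurable ?n" "(\<integral>\<^sup>+ y. enn_powr (\<rho> y) p \<partial>?n) < \<infinity>" "ug_off \<Omega> \<rho> W g"
    using minimal_wug_exists[OF n p1 proper_open_sigma_compact[OF d\<mu> X po] fin kc k0 kug] by blast
  have bm: "borel_measurable ?n = (borel_measurable (restrict_space borel \<Omega>) :: ('a \<Rightarrow> ennreal) set)"
    by (rule measurable_cong_sets) (use n in auto)
  interpret Wh: whitney X \<Omega> "1 / 8" C I x \<phi>
    by unfold_locales (use po wp in \<open>auto simp: whitney_partition_iff\<close>)
  have Ws: "W = Wh.smooth (\<lambda>i. avg \<mu> (wball X \<Omega> 1 (x i)) w)"
    by (simp add: W_def discrete_convolution_def Wh.smooth_def fun_eq_iff)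
  have Cp: "1 \<le> C\<^sub>p" using hardy by (simp add: hardy_def)
  show ?thesis
  proof (rule weighted_hardy[OF X d\<mu> po p hardy grad(2) grad(1) _ kc k0 _ g(3) _ g(5,6) gc[OF g(1)] _ _ u h hb])
    show "\<exists>e>0. \<exists>L\<ge>0. \<forall>y\<in>ball_in X z e. \<forall>y'\<in>ball_in X z e. \<bar>W y - W y'\<bar> \<le> L * dist y y'" if "z \<in> \<Omega>" for z
      using Wh.smooth_locally_lipschitz[OF that, of "\<lambda>i. avg \<mu> (wball X \<Omega> 1 (x i)) w"] unfolding Ws by metis
    show "g \<in> borel_measurable (restrict_space borel \<Omega>)" "\<rho> \<in> borel_measurable (restrict_space borel \<Omega>)"
      using g(2,4) bm by auto
    show "0 \<le> C\<^sub>0 * \<delta>" using C0 \<delta> by simp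
    have "C\<^sub>0 * \<delta> / p \<le> 1 / 2 * (2 * C\<^sub>p) powr (- (1 / p))"
    proof -
      have "C\<^sub>0 * \<delta> \<le> C\<^sub>0 * (p / (2 * C\<^sub>0) * (2 * C\<^sub>p) powr (- (1 / p)))" using small C0 by (intro mult_left_mono) auto
      also have "\<dots> = p * (1 / 2 * (2 * C\<^sub>p) powr (- (1 / p)))" using C0 by simp
      finally show ?thesis using p by (simp add: divide_le_eq mult.commute)
    qed
    then have "(C\<^sub>0 * \<delta> / p) powr p \<le> (1 / 2 * (2 * C\<^sub>p) powr (- (1 / p))) powr p"
      by (rule powr_mono2[rotated 2]) (use p C0 \<delta> in auto)
    also have "\<dots> = (1 / 2) powr p * (1 / (2 * C\<^sub>p))"
    proof -
      define D where "D = 2 * C\<^sub>p"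
      have D: "0 < D" using Cp by (simp add: D_def)
      have "(D powr (- (1 / p))) powr p = D powr (- (1 / p) * p)" by (rule powr_powr)
      also have "- (1 / p) * p = - 1" using p by simp
      also have "D powr - 1 = 1 / D" using D by (simp add: powr_minus_divide)
      finally have "(D powr (- (1 / p))) powr p = 1 / D" .
      then show ?thesis unfolding D_def[symmetric] powr_mult by simp
    qed
    finally have "C\<^sub>p * 2 powr p * (C\<^sub>0 * \<delta> / p) powr p \<le> C\<^sub>p * 2 powr p * ((1 / 2) powr p * (1 / (2 * C\<^sub>p)))"
      using Cp by (intro mult_left_mono) auto
    also have "\<dots> = (2 * (1 / 2)) powr p * (C\<^sub>p * (1 / (2 * C\<^sub>p)))" unfolding powr_mult by simp
    also have "\<dots> = 1 / 2" using Cp by simp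
    finally show "C\<^sub>p * 2 powr p * (C\<^sub>0 * \<delta> / p) powr p \<le> 1 / 2" .
  qed
qed

text \<open>With \<open>m = w d\<mu>\<close>, \<open>r\<^sub>j\<close> the radii and \<open>a\<^sub>j\<close> the \<open>m\<close>-averages of \<open>u\<close> over the balls \<open>B\<^sub>j\<close>, the left-hand side is at most a
  constant times \<open>\<Sum> r\<^sub>j\<^sup>-\<^sup>p (\<integral>\<^bsub>B_j\<^esub> |u - a\<^sub>j|\<^sup>p dm + |a\<^sub>j|\<^sup>p m(B\<^sub>j))\<close>.  The first terms are bounded by the \<open>(p, p)\<close>-Poincare inequality.
  In the second terms \<open>a\<^sub>j\<close> is replaced by \<open>v = \<Sum> a\<^sub>i \<phi>\<^sub>i\<close>, up to the oscillation \<open>E\<^sub>j\<close> of neighbouring averages, and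
  \<open>m(B\<^sub>j)\<close> by \<open>\<integral>\<^bsub>B_j\<^esub> W d\<mu>\<close>; then the Hardy inequality for \<open>v\<close> and \<open>W d\<mu>\<close> applies, and the gradient of \<open>v\<close> on \<open>B\<^sub>j\<close> is at most a constant times
  \<open>E\<^sub>j / r\<^sub>j\<close>.  Finally, \<open>E\<^sub>j\<^sup>p r\<^sub>j\<^sup>-\<^sup>p m(B\<^sub>j)\<close> is bounded by the energy of \<open>u\<close> on a dilation of \<open>B\<^sub>j\<close>, and the dilations have
  bounded overlap.  The factor \<open>16\<close> in \<open>\<kappa>\<close> leaves room for the dilation by \<open>7 \<Lambda>\<close> that occurs.\<close>

lemma hardy_of_upper_gradient:
  fixes u :: "'a::metric_space \<Rightarrow> real" and G :: "'a \<Rightarrow> ennreal"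
  assumes X: "complete X" and d\<mu>: "doubling X \<mu> C\<^sub>\<mu>" and po: "proper_open X \<Omega>" and p: "1 < p" and hardy: "hardy p X \<Omega> \<mu> C\<^sub>p"
    and adm: "admissible p X \<mu> w C\<^sub>w CP \<Lambda>"
    and wp: "whitney_partition X \<Omega> C' I' x' \<phi>'" and reg: "regularizable X \<mu> \<Omega> \<delta> w" and \<delta>: "0 < \<delta>"
    and C0: "1 \<le> C\<^sub>0" and small: "\<delta> \<le> p / (2 * C\<^sub>0) * (2 * C\<^sub>p) powr (- (1 / p))"
    and gc: "\<And>g. minimal_wug p \<Omega> (restrict_space \<mu> \<Omega>) (\<lambda>y. ereal (discrete_convolution X \<mu> \<Omega> I' x' \<phi>' w y)) g \<Longrightarrow>
      AE y in restrict_space \<mu> \<Omega>. g y \<le> ennreal (C\<^sub>0 * \<delta> / d_compl X \<Omega> y * discrete_convolution X \<mu> \<Omega> I' x' \<phi>' w y)"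
    and \<kappa>: "\<kappa> = 1 / (16 * \<Lambda>)" and k: "1 / \<kappa> \<le> 2 ^ k" and wh: "whitney_at X \<Omega> \<kappa> C I x \<phi>"
    and u: "u \<in> Lip_c X \<Omega>" and G: "G \<in> borel_measurable (restrict_space borel X)" "ug_off X (\<lambda>_. 0) u G"
  defines "kpp \<equiv> 2 powr p * (2 powr p * 2 * C\<^sub>w ^ 6 + 4 powr p) * (C\<^sub>w\<^sup>2 * CP) powr p"
    and "cE \<equiv> (2 * C\<^sub>w ^ 5) powr p * (7 * CP) powr p" and "cW \<equiv> (C\<^sub>w * C\<^sub>\<mu>) ^ (k + 3)"
  shows "(\<integral>\<^sup>+ y \<in> \<Omega>. ennreal (\<bar>u y\<bar> powr p / d_compl X \<Omega> y powr p) \<partial>weighted w \<mu>)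
    \<le> ennreal (2 powr p * (kpp * C + 2 powr p * ((2 / \<kappa>) powr p * cW * C *
          (2 * (C\<^sub>p * 2 powr p) * ((4 * C\<^sup>2) powr p * cW * (cE * C))) + cE * C)))
      * (\<integral>\<^sup>+ y \<in> \<Omega>. enn_powr (G y) p \<partial>weighted w \<mu>)"
proof -
  let ?m = "weighted w \<mu>" and ?d = "d_compl X \<Omega>" and ?\<alpha> = "2 powr p :: real"
  have w: "weight X \<mu> w" and dw: "doubling X ?m C\<^sub>w" and pi: "poincare p X ?m CP \<Lambda>" using adm by (auto simp: admissible_def)
  have \<Lambda>: "1 \<le> \<Lambda>" and CP: "1 \<le> CP" using pi by (auto simp: poincare_def)
  have \<kappa>0: "0 < \<kappa>" "\<kappa> \<le> 1 / 8" "\<kappa> * \<Lambda> = 1 / 16" using \<Lambda> by (auto simp: \<kappa> divide_simps)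
  have p0: "0 < p" and p1: "1 \<le> p" using p by auto
  interpret Wh: whitney X \<Omega> \<kappa> C I x \<phi> by unfold_locales (use po wh \<kappa>0 in auto)
  obtain Lu where Lu: "Lu-lipschitz_on X u" and Kc: "compact (closure {y \<in> X. u y \<noteq> 0})" "closure {y \<in> X. u y \<noteq> 0} \<subseteq> \<Omega>"
    using u by (auto simp: Lip_c_def)
  define K where "K = closure {y \<in> X. u y \<noteq> 0}"
  have K: "compact K" "K \<subseteq> \<Omega>" using Kc by (auto simp: K_def)
  have u0: "u y = 0" if "y \<in> X" "y \<notin> K" for y using that closure_subset[of "{y \<in> X. u y \<noteq> 0}"] by (auto simp: K_def)
  have uc: "continuous_on X u" by (rule lipschitz_on_continuous_on[OF Lu])
  have \<Omega>X: "\<Omega> \<subseteq> X" by (rule Wh.\<Omega>_subset)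
  obtain M where M: "\<And>y. y \<in> X \<Longrightarrow> \<bar>u y\<bar> \<le> M"
  proof -
    have "compact (u ` K)" by (intro compact_continuous_image continuous_on_subset[OF uc] K) (use K \<Omega>X in auto)
    then obtain B where B: "\<forall>z\<in>u ` K. norm z \<le> B" using compact_imp_bounded bounded_iff by blast
    have "\<bar>u y\<bar> \<le> \<bar>B\<bar>" if "y \<in> X" for y using B u0[OF that] by (cases "y \<in> K") force+
    then show thesis using that by blast
  qed
  interpret P: poincare_space X ?m C\<^sub>w p CP \<Lambda> u G M
    by unfold_locales (use dw pi p1 uc M G in auto)
  have m\<mu>: "sets \<mu> = sets (restrict_space borel X)" by (rule doubling_sets[OF d\<mu>])
  have mm: "sets ?m = sets (restrict_space borel X)" by (rule P.sets_m)
  define r where "r j = \<kappa> * ?d (x j)" for j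
  have r: "0 < r j" if "j \<in> I" for j using Wh.centre(3)[OF that] \<kappa>0(1) by (simp add: r_def)
  have BB: "Wh.B \<kappa> j = ball_in X (x j) (r j)" for j by (simp add: Wh.B_def r_def)
  define a where "a i = P.mean (x i) (r i)" for i
  define mB where "mB j = measure ?m (Wh.B \<kappa> j)" for j
  define muB where "muB j = measure \<mu> (Wh.B \<kappa> j)" for j
  have mB: "0 < mB j" "0 < muB j" "emeasure ?m (Wh.B \<kappa> j) = ennreal (mB j)" "emeasure \<mu> (Wh.B \<kappa> j) = ennreal (muB j)" if "j \<in> I" for j
    using doubling_measure_pos[OF dw Wh.centre(2)[OF that] r[OF that]] doubling_measure_pos[OF d\<mu> Wh.centre(2)[OF that] r[OF that]]
      doubling_emeasure[OF dw Wh.centre(2)[OF that], of "r j"] doubling_emeasure[OF d\<mu> Wh.centre(2)[OF that], of "r j"]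
    by (auto simp: mB_def muB_def BB)
  define En where "En j = (\<integral>\<^sup>+ y \<in> Wh.B (3 / 4) j. enn_powr (G y) p \<partial>?m)" for j
  define T where "T = (\<integral>\<^sup>+ y \<in> \<Omega>. enn_powr (G y) p \<partial>?m)"
  have energy_En: "P.energy (x j) (\<Lambda> * (t * r j)) \<le> En j" if j: "j \<in> I" "t \<le> 7" for j t
  proof -
    have "\<Lambda> * (t * r j) = t * (\<kappa> * \<Lambda>) * ?d (x j)" by (simp add: r_def mult_ac)
    also have "\<dots> = t / 16 * ?d (x j)" by (simp add: \<kappa>0(3))
    also have "\<dots> \<le> 3 / 4 * ?d (x j)" using j Wh.centre(3)[OF j(1)] by (intro mult_right_mono) auto
    finally have "ball_in X (x j) (\<Lambda> * (t * r j)) \<subseteq> ball_in X (x j) (3 / 4 * ?d (x j))" by (rule ball_in_mono)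
    then show ?thesis unfolding P.energy_def En_def Wh.B_def by (intro nn_integral_mono) (auto split: split_indicator)
  qed
  \<comment> \<open>averages over neighbouring balls are compared through \<open>B(x\<^sub>j, 7 r\<^sub>j)\<close>, which contains all of them\<close>
  define E where "E j = Max ((\<lambda>i. \<bar>a i - a j\<bar>) ` Wh.nbrs j)" for j
  have E_ge: "\<bar>a i - a j\<bar> \<le> E j" if "j \<in> I" "i \<in> Wh.nbrs j" for i j
    unfolding E_def using Wh.nbrs_finite[OF that(1)] that(2) by (intro Max_ge) auto
  have E0: "0 \<le> E j" if "j \<in> I" for j using E_ge[OF that Wh.self_nbr[OF that]] by simp
  have E_En: "ennreal (E j powr p * mB j) \<le> ennreal (cE * r j powr p) * En j" if j: "j \<in> I" for j
  proof -
    have R7: "0 < 7 * r j" using r[OF j] by simp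
    have close: "ennreal \<bar>a i - P.mean (x j) (7 * r j)\<bar> \<le> ennreal (C\<^sub>w ^ 5) * P.osc (x j) (7 * r j)" if i: "i \<in> Wh.nbrs j" for i
    proof -
      have iI: "i \<in> I" using i by (simp add: Wh.nbrs_def)
      note cmp = Wh.nbrs_comparable[OF j i]
      have ri: "r j \<le> 2 * r i" "r i \<le> 2 * r j"
        using cmp(1,2) \<kappa>0(1) mult_left_mono[of "?d (x j) / 2" "?d (x i)" \<kappa>] mult_left_mono[of "?d (x i)" "2 * ?d (x j)" \<kappa>]
        by (auto simp: r_def)
      have dist: "dist (x i) (x j) < 5 * r j" using cmp(3) by (simp add: r_def mult.assoc)
      show ?thesis
        unfolding a_def
      proof (rule P.mean_diff_le[OF Wh.centre(2)[OF iI] Wh.centre(2)[OF j] r[OF iI] R7])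
        show "ball_in X (x i) (r i) \<subseteq> ball_in X (x j) (7 * r j)"
        proof
          fix y assume "y \<in> ball_in X (x i) (r i)"
          then show "y \<in> ball_in X (x j) (7 * r j)"
            using dist_triangle[of "x j" y "x i"] dist ri(2) by (simp add: ball_in_iff dist_commute)
        qed
        show "measure ?m (ball_in X (x j) (7 * r j)) \<le> C\<^sub>w ^ 5 * measure ?m (ball_in X (x i) (r i))"
          by (rule doubling_compare[OF dw Wh.centre(2)[OF j] Wh.centre(2)[OF iI] r[OF iI]])
             (use dist ri(1) r[OF iI] in \<open>simp add: dist_commute\<close>)
      qed
    qed
    have fin: "finite ((\<lambda>i. \<bar>a i - a j\<bar>) ` Wh.nbrs j)" "(\<lambda>i. \<bar>a i - a j\<bar>) ` Wh.nbrs j \<noteq> {}"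
      using Wh.nbrs_finite[OF j] Wh.self_nbr[OF j] by auto
    obtain i where i: "i \<in> Wh.nbrs j" "E j = \<bar>a i - a j\<bar>" using Max_in[OF fin] by (auto simp: E_def)
    let ?c = "P.mean (x j) (7 * r j)" and ?o = "P.osc (x j) (7 * r j)"
    have "ennreal (E j) \<le> ennreal (\<bar>a i - ?c\<bar> + \<bar>a j - ?c\<bar>)" unfolding i(2) by (intro ennreal_leI) simp
    also have "\<dots> = ennreal \<bar>a i - ?c\<bar> + ennreal \<bar>a j - ?c\<bar>" by (intro ennreal_plus) auto
    also have "\<dots> \<le> ennreal (C\<^sub>w ^ 5) * ?o + ennreal (C\<^sub>w ^ 5) * ?o" by (intro add_mono close i Wh.self_nbr[OF j])
    also have "\<dots> = (ennreal (C\<^sub>w ^ 5) + ennreal (C\<^sub>w ^ 5)) * ?o" by (rule distrib_right[symmetric])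
    also have "ennreal (C\<^sub>w ^ 5) + ennreal (C\<^sub>w ^ 5) = ennreal (2 * C\<^sub>w ^ 5)" using P.C1 by (subst ennreal_plus[symmetric]) auto
    finally have Eo: "ennreal (E j) \<le> ennreal (2 * C\<^sub>w ^ 5) * ?o" .
    have Cw0: "0 \<le> 2 * C\<^sub>w ^ 5" using P.C1 by simp
    have "ennreal (E j powr p) = enn_powr (ennreal (E j)) p" using E0[OF j] by simp
    also have "\<dots> \<le> enn_powr (ennreal (2 * C\<^sub>w ^ 5) * ?o) p" by (rule enn_powr_mono[OF Eo]) (use p0 in simp)
    also have "\<dots> = ennreal ((2 * C\<^sub>w ^ 5) powr p) * (ennreal ((CP * (7 * r j)) powr p) *
        (P.energy (x j) (\<Lambda> * (7 * r j)) * ennreal (1 / P.mu (x j) (\<Lambda> * (7 * r j)))))"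
      using R7 by (subst enn_powr_mult[OF p0], subst enn_powr_ennreal[OF Cw0], subst P.osc_powr) auto
    also have "\<dots> = ennreal (cE * r j powr p) * (P.energy (x j) (\<Lambda> * (7 * r j)) * ennreal (1 / P.mu (x j) (\<Lambda> * (7 * r j))))"
    proof -
      have "cE * r j powr p = (2 * C\<^sub>w ^ 5) powr p * (CP * (7 * r j)) powr p"
        unfolding cE_def by (simp add: powr_mult mult_ac)
      then show ?thesis by (simp add: ennreal_mult mult.assoc)
    qed
    finally have Ep: "ennreal (E j powr p) \<le> \<dots>" .
    have le: "1 / P.mu (x j) (\<Lambda> * (7 * r j)) * mB j \<le> 1"
    proof -
      have "1 * r j \<le> \<Lambda> * (7 * r j)" using \<Lambda> r[OF j] by (intro mult_mono) auto
      then have "mB j \<le> P.mu (x j) (\<Lambda> * (7 * r j))"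
        unfolding mB_def BB by (intro doubling_measure_mono[OF dw Wh.centre(2)[OF j]] ball_in_mono P.ball_m) simp
      moreover have "0 < P.mu (x j) (\<Lambda> * (7 * r j))" by (rule P.mu_pos[OF Wh.centre(2)[OF j]]) (use \<Lambda> r[OF j] in simp)
      ultimately show ?thesis by simp
    qed
    have "ennreal (E j powr p * mB j) = ennreal (E j powr p) * ennreal (mB j)" by (rule ennreal_mult') simp
    also have "\<dots> \<le> ennreal (cE * r j powr p) * (P.energy (x j) (\<Lambda> * (7 * r j)) * ennreal (1 / P.mu (x j) (\<Lambda> * (7 * r j)))) * ennreal (mB j)"
      by (intro mult_right_mono Ep) simp
    also have "\<dots> = ennreal (cE * r j powr p) * (P.energy (x j) (\<Lambda> * (7 * r j)) * ennreal (1 / P.mu (x j) (\<Lambda> * (7 * r j)) * mB j))"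
      by (subst ennreal_mult'[of "1 / P.mu (x j) (\<Lambda> * (7 * r j))"]) (simp_all add: mult.assoc)
    also have "\<dots> \<le> ennreal (cE * r j powr p) * (En j * 1)"
      using le energy_En[OF j order_refl] by (intro mult_left_mono mult_mono) (auto simp: ennreal_le_1)
    finally show ?thesis by simp
  qed
  have E_En': "ennreal (E j powr p * mB j / r j powr p) \<le> ennreal cE * En j" if j: "j \<in> I" for j
  proof -
    have "ennreal (E j powr p * mB j / r j powr p) = ennreal (E j powr p * mB j) * ennreal (1 / r j powr p)"
      by (subst ennreal_mult''[symmetric]) auto
    also have "\<dots> \<le> ennreal (cE * r j powr p) * En j * ennreal (1 / r j powr p)" by (intro mult_right_mono E_En[OF j]) simp
    also have "\<dots> = ennreal (cE * r j powr p * (1 / r j powr p)) * En j"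
      by (subst ennreal_mult''[of "1 / r j powr p"]) (simp_all add: mult_ac)
    also have "cE * r j powr p * (1 / r j powr p) = cE" using r[OF j] by simp
    finally show ?thesis .
  qed
  have sum_En: "Wh.isum En \<le> ennreal C * T"
  proof -
    have "\<Omega> \<in> sets ?m" by (rule proper_open_sets[OF po mm])
    then have "(\<lambda>y. enn_powr (G y) p * indicator \<Omega> y) \<in> borel_measurable ?m" using P.G_m by measurable
    then show ?thesis unfolding T_def En_def by (rule Wh.isum_overlap[OF mm])
  qed
  \<comment> \<open>the averages vanish on balls off the support of \<open>u\<close>, so \<open>v = \<Sum> a\<^sub>i \<phi>\<^sub>i\<close> is an admissible test function\<close>
  have afin: "finite {i \<in> I. a i \<noteq> 0}"
  proof (rule finite_subset[OF _ Wh.finite_meeting_compact[OF K]])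
    show "{i \<in> I. a i \<noteq> 0} \<subseteq> {i \<in> I. Wh.B \<kappa> i \<inter> K \<noteq> {}}"
    proof (rule subsetI, rule ccontr)
      fix i assume i: "i \<in> {i \<in> I. a i \<noteq> 0}" "i \<notin> {i \<in> I. Wh.B \<kappa> i \<inter> K \<noteq> {}}"
      then have disj: "ball_in X (x i) (r i) \<inter> K = {}" by (simp add: BB)
      have "u y = 0" if "y \<in> ball_in X (x i) (r i)" for y
      proof (rule u0)
        show "y \<in> X" using that by (simp add: ball_in_iff)
        show "y \<notin> K" using that disj by blast
      qed
      then have eq: "(\<lambda>y. indicator (ball_in X (x i) (r i)) y *\<^sub>R u y) = (\<lambda>_. 0)"
        by (auto simp: fun_eq_iff split: split_indicator)
      have "a i = 0" unfolding a_def avg_def set_lebesgue_integral_def eq by simp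
      then show False using i by simp
    qed
  qed
  let ?v = "Wh.smooth a"
  have v: "?v \<in> Lip_c X \<Omega>" by (rule Wh.smooth_Lip_c[OF d\<mu> X afin])
  then obtain L where L: "L-lipschitz_on X ?v" by (auto simp: Lip_c_def)
  have L0: "0 \<le> L" using L by (rule lipschitz_on_nonneg)
  have vc: "continuous_on X ?v" by (rule lipschitz_on_continuous_on[OF L])
  define c where "c j = (4 * C\<^sup>2 * E j / r j) powr p" for j
  define h where "h y = min (ennreal L) (enn_powr (Wh.isum (\<lambda>j. ennreal (c j) * indicator (Wh.B \<kappa> j) y)) (1 / p))" for y
  have h: "h \<in> borel_measurable (restrict_space borel X)" "ug_off X (\<lambda>_. 0) ?v h"
    using Wh.smooth_upper_gradient[OF p0 v L, of E] E_ge unfolding h_def c_def r_def by blast+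
  define W where "W = discrete_convolution X \<mu> \<Omega> I' x' \<phi>' w"
  define I1 where "I1 = (\<integral>\<^sup>+ y \<in> \<Omega>. ennreal (\<bar>?v y\<bar> powr p / ?d y powr p * W y) \<partial>\<mu>)"
  have step3: "I1 \<le> ennreal (2 * (C\<^sub>p * 2 powr p)) * (\<integral>\<^sup>+ y \<in> \<Omega>. enn_powr (h y) p * ennreal (W y) \<partial>\<mu>)"
    unfolding I1_def W_def
    by (rule weighted_hardy_regularizable[OF X d\<mu> po p hardy wp reg \<delta> C0 small gc v h(2,1) _ L0]) (auto simp: h_def)
  have W_pos: "0 < W y" if "y \<in> \<Omega>" for y
    unfolding W_def by (rule discrete_convolution_gradient(1)[OF d\<mu> po wp reg that])
  have W_cont: "continuous_on \<Omega> W"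
    unfolding W_def by (rule discrete_convolution_gradient(2)[OF d\<mu> po wp reg])
  have Wle: "W y \<le> cW * (mB j / muB j)" "mB j / muB j \<le> cW * W y" if "j \<in> I" "y \<in> Wh.B \<kappa> j" for j y
    using discrete_convolution_comparable[OF d\<mu> w dw po wp \<kappa>0(1,2) k Wh.centre(1)[OF that(1)], of y] that(2)
    by (auto simp: W_def cW_def mB_def muB_def Wh.B_def)
  have cW0: "0 \<le> cW" using doubling_ge_1[OF d\<mu>] P.C1 by (simp add: cW_def)
  have \<Omega>b: "\<Omega> \<in> sets borel" by (rule proper_open_borel[OF po])
  have Bsets: "Wh.B \<kappa> j \<in> sets \<mu>" for j unfolding BB by (rule ball_in_sets[OF m\<mu>])
  have Wm: "W \<in> borel_measurable (restrict_space borel \<Omega>)" by (rule borel_measurable_continuous_on_restrict[OF W_cont])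
  have cut\<mu>: "(\<lambda>y. F y * indicator \<Omega> y) \<in> borel_measurable \<mu>" if "F \<in> borel_measurable (restrict_space borel \<Omega>)" for F :: "'a \<Rightarrow> ennreal"
    unfolding measurable_cong_sets[OF m\<mu> refl] by (intro measurable_restrict_space1 measurable_cut[OF that \<Omega>b \<Omega>b]) simp
  have cutB: "(\<lambda>y. F y * indicator (Wh.B \<kappa> j) y) \<in> borel_measurable \<mu>"
    if "F \<in> borel_measurable (restrict_space borel \<Omega>)" "j \<in> I" for F :: "'a \<Rightarrow> ennreal" and j
  proof -
    have "(\<lambda>y. F y * indicator (Wh.B \<kappa> j) y) = (\<lambda>y. F y * indicator \<Omega> y * indicator (Wh.B \<kappa> j) y)"
      using Wh.cover that(2) by (auto simp: fun_eq_iff split: split_indicator)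
    then show ?thesis using cut\<mu>[OF that(1)] Bsets[of j] by simp
  qed
  have step4: "(\<integral>\<^sup>+ y \<in> \<Omega>. enn_powr (h y) p * ennreal (W y) \<partial>\<mu>) \<le> ennreal ((4 * C\<^sup>2) powr p * cW) * (ennreal cE * (ennreal C * T))"
  proof -
    have "(\<integral>\<^sup>+ y \<in> \<Omega>. enn_powr (h y) p * ennreal (W y) \<partial>\<mu>)
        \<le> (\<integral>\<^sup>+ y. Wh.isum (\<lambda>j. ennreal (c j) * (ennreal (W y) * indicator (Wh.B \<kappa> j) y)) \<partial>\<mu>)"
    proof (rule nn_integral_mono)
      fix y
      have "enn_powr (h y) p \<le> enn_powr (enn_powr (Wh.isum (\<lambda>j. ennreal (c j) * indicator (Wh.B \<kappa> j) y)) (1 / p)) p"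
        by (rule enn_powr_mono) (use p0 in \<open>auto simp: h_def\<close>)
      also have "\<dots> = Wh.isum (\<lambda>j. ennreal (c j) * indicator (Wh.B \<kappa> j) y)" by (rule enn_powr_inverse(2)[OF p0])
      finally have "ennreal (W y) * enn_powr (h y) p \<le> ennreal (W y) * Wh.isum (\<lambda>j. ennreal (c j) * indicator (Wh.B \<kappa> j) y)"
        by (rule mult_left_mono) simp
      also have "\<dots> = Wh.isum (\<lambda>j. ennreal (c j) * (ennreal (W y) * indicator (Wh.B \<kappa> j) y))"
        by (simp add: Wh.isum_cmult[symmetric] mult_ac)
      finally show "enn_powr (h y) p * ennreal (W y) * indicator \<Omega> y \<le> Wh.isum (\<lambda>j. ennreal (c j) * (ennreal (W y) * indicator (Wh.B \<kappa> j) y))"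
        by (auto simp: mult.commute split: split_indicator)
    qed
    also have "\<dots> = Wh.isum (\<lambda>j. ennreal (c j) * (\<integral>\<^sup>+ y \<in> Wh.B \<kappa> j. ennreal (W y) \<partial>\<mu>))"
    proof -
      have Wm': "(\<lambda>y. ennreal (W y)) \<in> borel_measurable (restrict_space borel \<Omega>)" using Wm by measurable
      have "Wh.isum (\<lambda>j. \<integral>\<^sup>+ y. ennreal (c j) * (ennreal (W y) * indicator (Wh.B \<kappa> j) y) \<partial>\<mu>)
          = Wh.isum (\<lambda>j. ennreal (c j) * (\<integral>\<^sup>+ y \<in> Wh.B \<kappa> j. ennreal (W y) \<partial>\<mu>))"
        by (intro antisym Wh.isum_mono) (simp_all add: nn_integral_cmult cutB[OF Wm'])
      moreover have "(\<integral>\<^sup>+ y. Wh.isum (\<lambda>j. ennreal (c j) * (ennreal (W y) * indicator (Wh.B \<kappa> j) y)) \<partial>\<mu>)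
          = Wh.isum (\<lambda>j. \<integral>\<^sup>+ y. ennreal (c j) * (ennreal (W y) * indicator (Wh.B \<kappa> j) y) \<partial>\<mu>)"
        by (rule Wh.isum_nn_integral) (intro borel_measurable_times_ennreal borel_measurable_const cutB[OF Wm'])
      ultimately show ?thesis by simp
    qed
    also have "\<dots> \<le> Wh.isum (\<lambda>j. ennreal ((4 * C\<^sup>2) powr p * cW) * (ennreal cE * En j))"
    proof (rule Wh.isum_mono)
      fix j assume j: "j \<in> I"
      have "(\<integral>\<^sup>+ y \<in> Wh.B \<kappa> j. ennreal (W y) \<partial>\<mu>) \<le> (\<integral>\<^sup>+ y. ennreal (cW * (mB j / muB j)) * indicator (Wh.B \<kappa> j) y \<partial>\<mu>)"
        by (intro nn_integral_mono) (use Wle(1)[OF j] in \<open>auto split: split_indicator intro!: ennreal_leI\<close>)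
      also have "\<dots> = ennreal (cW * (mB j / muB j)) * ennreal (muB j)"
        using Bsets[of j] mB(4)[OF j] by (simp add: nn_integral_cmult_indicator)
      also have "\<dots> = ennreal (cW * (mB j / muB j) * muB j)" by (rule ennreal_mult''[symmetric]) (use mB(2)[OF j] in simp)
      also have "cW * (mB j / muB j) * muB j = cW * mB j" using mB(2)[OF j] by simp
      finally have "ennreal (c j) * (\<integral>\<^sup>+ y \<in> Wh.B \<kappa> j. ennreal (W y) \<partial>\<mu>) \<le> ennreal (c j) * ennreal (cW * mB j)"
        by (rule mult_left_mono) simp
      also have "\<dots> = ennreal (c j * (cW * mB j))" by (rule ennreal_mult'[symmetric]) (simp add: c_def)
      also have "c j * (cW * mB j) = (4 * C\<^sup>2) powr p * cW * (E j powr p * mB j / r j powr p)"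
        by (simp add: c_def powr_mult powr_divide mult_ac)
      also have "ennreal \<dots> = ennreal ((4 * C\<^sup>2) powr p * cW) * ennreal (E j powr p * mB j / r j powr p)"
        by (rule ennreal_mult') (use cW0 in simp)
      also have "\<dots> \<le> ennreal ((4 * C\<^sup>2) powr p * cW) * (ennreal cE * En j)" by (intro mult_left_mono E_En'[OF j]) simp
      finally show "ennreal (c j) * (\<integral>\<^sup>+ y \<in> Wh.B \<kappa> j. ennreal (W y) \<partial>\<mu>) \<le> ennreal ((4 * C\<^sup>2) powr p * cW) * (ennreal cE * En j)" .
    qed
    also have "\<dots> = ennreal ((4 * C\<^sup>2) powr p * cW) * (ennreal cE * Wh.isum En)" by (simp add: Wh.isum_cmult)
    also have "\<dots> \<le> ennreal ((4 * C\<^sup>2) powr p * cW) * (ennreal cE * (ennreal C * T))" by (intro mult_left_mono sum_En) auto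
    finally show ?thesis .
  qed
  \<comment> \<open>\<open>|v - a\<^sub>j| \<le> E\<^sub>j\<close> on \<open>B\<^sub>j\<close>, and \<open>m(B\<^sub>j)\<close> is comparable to the integral of \<open>W\<close> over \<open>B\<^sub>j\<close>\<close>
  define Fv where "Fv y = ennreal (\<bar>?v y\<bar> powr p / ?d y powr p * W y)" for y
  have Fvm: "Fv \<in> borel_measurable (restrict_space borel \<Omega>)"
  proof -
    have [measurable]: "W \<in> borel_measurable (restrict_space borel \<Omega>)" by fact
    have [measurable]: "?v \<in> borel_measurable (restrict_space borel \<Omega>)"
      by (rule borel_measurable_continuous_on_restrict[OF continuous_on_subset[OF vc \<Omega>X]])
    have [measurable]: "?d \<in> borel_measurable (restrict_space borel \<Omega>)"
      by (rule borel_measurable_continuous_on_restrict[OF d_compl_continuous])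
    show ?thesis unfolding Fv_def by measurable
  qed
  have dle: "?d y \<le> 2 / \<kappa> * r j" "r j \<le> ?d y" "y \<in> \<Omega>" "0 < ?d y" if j: "j \<in> I" and y: "y \<in> Wh.B \<kappa> j" for j y
  proof -
    have e: "(1 - \<kappa>) * ?d (x j) \<le> ?d y" "?d y \<le> (1 + \<kappa>) * ?d (x j)"
      using d_compl_comparable[OF po, of "x j" y \<kappa>] y by (auto simp: Wh.B_def ball_in_iff)
    have "(1 + \<kappa>) * ?d (x j) \<le> 2 * ?d (x j)" using \<kappa>0 Wh.centre(3)[OF j] by (intro mult_right_mono) auto
    moreover have "2 / \<kappa> * r j = 2 * ?d (x j)" using \<kappa>0(1) by (simp add: r_def)
    ultimately show "?d y \<le> 2 / \<kappa> * r j" using e by simp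
    have "r j \<le> (1 - \<kappa>) * ?d (x j)" unfolding r_def using \<kappa>0 Wh.centre(3)[OF j] by (intro mult_right_mono) auto
    then show "r j \<le> ?d y" using e by simp
    show "y \<in> \<Omega>" using y j Wh.cover by blast
    then show "0 < ?d y" by (rule d_compl_pos[OF po])
  qed
  define t where "t j = \<bar>a j\<bar> powr p * mB j / r j powr p" for j
  have t_le: "ennreal (t j) \<le> ennreal ?\<alpha> * (ennreal ((2 / \<kappa>) powr p * cW) * (\<integral>\<^sup>+ y \<in> Wh.B \<kappa> j. Fv y \<partial>\<mu>) + ennreal cE * En j)"
    if j: "j \<in> I" for j
  proof -
    define A where "A = mB j / muB j"
    have A0: "0 \<le> A" using mB(1,2)[OF j] by (simp add: A_def)
    define q where "q = E j powr p * A / r j powr p"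
    have q0: "0 \<le> q" using A0 by (simp add: q_def)
    have "ennreal (t j) = ennreal (\<bar>a j\<bar> powr p * A / r j powr p) * ennreal (muB j)"
      using mB(2)[OF j] by (subst ennreal_mult''[symmetric]) (auto simp: t_def A_def)
    also have "\<dots> = (\<integral>\<^sup>+ y. ennreal (\<bar>a j\<bar> powr p * A / r j powr p) * indicator (Wh.B \<kappa> j) y \<partial>\<mu>)"
      using Bsets[of j] mB(4)[OF j] by (simp add: nn_integral_cmult_indicator)
    also have "\<dots> \<le> (\<integral>\<^sup>+ y. ennreal ?\<alpha> * (ennreal ((2 / \<kappa>) powr p * cW) * (Fv y * indicator (Wh.B \<kappa> j) y) + ennreal q * indicator (Wh.B \<kappa> j) y) \<partial>\<mu>)"
    proof (rule nn_integral_mono)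
      fix y
      show "ennreal (\<bar>a j\<bar> powr p * A / r j powr p) * indicator (Wh.B \<kappa> j) y
        \<le> ennreal ?\<alpha> * (ennreal ((2 / \<kappa>) powr p * cW) * (Fv y * indicator (Wh.B \<kappa> j) y) + ennreal q * indicator (Wh.B \<kappa> j) y)"
      proof (cases "y \<in> Wh.B \<kappa> j")
        case True
        note dy = dle[OF j True]
        have "\<bar>?v y - a j\<bar> \<le> E j" by (rule Wh.smooth_dist_le[OF j True]) (rule E_ge[OF j])
        then have "\<bar>a j\<bar> \<le> \<bar>?v y\<bar> + E j" by linarith
        then have "\<bar>a j\<bar> powr p \<le> (\<bar>?v y\<bar> + E j) powr p" using p0 by (intro powr_mono2) auto
        also have "\<dots> \<le> ?\<alpha> * (\<bar>?v y\<bar> powr p + E j powr p)" by (rule powr_add_le) (use p0 E0[OF j] in auto)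
        finally have "\<bar>a j\<bar> powr p * (A / r j powr p) \<le> ?\<alpha> * (\<bar>?v y\<bar> powr p + E j powr p) * (A / r j powr p)"
          using A0 by (intro mult_right_mono) auto
        also have "\<dots> = ?\<alpha> * (\<bar>?v y\<bar> powr p * (A / r j powr p) + q)" by (simp add: q_def algebra_simps)
        also have "\<dots> \<le> ?\<alpha> * (\<bar>?v y\<bar> powr p * (cW * W y * ((2 / \<kappa>) powr p / ?d y powr p)) + q)"
        proof -
          have "?d y powr p \<le> (2 / \<kappa> * r j) powr p" using dy p0 by (intro powr_mono2) auto
          then have "?d y powr p \<le> (2 / \<kappa>) powr p * r j powr p" by (simp only: powr_mult)
          then have "1 / r j powr p \<le> (2 / \<kappa>) powr p / ?d y powr p" using r[OF j] dy(4) by (simp add: field_simps)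
          then have "A * (1 / r j powr p) \<le> cW * W y * ((2 / \<kappa>) powr p / ?d y powr p)"
            using Wle(2)[OF j True] cW0 W_pos[OF dy(3)] by (intro mult_mono) (auto simp: A_def intro: less_imp_le)
          then show ?thesis by (intro mult_left_mono add_right_mono) auto
        qed
        also have "\<dots> = ?\<alpha> * ((2 / \<kappa>) powr p * cW * (\<bar>?v y\<bar> powr p / ?d y powr p * W y) + q)" by (simp add: mult_ac)
        finally have "ennreal (\<bar>a j\<bar> powr p * A / r j powr p) \<le> ennreal (?\<alpha> * ((2 / \<kappa>) powr p * cW * (\<bar>?v y\<bar> powr p / ?d y powr p * W y) + q))"
          by (intro ennreal_leI) simp
        also have "\<dots> = ennreal ?\<alpha> * (ennreal ((2 / \<kappa>) powr p * cW) * Fv y + ennreal q)"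
        proof -
          define \<beta> where "\<beta> = (2 / \<kappa>) powr p * cW"
          define \<zeta> where "\<zeta> = \<bar>?v y\<bar> powr p / ?d y powr p * W y"
          have nn: "0 \<le> \<beta>" "0 \<le> \<zeta>" using cW0 W_pos[OF dy(3)] by (auto simp: \<beta>_def \<zeta>_def)
          have "ennreal (?\<alpha> * (\<beta> * \<zeta> + q)) = ennreal ?\<alpha> * ennreal (\<beta> * \<zeta> + q)" by (rule ennreal_mult') simp
          also have "ennreal (\<beta> * \<zeta> + q) = ennreal (\<beta> * \<zeta>) + ennreal q" by (rule ennreal_plus) (use nn q0 in auto)
          also have "ennreal (\<beta> * \<zeta>) = ennreal \<beta> * ennreal \<zeta>" by (rule ennreal_mult') (rule nn)
          finally show ?thesis unfolding Fv_def \<beta>_def \<zeta>_def .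
        qed
        finally show ?thesis using True by simp
      qed simp
    qed
    also have "\<dots> = ennreal ?\<alpha> * (ennreal ((2 / \<kappa>) powr p * cW) * (\<integral>\<^sup>+ y \<in> Wh.B \<kappa> j. Fv y \<partial>\<mu>) + ennreal q * ennreal (muB j))"
      using cutB[OF Fvm j] Bsets[of j] mB(4)[OF j] by (simp add: nn_integral_cmult nn_integral_add nn_integral_cmult_indicator)
    also have "ennreal q * ennreal (muB j) = ennreal (E j powr p * mB j / r j powr p)"
      using mB(2)[OF j] by (subst ennreal_mult''[symmetric]) (auto simp: q_def A_def)
    also have "\<dots> \<le> ennreal cE * En j" by (rule E_En'[OF j])
    finally show ?thesis by (simp add: mult_left_mono)
  qed
  \<comment> \<open>on \<open>B\<^sub>j\<close> split \<open>u = (u - a\<^sub>j) + a\<^sub>j\<close> and apply the \<open>(p, p)\<close>-Poincare inequality to the first summand\<close>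
  define Fu where "Fu y = ennreal (\<bar>u y\<bar> powr p / ?d y powr p)" for y
  have Fum: "(\<lambda>y. Fu y * indicator \<Omega> y) \<in> borel_measurable ?m"
  proof -
    have [measurable]: "u \<in> borel_measurable (restrict_space borel \<Omega>)"
      by (rule borel_measurable_continuous_on_restrict[OF continuous_on_subset[OF uc \<Omega>X]])
    have [measurable]: "?d \<in> borel_measurable (restrict_space borel \<Omega>)"
      by (rule borel_measurable_continuous_on_restrict[OF d_compl_continuous])
    have "Fu \<in> borel_measurable (restrict_space borel \<Omega>)" unfolding Fu_def by measurable
    then show ?thesis using cut\<mu> by simp
  qed
  have Fu_le: "(\<integral>\<^sup>+ y \<in> Wh.B \<kappa> j. Fu y \<partial>?m) \<le> ennreal ?\<alpha> * (ennreal kpp * En j + ennreal (t j))" if j: "j \<in> I" for j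
  proof -
    let ?\<rho> = "1 / r j powr p"
    have Bm: "Wh.B \<kappa> j \<in> sets ?m" using Bsets by simp
    have "(\<integral>\<^sup>+ y \<in> Wh.B \<kappa> j. Fu y \<partial>?m) \<le> (\<integral>\<^sup>+ y. ennreal ?\<alpha> * (ennreal ?\<rho> * (ennreal (\<bar>u y - a j\<bar> powr p) * indicator (Wh.B \<kappa> j) y)
        + ennreal (?\<rho> * \<bar>a j\<bar> powr p) * indicator (Wh.B \<kappa> j) y) \<partial>?m)"
    proof (rule nn_integral_mono)
      fix y
      show "Fu y * indicator (Wh.B \<kappa> j) y \<le> ennreal ?\<alpha> * (ennreal ?\<rho> * (ennreal (\<bar>u y - a j\<bar> powr p) * indicator (Wh.B \<kappa> j) y)
        + ennreal (?\<rho> * \<bar>a j\<bar> powr p) * indicator (Wh.B \<kappa> j) y)"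
      proof (cases "y \<in> Wh.B \<kappa> j")
        case True
        note dy = dle[OF j True]
        have "\<bar>u y\<bar> powr p \<le> (\<bar>u y - a j\<bar> + \<bar>a j\<bar>) powr p" using p0 by (intro powr_mono2) auto
        also have "\<dots> \<le> ?\<alpha> * (\<bar>u y - a j\<bar> powr p + \<bar>a j\<bar> powr p)" by (rule powr_add_le) (use p0 in auto)
        finally have up: "\<bar>u y\<bar> powr p \<le> \<dots>" .
        have "r j powr p \<le> ?d y powr p" using dy r[OF j] p0 by (intro powr_mono2) auto
        then have "1 / ?d y powr p \<le> ?\<rho>" using r[OF j] dy(4) by (intro divide_left_mono) auto
        then have "\<bar>u y\<bar> powr p * (1 / ?d y powr p) \<le> ?\<alpha> * (\<bar>u y - a j\<bar> powr p + \<bar>a j\<bar> powr p) * ?\<rho>"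
          using up by (intro mult_mono) auto
        then have "Fu y \<le> ennreal (?\<alpha> * (?\<rho> * \<bar>u y - a j\<bar> powr p + ?\<rho> * \<bar>a j\<bar> powr p))"
          unfolding Fu_def by (intro ennreal_leI) (simp add: algebra_simps)
        also have "\<dots> = ennreal ?\<alpha> * (ennreal ?\<rho> * ennreal (\<bar>u y - a j\<bar> powr p) + ennreal (?\<rho> * \<bar>a j\<bar> powr p))"
          by (subst ennreal_mult', simp, subst ennreal_plus, simp, simp, subst ennreal_mult'[of ?\<rho>]) simp_all
        finally show ?thesis using True by simp
      qed simp
    qed
    also have "\<dots> = ennreal ?\<alpha> * (ennreal ?\<rho> * (\<integral>\<^sup>+ y \<in> Wh.B \<kappa> j. ennreal (\<bar>u y - a j\<bar> powr p) \<partial>?m) + ennreal (?\<rho> * \<bar>a j\<bar> powr p) * ennreal (mB j))"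
    proof -
      have m1: "(\<lambda>y. ennreal (\<bar>u y - a j\<bar> powr p) * indicator (Wh.B \<kappa> j) y) \<in> borel_measurable ?m"
        using P.u_m Bm by measurable
      have m2: "(\<lambda>y. ennreal (?\<rho> * \<bar>a j\<bar> powr p) * indicator (Wh.B \<kappa> j) y) \<in> borel_measurable ?m" using Bm by measurable
      have m3: "(\<lambda>y. ennreal ?\<rho> * (ennreal (\<bar>u y - a j\<bar> powr p) * indicator (Wh.B \<kappa> j) y)) \<in> borel_measurable ?m"
        by (intro borel_measurable_times_ennreal borel_measurable_const m1)
      show ?thesis
        unfolding nn_integral_cmult[OF borel_measurable_add[OF m3 m2]] nn_integral_add[OF m3 m2]
          nn_integral_cmult[OF m1] nn_integral_cmult_indicator[OF Bm] mB(3)[OF j] ..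
    qed
    also have "\<dots> \<le> ennreal ?\<alpha> * (ennreal kpp * En j + ennreal (t j))"
    proof (intro mult_left_mono add_mono)
      have "(\<integral>\<^sup>+ y \<in> Wh.B \<kappa> j. ennreal (\<bar>u y - a j\<bar> powr p) \<partial>?m) \<le> ennreal (kpp * r j powr p) * P.energy (x j) (3 * \<Lambda> * r j)"
        unfolding BB a_def kpp_def by (rule P.poincare_p_p[OF Wh.centre(2)[OF j] r[OF j]])
      also have "P.energy (x j) (3 * \<Lambda> * r j) \<le> En j" using energy_En[OF j, of 3] by (simp add: mult_ac)
      finally have "(\<integral>\<^sup>+ y \<in> Wh.B \<kappa> j. ennreal (\<bar>u y - a j\<bar> powr p) \<partial>?m) \<le> ennreal (kpp * r j powr p) * En j" by (simp add: mult_left_mono)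
      then have "ennreal ?\<rho> * (\<integral>\<^sup>+ y \<in> Wh.B \<kappa> j. ennreal (\<bar>u y - a j\<bar> powr p) \<partial>?m) \<le> ennreal ?\<rho> * (ennreal (kpp * r j powr p) * En j)"
        by (rule mult_left_mono) simp
      also have "\<dots> = ennreal (?\<rho> * (kpp * r j powr p)) * En j" by (subst ennreal_mult'[of ?\<rho>]) (simp_all add: mult.assoc)
      also have "?\<rho> * (kpp * r j powr p) = kpp" using r[OF j] by simp
      finally show "ennreal ?\<rho> * (\<integral>\<^sup>+ y \<in> Wh.B \<kappa> j. ennreal (\<bar>u y - a j\<bar> powr p) \<partial>?m) \<le> ennreal kpp * En j" .
      have "ennreal (?\<rho> * \<bar>a j\<bar> powr p) * ennreal (mB j) = ennreal (t j)"
        using mB(1)[OF j] by (subst ennreal_mult''[symmetric]) (auto simp: t_def)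
      then show "ennreal (?\<rho> * \<bar>a j\<bar> powr p) * ennreal (mB j) \<le> ennreal (t j)" by simp
    qed simp
    finally show ?thesis .
  qed
  have kpp0: "0 \<le> kpp" and cE0: "0 \<le> cE" using P.C1 by (simp_all add: kpp_def cE_def)
  have sum_Fv: "Wh.isum (\<lambda>j. \<integral>\<^sup>+ y \<in> Wh.B \<kappa> j. Fv y \<partial>\<mu>) \<le> ennreal C * I1"
  proof -
    have "Wh.isum (\<lambda>j. \<integral>\<^sup>+ y \<in> Wh.B \<kappa> j. Fv y \<partial>\<mu>) \<le> Wh.isum (\<lambda>j. \<integral>\<^sup>+ y \<in> Wh.B (3 / 4) j. Fv y \<partial>\<mu>)"
      using Wh.B_mono[of \<kappa> "3 / 4"] \<kappa>0 by (intro Wh.isum_mono nn_integral_mono) (auto split: split_indicator)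
    also have "\<dots> \<le> ennreal C * I1" unfolding I1_def Fv_def[symmetric] by (rule Wh.isum_overlap[OF m\<mu> cut\<mu>[OF Fvm]])
    finally show ?thesis .
  qed
  let ?b = "ennreal ((2 / \<kappa>) powr p * cW)"
  have "(\<integral>\<^sup>+ y \<in> \<Omega>. Fu y \<partial>?m) \<le> Wh.isum (\<lambda>j. \<integral>\<^sup>+ y \<in> Wh.B \<kappa> j. Fu y \<partial>?m)" by (rule Wh.cover_le_isum[OF mm Fum])
  also have "\<dots> \<le> Wh.isum (\<lambda>j. ennreal ?\<alpha> * (ennreal kpp * En j + ennreal ?\<alpha> * (?b * (\<integral>\<^sup>+ y \<in> Wh.B \<kappa> j. Fv y \<partial>\<mu>) + ennreal cE * En j)))"
  proof (rule Wh.isum_mono)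
    fix j assume j: "j \<in> I"
    show "(\<integral>\<^sup>+ y \<in> Wh.B \<kappa> j. Fu y \<partial>?m) \<le> ennreal ?\<alpha> * (ennreal kpp * En j + ennreal ?\<alpha> * (?b * (\<integral>\<^sup>+ y \<in> Wh.B \<kappa> j. Fv y \<partial>\<mu>) + ennreal cE * En j))"
      by (rule order_trans[OF Fu_le[OF j]]) (intro mult_left_mono add_left_mono t_le[OF j], simp)
  qed
  also have "\<dots> = ennreal ?\<alpha> * (ennreal kpp * Wh.isum En + ennreal ?\<alpha> * (?b * Wh.isum (\<lambda>j. \<integral>\<^sup>+ y \<in> Wh.B \<kappa> j. Fv y \<partial>\<mu>) + ennreal cE * Wh.isum En))"
    by (simp only: Wh.isum_cmult Wh.isum_add)
  also have "\<dots> \<le> ennreal ?\<alpha> * (ennreal kpp * (ennreal C * T) + ennreal ?\<alpha> * (?b * (ennreal C *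
      (ennreal (2 * (C\<^sub>p * 2 powr p)) * (ennreal ((4 * C\<^sup>2) powr p * cW) * (ennreal cE * (ennreal C * T))))) + ennreal cE * (ennreal C * T)))"
  proof (intro mult_left_mono add_mono sum_En zero_le)
    have "I1 \<le> ennreal (2 * (C\<^sub>p * 2 powr p)) * (ennreal ((4 * C\<^sup>2) powr p * cW) * (ennreal cE * (ennreal C * T)))"
      by (rule order_trans[OF step3]) (intro mult_left_mono step4, simp)
    then show "Wh.isum (\<lambda>j. \<integral>\<^sup>+ y \<in> Wh.B \<kappa> j. Fv y \<partial>\<mu>) \<le> ennreal C *
      (ennreal (2 * (C\<^sub>p * 2 powr p)) * (ennreal ((4 * C\<^sup>2) powr p * cW) * (ennreal cE * (ennreal C * T))))"
      by (intro order_trans[OF sum_Fv] mult_left_mono) auto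
  qed
  also have "\<dots> = ennreal (2 powr p * (kpp * C + 2 powr p * ((2 / \<kappa>) powr p * cW * C *
          (2 * (C\<^sub>p * 2 powr p) * ((4 * C\<^sup>2) powr p * cW * (cE * C))) + cE * C))) * T"
  proof -
    have dist: "ennreal A * (ennreal K * (ennreal D * T) + ennreal A * (ennreal b * (ennreal D * (ennreal P * (ennreal Q * (ennreal e * (ennreal D * T))))) + ennreal e * (ennreal D * T)))
      = ennreal (A * (K * D + A * (b * D * (P * (Q * (e * D))) + e * D))) * T"
      if "0 \<le> A" "0 \<le> K" "0 \<le> D" "0 \<le> b" "0 \<le> P" "0 \<le> Q" "0 \<le> e" for A K D b P Q e
      using that by (simp add: ennreal_mult ennreal_plus distrib_left distrib_right mult_ac)
    have "0 \<le> C" "0 \<le> 2 * (C\<^sub>p * 2 powr p)" using Wh.C_pos hardy by (auto simp: hardy_def)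
    then show ?thesis using kpp0 cE0 cW0 by (subst dist) (auto simp: mult.assoc)
  qed
  finally show ?thesis unfolding Fu_def T_def .
qed

text \<open>The scale \<open>\<kappa>\<close> is that of the partition used for the discretization, and \<open>C\<close> is its constant.  The outer factor \<open>2\<^sup>p\<close> pays for
  the passage from upper gradients to weak upper gradients, and the maximum with \<open>1\<close> is required of a Hardy constant.\<close>

definition hardy_const :: "real \<Rightarrow> real \<Rightarrow> real \<Rightarrow> real \<Rightarrow> real \<Rightarrow> real \<Rightarrow> real" where
  "hardy_const p C\<^sub>\<mu> C\<^sub>p C\<^sub>w CP \<Lambda> =
    (let \<kappa> = 1 / (16 * \<Lambda>); k = (LEAST k::nat. 32 / \<kappa> + 1 \<le> 2 ^ k); C = 9 * C\<^sub>\<mu> ^ k;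
       kpp = 2 powr p * (2 powr p * 2 * C\<^sub>w ^ 6 + 4 powr p) * (C\<^sub>w\<^sup>2 * CP) powr p;
       cE = (2 * C\<^sub>w ^ 5) powr p * (7 * CP) powr p; cW = (C\<^sub>w * C\<^sub>\<mu>) ^ (k + 3)
     in max 1 (2 powr p * (2 powr p * (kpp * C + 2 powr p * ((2 / \<kappa>) powr p * cW * C *
          (2 * (C\<^sub>p * 2 powr p) * ((4 * C\<^sup>2) powr p * cW * (cE * C))) + cE * C)))))"

lemma le_of_perturbed_le:
  assumes p: "0 < p" and R: "R < \<infinity>"
    and le: "\<And>\<epsilon>. 0 < \<epsilon> \<Longrightarrow> A \<le> ennreal K * (T + ennreal (\<epsilon> powr p) * R)"
  shows "A \<le> ennreal K * (T :: ennreal)"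
proof (rule ennreal_le_epsilon)
  fix e :: real assume e: "0 < e"
  obtain s where s: "R = ennreal s" "0 \<le> s" using R by (cases R) auto
  define \<epsilon> where "\<epsilon> = (e / (1 + \<bar>K\<bar> * s)) powr (1 / p)"
  have pos: "0 < 1 + \<bar>K\<bar> * s" using s(2) by (intro add_pos_nonneg) auto
  then have \<epsilon>: "0 < \<epsilon>" "\<epsilon> powr p = e / (1 + \<bar>K\<bar> * s)" using e p by (auto simp: \<epsilon>_def powr_powr)
  have "ennreal K * (ennreal (\<epsilon> powr p) * R) \<le> ennreal \<bar>K\<bar> * (ennreal (\<epsilon> powr p) * R)"
    by (intro mult_right_mono ennreal_leI) auto
  also have "\<dots> = ennreal (\<bar>K\<bar> * (\<epsilon> powr p * s))"
    unfolding s(1) using s(2) by (simp add: ennreal_mult)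
  also have "\<bar>K\<bar> * (\<epsilon> powr p * s) \<le> e"
    unfolding \<epsilon>(2) using e pos by (simp add: field_simps)
  finally have "ennreal K * (ennreal (\<epsilon> powr p) * R) \<le> ennreal e" by (simp add: ennreal_leI)
  then show "A \<le> ennreal K * T + ennreal e"
    using le[OF \<epsilon>(1)] by (simp add: distrib_left) (meson add_left_mono order_trans)
qed

text \<open>If the inequality for \<open>u\<close> and \<open>g\<close> holds along all curves on which \<open>\<rho>\<close> is integrable, then \<open>g + \<epsilon> \<rho>\<close> is an upper gradient for
  every \<open>\<epsilon> > 0\<close>.\<close>

lemma hardy_transfer:
  fixes X :: "'a::metric_space set"
  assumes X: "complete X" and d\<mu>: "doubling X \<mu> C\<^sub>\<mu>" and po: "proper_open X \<Omega>" and p: "1 < p" and hardy: "hardy p X \<Omega> \<mu> C\<^sub>p"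
    and adm: "admissible p X \<mu> w C\<^sub>w CP \<Lambda>"
    and wp: "whitney_partition X \<Omega> C' I' x' \<phi>'" and reg: "regularizable X \<mu> \<Omega> \<delta> w" and \<delta>: "0 < \<delta>"
    and C0: "1 \<le> C\<^sub>0" and small: "\<delta> \<le> p / (2 * C\<^sub>0) * (2 * C\<^sub>p) powr (- (1 / p))"
    and gc: "\<And>g. minimal_wug p \<Omega> (restrict_space \<mu> \<Omega>) (\<lambda>y. ereal (discrete_convolution X \<mu> \<Omega> I' x' \<phi>' w y)) g \<Longrightarrow>
      AE y in restrict_space \<mu> \<Omega>. g y \<le> ennreal (C\<^sub>0 * \<delta> / d_compl X \<Omega> y * discrete_convolution X \<mu> \<Omega> I' x' \<phi>' w y)"
  shows "hardy p X \<Omega> (weighted w \<mu>) (hardy_const p C\<^sub>\<mu> C\<^sub>p C\<^sub>w CP \<Lambda>)"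
proof -
  let ?m = "weighted w \<mu>"
  have dw: "doubling X ?m C\<^sub>w" and \<Lambda>: "1 \<le> \<Lambda>" using adm by (auto simp: admissible_def poincare_def)
  have mm: "sets ?m = sets (restrict_space borel X)" by (rule doubling_sets[OF dw])
  have p0: "0 < p" and p1: "1 \<le> p" using p by auto
  define \<kappa> where "\<kappa> = 1 / (16 * \<Lambda>)"
  have \<kappa>0: "0 < \<kappa>" "\<kappa> \<le> 1 / 8" using \<Lambda> by (auto simp: \<kappa>_def divide_simps)
  define k where "k = (LEAST k::nat. 32 / \<kappa> + 1 \<le> 2 ^ k)"
  have k: "32 / \<kappa> + 1 \<le> 2 ^ k"
  proof -
    obtain n :: nat where "32 / \<kappa> + 1 < 2 ^ n" using real_arch_pow[of 2] by auto
    then have "32 / \<kappa> + 1 \<le> 2 ^ n" by simp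
    then show ?thesis unfolding k_def by (rule LeastI)
  qed
  have "0 < 1 / \<kappa>" using \<kappa>0(1) by simp
  then have k': "1 / \<kappa> \<le> 2 ^ k" using k by linarith
  define C where "C = 9 * C\<^sub>\<mu> ^ k"
  obtain I x \<phi> where wh: "whitney_at X \<Omega> \<kappa> C I x \<phi>"
    using whitney_at_exists[OF d\<mu> po \<kappa>0 k] unfolding C_def by blast
  define kpp where "kpp = 2 powr p * (2 powr p * 2 * C\<^sub>w ^ 6 + 4 powr p) * (C\<^sub>w\<^sup>2 * CP) powr p"
  define cE where "cE = (2 * C\<^sub>w ^ 5) powr p * (7 * CP) powr p"
  define cW where "cW = (C\<^sub>w * C\<^sub>\<mu>) ^ (k + 3)"
  define K where "K = 2 powr p * (kpp * C + 2 powr p * ((2 / \<kappa>) powr p * cW * C *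
          (2 * (C\<^sub>p * 2 powr p) * ((4 * C\<^sup>2) powr p * cW * (cE * C))) + cE * C))"
  have K: "hardy_const p C\<^sub>\<mu> C\<^sub>p C\<^sub>w CP \<Lambda> = max 1 (2 powr p * K)"
    unfolding hardy_const_def Let_def K_def kpp_def cE_def cW_def C_def k_def \<kappa>_def ..
  show ?thesis
    unfolding hardy_def
  proof (intro conjI ballI allI impI)
    show "1 \<le> hardy_const p C\<^sub>\<mu> C\<^sub>p C\<^sub>w CP \<Lambda>" by (simp add: K)
    fix u g assume u: "u \<in> Lip_c X \<Omega>" and min: "minimal_wug p X ?m (\<lambda>x. ereal (u x)) g"
    have wug: "weak_upper_gradient p X ?m (\<lambda>x. ereal (u x)) g" using min by (simp add: minimal_wug_def)
    then have gm: "g \<in> borel_measurable ?m" by (simp add: weak_upper_gradient_def)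
    obtain \<rho> where \<rho>: "\<rho> \<in> borel_measurable ?m" "(\<integral>\<^sup>+ x. enn_powr (\<rho> x) p \<partial>?m) < \<infinity>" "ug_off X \<rho> u g"
      by (rule weak_upper_gradientD[OF mm p1 wug])
    have cong: "borel_measurable ?m = (borel_measurable (restrict_space borel X) :: ('a \<Rightarrow> ennreal) set)"
      by (rule measurable_cong_sets[OF mm refl])
    let ?A = "\<integral>\<^sup>+ y \<in> \<Omega>. ennreal (\<bar>u y\<bar> powr p / d_compl X \<Omega> y powr p) \<partial>?m"
    let ?T = "\<integral>\<^sup>+ y \<in> \<Omega>. enn_powr (g y) p \<partial>?m" and ?R = "\<integral>\<^sup>+ y. enn_powr (\<rho> y) p \<partial>?m"
    have [measurable]: "\<Omega> \<in> sets ?m" by (rule proper_open_sets[OF po mm])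
    have gpm: "(\<lambda>y. enn_powr (g y) p * indicator \<Omega> y) \<in> borel_measurable ?m" and \<rho>pm: "(\<lambda>y. enn_powr (\<rho> y) p) \<in> borel_measurable ?m"
      using gm \<rho>(1) by measurable
    have "?A \<le> ennreal (2 powr p * K) * (?T + ennreal (\<epsilon> powr p) * ?R)" if \<epsilon>: "0 < \<epsilon>" for \<epsilon>
    proof -
      define G where "G y = g y + ennreal \<epsilon> * \<rho> y" for y
      have "G \<in> borel_measurable ?m" unfolding G_def using gm \<rho>(1) by measurable
      then have Gm: "G \<in> borel_measurable (restrict_space borel X)" using cong by simp
      have Gug: "ug_off X (\<lambda>_. 0) u G"
        unfolding ug_off_def
      proof (intro ballI impI)
        fix c assume c: "c \<in> rect_curves X"
        show "ug_along (\<lambda>x. ereal (u x)) G c"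
        proof (cases "line_integral \<rho> c < \<infinity>")
          case True
          then have "ug_along (\<lambda>x. ereal (u x)) g c" using \<rho>(3) c by (auto simp: ug_off_def)
          moreover have "line_integral g c \<le> line_integral G c" by (rule line_integral_mono[OF c]) (simp add: G_def)
          ultimately show ?thesis unfolding ug_along_arc[OF c] by (rule order_trans)
        next
          case False
          have "line_integral (\<lambda>y. ennreal \<epsilon> * \<rho> y) c = ennreal \<epsilon> * line_integral \<rho> c"
            by (rule line_integral_cmult[OF c]) (use \<rho>(1) cong in simp)
          also have "\<dots> = top" using False \<epsilon> by (simp add: not_less top_unique ennreal_mult_top)
          finally have "top \<le> line_integral G c"
            using line_integral_mono[OF c, of "\<lambda>y. ennreal \<epsilon> * \<rho> y" G] by (simp add: G_def)
          then show ?thesis unfolding ug_along_arc[OF c] by (simp add: top_unique)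
        qed
      qed
      have "?A \<le> ennreal K * (\<integral>\<^sup>+ y \<in> \<Omega>. enn_powr (G y) p \<partial>?m)"
        unfolding K_def kpp_def cE_def cW_def
        by (rule hardy_of_upper_gradient[OF X d\<mu> po p hardy adm wp reg \<delta> C0 small gc \<kappa>_def k' wh u Gm Gug])
      also have "(\<integral>\<^sup>+ y \<in> \<Omega>. enn_powr (G y) p \<partial>?m)
          \<le> (\<integral>\<^sup>+ y. ennreal (2 powr p) * (enn_powr (g y) p * indicator \<Omega> y + ennreal (\<epsilon> powr p) * enn_powr (\<rho> y) p) \<partial>?m)"
      proof (rule nn_integral_mono)
        fix y
        have "enn_powr (G y) p \<le> ennreal (2 powr p) * (enn_powr (g y) p + enn_powr (ennreal \<epsilon> * \<rho> y) p)"
          unfolding G_def by (rule enn_powr_add_le[OF p0])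
        then show "enn_powr (G y) p * indicator \<Omega> y
          \<le> ennreal (2 powr p) * (enn_powr (g y) p * indicator \<Omega> y + ennreal (\<epsilon> powr p) * enn_powr (\<rho> y) p)"
          using \<epsilon> by (auto simp: enn_powr_mult[OF p0] split: split_indicator)
      qed
      also have "\<dots> = ennreal (2 powr p) * (?T + ennreal (\<epsilon> powr p) * ?R)"
        using gpm \<rho>pm by (simp add: nn_integral_cmult nn_integral_add)
      finally have "?A \<le> ennreal K * (ennreal (2 powr p) * (?T + ennreal (\<epsilon> powr p) * ?R))" by (simp add: mult_left_mono)
      also have "\<dots> = ennreal (2 powr p * K) * (?T + ennreal (\<epsilon> powr p) * ?R)"
        by (subst ennreal_mult'[of "2 powr p"]) (simp_all add: mult_ac)
      finally show ?thesis .
    qed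
    then have "?A \<le> ennreal (2 powr p * K) * ?T" by (rule le_of_perturbed_le[OF p0 \<rho>(2)])
    also have "\<dots> \<le> ennreal (hardy_const p C\<^sub>\<mu> C\<^sub>p C\<^sub>w CP \<Lambda>) * ?T"
      unfolding K by (intro mult_right_mono ennreal_leI) auto
    finally show "?A \<le> ennreal (hardy_const p C\<^sub>\<mu> C\<^sub>p C\<^sub>w CP \<Lambda>) * ?T" .
  qed
qed

theorem theorem1p7:
  shows
    "(\<forall>C\<^sub>\<mu>\<ge>1. \<exists>C\<^sub>0\<ge>1. \<forall>p>1. gradient_constant TYPE('a::metric_space) p C\<^sub>\<mu> C\<^sub>0) \<and>
     (\<exists>K :: real \<Rightarrow> real \<Rightarrow> real \<Rightarrow> real \<Rightarrow> real \<Rightarrow> real \<Rightarrow> real.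
        \<forall>(X :: 'a set) \<mu> \<Omega> p C\<^sub>\<mu> C\<^sub>p.
          complete X \<and> doubling X \<mu> C\<^sub>\<mu> \<and> 1 < p \<and> openin (top_of_set X) \<Omega> \<and> hardy p X \<Omega> \<mu> C\<^sub>p \<longrightarrow>
          (\<exists>\<delta>\<^sub>p>0. \<forall>w C\<^sub>w C\<^sub>P\<^sub>I \<Lambda> \<delta>.
             admissible p X \<mu> w C\<^sub>w C\<^sub>P\<^sub>I \<Lambda> \<and> regularizable X \<mu> \<Omega> \<delta> w \<and> 0 < \<delta> \<and> \<delta> \<le> \<delta>\<^sub>p \<longrightarrow>
             hardy p X \<Omega> (weighted w \<mu>) (K p C\<^sub>\<mu> C\<^sub>p C\<^sub>w C\<^sub>P\<^sub>I \<Lambda>)) \<and>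
          (\<forall>C\<^sub>0\<ge>1. gradient_constant TYPE('a) p C\<^sub>\<mu> C\<^sub>0 \<longrightarrow>
             (\<forall>w C\<^sub>w C\<^sub>P\<^sub>I \<Lambda> \<delta>.
                admissible p X \<mu> w C\<^sub>w C\<^sub>P\<^sub>I \<Lambda> \<and> regularizable X \<mu> \<Omega> \<delta> w \<and>
                0 < \<delta> \<and> \<delta> \<le> p / (2 * C\<^sub>0) * (2 * C\<^sub>p) powr (- (1 / p)) \<longrightarrow>
                hardy p X \<Omega> (weighted w \<mu>) (K p C\<^sub>\<mu> C\<^sub>p C\<^sub>w C\<^sub>P\<^sub>I \<Lambda>))))"
proof -
  have main: "hardy p X \<Omega> (weighted w \<mu>) (hardy_const p C\<^sub>\<mu> C\<^sub>p C\<^sub>w C\<^sub>P\<^sub>I \<Lambda>)"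
    if A: "complete X \<and> doubling X \<mu> C\<^sub>\<mu> \<and> 1 < p \<and> openin (top_of_set X) \<Omega> \<and> hardy p X \<Omega> \<mu> C\<^sub>p"
      and C0: "1 \<le> C\<^sub>0" "gradient_constant TYPE('a) p C\<^sub>\<mu> C\<^sub>0"
      and w: "admissible p X \<mu> w C\<^sub>w C\<^sub>P\<^sub>I \<Lambda> \<and> regularizable X \<mu> \<Omega> \<delta> w \<and>
                0 < \<delta> \<and> \<delta> \<le> p / (2 * C\<^sub>0) * (2 * C\<^sub>p) powr (- (1 / p))"
    for X :: "'a set" and \<mu> \<Omega> p C\<^sub>\<mu> C\<^sub>p C\<^sub>0 w C\<^sub>w C\<^sub>P\<^sub>I \<Lambda> \<delta>
  proof (cases "\<Omega> = X")
    case True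
    \<comment> \<open>here \<open>1 / d\<close> vanishes, and so does the left-hand side\<close>
    then have "d_compl X \<Omega> y = 0" for y by (simp add: d_compl_def infdist_def)
    then show ?thesis by (simp add: hardy_def hardy_const_def Let_def)
  next
    case False
    then have po: "proper_open X \<Omega>" using A by (intro proper_openI) auto
    have "\<exists>C I x \<phi>. whitney_partition X \<Omega> C I x \<phi> \<and>
           (\<forall>\<delta>>0. \<forall>w g.
              regularizable X \<mu> \<Omega> \<delta> w \<and>
              minimal_wug p \<Omega> (restrict_space \<mu> \<Omega>) (\<lambda>y. ereal (discrete_convolution X \<mu> \<Omega> I x \<phi> w y)) g \<longrightarrow>
              (AE y in restrict_space \<mu> \<Omega>. g y \<le> ennreal (C\<^sub>0 * \<delta> / d_compl X \<Omega> y * discrete_convolution X \<mu> \<Omega> I x \<phi> w y)))"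
      using C0(2) unfolding gradient_constant_def
      by (elim exE, drule_tac x = X in spec, drule_tac x = \<mu> in spec, drule_tac x = \<Omega> in spec)
         (drule mp, use A False in simp, rule exI, assumption)
    then obtain C I x \<phi> where wp: "whitney_partition X \<Omega> C I x \<phi>" and gc: "\<forall>\<delta>>0. \<forall>w g.
              regularizable X \<mu> \<Omega> \<delta> w \<and>
              minimal_wug p \<Omega> (restrict_space \<mu> \<Omega>) (\<lambda>y. ereal (discrete_convolution X \<mu> \<Omega> I x \<phi> w y)) g \<longrightarrow>
              (AE y in restrict_space \<mu> \<Omega>. g y \<le> ennreal (C\<^sub>0 * \<delta> / d_compl X \<Omega> y * discrete_convolution X \<mu> \<Omega> I x \<phi> w y))"
      by (elim exE conjE) (rule that)
    have reg: "regularizable X \<mu> \<Omega> \<delta> w" and \<delta>: "0 < \<delta>" using w by auto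
    show ?thesis
    proof (rule hardy_transfer[OF _ _ po _ _ _ wp reg \<delta> C0(1)])
      fix g assume "minimal_wug p \<Omega> (restrict_space \<mu> \<Omega>) (\<lambda>y. ereal (discrete_convolution X \<mu> \<Omega> I x \<phi> w y)) g"
      with gc[rule_format, OF \<delta>] reg
      show "AE y in restrict_space \<mu> \<Omega>. g y \<le> ennreal (C\<^sub>0 * \<delta> / d_compl X \<Omega> y * discrete_convolution X \<mu> \<Omega> I x \<phi> w y)"
        by simp
    qed (use A w in simp_all)
  qed
  show ?thesis
  proof (intro conjI exI[of _ hardy_const] allI impI)
    fix C\<^sub>\<mu> :: real assume "1 \<le> C\<^sub>\<mu>"
    then show "\<exists>C\<^sub>0\<ge>1. \<forall>p>1. gradient_constant TYPE('a) p C\<^sub>\<mu> C\<^sub>0" by (rule gradient_constant_exists)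
  next
    fix X :: "'a set" and \<mu> \<Omega> p C\<^sub>\<mu> C\<^sub>p
    assume A: "complete X \<and> doubling X \<mu> C\<^sub>\<mu> \<and> 1 < p \<and> openin (top_of_set X) \<Omega> \<and> hardy p X \<Omega> \<mu> C\<^sub>p"
    then have "1 \<le> C\<^sub>\<mu>" using doubling_ge_1 by blast
    then obtain C\<^sub>0 where C0: "1 \<le> C\<^sub>0" "\<forall>p>1. gradient_constant TYPE('a) p C\<^sub>\<mu> C\<^sub>0"
      using gradient_constant_exists[where 'a = 'a, of C\<^sub>\<mu>] by blast
    then have gc: "gradient_constant TYPE('a) p C\<^sub>\<mu> C\<^sub>0" using A by simp
    show "\<exists>\<delta>\<^sub>p>0. \<forall>w C\<^sub>w C\<^sub>P\<^sub>I \<Lambda> \<delta>.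
             admissible p X \<mu> w C\<^sub>w C\<^sub>P\<^sub>I \<Lambda> \<and> regularizable X \<mu> \<Omega> \<delta> w \<and> 0 < \<delta> \<and> \<delta> \<le> \<delta>\<^sub>p \<longrightarrow>
             hardy p X \<Omega> (weighted w \<mu>) (hardy_const p C\<^sub>\<mu> C\<^sub>p C\<^sub>w C\<^sub>P\<^sub>I \<Lambda>)"
    proof (rule exI[of _ "p / (2 * C\<^sub>0) * (2 * C\<^sub>p) powr (- (1 / p))"], intro conjI allI impI)
      show "0 < p / (2 * C\<^sub>0) * (2 * C\<^sub>p) powr (- (1 / p))" using A C0(1) by (auto simp: hardy_def)
    qed (rule main[OF A C0(1) gc])
  next
    fix X :: "'a set" and \<mu> \<Omega> p C\<^sub>\<mu> C\<^sub>p C\<^sub>0 w C\<^sub>w C\<^sub>P\<^sub>I \<Lambda> \<delta>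
    assume "complete X \<and> doubling X \<mu> C\<^sub>\<mu> \<and> 1 < p \<and> openin (top_of_set X) \<Omega> \<and> hardy p X \<Omega> \<mu> C\<^sub>p"
      "1 \<le> C\<^sub>0" "gradient_constant TYPE('a) p C\<^sub>\<mu> C\<^sub>0"
      "admissible p X \<mu> w C\<^sub>w C\<^sub>P\<^sub>I \<Lambda> \<and> regularizable X \<mu> \<Omega> \<delta> w \<and>
                0 < \<delta> \<and> \<delta> \<le> p / (2 * C\<^sub>0) * (2 * C\<^sub>p) powr (- (1 / p))"
    then show "hardy p X \<Omega> (weighted w \<mu>) (hardy_const p C\<^sub>\<mu> C\<^sub>p C\<^sub>w C\<^sub>P\<^sub>I \<Lambda>)" by (rule main)
  qed
qed

end
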